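(* Let $0<T<\infty$, let $f_0,g_0$ be tagged-admissible and background-admissible probability densities on $U\times\mathbb{R}^3$, and let $\hat P^\varepsilon_t$ ($N\varepsilon^2=1$) be the empirical distribution on collision trees. For $\varepsilon$ sufficiently small and for all $\Phi\in\mathcal{G}(\varepsilon)$, $\hat P^\varepsilon_t$ solves $$\partial_t\hat P^\varepsilon_t(\Phi)=(1-\gamma^\varepsilon(t))\,\hat{\mathcal{Q}}^\varepsilon_t[\hat P^\varepsilon_t](\Phi),\qquad \hat P^\varepsilon_0(\Phi)=\zeta^\varepsilon(\Phi)f_0(x_0,v_0)\mathbb{1}_{n(\Phi)=0},$$ where $$\zeta^\varepsilon(\Phi)=\Big(1-\int_{B_\varepsilon(x_0)}\int_{\mathbb{R}^3}g_0(\bar x,\bar v)\,d\bar v\,d\bar x\Big)^N,\qquad \gamma^\varepsilon(t)=\begin{cases}1&t<\tau,\\ n(\bar\Phi)\varepsilon^2&t=\tau,\\ n(\Phi)\varepsilon^2&t>\tau,\end{cases}$$ $\hat{\mathcal{Q}}^\varepsilon_t=\hat{\mathcal{Q}}^{\varepsilon,+}_t-\hat{\mathcal{Q}}^{\varepsilon,-}_t$, $$\hat{\mathcal{Q}}^{\varepsilon,+}_t[\hat P_t](\Phi)=\delta(t-\tau)\,\hat P_t(\bar\Phi)\,\frac{g_\tau(x(\tau)+\varepsilon\nu,v')[(v(\tau^-)-v')\cdot\nu]_+}{\int_{U\times\mathbb{R}^3}g_0(\bar x,\bar v)\mathbb{1}^\varepsilon_\tau[\Phi](\bar x,\bar v)\,d\bar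 x\,d\bar v}\ \text{ if } n\ge1,\qquad \hat{\mathcal{Q}}^{\varepsilon,+}_t[\hat P_t](\Phi)=0\ \text{ if } n=0,$$ $$\hat{\mathcal{Q}}^{\varepsilon,-}_t[\hat P_t](\Phi)=\hat P_t(\Phi)\,\frac{\int_{\mathbb{S}^2}\int_{\mathbb{R}^3}g_t(x(t)+\varepsilon\nu,\bar v)[(v(\tau)-\bar v)\cdot\nu]_+\,d\bar v\,d\nu-\hat C(\varepsilon)}{\int_{U\times\mathbb{R}^3}g_0(\bar x,\bar v)\mathbb{1}^\varepsilon_t[\Phi](\bar x,\bar v)\,d\bar x\,d\bar v},$$ for some $\hat C(\varepsilon)>0$ depending on $t$ and $\Phi$ with $\hat C(\varepsilon)=o(1)$ as $\varepsilon\to0$.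
   Context: $U=[0,1]^3$ with periodic boundary conditions (the torus $\mathbb{R}^3/\mathbb{Z}^3$); distances and balls $B_\varepsilon(x_0)$ in $U$ are with respect to the torus distance; $[a]_+=\max(a,0)$. Admissibility. A probability density $f_0\in L^1(U\times\mathbb{R}^3)$ is tagged-admissible if $\int_{U\times\mathbb{R}^3} f_0(x,v)(1+|v|^2)\,dx\,dv<\infty$. For a probability density $g_0\in L^1(U\times\mathbb{R}^3)$ put $\bar g(v)=\operatorname{ess\,sup}_{x\in U}g_0(x,v)$. Then $g_0$ is background-admissible if: $\int_{\mathbb{R}^3}\bar g(v)(1+|v|^2)\,dv<\infty$; $\operatorname{ess\,sup}_{v}\bar g(v)(1+|v|)<\infty$; for almost all $v$, $g_0(\cdot,v)\in W^{1,1}(U)$, and $\operatorname{ess\,sup}_{x\in U}\int_{\mathbb{R}^3}|\partial_x g_0(x,v)|(1+|v|)\,dv<\infty$; and there are a constant $M_H>0$ and $0<\alpha\le 1$ such that for almost all $v$ and all $x,y\in U$, $|g_0(x,v)-g_0(y,v)|<M_H|x-y|^\alpha$. Put $g_t(x,v)=g_0(x-tv,v)$. Particle dynamics. One tagged particle and $N$ background particles, unit mass, diameter $\varepsilon=N^{-1/2}$; independent initial data, tagged particle with density $f_0$, each background particle with density $g_0$. Background particles do not interact with each other; an initial overlap (distance $\le\varepsilon$ at time $0$) between the tagged particle and a background particle is ignored (they pass through each other); otherwise whenever the tagged particle $(x,v)$ and a background particle $(x_j,v_j)$ come to distance $\varepsilon$ they collide elastically: with $\nu=(x_j-x)/|x_j-x|$,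 $v\mapsto v-(\nu\cdot(v-v_j))\nu$, $v_j\mapsto v_j+(\nu\cdot(v-v_j))\nu$; otherwise all velocities are constant. Trees. $\mathcal{MT}$ is the set of all $\Phi=((x_0,v_0),(t_1,\nu_1,v_1),\dots,(t_n,\nu_n,v_n))$ with $n=n(\Phi)\ge0$, $(x_0,v_0)\in U\times\mathbb{R}^3$, $(t_j,\nu_j,v_j)\in[0,T]\times\mathbb{S}^2\times\mathbb{R}^3$, $t_1<\dots<t_n$, with Lebesgue measure on each component. It records a collision history of the tagged particle: initial state, and for each collision its time, collision parameter (unit vector from tagged to background particle) and the incoming velocity of the background particle. $\tau=0$ if $n=0$, $\tau=t_n$ if $n\ge1$; for $n\ge1$ $(\tau,\nu,v')=(t_n,\nu_n,v_n)$ and $\bar\Phi$ is $\Phi$ with the last collision removed. The tree determines the root trajectory $(x(t),v(t))$ on $[0,T]$: start at $(x_0,v_0)$, $\dot x=v$, $v$ piecewise constant, $v(t_j)=v(t_j^-)-(\nu_j\cdot(v(t_j^-)-v_j))\nu_j$; and for given $\varepsilon$ the trajectory of the $j$-th collision partner: $x_j(t)=x(t_j)+\varepsilon\nu_j-(t_j-t)v_j$ with velocity $v_j$ for $t<t_j$, and $x_j(t)=x(t_j)+\varepsilon\nu_j+(t-t_j)\bar v_j$ with velocity $\bar v_j=v_j+(\nu_j\cdot(v(t_j^-)-v_j))\nu_j$ for $t\ge t_j$. Good trees. $V,M:(0,\infty)\to[0,\infty)$ are fixed decreasing functions tending to $\infty$ as $\varepsilon\to0$, with $\varepsilon V(\varepsilon)^3\le1/8$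 and $M(\varepsilon)\le\varepsilon^{-1/2}$ for $0<\varepsilon<1$. $\mathcal{G}(\varepsilon)$ is the set of $\Phi\in\mathcal{MT}$ with: $n(\Phi)\le M(\varepsilon)$; all root and collision-partner velocities on $[0,T]$ bounded in norm by $V(\varepsilon)$; re-collision free: $|x(t)-x_j(t)|>\varepsilon$ for all $j=1,\dots,n$ and all $t\in[0,T]\setminus\{t_j\}$; free from initial overlap: initially the root is at distance $>\varepsilon$ from all the background particles $j=1,\dots,N$; non-grazing: $\nu_j\cdot(v(t_j^-)-v_j)>0$ for all $j=1,\dots,n$. Empirical distribution. $\hat P^\varepsilon_t$ is the probability measure on $\mathcal{MT}$ obtained by observing the particle dynamics, i.e. the law of the collision history of the tagged particle up to time $t$. For $\Phi\in\mathcal{G}(\varepsilon)$ it is absolutely continuous with respect to Lebesgue measure on a neighbourhood of $\Phi$, and $\hat P^\varepsilon_t(\Phi)$ denotes its density. $\mathbb{1}^\varepsilon_t[\Phi](\bar x,\bar v)=1$ if $|x(s)-(\bar x+s\bar v)|>\varepsilon$ for all $s\in(0,t)$, and $0$ otherwise. Meaning of the equation: for $n\ge1$, $\hat P^\varepsilon_t(\Phi)=0$ for $t<\tau$; at $t=\tau$, $\hat P^\varepsilon_\tau(\Phi)$ equals $(1-\gamma^\varepsilon(\tau))$ times the coefficient of $\delta(t-\tau)$ in $\hat{\mathcal{Q}}^{\varepsilon,+}$; and for $t\in(\tau,T]$ (any $n$), $\hat P^\varepsilon_t(\Phi)$ is differentiable in $t$ with $\partial_t\hat P^\varepsilon_t(\Phi)=-(1-\gamma^\varepsilon(t))\hat{\mathcal{Q}}^{\varepsilon,-}_t[\hat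 P^\varepsilon_t](\Phi)$.
   Formalization: The correction Ĉ(ε) is shown to be nonnegative instead of strictly positive; strict positivity fails, e.g. for g₀ independent of x with bounded velocity support, a tree with n=0 and small t, where Ĉ(ε)=0. *)

theory Defs
  imports "HOL-Analysis.Analysis" "HOL-Probability.Probability"
begin

section \<open>The torus\<close>

text \<open>
  Points of the torus are represented by arbitrary lifts in \<open>real ^ 3\<close>, functions on the torus by
  functions invariant under the integer lattice. The half-open unit cube is the fundamental domain
  over which one integrates.
\<close>

type_synonym vec3 = "real ^ 3"
type_synonym state = "vec3 \<times> vec3"

definition int_lattice :: "vec3 set" where
  "int_lattice = {k. \<forall>i. k $ i \<in> \<int>}"

definition torus_cell :: "vec3 set" where
  "torus_cell = {x. \<forall>i. 0 \<le> x $ i \<and> x $ i < 1}"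

definition tdist :: "vec3 \<Rightarrow> vec3 \<Rightarrow> real" where
  "tdist x y = infdist (x - y) int_lattice"

definition torus_ball :: "real \<Rightarrow> vec3 \<Rightarrow> vec3 set" where
  "torus_ball \<epsilon> x = {y \<in> torus_cell. tdist x y < \<epsilon>}"

definition periodic :: "(vec3 \<Rightarrow> 'b) \<Rightarrow> bool" where
  "periodic h \<longleftrightarrow> (\<forall>x. \<forall>k \<in> int_lattice. h (x + k) = h x)"

text \<open>
  Surface measure of the unit sphere, as the cone measure: the area of \<open>A\<close> is three times the volume
  of the part of the unit ball lying over \<open>A\<close>. It is a Borel measure on \<open>real ^ 3\<close> that is
  concentrated on the sphere and has total mass \<open>4 * pi\<close>.
\<close>

definition sphere_measure :: "vec3 measure" where
  "sphere_measure = distr (density lborel (\<lambda>x. 3 * indicator (ball 0 1) x)) borel sgn"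


section \<open>Admissible initial densities\<close>

definition torus_density :: "(vec3 \<Rightarrow> vec3 \<Rightarrow> real) \<Rightarrow> bool" where
  "torus_density f \<longleftrightarrow>
     (\<lambda>z. f (fst z) (snd z)) \<in> borel_measurable borel \<and>
     (\<forall>x v. 0 \<le> f x v) \<and>
     (\<forall>v. periodic (\<lambda>x. f x v)) \<and>
     (\<integral>\<^sup>+ z \<in> torus_cell \<times> UNIV. ennreal (f (fst z) (snd z)) \<partial>lborel) = 1"

definition tagged_admissible :: "(vec3 \<Rightarrow> vec3 \<Rightarrow> real) \<Rightarrow> bool" where
  "tagged_admissible f \<longleftrightarrow>
     torus_density f \<and>
     (\<integral>\<^sup>+ z \<in> torus_cell \<times> UNIV. ennreal (f (fst z) (snd z) * (1 + (norm (snd z))\<^sup>2)) \<partial>lborel) < \<infinity>"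

definition ess_bound :: "(vec3 \<Rightarrow> vec3 \<Rightarrow> real) \<Rightarrow> vec3 \<Rightarrow> ennreal" where
  "ess_bound g v = esssup (restrict_space lborel torus_cell) (\<lambda>x. ennreal (g x v))"

text \<open>
  \<open>h\<close> belongs to the Sobolev space \<open>W\<close> of order (1,1) on the torus, with weak gradient \<open>G\<close>. On the
  torus the test functions are periodic; testing with continuously differentiable functions is
  equivalent to testing with smooth ones.
\<close>

definition weak_gradient :: "(vec3 \<Rightarrow> real) \<Rightarrow> (vec3 \<Rightarrow> vec3) \<Rightarrow> bool" where
  "weak_gradient h G \<longleftrightarrow>
     set_integrable lborel torus_cell h \<and> set_integrable lborel torus_cell G \<and>
     (\<forall>\<phi> D\<phi>. periodic \<phi> \<and> continuous_on UNIV D\<phi> \<and>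
        (\<forall>x. (\<phi> has_derivative (\<lambda>k. D\<phi> x \<bullet> k)) (at x)) \<longrightarrow>
        (LINT x:torus_cell|lborel. h x *\<^sub>R D\<phi> x) = - (LINT x:torus_cell|lborel. \<phi> x *\<^sub>R G x))"

text \<open>
  The strict Hoelder bound is required at pairs of distinct points of the torus; for equal points
  it would read \<open>0 < 0\<close>.
\<close>

definition background_admissible :: "(vec3 \<Rightarrow> vec3 \<Rightarrow> real) \<Rightarrow> bool" where
  "background_admissible g \<longleftrightarrow>
     torus_density g \<and>
     (\<integral>\<^sup>+ v. ess_bound g v * ennreal (1 + (norm v)\<^sup>2) \<partial>lborel) < \<infinity> \<and>
     esssup lborel (\<lambda>v. ess_bound g v * ennreal (1 + norm v)) < \<infinity> \<and>
     (\<exists>G. (\<lambda>z. G (fst z) (snd z)) \<in> borel_measurable borel \<and>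
        (AE v in lborel. weak_gradient (\<lambda>x. g x v) (\<lambda>x. G x v)) \<and>
        esssup (restrict_space lborel torus_cell)
          (\<lambda>x. \<integral>\<^sup>+ v. ennreal (norm (G x v) * (1 + norm v)) \<partial>lborel) < \<infinity>) \<and>
     (\<exists>H \<alpha>. 0 < H \<and> 0 < \<alpha> \<and> \<alpha> \<le> 1 \<and>
        (AE v in lborel. \<forall>x y. tdist x y \<noteq> 0 \<longrightarrow> \<bar>g x v - g y v\<bar> < H * tdist x y powr \<alpha>))"

definition transported :: "(vec3 \<Rightarrow> vec3 \<Rightarrow> real) \<Rightarrow> real \<Rightarrow> vec3 \<Rightarrow> vec3 \<Rightarrow> real" where
  "transported g t x v = g (x - t *\<^sub>R v) v"


section \<open>Particle dynamics\<close>

text \<open>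
  An initial configuration consists of the state of the tagged particle and the states of the
  background particles, indexed by \<open>{..<N}\<close>.
\<close>

type_synonym config = "state \<times> (nat \<Rightarrow> state)"

definition state_law :: "(vec3 \<Rightarrow> vec3 \<Rightarrow> real) \<Rightarrow> state measure" where
  "state_law f =
     density lborel (\<lambda>z. ennreal (f (fst z) (snd z)) * indicator (torus_cell \<times> UNIV) z)"

definition initial_law ::
    "nat \<Rightarrow> (vec3 \<Rightarrow> vec3 \<Rightarrow> real) \<Rightarrow> (vec3 \<Rightarrow> vec3 \<Rightarrow> real) \<Rightarrow> config measure" where
  "initial_law N f g = state_law f \<Otimes>\<^sub>M (\<Pi>\<^sub>M i\<in>{..<N}. state_law g)"

definition no_initial_overlap :: "real \<Rightarrow> nat \<Rightarrow> config \<Rightarrow> bool" where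
  "no_initial_overlap \<epsilon> N \<omega> \<longleftrightarrow> (\<forall>i<N. tdist (fst (fst \<omega>)) (fst (snd \<omega> i)) > \<epsilon>)"

text \<open>
  Times in \<open>{0<..t}\<close> at which the paths \<open>X\<close> and \<open>Y\<close> come to distance \<open>\<epsilon>\<close> from outside. In particular
  particles that overlap initially leave the overlap without colliding.
\<close>

definition contact_times :: "real \<Rightarrow> real \<Rightarrow> (real \<Rightarrow> vec3) \<Rightarrow> (real \<Rightarrow> vec3) \<Rightarrow> real set" where
  "contact_times \<epsilon> t X Y =
     {s. 0 < s \<and> s \<le> t \<and> tdist (X s) (Y s) = \<epsilon> \<and>
         (\<forall>\<^sub>F r in at_left s. tdist (X r) (Y r) > \<epsilon>)}"

text \<open>\<open>\<nu>\<close> is the unit vector pointing from \<open>x\<close> to the point \<open>y\<close> at torus distance \<open>\<epsilon>\<close>.\<close>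

definition impact :: "real \<Rightarrow> vec3 \<Rightarrow> vec3 \<Rightarrow> vec3 \<Rightarrow> bool" where
  "impact \<epsilon> x y \<nu> \<longleftrightarrow> norm \<nu> = 1 \<and> y - (x + \<epsilon> *\<^sub>R \<nu>) \<in> int_lattice"

definition tagged_after :: "vec3 \<Rightarrow> vec3 \<Rightarrow> vec3 \<Rightarrow> vec3" where
  "tagged_after \<nu> v w = v - (\<nu> \<bullet> (v - w)) *\<^sub>R \<nu>"

definition background_after :: "vec3 \<Rightarrow> vec3 \<Rightarrow> vec3 \<Rightarrow> vec3" where
  "background_after \<nu> v w = w + (\<nu> \<bullet> (v - w)) *\<^sub>R \<nu>"

text \<open>
  Motion on \<open>{0..t}\<close> with constant velocity except at the times in \<open>C\<close>; the velocity is continuous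
  from the right.
\<close>

definition free_flight :: "real \<Rightarrow> real set \<Rightarrow> (real \<Rightarrow> vec3) \<Rightarrow> (real \<Rightarrow> vec3) \<Rightarrow> bool" where
  "free_flight t C X V \<longleftrightarrow>
     (\<forall>r s. 0 \<le> r \<and> r \<le> s \<and> s \<le> t \<longrightarrow>
        (C \<inter> {r<..<s} = {} \<longrightarrow> X s = X r + (s - r) *\<^sub>R V r) \<and>
        (C \<inter> {r<..s} = {} \<longrightarrow> V s = V r))"

text \<open>
  \<open>(X, V)\<close> is the motion of the tagged particle and \<open>(Y i, W i)\<close> that of background particle \<open>i\<close> up to
  time \<open>t\<close>. Configurations leading to simultaneous or infinitely many collisions, which form a null
  set, have no such motion; otherwise the motion is unique on \<open>{0..t}\<close>.
\<close>

definition particle_motion ::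
    "real \<Rightarrow> nat \<Rightarrow> real \<Rightarrow> config \<Rightarrow>
     (real \<Rightarrow> vec3) \<Rightarrow> (real \<Rightarrow> vec3) \<Rightarrow> (nat \<Rightarrow> real \<Rightarrow> vec3) \<Rightarrow> (nat \<Rightarrow> real \<Rightarrow> vec3) \<Rightarrow> bool" where
  "particle_motion \<epsilon> N t \<omega> X V Y W \<longleftrightarrow>
     (X 0, V 0) = fst \<omega> \<and>
     (\<forall>i<N. (Y i 0, W i 0) = snd \<omega> i) \<and>
     finite (\<Union>i<N. contact_times \<epsilon> t X (Y i)) \<and>
     (\<forall>i<N. \<forall>j<N. i \<noteq> j \<longrightarrow> contact_times \<epsilon> t X (Y i) \<inter> contact_times \<epsilon> t X (Y j) = {}) \<and>
     free_flight t (\<Union>i<N. contact_times \<epsilon> t X (Y i)) X V \<and>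
     (\<forall>i<N. free_flight t (contact_times \<epsilon> t X (Y i)) (Y i) (W i)) \<and>
     (\<forall>i<N. \<forall>s \<in> contact_times \<epsilon> t X (Y i). \<exists>\<nu>. impact \<epsilon> (X s) (Y i s) \<nu> \<and>
        V s = tagged_after \<nu> (Lim (at_left s) V) (Lim (at_left s) (W i)) \<and>
        W i s = background_after \<nu> (Lim (at_left s) V) (Lim (at_left s) (W i)))"


section \<open>Collision trees\<close>

type_synonym mark = "real \<times> vec3 \<times> vec3"
type_synonym tree = "state \<times> mark list"

definition collision_trees :: "real \<Rightarrow> tree set" where
  "collision_trees T = {(z, cs). fst z \<in> torus_cell \<and> sorted_wrt (<) (map fst cs) \<and>
                (\<forall>(s, \<nu>, w) \<in> set cs. 0 \<le> s \<and> s \<le> T \<and> norm \<nu> = 1)}"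

definition n_coll :: "tree \<Rightarrow> nat" where
  "n_coll \<Phi> = length (snd \<Phi>)"

definition coll_time :: "tree \<Rightarrow> nat \<Rightarrow> real" where
  "coll_time \<Phi> j = fst (snd \<Phi> ! j)"

definition coll_param :: "tree \<Rightarrow> nat \<Rightarrow> vec3" where
  "coll_param \<Phi> j = fst (snd (snd \<Phi> ! j))"

definition coll_vel :: "tree \<Rightarrow> nat \<Rightarrow> vec3" where
  "coll_vel \<Phi> j = snd (snd (snd \<Phi> ! j))"

definition last_time :: "tree \<Rightarrow> real" where
  "last_time \<Phi> = (if n_coll \<Phi> = 0 then 0 else coll_time \<Phi> (n_coll \<Phi> - 1))"

definition parent :: "tree \<Rightarrow> tree" where
  "parent \<Phi> = (fst \<Phi>, butlast (snd \<Phi>))"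

definition truncate_tree :: "nat \<Rightarrow> tree \<Rightarrow> tree" where
  "truncate_tree j \<Phi> = (fst \<Phi>, take j (snd \<Phi>))"

text \<open>State at time \<open>s\<close> of a root that is in state \<open>(x, v)\<close> at time \<open>r\<close> and then suffers the listed collisions.\<close>

fun root_from :: "real \<Rightarrow> state \<Rightarrow> mark list \<Rightarrow> real \<Rightarrow> state" where
  "root_from r (x, v) [] s = (x + (s - r) *\<^sub>R v, v)"
| "root_from r (x, v) ((t, \<nu>, w) # cs) s =
     (if s < t then (x + (s - r) *\<^sub>R v, v)
      else root_from t (x + (t - r) *\<^sub>R v, tagged_after \<nu> v w) cs s)"

definition root_pos :: "tree \<Rightarrow> real \<Rightarrow> vec3" where
  "root_pos \<Phi> s = fst (root_from 0 (fst \<Phi>) (snd \<Phi>) s)"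

definition root_vel :: "tree \<Rightarrow> real \<Rightarrow> vec3" where
  "root_vel \<Phi> s = snd (root_from 0 (fst \<Phi>) (snd \<Phi>) s)"

text \<open>
  The root velocity just before collision \<open>j\<close> (collisions are counted from \<open>0\<close>), obtained by
  leaving out this collision and the later ones.
\<close>

definition pre_vel :: "tree \<Rightarrow> nat \<Rightarrow> vec3" where
  "pre_vel \<Phi> j = root_vel (truncate_tree j \<Phi>) (coll_time \<Phi> j)"

definition partner_vel :: "tree \<Rightarrow> nat \<Rightarrow> real \<Rightarrow> vec3" where
  "partner_vel \<Phi> j s =
     (if s < coll_time \<Phi> j then coll_vel \<Phi> j
      else background_after (coll_param \<Phi> j) (pre_vel \<Phi> j) (coll_vel \<Phi> j))"

definition partner_pos :: "real \<Rightarrow> tree \<Rightarrow> nat \<Rightarrow> real \<Rightarrow> vec3" where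
  "partner_pos \<epsilon> \<Phi> j s =
     root_pos \<Phi> (coll_time \<Phi> j) + \<epsilon> *\<^sub>R coll_param \<Phi> j + (s - coll_time \<Phi> j) *\<^sub>R partner_vel \<Phi> j s"

text \<open>
  Lebesgue measure on trees, that is, on each component with a fixed number of collisions.
\<close>

definition mk_tree :: "nat \<Rightarrow> state \<times> (nat \<Rightarrow> mark) \<Rightarrow> tree" where
  "mk_tree n y = (fst y, map (snd y) [0..<n])"

definition component_measure :: "nat \<Rightarrow> (state \<times> (nat \<Rightarrow> mark)) measure" where
  "component_measure n =
     lborel \<Otimes>\<^sub>M (\<Pi>\<^sub>M j\<in>{..<n}. lborel \<Otimes>\<^sub>M (sphere_measure \<Otimes>\<^sub>M lborel))"

definition component_part :: "nat \<Rightarrow> tree set \<Rightarrow> (state \<times> (nat \<Rightarrow> mark)) set" where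
  "component_part n A = mk_tree n -` A \<inter> space (component_measure n)"

definition tree_measure :: "real \<Rightarrow> tree measure" where
  "tree_measure T =
     measure_of (collision_trees T) {A. A \<subseteq> collision_trees T \<and> (\<forall>n. component_part n A \<in> sets (component_measure n))}
       (\<lambda>A. \<Sum>n. emeasure (component_measure n) (component_part n A))"


section \<open>Good trees\<close>

definition recollision_free :: "real \<Rightarrow> real \<Rightarrow> tree \<Rightarrow> bool" where
  "recollision_free \<epsilon> t \<Phi> \<longleftrightarrow>
     (\<forall>j < n_coll \<Phi>. \<forall>s \<in> {0..t} - {coll_time \<Phi> j}. tdist (root_pos \<Phi> s) (partner_pos \<epsilon> \<Phi> j s) > \<epsilon>)"

definition partners_apart :: "real \<Rightarrow> tree \<Rightarrow> bool" where
  "partners_apart \<epsilon> \<Phi> \<longleftrightarrow>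
     (\<forall>j < n_coll \<Phi>. tdist (root_pos \<Phi> 0) (partner_pos \<epsilon> \<Phi> j 0) > \<epsilon>)"

definition non_grazing :: "tree \<Rightarrow> bool" where
  "non_grazing \<Phi> \<longleftrightarrow>
     (\<forall>j < n_coll \<Phi>. coll_param \<Phi> j \<bullet> (pre_vel \<Phi> j - coll_vel \<Phi> j) > 0)"

text \<open>
  Trees that are regular up to time \<open>t\<close>. This set is larger than the set of good trees: it leaves a
  neighbourhood around them, and it contains \<open>parent \<Phi>\<close> for good \<open>\<Phi>\<close> and \<open>t = last_time \<Phi>\<close>, although
  \<open>parent \<Phi>\<close> may have a re-collision after time \<open>t\<close> and hence need not be good.
\<close>

definition regular_trees :: "real \<Rightarrow> real \<Rightarrow> real \<Rightarrow> tree set" where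
  "regular_trees T \<epsilon> t = {\<Phi> \<in> collision_trees T. recollision_free \<epsilon> t \<Phi> \<and> partners_apart \<epsilon> \<Phi> \<and> non_grazing \<Phi>}"

text \<open>
  A tree does not contain the background particles that never collide with the root. For these the
  absence of an initial overlap is part of the observed event, see the definition of
  \<open>empirical_law\<close>; for the collision partners it is a condition on the tree.
\<close>

definition good_trees :: "real \<Rightarrow> (real \<Rightarrow> real) \<Rightarrow> (real \<Rightarrow> real) \<Rightarrow> real \<Rightarrow> tree set" where
  "good_trees T V M \<epsilon> =
     {\<Phi> \<in> collision_trees T.
        real (n_coll \<Phi>) \<le> M \<epsilon> \<and>
        (\<forall>s \<in> {0..T}. norm (root_vel \<Phi> s) \<le> V \<epsilon> \<and> (\<forall>j < n_coll \<Phi>. norm (partner_vel \<Phi> j s) \<le> V \<epsilon>)) \<and>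
        recollision_free \<epsilon> T \<Phi> \<and> partners_apart \<epsilon> \<Phi> \<and> non_grazing \<Phi>}"

definition cutoffs :: "(real \<Rightarrow> real) \<Rightarrow> (real \<Rightarrow> real) \<Rightarrow> bool" where
  "cutoffs V M \<longleftrightarrow>
     (\<forall>\<epsilon>>0. 0 \<le> V \<epsilon> \<and> 0 \<le> M \<epsilon>) \<and>
     antimono_on {0<..} V \<and> antimono_on {0<..} M \<and>
     filterlim V at_top (at_right 0) \<and> filterlim M at_top (at_right 0) \<and>
     (\<forall>\<epsilon>. 0 < \<epsilon> \<and> \<epsilon> < 1 \<longrightarrow> \<epsilon> * V \<epsilon> ^ 3 \<le> 1 / 8 \<and> M \<epsilon> \<le> \<epsilon> powr (- 1 / 2))"


section \<open>The empirical distribution\<close>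

text \<open>\<open>\<Phi>\<close> records the collisions of the tagged particle up to time \<open>t\<close> when the particles start from \<open>\<omega>\<close>.\<close>

definition collision_history :: "real \<Rightarrow> nat \<Rightarrow> real \<Rightarrow> config \<Rightarrow> tree \<Rightarrow> bool" where
  "collision_history \<epsilon> N t \<omega> \<Phi> \<longleftrightarrow>
     fst \<Phi> = fst \<omega> \<and> sorted_wrt (<) (map fst (snd \<Phi>)) \<and>
     (\<exists>X V Y W. particle_motion \<epsilon> N t \<omega> X V Y W \<and>
        fst ` set (snd \<Phi>) = (\<Union>i<N. contact_times \<epsilon> t X (Y i)) \<and>
        (\<forall>(s, \<nu>, w) \<in> set (snd \<Phi>). \<exists>i<N. s \<in> contact_times \<epsilon> t X (Y i) \<and>
           impact \<epsilon> (X s) (Y i s) \<nu> \<and> w = Lim (at_left s) (W i)))"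

text \<open>
  The law of the collision history up to time \<open>t\<close>, observed together with the information (a Boolean
  flag) whether the configuration is free from initial overlap between the tagged particle and all
  of the \<open>N\<close> background particles. The completion is used because the history is defined only almost
  surely.
\<close>

definition empirical_law ::
    "real \<Rightarrow> nat \<Rightarrow> (vec3 \<Rightarrow> vec3 \<Rightarrow> real) \<Rightarrow> (vec3 \<Rightarrow> vec3 \<Rightarrow> real) \<Rightarrow> real \<Rightarrow> (bool \<times> tree) set \<Rightarrow> ennreal" where
  "empirical_law \<epsilon> N f g t B =
     emeasure (completion (initial_law N f g))
       {\<omega> \<in> space (initial_law N f g).
          \<exists>\<Phi>. collision_history \<epsilon> N t \<omega> \<Phi> \<and> (no_initial_overlap \<epsilon> N \<omega>, \<Phi>) \<in> B}"

text \<open>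
  \<open>P t\<close> is, for each time \<open>t\<close>, a version of the density of the empirical distribution on the trees
  free from initial overlap. Densities being unique only up to null sets, the version is chosen
  continuous from the right in time on good trees; this is what gives meaning to the value \<open>P t \<Phi>\<close>
  at the single time \<open>t = last_time \<Phi>\<close>.
\<close>

definition empirical_density ::
    "real \<Rightarrow> (real \<Rightarrow> real) \<Rightarrow> (real \<Rightarrow> real) \<Rightarrow> real \<Rightarrow> nat \<Rightarrow>
     (vec3 \<Rightarrow> vec3 \<Rightarrow> real) \<Rightarrow> (vec3 \<Rightarrow> vec3 \<Rightarrow> real) \<Rightarrow> (real \<Rightarrow> tree \<Rightarrow> real) \<Rightarrow> bool" where
  "empirical_density T V M \<epsilon> N f g P \<longleftrightarrow>
     (\<forall>t \<in> {0..T}.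
        P t \<in> borel_measurable (tree_measure T) \<and> (\<forall>\<Phi> \<in> collision_trees T. 0 \<le> P t \<Phi>) \<and>
        (\<forall>A \<in> sets (tree_measure T). A \<subseteq> regular_trees T \<epsilon> t \<longrightarrow>
           empirical_law \<epsilon> N f g t ({True} \<times> A) = (\<integral>\<^sup>+ \<Phi> \<in> A. ennreal (P t \<Phi>) \<partial>tree_measure T))) \<and>
     (\<forall>\<Phi> \<in> good_trees T V M \<epsilon>. \<forall>t \<in> {0..<T}. continuous (at_right t) (\<lambda>s. P s \<Phi>))"


section \<open>The evolution equation\<close>

text \<open>\<open>unmet \<epsilon> \<Phi> t\<close> is the set whose indicator function is the weight in the denominators.\<close>

definition unmet :: "real \<Rightarrow> tree \<Rightarrow> real \<Rightarrow> state set" where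
  "unmet \<epsilon> \<Phi> t = {(y, w). \<forall>s. 0 < s \<and> s < t \<longrightarrow> tdist (root_pos \<Phi> s) (y + s *\<^sub>R w) > \<epsilon>}"

definition unmet_mass :: "real \<Rightarrow> (vec3 \<Rightarrow> vec3 \<Rightarrow> real) \<Rightarrow> tree \<Rightarrow> real \<Rightarrow> real" where
  "unmet_mass \<epsilon> g \<Phi> t =
     (LINT z:torus_cell \<times> UNIV|lborel. g (fst z) (snd z) * indicator (unmet \<epsilon> \<Phi> t) z)"

definition zeta :: "real \<Rightarrow> nat \<Rightarrow> (vec3 \<Rightarrow> vec3 \<Rightarrow> real) \<Rightarrow> tree \<Rightarrow> real" where
  "zeta \<epsilon> N g \<Phi> = (1 - (LINT y:torus_ball \<epsilon> (fst (fst \<Phi>))|lborel. (LINT w|lborel. g y w))) ^ N"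

definition gamma_coeff :: "real \<Rightarrow> tree \<Rightarrow> real \<Rightarrow> real" where
  "gamma_coeff \<epsilon> \<Phi> t =
     (if t < last_time \<Phi> then 1
      else if t = last_time \<Phi> then real (n_coll (parent \<Phi>)) * \<epsilon>\<^sup>2
      else real (n_coll \<Phi>) * \<epsilon>\<^sup>2)"

text \<open>The factor of the Dirac mass \<open>\<delta>(t - \<tau>)\<close> in the gain term; \<open>p\<close> is the density at time \<open>\<tau>\<close>.\<close>

definition gain_coeff :: "real \<Rightarrow> (vec3 \<Rightarrow> vec3 \<Rightarrow> real) \<Rightarrow> (tree \<Rightarrow> real) \<Rightarrow> tree \<Rightarrow> real" where
  "gain_coeff \<epsilon> g p \<Phi> =
     (if n_coll \<Phi> = 0 then 0
      else
        (let \<tau> = last_time \<Phi>; l = n_coll \<Phi> - 1; \<nu> = coll_param \<Phi> l; v' = coll_vel \<Phi> l in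
           p (parent \<Phi>) *
           (transported g \<tau> (root_pos \<Phi> \<tau> + \<epsilon> *\<^sub>R \<nu>) v' * max ((pre_vel \<Phi> l - v') \<bullet> \<nu>) 0
            / unmet_mass \<epsilon> g \<Phi> \<tau>)))"

text \<open>
  The loss term at time \<open>t\<close>; \<open>p\<close> is the density at time \<open>t\<close> and \<open>c\<close> the correction. The correction
  is the incoming flux of background particles that have been in contact with the root before. It is
  nonnegative, but not always positive: if \<open>g\<close> vanishes for large velocities, there is no such particle
  for a tree without collisions and small \<open>t\<close>.
\<close>

definition loss :: "real \<Rightarrow> (vec3 \<Rightarrow> vec3 \<Rightarrow> real) \<Rightarrow> real \<Rightarrow> real \<Rightarrow> (tree \<Rightarrow> real) \<Rightarrow> tree \<Rightarrow> real" where
  "loss \<epsilon> g c t p \<Phi> =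
     p \<Phi> *
     (((LINT \<nu>|sphere_measure. (LINT w|lborel.
          transported g t (root_pos \<Phi> t + \<epsilon> *\<^sub>R \<nu>) w * max ((root_vel \<Phi> (last_time \<Phi>) - w) \<bullet> \<nu>) 0)) - c)
      / unmet_mass \<epsilon> g \<Phi> t)"

end

theory Submission
  imports Defs
begin

text \<open>
  A background particle is free until it meets the root, so its initial state is determined by the
  mark \<open>(s, \<nu>, w)\<close> of its first contact: \<open>y = x(s) + \<epsilon> \<nu> - s w\<close>. This change of variables has the
  Jacobian \<open>\<epsilon>\<^sup>2 [(v - w) \<bullet> \<nu>]\<^sub>+\<close>. Applying it successively to the \<open>n\<close> collision partners, and summing
  over the \<open>N (N - 1) \<dots> (N - n + 1)\<close> ways to choose them, shows that the empirical distribution has the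
  density \<open>f\<^sub>0 \<Prod>\<^sub>j (N - j) \<epsilon>\<^sup>2 g\<^sub>0 [(v - w\<^sub>j) \<bullet> \<nu>\<^sub>j]\<^sub>+\<close> times the power \<open>S(t)\<^bsup>N - n\<^esup>\<close> of the probability that a
  background particle does not meet the root up to time \<open>t\<close>. This also gives the gain term. The loss term
  comes from \<open>S'(t) = - \<epsilon>\<^sup>2 R(t)\<close>, where \<open>R\<close> is the incoming flux of particles that have not met the root
  before. It differs from the full flux by the correction \<open>C\<close>, which tends to \<open>0\<close> since the particles
  that meet a given path twice in the limit \<open>\<epsilon> = 0\<close> have their velocities on countably many lines.
\<close>


section \<open>The torus and the sphere\<close>

text \<open>The equation is claimed at every time and for every good tree once \<epsilon> is small,
  not almost everywhere, and this shapes the analysis. To differentiate S at each t, R must be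
  continuous; hence the velocities whose backward line touches the tube around the path without
  entering it have to be null. Division by S needs S > 0 uniformly over good trees: a particle of
  velocity w meets a path of speed at most L only from a set of volume of order \<epsilon>^2 (L +
  |w| + 1), and the cutoffs keep \<epsilon>^2 V(\<epsilon>) small. The Jacobian is computed on the
  unit ball. The sphere carries the cone measure, so the cube of the radius and the direction are
  independent; contact time and collision parameter are packed into one point, and a single
  injective map of an open half ball replaces charts of the sphere. The motion of N particles must
  be reduced to a function of the partners. A regular tree has no re-collision, so each partner is
  free until its only contact, and a configuration determines both the tree and the labels of the
  partners. Events for different labels are therefore disjoint and their probabilities add
  up.\<close>

definition wrap :: "vec3 \<Rightarrow> vec3" where
  "wrap x = (\<chi> i. x $ i - of_int \<lfloor>x $ i + 1 / 2\<rfloor>)"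

lemma lattice_0 [simp]: "0 \<in> int_lattice"
  by (simp add: int_lattice_def)

lemma lattice_diff: "k \<in> int_lattice \<Longrightarrow> l \<in> int_lattice \<Longrightarrow> k - l \<in> int_lattice"
  by (simp add: int_lattice_def)

lemma lattice_uminus [simp]: "- k \<in> int_lattice \<longleftrightarrow> k \<in> int_lattice"
  by (simp add: int_lattice_def)

lemma lattice_wrap: "x - wrap x \<in> int_lattice"
  by (simp add: int_lattice_def wrap_def)

text \<open>In each coordinate \<open>wrap\<close> subtracts a nearest integer, so no other integer
  leaves a smaller remainder. Thus \<open>wrap x\<close> is a shortest representative of the class
  of \<open>x\<close>, and the infimum in \<open>tdist\<close> is attained at it.\<close>

lemma wrap_le: "k \<in> int_lattice \<Longrightarrow> norm (wrap x) \<le> norm (x - k)"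
proof (rule norm_le_componentwise_cart)
  fix i assume "k \<in> int_lattice"
  then obtain n :: int where n: "k $ i = of_int n"
    by (auto simp: int_lattice_def elim: Ints_cases)
  show "norm (wrap x $ i) \<le> norm ((x - k) $ i)"
  proof (cases "n = \<lfloor>x $ i + 1 / 2\<rfloor>")
    case True then show ?thesis by (simp add: wrap_def n)
  next
    case False
    then show ?thesis by (simp add: wrap_def n) linarith
  qed
qed

lemma tdist_wrap: "tdist x y = norm (wrap (x - y))"
proof (rule antisym)
  have "infdist (x - y) int_lattice \<le> dist (x - y) ((x - y) - wrap (x - y))"
    by (rule infdist_le[OF lattice_wrap])
  then show "tdist x y \<le> norm (wrap (x - y))"
    by (simp add: tdist_def dist_norm)
  have "norm (wrap (x - y)) \<le> infdist (x - y) int_lattice"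
    unfolding infdist_def using lattice_0
    by (auto intro!: cINF_greatest wrap_le simp: dist_norm simp del: lattice_0)
  then show "norm (wrap (x - y)) \<le> tdist x y"
    by (simp add: tdist_def)
qed

lemma tdist_nonneg [simp]: "0 \<le> tdist x y"
  by (simp add: tdist_wrap)

lemma tdist_le: "k \<in> int_lattice \<Longrightarrow> tdist x y \<le> norm (x - y - k)"
  unfolding tdist_wrap by (rule wrap_le)

lemma tdist_attained: obtains k where "k \<in> int_lattice" "tdist x y = norm (x - y - k)"
  using lattice_wrap[of "x - y"] by (auto simp: tdist_wrap intro: that[of "x - y - wrap (x - y)"])

lemma tdist_le_iff: "tdist x y \<le> c \<longleftrightarrow> (\<exists>k \<in> int_lattice. norm (x - y - k) \<le> c)"
  using tdist_le[of _ x y] tdist_attained[of x y] by (metis order.trans)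

lemma tdist_lipschitz: "\<bar>tdist x y - tdist x' y'\<bar> \<le> norm ((x - y) - (x' - y'))"
  unfolding tdist_def using infdist_triangle_abs[of "x - y" int_lattice "x' - y'"]
  by (simp add: dist_norm)

lemma tdist_lattice: "(x - y) - (x' - y') \<in> int_lattice \<Longrightarrow> tdist x y = tdist x' y'"
proof -
  have *: "tdist x' y' \<le> tdist x y" if "(x - y) - (x' - y') \<in> int_lattice" for x y x' y'
  proof -
    obtain k where k: "k \<in> int_lattice" "tdist x y = norm (x - y - k)"
      by (rule tdist_attained)
    have "tdist x' y' \<le> norm (x' - y' - (k - ((x - y) - (x' - y'))))"
      by (rule tdist_le[OF lattice_diff[OF k(1) that]])
    also have "x' - y' - (k - ((x - y) - (x' - y'))) = x - y - k" by simp
    finally show ?thesis by (simp add: k)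
  qed
  assume a: "(x - y) - (x' - y') \<in> int_lattice"
  then have "(x' - y') - (x - y) \<in> int_lattice"
    using lattice_uminus[of "(x - y) - (x' - y')"] by simp
  with a show ?thesis by (intro antisym *)
qed

lemma tdist_commute: "tdist x y = tdist y x"
proof -
  have *: "tdist x y \<le> tdist y x" for x y
  proof -
    obtain k where k: "k \<in> int_lattice" "tdist y x = norm (y - x - k)"
      by (rule tdist_attained)
    then have "tdist x y \<le> norm (x - y - (- k))" by (intro tdist_le) auto
    also have "\<dots> = norm (y - x - k)" by (metis minus_diff_eq norm_minus_cancel diff_minus_eq_add add.commute diff_add_eq)
    finally show ?thesis by (simp add: k)
  qed
  show ?thesis by (intro antisym *)
qed

lemma tdist_eq_norm: "norm (x - y) < 1 / 2 \<Longrightarrow> tdist x y = norm (x - y)"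
proof -
  assume a: "norm (x - y) < 1 / 2"
  have "wrap (x - y) = x - y"
  proof -
    have "\<lfloor>(x - y) $ i + 1 / 2\<rfloor> = 0" for i
    proof -
      have "\<bar>(x - y) $ i\<bar> < 1 / 2" using a component_le_norm_cart[of "x - y" i] by linarith
      then show ?thesis by linarith
    qed
    then show ?thesis by (simp add: wrap_def vec_eq_iff)
  qed
  then show ?thesis by (simp add: tdist_wrap)
qed

lemma lattice_small: "k \<in> int_lattice \<Longrightarrow> norm k < 1 \<Longrightarrow> k = 0"
proof -
  assume k: "k \<in> int_lattice" "norm k < 1"
  have "k $ i = 0" for i
  proof -
    obtain n :: int where n: "k $ i = of_int n"
      using k by (auto simp: int_lattice_def elim: Ints_cases)
    moreover have "\<bar>k $ i\<bar> < 1" using k component_le_norm_cart[of k i] by linarith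
    ultimately have "\<bar>real_of_int n\<bar> < 1" by simp
    then have "n = 0" by linarith
    with n show ?thesis by simp
  qed
  then show ?thesis by (simp add: vec_eq_iff)
qed

text \<open>Two representatives of one class, one shorter than 1/2 and one shortest, differ by a
  lattice vector of norm below 1, which is 0. For \<open>\<epsilon> < 1 / 2\<close> this lets
  \<open>wrap\<close> recover \<open>\<epsilon> *\<^sub>R \<nu>\<close> from the positions at a
  contact.\<close>

lemma wrap_lattice: "x - y \<in> int_lattice \<Longrightarrow> norm y < 1 / 2 \<Longrightarrow> wrap x = y"
proof -
  assume a: "x - y \<in> int_lattice" "norm y < 1 / 2"
  have "norm (wrap x) \<le> norm (x - (x - y))" by (rule wrap_le[OF a(1)])
  then have "norm (wrap x - y) < 1"
    using a(2) norm_triangle_ineq4[of "wrap x" y] by simp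
  moreover have "wrap x - y \<in> int_lattice"
  proof -
    have "wrap x - y = (x - y) - (x - wrap x)" by simp
    then show ?thesis using lattice_wrap[of x] a(1) by (metis lattice_diff)
  qed
  ultimately show ?thesis using lattice_small by fastforce
qed

lemma countable_lattice: "countable int_lattice"
proof -
  have "int_lattice \<subseteq> range (\<lambda>n :: int ^ 3. \<chi> i. of_int (n $ i))"
  proof
    fix k assume "k \<in> int_lattice"
    then have "k = (\<chi> i. of_int ((\<chi> i. \<lfloor>k $ i\<rfloor>) $ i))"
      by (auto simp: int_lattice_def vec_eq_iff elim: Ints_cases)
    then show "k \<in> range (\<lambda>n :: int ^ 3. (\<chi> i. of_int (n $ i)) :: vec3)" by blast
  qed
  moreover have "countable (range (\<lambda>n :: int ^ 3. (\<chi> i. of_int (n $ i)) :: vec3))"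
    by (rule countable_image) (rule countableI_type)
  ultimately show ?thesis by (rule countable_subset)
qed

lemma continuous_tdist [continuous_intros]:
  fixes f g :: "'a :: t2_space \<Rightarrow> vec3"
  assumes "continuous_on S f" "continuous_on S g"
  shows "continuous_on S (\<lambda>x. tdist (f x) (g x))"
  unfolding tdist_def using assms by (intro continuous_intros)

lemma tendsto_tdist [tendsto_intros]:
  assumes "(f \<longlongrightarrow> a) F" "(g \<longlongrightarrow> b) F"
  shows "((\<lambda>x. tdist (f x) (g x)) \<longlongrightarrow> tdist a b) F"
  unfolding tdist_def using assms by (intro tendsto_intros)

lemma measurable_tdist [measurable (raw)]:
  assumes [measurable]: "f \<in> borel_measurable M" "g \<in> borel_measurable M"
  shows "(\<lambda>x. tdist (f x) (g x)) \<in> borel_measurable M"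
proof -
  have "(\<lambda>z. infdist z int_lattice) \<in> borel_measurable borel"
    by (intro borel_measurable_continuous_onI continuous_intros)
  then have "(\<lambda>z. infdist z int_lattice) \<circ> (\<lambda>x. f x - g x) \<in> borel_measurable M"
    by (intro measurable_comp[of _ _ borel]) auto
  then show ?thesis by (simp add: tdist_def o_def)
qed

lemma measurable_wrap [measurable]: "wrap \<in> borel_measurable borel"
proof (rule borel_measurable_euclidean_space[THEN iffD2], rule ballI)
  fix b :: vec3 assume "b \<in> Basis"
  then obtain i where b: "b = axis i 1" by (auto simp: Basis_vec_def)
  have "(\<lambda>x::vec3. x $ i - of_int \<lfloor>x $ i + 1 / 2\<rfloor>) \<in> borel_measurable borel" by measurable
  then show "(\<lambda>x. wrap x \<bullet> b) \<in> borel_measurable borel"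
    by (simp add: b inner_axis wrap_def)
qed

lemma torus_cell_measurable [measurable]: "torus_cell \<in> sets borel"
proof -
  have "torus_cell = (\<Inter>i. {x. 0 \<le> x $ i \<and> x $ i < 1})" by (auto simp: torus_cell_def)
  moreover have "\<dots> \<in> sets borel" by measurable
  ultimately show ?thesis by simp
qed

lemma torus_cell_translate: "\<exists>!k. k \<in> int_lattice \<and> x - k \<in> torus_cell"
proof (rule ex1I)
  let ?k = "(\<chi> i. of_int \<lfloor>x $ i\<rfloor>) :: vec3"
  show "?k \<in> int_lattice \<and> x - ?k \<in> torus_cell"
    by (auto simp: int_lattice_def torus_cell_def) linarith
  fix k assume k: "k \<in> int_lattice \<and> x - k \<in> torus_cell"
  have "k $ i = of_int \<lfloor>x $ i\<rfloor>" for i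
  proof -
    obtain n :: int where n: "k $ i = of_int n"
      using k by (auto simp: int_lattice_def elim: Ints_cases)
    have "0 \<le> (x - k) $ i" "(x - k) $ i < 1" using k unfolding torus_cell_def by blast+
    then have "0 \<le> x $ i - n" "x $ i - n < 1" by (simp_all add: n)
    then have "n = \<lfloor>x $ i\<rfloor>" by linarith
    then show ?thesis by (simp add: n)
  qed
  then show "k = ?k" by (simp add: vec_eq_iff)
qed

lemma nn_integral_translate:
  fixes G :: "'a :: euclidean_space \<Rightarrow> ennreal"
  assumes [measurable]: "G \<in> borel_measurable borel"
  shows "(\<integral>\<^sup>+ y. G (y + c) \<partial>lborel) = (\<integral>\<^sup>+ y. G y \<partial>lborel)"
proof -
  have "(\<integral>\<^sup>+ y. G y \<partial>lborel) = (\<integral>\<^sup>+ y. G y \<partial>distr lborel borel ((+) c))"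
    by (simp add: lborel_distr_plus)
  also have "\<dots> = (\<integral>\<^sup>+ y. G (c + y) \<partial>lborel)" by (subst nn_integral_distr) auto
  finally show ?thesis by (simp add: add.commute)
qed

text \<open>The integer translates of the half-open cell tile the space. The identity links Lebesgue
  measure on \<open>real ^ 3\<close>, where Jacobians are computed, to integrals over the torus,
  where the initial laws live.\<close>

lemma nn_integral_fold:
  assumes G [measurable]: "G \<in> borel_measurable borel"
  shows "(\<integral>\<^sup>+ y. G y \<partial>lborel)
    = (\<integral>\<^sup>+ y \<in> torus_cell. (\<integral>\<^sup>+ k. G (y + k) \<partial>count_space int_lattice) \<partial>lborel)"
proof -
  have "(\<integral>\<^sup>+ y. G y \<partial>lborel)
      = (\<integral>\<^sup>+ y. (\<integral>\<^sup>+ k. G y * indicator torus_cell (y - k) \<partial>count_space int_lattice) \<partial>lborel)"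
  proof (rule nn_integral_cong)
    fix y :: vec3
    obtain k where k: "k \<in> int_lattice \<and> y - k \<in> torus_cell"
      and u: "\<forall>l. l \<in> int_lattice \<and> y - l \<in> torus_cell \<longrightarrow> l = k"
      by (rule ex1E[OF torus_cell_translate[of y]])
    have "(\<integral>\<^sup>+ l. G y * indicator torus_cell (y - l) \<partial>count_space int_lattice)
        = (\<integral>\<^sup>+ l. G y * indicator {k} l \<partial>count_space int_lattice)"
    proof (rule nn_integral_cong)
      fix l assume "l \<in> space (count_space int_lattice)"
      then have "y - l \<in> torus_cell \<longleftrightarrow> l \<in> {k}" using k u unfolding singleton_iff space_count_space by blast
      then show "G y * indicator torus_cell (y - l) = G y * indicator {k} l"
        unfolding indicator_def by simp
    qed
    also have "\<dots> = G y"
      using k by (subst nn_integral_cmult_indicator) (auto simp: emeasure_count_space)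
    finally show "G y = (\<integral>\<^sup>+ k. G y * indicator torus_cell (y - k) \<partial>count_space int_lattice)" by (rule sym)
  qed
  also have "\<dots> = (\<integral>\<^sup>+ k. (\<integral>\<^sup>+ y. G y * indicator torus_cell (y - k) \<partial>lborel) \<partial>count_space int_lattice)"
    by (rule nn_integral_count_space_nn_integral[OF countable_lattice]) measurable
  also have "\<dots> = (\<integral>\<^sup>+ k. (\<integral>\<^sup>+ y. G (y + k) * indicator torus_cell y \<partial>lborel) \<partial>count_space int_lattice)"
  proof (rule nn_integral_cong)
    fix k :: vec3
    show "(\<integral>\<^sup>+ y. G y * indicator torus_cell (y - k) \<partial>lborel) = (\<integral>\<^sup>+ y. G (y + k) * indicator torus_cell y \<partial>lborel)"
      by (subst nn_integral_translate[symmetric, of _ k]) auto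
  qed
  also have "\<dots> = (\<integral>\<^sup>+ y. (\<integral>\<^sup>+ k. G (y + k) * indicator torus_cell y \<partial>count_space int_lattice) \<partial>lborel)"
    by (rule nn_integral_count_space_nn_integral[OF countable_lattice, symmetric]) measurable
  also have "\<dots> = (\<integral>\<^sup>+ y \<in> torus_cell. (\<integral>\<^sup>+ k. G (y + k) \<partial>count_space int_lattice) \<partial>lborel)"
    by (intro nn_integral_cong nn_integral_multc) auto
  finally show ?thesis .
qed

section \<open>Polar coordinates for the cone measure of the sphere\<close>

lemma sets_sphere_measure [measurable_cong, simp]: "sets sphere_measure = sets borel"
  by (simp add: sphere_measure_def)

lemma space_sphere_measure [simp]: "space sphere_measure = UNIV"
  by (simp add: sphere_measure_def)

lemma ball_measurable [measurable]: "ball (c::vec3) r \<in> sets borel"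
  by simp

lemma nn_integral_sphere_measure:
  assumes [measurable]: "F \<in> borel_measurable borel"
  shows "(\<integral>\<^sup>+ \<nu>. F \<nu> \<partial>sphere_measure) = (\<integral>\<^sup>+ x. 3 * indicator (ball 0 1) x * F (sgn x) \<partial>lborel)"
  unfolding sphere_measure_def by (subst nn_integral_distr, simp_all, subst nn_integral_density) auto

lemma emeasure_sphere_measure:
  assumes [measurable]: "B \<in> sets borel"
  shows "emeasure sphere_measure B = 3 * emeasure lborel {x. norm x < 1 \<and> sgn x \<in> B}"
proof -
  have "emeasure sphere_measure B = (\<integral>\<^sup>+ \<nu>. indicator B \<nu> \<partial>sphere_measure)"
    by (subst nn_integral_indicator) auto
  also have "\<dots> = (\<integral>\<^sup>+ x. 3 * indicator {x. norm x < 1 \<and> sgn x \<in> B} x \<partial>lborel)"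
    by (subst nn_integral_sphere_measure) (auto intro!: nn_integral_cong simp: indicator_def)
  also have "\<dots> = 3 * emeasure lborel {x. norm x < 1 \<and> sgn x \<in> B}"
    by (subst nn_integral_cmult_indicator) auto
  finally show ?thesis .
qed

lemma finite_sphere_measure: "finite_measure sphere_measure"
proof
  have "emeasure lborel {x::vec3. norm x < 1} = emeasure lborel (ball (0::vec3) 1)"
    by (rule arg_cong[where f = "emeasure lborel"]) auto
  also have "\<dots> < \<infinity>" using emeasure_lborel_ball_finite by blast
  finally show "emeasure sphere_measure (space sphere_measure) \<noteq> \<infinity>"
    by (simp add: emeasure_sphere_measure ennreal_mult_eq_top_iff)
qed

interpretation sphere: finite_measure sphere_measure by (rule finite_sphere_measure)

lemma AE_sphere_measure: "AE \<nu> in sphere_measure. norm \<nu> = 1"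
proof -
  have "AE x in lborel. x \<noteq> (0::vec3)" by (rule AE_lborel_singleton)
  then have "AE x in density lborel (\<lambda>x::vec3. 3 * indicator (ball 0 1) x). norm (sgn x) = 1"
    by (subst AE_density) (auto elim!: eventually_mono simp: norm_sgn)
  then show ?thesis unfolding sphere_measure_def
    by (subst AE_distr_iff) auto
qed

lemma emeasure_cone_scale:
  assumes [measurable]: "B \<in> sets borel" and r: "0 < r"
  shows "emeasure lborel {x::vec3. norm x \<le> r \<and> sgn x \<in> B}
    = ennreal (r ^ 3) * emeasure lborel {x::vec3. norm x \<le> 1 \<and> sgn x \<in> B}"
proof -
  have l: "lborel = density (distr lborel borel (\<lambda>x::vec3. 0 + r *\<^sub>R x)) (\<lambda>_. ennreal (\<bar>r\<bar> ^ DIM(vec3)))"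
    using r by (intro lborel_affine) auto
  have "emeasure lborel {x::vec3. norm x \<le> r \<and> sgn x \<in> B}
      = (\<integral>\<^sup>+ x. indicator {x::vec3. norm x \<le> r \<and> sgn x \<in> B} x \<partial>lborel)"
    by (subst nn_integral_indicator) auto
  also have "\<dots> = (\<integral>\<^sup>+ x. ennreal (r ^ 3) * indicator {x::vec3. norm x \<le> r \<and> sgn x \<in> B} (r *\<^sub>R x) \<partial>lborel)"
    by (subst l, subst nn_integral_density, simp, simp, subst nn_integral_distr) (simp_all add: r less_imp_le)
  also have "\<dots> = (\<integral>\<^sup>+ x. ennreal (r ^ 3) * indicator {x::vec3. norm x \<le> 1 \<and> sgn x \<in> B} x \<partial>lborel)"
    using r by (intro nn_integral_cong) (auto simp: indicator_def sgn_scaleR)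
  also have "\<dots> = ennreal (r ^ 3) * emeasure lborel {x::vec3. norm x \<le> 1 \<and> sgn x \<in> B}"
    by (subst nn_integral_cmult_indicator) auto
  finally show ?thesis .
qed

lemma emeasure_cone_closed:
  assumes [measurable]: "B \<in> sets borel"
  shows "3 * emeasure lborel {x::vec3. norm x \<le> 1 \<and> sgn x \<in> B} = emeasure sphere_measure B"
proof -
  have "negligible (sphere (0::vec3) 1)" by (rule negligible_sphere)
  then have n: "sphere (0::vec3) 1 \<in> null_sets lborel"
    by (simp add: negligible_iff_null_sets null_sets_completion_iff)
  have "emeasure lborel {x::vec3. norm x \<le> 1 \<and> sgn x \<in> B} = emeasure lborel {x::vec3. norm x < 1 \<and> sgn x \<in> B}"
    using AE_not_in[OF n] by (intro emeasure_eq_AE) (auto elim!: eventually_mono)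
  then show ?thesis by (simp add: emeasure_sphere_measure)
qed

text \<open>The part of a cone inside radius \<open>r\<close> has volume proportional to
  \<open>r ^ 3\<close>, so the cube of the radius is uniform on the unit interval, whatever the set
  \<open>B\<close> of directions. The two measures are compared on the half-lines
  \<open>{c<..}\<close>, of which only those with 0 < c < 1 are not degenerate.\<close>

lemma cone_radius_distr:
  assumes B [measurable]: "B \<in> sets borel"
  shows "distr (density lborel (\<lambda>x::vec3. 3 * indicator {x. norm x < 1 \<and> sgn x \<in> B} x)) borel (\<lambda>x. norm x ^ 3)
    = density lborel (\<lambda>r. emeasure sphere_measure B * indicator {0<..<1::real} r)"
    (is "distr ?D borel ?f = ?E")
proof (rule measure_eqI_lessThan)
  let ?s = "emeasure sphere_measure B"
  have s: "?s < \<infinity>" using sphere.emeasure_finite[of B] by (simp add: less_top[symmetric])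
  have A: "emeasure (distr ?D borel ?f) {c<..} = 3 * emeasure lborel {x::vec3. norm x < 1 \<and> sgn x \<in> B \<and> c < norm x ^ 3}" for c
  proof -
    have "emeasure (distr ?D borel ?f) {c<..} = emeasure ?D {x. c < norm x ^ 3}"
      by (subst emeasure_distr) (auto intro!: arg_cong[where f = "emeasure ?D"])
    also have "\<dots> = (\<integral>\<^sup>+ x. 3 * indicator {x::vec3. norm x < 1 \<and> sgn x \<in> B \<and> c < norm x ^ 3} x \<partial>lborel)"
      by (subst emeasure_density) (auto intro!: nn_integral_cong simp: indicator_def)
    also have "\<dots> = 3 * emeasure lborel {x::vec3. norm x < 1 \<and> sgn x \<in> B \<and> c < norm x ^ 3}"
      by (subst nn_integral_cmult_indicator) auto
    finally show ?thesis .
  qed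
  show "emeasure (distr ?D borel ?f) {c<..} = emeasure ?E {c<..}" for c
  proof -
    have E: "emeasure ?E {c<..} = ?s * emeasure lborel ({0<..<1} \<inter> {c<..})"
      by (subst emeasure_density)
         (auto simp: nn_integral_cmult_indicator[symmetric] indicator_inter_arith mult.assoc)
    show ?thesis
    proof (cases "c \<le> 0 \<or> 1 \<le> c")
      case True
      then show ?thesis
      proof
        assume c: "c \<le> 0"
        have "{0<..<1} \<inter> {c<..} = {0<..<1::real}" using c by auto
        moreover have "emeasure lborel {x::vec3. norm x < 1 \<and> sgn x \<in> B \<and> c < norm x ^ 3}
            = emeasure lborel {x::vec3. norm x < 1 \<and> sgn x \<in> B}"
        proof (rule emeasure_eq_AE)
          have "AE x in lborel. x \<noteq> (0::vec3)" by (rule AE_lborel_singleton)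
          then show "AE x in lborel. (x \<in> {x::vec3. norm x < 1 \<and> sgn x \<in> B \<and> c < norm x ^ 3}) = (x \<in> {x. norm x < 1 \<and> sgn x \<in> B})"
            by eventually_elim (use c in \<open>auto intro: le_less_trans\<close>)
        qed auto
        ultimately show ?thesis unfolding A E by (simp add: emeasure_sphere_measure)
      next
        assume c: "1 \<le> c"
        have "{0<..<1} \<inter> {c<..} = ({}::real set)" using c by auto
        moreover have "{x::vec3. norm x < 1 \<and> sgn x \<in> B \<and> c < norm x ^ 3} = {}"
        proof -
          have "\<not> c < norm x ^ 3" if "norm x < 1" for x :: vec3
          proof -
            have "norm x ^ 3 \<le> 1" using that by (intro power_le_one) auto
            with c show ?thesis by simp
          qed
          then show ?thesis by blast
        qed
        ultimately show ?thesis unfolding A E by (simp only: emeasure_empty mult_zero_right)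
      qed
    next
      case False
      then have c: "0 < c" "c < 1" by auto
      \<comment> \<open>At this radius the cube equals \<open>c\<close>: the condition on the cube
        then removes a smaller cone, whose volume is known by scaling.\<close>
      define r where "r = root 3 c"
      have r: "0 < r" "r < 1" "r ^ 3 = c" using c by (auto simp: r_def)
      have lt: "c < norm x ^ 3 \<longleftrightarrow> r < norm x" for x :: vec3
        using r power_less_imp_less_base[of r 3 "norm x"] power_strict_mono[of r "norm x" 3] by auto
      have "emeasure lborel {x::vec3. norm x < 1 \<and> sgn x \<in> B \<and> c < norm x ^ 3}
          = emeasure lborel ({x::vec3. norm x < 1 \<and> sgn x \<in> B} - {x. norm x \<le> r \<and> sgn x \<in> B})"
        by (intro arg_cong[where f = "emeasure lborel"]) (auto simp: lt)
      also have "\<dots> = emeasure lborel {x::vec3. norm x < 1 \<and> sgn x \<in> B} - emeasure lborel {x::vec3. norm x \<le> r \<and> sgn x \<in> B}"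
      proof (rule emeasure_Diff)
        have "emeasure lborel {x::vec3. norm x \<le> r \<and> sgn x \<in> B} \<le> emeasure lborel (cball (0::vec3) r)"
          by (intro emeasure_mono) auto
        also have "\<dots> < \<infinity>" using emeasure_lborel_cball_finite by blast
        finally show "emeasure lborel {x::vec3. norm x \<le> r \<and> sgn x \<in> B} \<noteq> \<infinity>" by simp
      qed (use r in auto)
      finally have "3 * emeasure lborel {x::vec3. norm x < 1 \<and> sgn x \<in> B \<and> c < norm x ^ 3}
          = 3 * emeasure lborel {x::vec3. norm x < 1 \<and> sgn x \<in> B} - 3 * emeasure lborel {x::vec3. norm x \<le> r \<and> sgn x \<in> B}"
        by (simp add: ennreal_right_diff_distrib)
      also have "3 * emeasure lborel {x::vec3. norm x \<le> r \<and> sgn x \<in> B} = ennreal c * ?s"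
        unfolding emeasure_cone_scale[OF B r(1)] r(3) emeasure_cone_closed[OF B, symmetric]
        by (rule mult.left_commute)
      also have "3 * emeasure lborel {x::vec3. norm x < 1 \<and> sgn x \<in> B} = ?s"
        by (rule emeasure_sphere_measure[OF B, symmetric])
      also have "?s - ennreal c * ?s = ?s * ennreal (1 - c)"
        using c s by (cases ?s) (auto simp: ennreal_mult[symmetric] ennreal_minus algebra_simps)
      also have "\<dots> = emeasure ?E {c<..}"
      proof -
        have "{0<..<1} \<inter> {c<..} = {c<..<1::real}" using c by auto
        then show ?thesis unfolding E using c by simp
      qed
      finally show ?thesis unfolding A .
    qed
  qed
  show "emeasure (distr ?D borel ?f) {c<..} < \<infinity>" for c
  proof -
    have "emeasure lborel {x::vec3. norm x < 1 \<and> sgn x \<in> B \<and> c < norm x ^ 3} \<le> emeasure lborel (ball (0::vec3) 1)"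
      by (intro emeasure_mono) auto
    also have "\<dots> < \<infinity>" using emeasure_lborel_ball_finite by blast
    finally show ?thesis unfolding A by (simp add: ennreal_mult_less_top)
  qed
qed auto

text \<open>\<open>cone_radius_distr\<close> for all \<open>B\<close> at once says that cubed radius
  and direction are independent. These are polar coordinates in which the usual weight, the square
  of the radius, is absorbed by the cube, while the factor 3 is the normalization of
  \<open>sphere_measure\<close>.\<close>

lemma cone_distr:
  "density lborel (indicator {0<..<1::real}) \<Otimes>\<^sub>M sphere_measure
    = distr (density lborel (\<lambda>x::vec3. 3 * indicator (ball 0 1) x)) (borel \<Otimes>\<^sub>M borel) (\<lambda>x. (norm x ^ 3, sgn x))"
proof (rule pair_measure_eqI)
  have "emeasure (density lborel (indicator {0<..<1::real})) UNIV \<noteq> \<infinity>"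
    by (simp add: emeasure_density)
  then have "finite_measure (density lborel (indicator {0<..<1::real}))"
    by (intro finite_measureI) simp
  then show "sigma_finite_measure (density lborel (indicator {0<..<1::real}))"
    by (simp add: finite_measure.sigma_finite_measure)
  show "sigma_finite_measure sphere_measure" ..
  fix A B assume "A \<in> sets (density lborel (indicator {0<..<1::real}))" "B \<in> sets sphere_measure"
  then have [measurable]: "A \<in> sets borel" "B \<in> sets borel" by auto
  have "emeasure (distr (density lborel (\<lambda>x::vec3. 3 * indicator (ball 0 1) x)) (borel \<Otimes>\<^sub>M borel) (\<lambda>x. (norm x ^ 3, sgn x))) (A \<times> B)
      = emeasure (density lborel (\<lambda>x::vec3. 3 * indicator (ball 0 1) x)) {x. norm x ^ 3 \<in> A \<and> sgn x \<in> B}"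
    by (subst emeasure_distr) (auto intro!: arg_cong2[where f = emeasure])
  also have "\<dots> = emeasure (density lborel (\<lambda>x::vec3. 3 * indicator {x. norm x < 1 \<and> sgn x \<in> B} x)) {x. norm x ^ 3 \<in> A}"
    by (subst (1 2) emeasure_density) (auto intro!: nn_integral_cong simp: indicator_def)
  also have "\<dots> = emeasure (distr (density lborel (\<lambda>x::vec3. 3 * indicator {x. norm x < 1 \<and> sgn x \<in> B} x)) borel (\<lambda>x. norm x ^ 3)) A"
    by (subst emeasure_distr) (auto intro!: arg_cong2[where f = emeasure])
  also have "\<dots> = (\<integral>\<^sup>+ r. emeasure sphere_measure B * (indicator {0<..<1} r * indicator A r) \<partial>lborel)"
    by (subst cone_radius_distr) (auto simp: emeasure_density mult.assoc)
  also have "\<dots> = emeasure sphere_measure B * emeasure (density lborel (indicator {0<..<1::real})) A"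
    by (subst nn_integral_cmult) (auto simp: emeasure_density)
  finally show "emeasure (density lborel (indicator {0<..<1::real})) A * emeasure sphere_measure B
      = emeasure (distr (density lborel (\<lambda>x::vec3. 3 * indicator (ball 0 1) x)) (borel \<Otimes>\<^sub>M borel) (\<lambda>x. (norm x ^ 3, sgn x))) (A \<times> B)"
    by (simp add: mult.commute)
qed (simp cong: sets_pair_measure_cong)


section \<open>First contacts with a broken path\<close>

text \<open>Let \<open>u\<close> be the velocity of the root minus that of a particle. Up to a
  translation this is the set of initial positions from which the free particle comes into contact
  with a straight root within time \<open>h\<close> on the incoming hemisphere. Restricting to
  \<open>0 < u \<bullet> \<nu>\<close> makes the parametrization injective.\<close>

definition swept :: "vec3 \<Rightarrow> real \<Rightarrow> real \<Rightarrow> vec3 set" where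
  "swept u \<epsilon> h = {\<epsilon> *\<^sub>R \<nu> + s *\<^sub>R u | s \<nu>. 0 < s \<and> s < h \<and> norm \<nu> = 1 \<and> 0 < u \<bullet> \<nu>}"

text \<open>In the expanded square the mixed term
  \<open>2 * \<epsilon> * s * (u \<bullet> \<nu>)\<close> is positive. In terms of motion: traced
  back in time from an incoming contact, the particle moves away from the root.\<close>

lemma sweep_norm:
  assumes "norm \<nu> = 1" "0 < u \<bullet> \<nu>" "0 < \<epsilon>" "0 < s"
  shows "\<epsilon> < norm (\<epsilon> *\<^sub>R \<nu> + s *\<^sub>R u)"
proof -
  have "\<epsilon>\<^sup>2 < \<epsilon>\<^sup>2 + 2 * \<epsilon> * s * (u \<bullet> \<nu>) + s\<^sup>2 * (norm u)\<^sup>2"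
    using mult_pos_pos[OF mult_pos_pos[OF assms(3,4)] assms(2)] zero_le_power2[of "s * norm u"]
    unfolding power_mult_distrib by linarith
  also have "\<dots> = (norm (\<epsilon> *\<^sub>R \<nu> + s *\<^sub>R u))\<^sup>2"
    unfolding power2_norm_eq_inner
    using assms(1) by (simp add: inner_simps norm_eq_1 inner_commute power2_eq_square algebra_simps)
  finally show ?thesis
    by (rule power_less_imp_less_base) simp
qed

text \<open>If the times differed, say \<open>s' < s\<close>, then
  \<open>\<epsilon> *\<^sub>R \<nu>'\<close> would be of the form treated in
  \<open>sweep_norm\<close> with time \<open>s - s'\<close>, so its norm would exceed
  \<open>\<epsilon>\<close>.\<close>

lemma sweep_inj:
  assumes "norm \<nu> = 1" "0 < u \<bullet> \<nu>" "norm \<nu>' = 1" "0 < u \<bullet> \<nu>'" "0 < \<epsilon>"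
    and eq: "\<epsilon> *\<^sub>R \<nu> + s *\<^sub>R u = \<epsilon> *\<^sub>R \<nu>' + s' *\<^sub>R u"
  shows "s = s' \<and> \<nu> = \<nu>'"
proof -
  have *: "s \<le> s'" if "norm \<nu> = 1" "0 < u \<bullet> \<nu>" "norm \<nu>' = 1"
    "\<epsilon> *\<^sub>R \<nu> + s *\<^sub>R u = \<epsilon> *\<^sub>R \<nu>' + s' *\<^sub>R u" for s s' \<nu> \<nu>'
  proof (rule ccontr)
    assume "\<not> s \<le> s'"
    then have "\<epsilon> < norm (\<epsilon> *\<^sub>R \<nu> + (s - s') *\<^sub>R u)"
      using that assms(5) by (intro sweep_norm) auto
    also have "\<epsilon> *\<^sub>R \<nu> + (s - s') *\<^sub>R u = \<epsilon> *\<^sub>R \<nu>'" using that(4) by (simp add: algebra_simps)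
    finally show False using that assms(5) by simp
  qed
  have "s = s'" using *[OF assms(1-3) eq] *[OF assms(3,4,1) eq[symmetric]] by simp
  then show ?thesis using eq assms(5) by simp
qed

text \<open>The matrix determinant lemma for a rank-one perturbation of a multiple of the
  identity.\<close>

lemma det_rank_one:
  fixes x w :: vec3
  shows "det (\<chi> i j. a * (if i = j then 1 else 0) + w $ i * x $ j) = a ^ 3 + a\<^sup>2 * (x \<bullet> w)"
  unfolding det_3 by (simp add: inner_vec_def sum_3) (simp add: algebra_simps power2_eq_square power3_eq_cube)

section \<open>The Jacobian of the map from contacts to positions\<close>

context
  fixes u :: vec3 and \<epsilon> h :: real
  assumes eps: "0 < \<epsilon>" and h: "0 < h"
begin

text \<open>A point of the unit ball encodes both parameters of a contact: \<open>sgn x\<close> is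
  the collision parameter and \<open>h * norm x ^ 3\<close> the time. By \<open>cone_distr\<close>,
  Lebesgue measure on the ball then corresponds to the product of time and surface measure, and the
  change of variables takes place between open subsets of \<open>real ^ 3\<close>.\<close>

definition "sweep_map x = \<epsilon> *\<^sub>R sgn x + (h * norm x ^ 3) *\<^sub>R u" for x :: vec3

definition "sweep_deriv x k = (\<epsilon> / norm x) *\<^sub>R k + (x \<bullet> k) *\<^sub>R ((3 * h * norm x) *\<^sub>R u - (\<epsilon> / norm x ^ 3) *\<^sub>R x)"
  for x k :: vec3

definition "half_ball = {x::vec3. x \<noteq> 0 \<and> norm x < 1 \<and> 0 < u \<bullet> x}"

lemma sweep_map_deriv: "x \<noteq> 0 \<Longrightarrow> (sweep_map has_derivative sweep_deriv x) (at x)"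
proof -
  assume x: "x \<noteq> 0"
  have n: "(norm has_derivative (\<lambda>k. k \<bullet> sgn x)) (at x)"
    using has_derivative_norm[OF x] by simp
  have "((\<lambda>x. \<epsilon> *\<^sub>R (inverse (norm x) *\<^sub>R x) + (h * norm x ^ 3) *\<^sub>R u) has_derivative
    (\<lambda>k. \<epsilon> *\<^sub>R (inverse (norm x) *\<^sub>R k + (- (inverse (norm x) * (k \<bullet> sgn x) * inverse (norm x))) *\<^sub>R x)
       + (h * (of_nat 3 * (k \<bullet> sgn x) * norm x ^ (3 - 1))) *\<^sub>R u)) (at x)"
    by (intro derivative_intros n) (use x in auto)
  moreover have "(\<lambda>k. \<epsilon> *\<^sub>R (inverse (norm x) *\<^sub>R k + (- (inverse (norm x) * (k \<bullet> sgn x) * inverse (norm x))) *\<^sub>R x)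
       + (h * (of_nat 3 * (k \<bullet> sgn x) * norm x ^ (3 - 1))) *\<^sub>R u) = sweep_deriv x"
    using x by (auto simp: sweep_deriv_def fun_eq_iff sgn_div_norm inner_commute field_simps power2_eq_square power3_eq_cube
        scaleR_add_right scaleR_diff_right)
  moreover have "(\<lambda>x. \<epsilon> *\<^sub>R (inverse (norm x) *\<^sub>R x) + (h * norm x ^ 3) *\<^sub>R u) = sweep_map"
    by (auto simp: sweep_map_def sgn_div_norm fun_eq_iff)
  ultimately show ?thesis by simp
qed

text \<open>The radial part of the rank-one term contributes \<open>- \<epsilon> / norm x\<close> to
  \<open>x \<bullet> w\<close>, and this cancels the cube of \<open>\<epsilon> / norm x\<close>.
  What remains is the transport part: \<open>3 * h\<close> from the encoding of time, and the cross
  section \<open>\<epsilon>\<^sup>2\<close> times the normal component of the relative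
  velocity.\<close>

lemma det_sweep_deriv: "x \<noteq> 0 \<Longrightarrow> det (matrix (sweep_deriv x)) = 3 * h * \<epsilon>\<^sup>2 * (u \<bullet> sgn x)"
proof -
  assume x: "x \<noteq> 0"
  define w where "w = (3 * h * norm x) *\<^sub>R u - (\<epsilon> / norm x ^ 3) *\<^sub>R x"
  have "matrix (sweep_deriv x) = (\<chi> i j. (\<epsilon> / norm x) * (if i = j then 1 else 0) + w $ i * x $ j)"
  proof -
    have "x \<bullet> axis i 1 = x $ i" for i by (simp add: inner_axis)
    moreover have "axis j (1::real) $ i = (if i = j then 1 else 0)" for i j :: 3 by (simp add: axis_def)
    ultimately show ?thesis
      unfolding matrix_def sweep_deriv_def w_def vec_eq_iff by simp
  qed
  then have "det (matrix (sweep_deriv x)) = (\<epsilon> / norm x) ^ 3 + (\<epsilon> / norm x)\<^sup>2 * (x \<bullet> w)"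
    by (simp only: det_rank_one)
  also have "x \<bullet> w = 3 * h * norm x * (u \<bullet> x) - \<epsilon> / norm x ^ 3 * (norm x)\<^sup>2"
    by (simp add: w_def inner_simps power2_norm_eq_inner inner_commute)
  also have "(\<epsilon> / norm x) ^ 3 + (\<epsilon> / norm x)\<^sup>2 * \<dots> = 3 * h * \<epsilon>\<^sup>2 * (u \<bullet> sgn x)"
    using x by (simp add: sgn_div_norm field_simps power2_eq_square power3_eq_cube)
  finally show ?thesis .
qed

lemma inner_sgn_pos: "x \<in> half_ball \<Longrightarrow> norm (sgn x) = 1 \<and> 0 < u \<bullet> sgn x"
  by (auto simp: half_ball_def norm_sgn sgn_div_norm)

lemma sweep_map_inj: "inj_on sweep_map half_ball"
proof (rule inj_onI)
  fix x y assume half_ball: "x \<in> half_ball" "y \<in> half_ball" and eq: "sweep_map x = sweep_map y"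
  have "h * norm x ^ 3 = h * norm y ^ 3 \<and> sgn x = sgn y"
    using inner_sgn_pos[OF half_ball(1)] inner_sgn_pos[OF half_ball(2)] eq eps unfolding sweep_map_def by (intro sweep_inj) auto
  then have "norm x = norm y" "sgn x = sgn y"
    using h power_eq_imp_eq_base[of "norm x" 3 "norm y"] by auto
  then show "x = y" by (metis norm_scaleR sgn_div_norm scaleR_left_imp_eq inverse_nonzero_iff_nonzero norm_eq_zero)
qed

lemma sweep_map_image: "sweep_map ` half_ball = swept u \<epsilon> h"
proof (intro equalityI subsetI)
  fix z assume "z \<in> sweep_map ` half_ball"
  then obtain x where x: "x \<in> half_ball" "z = sweep_map x" by auto
  have "0 < norm x ^ 3" "norm x ^ 3 < 1" using x by (auto simp: half_ball_def power_less_one_iff)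
  then show "z \<in> swept u \<epsilon> h" using x inner_sgn_pos[OF x(1)] h
    unfolding swept_def sweep_map_def by (intro CollectI exI[of _ "h * norm x ^ 3"] exI[of _ "sgn x"]) auto
next
  fix z assume "z \<in> swept u \<epsilon> h"
  then obtain s \<nu> where z: "z = \<epsilon> *\<^sub>R \<nu> + s *\<^sub>R u" "0 < s" "s < h" "norm \<nu> = 1" "0 < u \<bullet> \<nu>"
    by (auto simp: swept_def)
  define r where "r = root 3 (s / h)"
  have r: "0 < r" "r < 1" "r ^ 3 = s / h" using z h by (auto simp: r_def)
  have "sgn (r *\<^sub>R \<nu>) = \<nu>" using r z by (simp add: sgn_div_norm)
  then have "sweep_map (r *\<^sub>R \<nu>) = z" using r z h by (simp add: sweep_map_def)
  moreover have "r *\<^sub>R \<nu> \<in> half_ball" using r z by (auto simp: half_ball_def)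
  ultimately show "z \<in> sweep_map ` half_ball" by blast
qed

lemma open_half_ball: "open half_ball"
proof -
  have "half_ball = - {0} \<inter> ball 0 1 \<inter> {x. 0 < u \<bullet> x}" by (auto simp: half_ball_def)
  then show ?thesis by (auto intro!: open_Int open_halfspace_gt)
qed

lemma open_swept: "open (swept u \<epsilon> h)"
proof -
  have "continuous_on half_ball sweep_map"
    using sweep_map_deriv by (intro continuous_at_imp_continuous_on ballI)
      (auto simp: half_ball_def intro!: has_derivative_continuous)
  then show ?thesis
    unfolding sweep_map_image[symmetric] using open_half_ball sweep_map_inj by (rule invariance_of_domain)
qed

lemma bounded_swept: "bounded (swept u \<epsilon> h)"
proof (rule boundedI)
  fix z assume "z \<in> swept u \<epsilon> h"
  then obtain s \<nu> where z: "z = \<epsilon> *\<^sub>R \<nu> + s *\<^sub>R u" "0 < s" "s < h" "norm \<nu> = 1"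
    by (auto simp: swept_def)
  have "norm z \<le> norm (\<epsilon> *\<^sub>R \<nu>) + norm (s *\<^sub>R u)" unfolding z by (rule norm_triangle_ineq)
  also have "\<dots> \<le> \<epsilon> + h * norm u" using z eps by (auto intro!: mult_right_mono)
  finally show "norm z \<le> \<epsilon> + h * norm u" .
qed

lemma sweep_map_measurable [measurable]: "sweep_map \<in> borel_measurable borel"
  unfolding sweep_map_def[abs_def] by measurable

lemma half_ball_measurable [measurable]: "half_ball \<in> sets borel"
  using open_half_ball by simp

text \<open>The change of variables for sets. Boundedness of \<open>swept\<close> gives the image
  finite measure, so that the real-valued Jacobian formula for injective differentiable maps
  applies.\<close>

lemma swept_change:
  assumes B [measurable]: "B \<in> sets borel"
  shows "(\<integral>\<^sup>+ x. ennreal (3 * h * \<epsilon>\<^sup>2 * (u \<bullet> sgn x)) * indicator (half_ball \<inter> sweep_map -` B) x \<partial>lborel)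
    = emeasure lborel (B \<inter> swept u \<epsilon> h)"
proof -
  let ?A = "half_ball \<inter> sweep_map -` B"
  have A [measurable]: "?A \<in> sets borel"
    by (metis half_ball_measurable sweep_map_measurable B measurable_sets_borel sets.Int)
  have der: "(sweep_map has_derivative sweep_deriv x) (at x within ?A)" if "x \<in> ?A" for x
    using sweep_map_deriv[of x] that by (auto simp: half_ball_def intro: has_derivative_at_withinI)
  have im: "sweep_map ` ?A = B \<inter> swept u \<epsilon> h" unfolding sweep_map_image[symmetric] by auto
  have sw [measurable]: "swept u \<epsilon> h \<in> sets borel" using open_swept by simp
  have "bounded (B \<inter> swept u \<epsilon> h)" using bounded_swept by (rule bounded_subset) auto
  then have lm: "sweep_map ` ?A \<in> lmeasurable"
    unfolding im by (intro bounded_set_imp_lmeasurable) (auto simp: sets_completionI_sets)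
  have inj: "inj_on sweep_map ?A" using sweep_map_inj by (rule inj_on_subset) auto
  have "((\<lambda>x. \<bar>det (matrix (sweep_deriv x))\<bar>) has_integral measure lebesgue (sweep_map ` ?A)) ?A"
    using measurable_differentiable_image_eq[of ?A sweep_map sweep_deriv] measure_differentiable_image_eq[of ?A sweep_map sweep_deriv] lm inj der A
    by (simp add: has_integral_iff sets_completionI_sets)
  then have "((\<lambda>x. 3 * h * \<epsilon>\<^sup>2 * (u \<bullet> sgn x)) has_integral measure lebesgue (sweep_map ` ?A)) ?A"
  proof (rule has_integral_eq[rotated])
    fix x assume "x \<in> ?A"
    then show "\<bar>det (matrix (sweep_deriv x))\<bar> = 3 * h * \<epsilon>\<^sup>2 * (u \<bullet> sgn x)"
      using inner_sgn_pos[of x] h eps by (subst det_sweep_deriv) (auto simp: half_ball_def)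
  qed
  then have "(\<integral>\<^sup>+ x. ennreal (3 * h * \<epsilon>\<^sup>2 * (u \<bullet> sgn x)) * indicator ?A x \<partial>lborel) = ennreal (measure lebesgue (sweep_map ` ?A))"
    by (rule nn_integral_has_integral_lebesgue'[rotated])
       (use h eps in \<open>auto dest!: inner_sgn_pos\<close>)
  also have "\<dots> = emeasure lebesgue (sweep_map ` ?A)"
    using lm by (simp add: emeasure_eq_measure2)
  finally show ?thesis by (simp add: im)
qed

text \<open>The flux through the incoming hemisphere, integrated over time, equals the integral over
  the swept volume. Time is rescaled to the unit interval, \<open>cone_distr\<close> moves the
  integral to the ball, and \<open>sweep_map\<close> pushes it forward.\<close>

lemma nn_integral_swept:
  assumes [measurable]: "G \<in> borel_measurable borel"
  shows "(\<integral>\<^sup>+ s. indicator {0<..<h} s * (\<integral>\<^sup>+ \<nu>. ennreal (\<epsilon>\<^sup>2 * max (u \<bullet> \<nu>) 0) * G (\<epsilon> *\<^sub>R \<nu> + s *\<^sub>R u) \<partial>sphere_measure) \<partial>lborel)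
    = (\<integral>\<^sup>+ z. G z * indicator (swept u \<epsilon> h) z \<partial>lborel)"
proof -
  have sw [measurable]: "swept u \<epsilon> h \<in> sets borel" using open_swept by simp
  let ?I = "density lborel (indicator {0<..<1::real})"
  let ?F = "\<lambda>s. \<integral>\<^sup>+ \<nu>. ennreal (\<epsilon>\<^sup>2 * max (u \<bullet> \<nu>) 0) * G (\<epsilon> *\<^sub>R \<nu> + s *\<^sub>R u) \<partial>sphere_measure"
  have "(\<integral>\<^sup>+ s. indicator {0<..<h} s * ?F s \<partial>lborel) = ennreal h * (\<integral>\<^sup>+ s. indicator {0<..<h} (h * s) * ?F (h * s) \<partial>lborel)"
    using h by (subst nn_integral_real_affine[of _ h 0]) auto
  also have "(\<integral>\<^sup>+ s. indicator {0<..<h} (h * s) * ?F (h * s) \<partial>lborel) = (\<integral>\<^sup>+ s. ?F (h * s) \<partial>?I)"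
    using h by (subst nn_integral_density) (auto intro!: nn_integral_cong simp: indicator_def zero_less_mult_iff)
  also have "\<dots> = (\<integral>\<^sup>+ (s, \<nu>). ennreal (\<epsilon>\<^sup>2 * max (u \<bullet> \<nu>) 0) * G (\<epsilon> *\<^sub>R \<nu> + (h * s) *\<^sub>R u) \<partial>(?I \<Otimes>\<^sub>M sphere_measure))"
    by (subst sphere.nn_integral_fst[symmetric]) auto
  also have "\<dots> = (\<integral>\<^sup>+ x. ennreal (\<epsilon>\<^sup>2 * max (u \<bullet> sgn x) 0) * G (sweep_map x) \<partial>density lborel (\<lambda>x::vec3. 3 * indicator (ball 0 1) x))"
    unfolding cone_distr by (subst nn_integral_distr) (auto simp: sweep_map_def)
  also have "\<dots> = (\<integral>\<^sup>+ x. 3 * indicator (ball 0 1) x * (ennreal (\<epsilon>\<^sup>2 * max (u \<bullet> sgn x) 0) * G (sweep_map x)) \<partial>lborel)"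
    by (subst nn_integral_density) auto
  also have "ennreal h * \<dots> = (\<integral>\<^sup>+ x. ennreal h * (3 * indicator (ball 0 1) x * (ennreal (\<epsilon>\<^sup>2 * max (u \<bullet> sgn x) 0) * G (sweep_map x))) \<partial>lborel)"
    by (subst nn_integral_cmult) auto
  \<comment> \<open>The positive part vanishes off the half ball; on it, the constants 3 and
    \<open>h\<close> combine with it to the Jacobian of \<open>sweep_map\<close>.\<close>
  also have "\<dots> = (\<integral>\<^sup>+ x. ennreal (3 * h * \<epsilon>\<^sup>2 * (u \<bullet> sgn x)) * indicator half_ball x * G (sweep_map x) \<partial>lborel)"
  proof (rule nn_integral_cong)
    fix x :: vec3
    show "ennreal h * (3 * indicator (ball 0 1) x * (ennreal (\<epsilon>\<^sup>2 * max (u \<bullet> sgn x) 0) * G (sweep_map x)))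
      = ennreal (3 * h * \<epsilon>\<^sup>2 * (u \<bullet> sgn x)) * indicator half_ball x * G (sweep_map x)"
    proof (cases "x \<in> half_ball")
      case True
      then have "x \<in> ball 0 1" "0 < u \<bullet> sgn x" using inner_sgn_pos[of x] by (auto simp: half_ball_def)
      then have "ennreal h * (3 * ennreal (\<epsilon>\<^sup>2 * (u \<bullet> sgn x))) = ennreal (3 * h * \<epsilon>\<^sup>2 * (u \<bullet> sgn x))"
        using h by (simp add: ennreal_mult[symmetric] ennreal_numeral[symmetric] mult_ac del: ennreal_numeral)
      with True \<open>x \<in> ball 0 1\<close> \<open>0 < u \<bullet> sgn x\<close> show ?thesis
        by (simp add: mult.assoc[symmetric] max_def)
    next
      case False
      then have "x \<notin> ball 0 1 \<or> \<not> 0 < u \<bullet> sgn x" by (auto simp: half_ball_def sgn_div_norm zero_less_mult_iff)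
      then have "indicator (ball 0 1) x = (0::ennreal) \<or> max (u \<bullet> sgn x) 0 = 0" by (auto simp: max_def)
      then show ?thesis using False by (elim disjE) simp_all
    qed
  qed
  also have "\<dots> = (\<integral>\<^sup>+ x. G x \<partial>distr (density lborel (\<lambda>x. ennreal (3 * h * \<epsilon>\<^sup>2 * (u \<bullet> sgn x)) * indicator half_ball x)) borel sweep_map)"
    by (subst nn_integral_distr, simp, simp, subst nn_integral_density) auto
  also have "distr (density lborel (\<lambda>x. ennreal (3 * h * \<epsilon>\<^sup>2 * (u \<bullet> sgn x)) * indicator half_ball x)) borel sweep_map
     = density lborel (indicator (swept u \<epsilon> h))"
  proof (rule measure_eqI)
    fix B assume "B \<in> sets (distr (density lborel (\<lambda>x. ennreal (3 * h * \<epsilon>\<^sup>2 * (u \<bullet> sgn x)) * indicator half_ball x)) borel sweep_map)"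
    then have [measurable]: "B \<in> sets borel" by simp
    have [measurable]: "sweep_map -` B \<in> sets borel" by (metis sweep_map_measurable \<open>B \<in> sets borel\<close> measurable_sets_borel)
    show "emeasure (distr (density lborel (\<lambda>x. ennreal (3 * h * \<epsilon>\<^sup>2 * (u \<bullet> sgn x)) * indicator half_ball x)) borel sweep_map) B
      = emeasure (density lborel (indicator (swept u \<epsilon> h))) B"
    proof -
      have "emeasure (distr (density lborel (\<lambda>x. ennreal (3 * h * \<epsilon>\<^sup>2 * (u \<bullet> sgn x)) * indicator half_ball x)) borel sweep_map) B
        = (\<integral>\<^sup>+ x. ennreal (3 * h * \<epsilon>\<^sup>2 * (u \<bullet> sgn x)) * indicator half_ball x * indicator (sweep_map -` B) x \<partial>lborel)"
        by (subst emeasure_distr, simp, simp, subst emeasure_density) auto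
      also have "\<dots> = emeasure lborel (B \<inter> swept u \<epsilon> h)"
        unfolding swept_change[OF \<open>B \<in> sets borel\<close>, symmetric] by (simp add: indicator_inter_arith mult.assoc)
      also have "\<dots> = emeasure (density lborel (indicator (swept u \<epsilon> h))) B"
        by (subst emeasure_density) (auto simp: indicator_inter_arith[symmetric] Int_commute)
      finally show ?thesis .
    qed
  qed simp
  also have "(\<integral>\<^sup>+ x. G x \<partial>\<dots>) = (\<integral>\<^sup>+ z. G z * indicator (swept u \<epsilon> h) z \<partial>lborel)"
    by (subst nn_integral_density) (auto simp: mult.commute)
  finally show ?thesis .
qed

end

text \<open>
  \<open>apart\<close> says that the free particle \<open>p\<close> keeps distance larger than \<open>\<epsilon>\<close> from the path \<open>X\<close> on \<open>{0..t}\<close>,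
  see \<open>apart_iff\<close>; it is phrased with countably many times so that it is visibly measurable.
\<close>

definition apart :: "real \<Rightarrow> (real \<Rightarrow> vec3) \<Rightarrow> real \<Rightarrow> state \<Rightarrow> bool" where
  "apart \<epsilon> X t p \<longleftrightarrow>
    (\<exists>m::nat. \<forall>q \<in> \<rat> \<inter> {0..1}. \<epsilon> + 1 / (real m + 1) \<le> tdist (X (q * t)) (fst p + (q * t) *\<^sub>R snd p))"

text \<open>The version of \<open>apart\<close> for the half-open interval, which must admit a
  contact at time \<open>t\<close> itself. It exhausts \<open>{0..<t}\<close> by the countably many
  closed intervals ending at \<open>t * (1 - 1 / (real n + 2))\<close>, so it is measurable like
  \<open>apart\<close>.\<close>

definition unmet_before :: "real \<Rightarrow> (real \<Rightarrow> vec3) \<Rightarrow> real \<Rightarrow> state \<Rightarrow> bool" where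
  "unmet_before \<epsilon> X t p \<longleftrightarrow> (\<forall>n::nat. apart \<epsilon> X (t * (1 - 1 / (real n + 2))) p)"

text \<open>The first contact is the end of the period in which the particle stays apart, hence the length of that period.\<close>

definition contact :: "real \<Rightarrow> (real \<Rightarrow> vec3) \<Rightarrow> state \<Rightarrow> real" where
  "contact \<epsilon> X p = enn2real (\<integral>\<^sup>+ r. indicator {r. 0 \<le> r \<and> apart \<epsilon> X r p} r \<partial>lborel)"

text \<open>Only meaningful for particles that do meet the path. For one that overlaps at time 0 or
  stays apart forever, \<open>contact\<close> has the default value 0, which \<open>hit\<close>
  discards by requiring a time after \<tau>.\<close>

definition contact_mark :: "real \<Rightarrow> (real \<Rightarrow> vec3) \<Rightarrow> state \<Rightarrow> mark" where
  "contact_mark \<epsilon> X p =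
    (contact \<epsilon> X p,
     (1 / \<epsilon>) *\<^sub>R wrap (fst p + contact \<epsilon> X p *\<^sub>R snd p - X (contact \<epsilon> X p)),
     snd p)"

text \<open>The inverse of \<open>contact_mark\<close>: from the contact described by the mark, the
  particle is traced back freely to time 0. It returns one particular lift of the initial
  position.\<close>

definition emitted :: "real \<Rightarrow> (real \<Rightarrow> vec3) \<Rightarrow> mark \<Rightarrow> state" where
  "emitted \<epsilon> X c = (X (fst c) + \<epsilon> *\<^sub>R fst (snd c) - fst c *\<^sub>R snd (snd c), snd (snd c))"

lemma rational_between:
  fixes a b :: real
  assumes "0 < t" "a < b"
  obtains q where "q \<in> \<rat>" "a < q * t" "q * t < b"
proof -
  have "a / t < b / t" using assms by (simp add: divide_strict_right_mono)
  then obtain q where "q \<in> \<rat>" "a / t < q" "q < b / t" using Rats_dense_in_real by blast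
  then show ?thesis using assms by (intro that[of q]) (auto simp: field_simps)
qed

text \<open>On a compact interval the distance attains its minimum, so a strict bound has a uniform
  margin \<open>1 / (real m + 1)\<close>. Conversely, by continuity, a margin at the rational
  multiples of \<open>t\<close> persists at all times.\<close>

lemma apart_iff:
  assumes X: "continuous_on {0..t} X" and t: "0 \<le> t"
  shows "apart \<epsilon> X t p \<longleftrightarrow> (\<forall>s \<in> {0..t}. \<epsilon> < tdist (X s) (fst p + s *\<^sub>R snd p))"
proof
  assume "apart \<epsilon> X t p"
  then obtain m :: nat where "\<forall>q \<in> \<rat> \<inter> {0..1}. \<epsilon> + 1 / (real m + 1) \<le> tdist (X (q * t)) (fst p + (q * t) *\<^sub>R snd p)"
    unfolding apart_def by blast
  then have m: "\<And>q. q \<in> \<rat> \<Longrightarrow> 0 \<le> q \<Longrightarrow> q \<le> 1 \<Longrightarrow>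
      \<epsilon> + 1 / (real m + 1) \<le> tdist (X (q * t)) (fst p + (q * t) *\<^sub>R snd p)"
    by simp
  let ?d = "\<lambda>s. tdist (X s) (fst p + s *\<^sub>R snd p)"
  have c: "continuous_on {0..t} ?d" using X by (intro continuous_intros)
  show "\<forall>s \<in> {0..t}. \<epsilon> < ?d s"
  proof
    fix s assume s: "s \<in> {0..t}"
    show "\<epsilon> < ?d s"
    proof (cases "t = 0")
      case True then show ?thesis using s m[of 0] by (simp add: less_le_trans[of \<epsilon> "\<epsilon> + 1 / (real m + 1)"])
    next
      case False
      then have t: "0 < t" using t by simp
      show ?thesis
      proof (rule ccontr)
        assume "\<not> \<epsilon> < ?d s"
        then have "?d s < \<epsilon> + 1 / (real m + 1)" by (simp add: not_less le_less_trans)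
        moreover have "(?d \<longlongrightarrow> ?d s) (at s within {0..t})" using c s by (simp add: continuous_on)
        ultimately have "\<forall>\<^sub>F r in at s within {0..t}. ?d r < \<epsilon> + 1 / (real m + 1)"
          by (rule order_tendstoD(2)[rotated])
        then obtain e where e: "0 < e"
          "\<And>r. r \<in> {0..t} \<Longrightarrow> r \<noteq> s \<Longrightarrow> dist r s < e \<Longrightarrow> ?d r < \<epsilon> + 1 / (real m + 1)"
          unfolding eventually_at by blast
        \<comment> \<open>A one-sided open interval next to \<open>s\<close> within
          \<open>{0..t}\<close>, to the right if \<open>s < t\<close> and to the left otherwise. It
          contains a rational multiple of \<open>t\<close>, where the margin applies.\<close>
        obtain a b where ab: "a < b" "{a<..<b} \<subseteq> {0..t}" "\<And>r. a < r \<Longrightarrow> r < b \<Longrightarrow> r \<noteq> s \<and> dist r s < e"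
        proof (cases "s < t")
          case True
          show ?thesis using True s e(1)
            by (intro that[of s "min t (s + e)"]) (auto simp: dist_real_def)
        next
          case False
          then show ?thesis using s e(1) t
            by (intro that[of "max 0 (s - e)" s]) (auto simp: dist_real_def)
        qed
        obtain q where q: "q \<in> \<rat>" "a < q * t" "q * t < b" using rational_between[OF t ab(1)] .
        then have "q * t \<in> {0..t}" using ab(2) by auto
        then have "0 \<le> q" "q \<le> 1" using t by (auto simp: zero_le_mult_iff)
        then have "\<epsilon> + 1 / (real m + 1) \<le> ?d (q * t)" using m q by blast
        moreover have "?d (q * t) < \<epsilon> + 1 / (real m + 1)"
          using e(2) ab(3) q \<open>q * t \<in> {0..t}\<close> by blast
        ultimately show False by simp
      qed
    qed
  qed
next
  let ?d = "\<lambda>s. tdist (X s) (fst p + s *\<^sub>R snd p)"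
  assume a: "\<forall>s \<in> {0..t}. \<epsilon> < ?d s"
  have c: "continuous_on {0..t} ?d" using X by (intro continuous_intros)
  obtain s where s: "s \<in> {0..t}" "\<And>r. r \<in> {0..t} \<Longrightarrow> ?d s \<le> ?d r"
    using continuous_attains_inf[OF _ _ c] t by (metis atLeastatMost_empty_iff compact_Icc not_le)
  have "0 < ?d s - \<epsilon>" using a s by auto
  then obtain m :: nat where m: "1 / (real m + 1) < ?d s - \<epsilon>"
    using reals_Archimedean[of "?d s - \<epsilon>"] by (auto simp: inverse_eq_divide add.commute)
  show "apart \<epsilon> X t p"
    unfolding apart_def
  proof (intro exI ballI)
    fix q assume "q \<in> \<rat> \<inter> {0..1::real}"
    then have "q * t \<in> {0..t}" using t by (auto simp: mult_left_le_one_le)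
    then show "\<epsilon> + 1 / (real m + 1) \<le> ?d (q * t)" using s(2) m by fastforce
  qed
qed

lemma unmet_before_iff:
  assumes X: "continuous_on {0..} X" and t: "0 < t"
  shows "unmet_before \<epsilon> X t p \<longleftrightarrow> (\<forall>s \<in> {0..<t}. \<epsilon> < tdist (X s) (fst p + s *\<^sub>R snd p))"
proof -
  let ?d = "\<lambda>s. tdist (X s) (fst p + s *\<^sub>R snd p)"
  let ?t = "\<lambda>n::nat. t * (1 - 1 / (real n + 2))"
  have t0: "0 \<le> ?t n" "?t n < t" for n using t by (auto simp: field_simps)
  have "unmet_before \<epsilon> X t p \<longleftrightarrow> (\<forall>n. \<forall>s \<in> {0..?t n}. \<epsilon> < ?d s)"
    unfolding unmet_before_def
    using t0 by (intro all_cong1 apart_iff continuous_on_subset[OF X]) auto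
  also have "\<dots> \<longleftrightarrow> (\<forall>s \<in> {0..<t}. \<epsilon> < ?d s)"
  proof (intro iffI ballI allI)
    fix s assume a: "\<forall>n. \<forall>s \<in> {0..?t n}. \<epsilon> < ?d s" and s: "s \<in> {0..<t}"
    obtain n :: nat where n: "1 / (real n + 1) < 1 - s / t"
      using reals_Archimedean[of "1 - s / t"] s by (auto simp: inverse_eq_divide add.commute)
    have "1 / (real n + 2) \<le> 1 / (real n + 1)" by (simp add: frac_le)
    then have "s / t \<le> 1 - 1 / (real n + 2)" using n by linarith
    then have "s \<le> ?t n" using t by (simp add: pos_divide_le_eq mult.commute)
    then show "\<epsilon> < ?d s" using a s by auto
  next
    fix n s assume "\<forall>s \<in> {0..<t}. \<epsilon> < ?d s" "s \<in> {0..?t n}"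
    then show "\<epsilon> < ?d s" using t0(2)[of n] by auto
  qed
  finally show ?thesis .
qed

lemma borel_measurable_fst:
  fixes f :: "'a \<Rightarrow> 'b :: topological_space \<times> 'c :: topological_space"
  shows "f \<in> borel_measurable M \<Longrightarrow> (\<lambda>x. fst (f x)) \<in> borel_measurable M"
  by (erule measurable_compose) (intro borel_measurable_continuous_onI continuous_intros)

lemma borel_measurable_snd:
  fixes f :: "'a \<Rightarrow> 'b :: topological_space \<times> 'c :: topological_space"
  shows "f \<in> borel_measurable M \<Longrightarrow> (\<lambda>x. snd (f x)) \<in> borel_measurable M"
  by (erule measurable_compose) (intro borel_measurable_continuous_onI continuous_intros)

text \<open>The path is allowed to depend on the sample point, because in a chain of collisions the
  path that a particle meets is shaped by the earlier particles.\<close>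

lemma measurable_apart [measurable]:
  assumes [measurable]: "case_prod X \<in> borel_measurable (M \<Otimes>\<^sub>M borel)"
    "t \<in> borel_measurable M" "p \<in> borel_measurable M"
  shows "Measurable.pred M (\<lambda>x. apart \<epsilon> (X x) (t x) (p x))"
proof -
  have [measurable]: "(\<lambda>x. X x (s x)) \<in> borel_measurable M" if [measurable]: "s \<in> borel_measurable M" for s
  proof -
    have "(\<lambda>x. case_prod X (x, s x)) \<in> borel_measurable M" by measurable
    then show ?thesis by simp
  qed
  have [measurable]: "countable (\<rat> \<inter> {0..1::real})" using countable_rat by (rule countable_subset[rotated]) auto
  have [measurable]: "(\<lambda>x. fst (p x)) \<in> borel_measurable M" "(\<lambda>x. snd (p x)) \<in> borel_measurable M"
    using assms(3) by (rule borel_measurable_fst borel_measurable_snd)+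
  show ?thesis unfolding apart_def by measurable
qed

lemma measurable_unmet_before [measurable]:
  assumes [measurable]: "case_prod X \<in> borel_measurable (M \<Otimes>\<^sub>M borel)"
    "t \<in> borel_measurable M" "p \<in> borel_measurable M"
  shows "Measurable.pred M (\<lambda>x. unmet_before \<epsilon> (X x) (t x) (p x))"
  unfolding unmet_before_def by measurable

text \<open>This is what the definition of \<open>contact\<close> as a length serves for: the
  integral of a jointly measurable indicator over one variable is measurable in the other.\<close>

lemma measurable_contact [measurable]:
  assumes [measurable]: "case_prod X \<in> borel_measurable (M \<Otimes>\<^sub>M borel)" "p \<in> borel_measurable M"
  shows "(\<lambda>x. contact \<epsilon> (X x) (p x)) \<in> borel_measurable M"
proof -
  have X: "case_prod (\<lambda>z. X (fst z)) \<in> borel_measurable ((M \<Otimes>\<^sub>M lborel) \<Otimes>\<^sub>M borel)"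
  proof -
    have "(\<lambda>z. case_prod X (fst (fst z), snd z)) \<in> borel_measurable ((M \<Otimes>\<^sub>M lborel) \<Otimes>\<^sub>M borel)"
      by measurable
    then show ?thesis by (simp add: case_prod_beta)
  qed
  have "Measurable.pred (M \<Otimes>\<^sub>M lborel) (\<lambda>z. 0 \<le> snd z \<and> apart \<epsilon> (X (fst z)) (snd z) (p (fst z)))"
    by (intro pred_intros_logic measurable_apart[where X = "\<lambda>z. X (fst z)", OF X]) measurable
  then have S: "{z \<in> space (M \<Otimes>\<^sub>M lborel). 0 \<le> snd z \<and> apart \<epsilon> (X (fst z)) (snd z) (p (fst z))} \<in> sets (M \<Otimes>\<^sub>M lborel)"
    by (simp only: pred_def)
  have "(\<lambda>x. \<integral>\<^sup>+ r. indicator {z \<in> space (M \<Otimes>\<^sub>M lborel). 0 \<le> snd z \<and> apart \<epsilon> (X (fst z)) (snd z) (p (fst z))} (x, r) \<partial>lborel) \<in> borel_measurable M"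
    using borel_measurable_indicator[OF S] by (intro lborel.borel_measurable_nn_integral) simp
  also have "?this \<longleftrightarrow> (\<lambda>x. \<integral>\<^sup>+ r. indicator {r. 0 \<le> r \<and> apart \<epsilon> (X x) r (p x)} r \<partial>lborel) \<in> borel_measurable M"
    by (intro measurable_cong nn_integral_cong) (auto simp: indicator_def space_pair_measure)
  finally show ?thesis unfolding contact_def by measurable
qed

lemma measurable_contact_mark [measurable]:
  assumes [measurable]: "case_prod X \<in> borel_measurable (M \<Otimes>\<^sub>M borel)" "p \<in> borel_measurable M"
  shows "(\<lambda>x. contact_mark \<epsilon> (X x) (p x)) \<in> M \<rightarrow>\<^sub>M borel \<Otimes>\<^sub>M (borel \<Otimes>\<^sub>M borel)"
proof -
  have [measurable]: "(\<lambda>x. fst (p x)) \<in> borel_measurable M" "(\<lambda>x. snd (p x)) \<in> borel_measurable M"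
    using assms(2) by (rule borel_measurable_fst borel_measurable_snd)+
  have [measurable]: "(\<lambda>x. X x (contact \<epsilon> (X x) (p x))) \<in> borel_measurable M"
  proof -
    have "(\<lambda>x. case_prod X (x, contact \<epsilon> (X x) (p x))) \<in> borel_measurable M" by measurable
    then show ?thesis by simp
  qed
  show ?thesis unfolding contact_mark_def by measurable
qed

section \<open>Broken paths with finitely many breaks\<close>

locale path =
  fixes C :: "real set" and X V :: "real \<Rightarrow> vec3"
  assumes finite_C: "finite C"
    and flight: "\<And>t. free_flight t C X V"
    and measurable_X [measurable]: "X \<in> borel_measurable borel"
begin

lemma straight: "0 \<le> r \<Longrightarrow> r \<le> s \<Longrightarrow> C \<inter> {r<..<s} = {} \<Longrightarrow> X s = X r + (s - r) *\<^sub>R V r"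
  using flight[of s] unfolding free_flight_def by blast

lemma steady: "0 \<le> r \<Longrightarrow> r \<le> s \<Longrightarrow> C \<inter> {r<..s} = {} \<Longrightarrow> V s = V r"
  using flight[of s] unfolding free_flight_def by blast

text \<open>Induction on the number of breaks strictly between the two times, splitting the interval
  at one of them.\<close>

lemma displacement_le:
  assumes "0 \<le> r" "r \<le> s" "\<And>q. r \<le> q \<Longrightarrow> q \<le> s \<Longrightarrow> norm (V q) \<le> L"
  shows "norm (X s - X r) \<le> L * (s - r)"
  using assms
proof (induction "card (C \<inter> {r<..<s})" arbitrary: r s rule: less_induct)
  case less
  show ?case
  proof (cases "C \<inter> {r<..<s} = {}")
    case True
    then have "X s - X r = (s - r) *\<^sub>R V r" using straight[OF less.prems(1,2)] by simp
    then show ?thesis using less.prems(2) less.prems(3)[of r] by (simp add: mult.commute[of L] mult_left_mono)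
  next
    case False
    then obtain c where c: "c \<in> C" "r < c" "c < s" by auto
    have "C \<inter> {r<..<c} \<subset> C \<inter> {r<..<s}" "C \<inter> {c<..<s} \<subset> C \<inter> {r<..<s}" using c by auto
    then have "card (C \<inter> {r<..<c}) < card (C \<inter> {r<..<s})" "card (C \<inter> {c<..<s}) < card (C \<inter> {r<..<s})"
      using finite_C by (auto intro!: psubset_card_mono)
    then have "norm (X c - X r) \<le> L * (c - r)" "norm (X s - X c) \<le> L * (s - c)"
      using less.hyps[of r c] less.hyps[of c s] less.prems c by auto
    moreover have "norm (X s - X r) \<le> norm (X s - X c) + norm (X c - X r)"
      using norm_triangle_ineq[of "X s - X c" "X c - X r"] by simp
    ultimately show ?thesis by (simp add: algebra_simps)
  qed
qed

lemma velocity_bounded: obtains L where "0 < L" "\<And>s. 0 \<le> s \<Longrightarrow> norm (V s) \<le> L"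
proof -
  define L where "L = Max (insert 1 ((\<lambda>s. norm (V s)) ` (insert 0 C)))"
  have f: "finite (insert 1 ((\<lambda>s. norm (V s)) ` (insert 0 C)))" using finite_C by simp
  have "norm (V s) \<le> L" if "0 \<le> s" for s
  proof -
    \<comment> \<open>The last break up to time \<open>s\<close>, or 0 if there is none. The
      velocity has not changed since, so only the finitely many velocities at 0 and at the breaks
      occur.\<close>
    define a where "a = Max (insert 0 (C \<inter> {0..s}))"
    have fa: "finite (insert 0 (C \<inter> {0..s}))" using finite_C by simp
    then have a: "a \<in> insert 0 (C \<inter> {0..s})" unfolding a_def by (rule Max_in) simp
    have "C \<inter> {a<..s} = {}"
    proof (rule ccontr)
      assume "C \<inter> {a<..s} \<noteq> {}"
      then obtain c where c: "c \<in> C" "a < c" "c \<le> s" by auto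
      have "0 \<le> a" using a by auto
      then have "c \<le> a" unfolding a_def using c fa by (intro Max_ge) (auto simp: a_def)
      then show False using c by simp
    qed
    then have "V s = V a" using a that by (intro steady) auto
    then show ?thesis unfolding L_def using f a by (intro Max_ge) auto
  qed
  moreover have "1 \<le> L" unfolding L_def using f by (intro Max_ge) auto
  ultimately show ?thesis by (intro that[of L]) auto
qed

lemma continuous_X: "continuous_on {0..} X"
proof -
  obtain L where L: "0 < L" "\<And>s. 0 \<le> s \<Longrightarrow> norm (V s) \<le> L" using velocity_bounded by metis
  have *: "dist (X s) (X r) \<le> L * dist s r" if "0 \<le> r" "r \<le> s" for r s
    using displacement_le[of r s L] L that by (auto simp: dist_norm)
  have "dist (X s) (X r) \<le> L * dist s r" if "0 \<le> r" "0 \<le> s" for r s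
    using *[of r s] *[of s r] that by (cases "r \<le> s") (auto simp: dist_commute)
  then have "L-lipschitz_on {0..} X" using L by (intro lipschitz_onI) auto
  then show ?thesis by (rule lipschitz_on_continuous_on)
qed

lemma apart_path_iff: "0 \<le> t \<Longrightarrow> apart \<epsilon> X t p \<longleftrightarrow> (\<forall>s \<in> {0..t}. \<epsilon> < tdist (X s) (fst p + s *\<^sub>R snd p))"
  by (intro apart_iff continuous_on_subset[OF continuous_X]) auto

lemma unmet_before_path_iff: "0 < t \<Longrightarrow> unmet_before \<epsilon> X t p \<longleftrightarrow> (\<forall>s \<in> {0..<t}. \<epsilon> < tdist (X s) (fst p + s *\<^sub>R snd p))"
  by (intro unmet_before_iff continuous_X)

lemma contact_eq:
  assumes s: "0 < s" "unmet_before \<epsilon> X s p" "tdist (X s) (fst p + s *\<^sub>R snd p) \<le> \<epsilon>"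
  shows "contact \<epsilon> X p = s"
proof -
  have "{r. 0 \<le> r \<and> apart \<epsilon> X r p} = {0..<s}"
  proof (intro equalityI subsetI)
    fix r assume r: "r \<in> {r. 0 \<le> r \<and> apart \<epsilon> X r p}"
    have "r < s"
    proof (rule ccontr)
      assume "\<not> r < s"
      then have "\<epsilon> < tdist (X s) (fst p + s *\<^sub>R snd p)"
        using r s(1) apart_path_iff[of r \<epsilon> p] by auto
      then show False using s(3) by simp
    qed
    then show "r \<in> {0..<s}" using r by auto
  next
    fix r assume "r \<in> {0..<s}"
    then show "r \<in> {r. 0 \<le> r \<and> apart \<epsilon> X r p}"
      using s(2) unmet_before_path_iff[OF s(1)] apart_path_iff[of r] by auto
  qed
  then show ?thesis using s(1) by (simp add: contact_def)
qed

end

lemma nn_integral_state_law: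
  assumes g: "(\<lambda>z. g (fst z) (snd z)) \<in> borel_measurable borel" and F: "F \<in> borel_measurable borel"
  shows "(\<integral>\<^sup>+ p. F p \<partial>state_law g)
    = (\<integral>\<^sup>+ w. \<integral>\<^sup>+ y. indicator torus_cell y * ennreal (g y w) * F (y, w) \<partial>lborel \<partial>lborel)"
proof -
  have [measurable]: "(\<lambda>z. g (fst z) (snd z)) \<in> borel_measurable (borel \<Otimes>\<^sub>M borel)"
    "F \<in> borel_measurable (borel \<Otimes>\<^sub>M borel)"
    using g F by (simp_all only: borel_prod)
  have "(\<integral>\<^sup>+ p. F p \<partial>state_law g)
      = (\<integral>\<^sup>+ z. ennreal (g (fst z) (snd z)) * indicator (torus_cell \<times> UNIV) z * F z \<partial>(lborel \<Otimes>\<^sub>M lborel))"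
    unfolding state_law_def lborel_prod[symmetric] by (subst nn_integral_density) auto
  also have "\<dots> = (\<integral>\<^sup>+ w. \<integral>\<^sup>+ y. ennreal (g y w) * indicator (torus_cell \<times> UNIV) (y, w) * F (y, w) \<partial>lborel \<partial>lborel)"
    by (subst lborel_pair.nn_integral_snd[symmetric]) auto
  finally show ?thesis
    by (simp add: indicator_def mult_ac cong: if_cong)
qed

lemma apart_lattice: "k \<in> int_lattice \<Longrightarrow> apart \<epsilon> X t (y + k, w) = apart \<epsilon> X t (y, w)"
proof -
  assume k: "k \<in> int_lattice"
  have "tdist (X s) (y + k + s *\<^sub>R w) = tdist (X s) (y + s *\<^sub>R w)" for s
    using k by (intro tdist_lattice) simp
  then show ?thesis by (simp add: apart_def)
qed

lemma wrap_add_lattice: "k \<in> int_lattice \<Longrightarrow> wrap (x + k) = wrap x"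
proof -
  assume k: "k \<in> int_lattice"
  have "wrap (x + k) $ i = wrap x $ i" for i
  proof -
    obtain n :: int where n: "k $ i = of_int n"
      using k by (auto simp: int_lattice_def elim: Ints_cases)
    have "\<lfloor>x $ i + of_int n + 1 / 2\<rfloor> = \<lfloor>x $ i + 1 / 2\<rfloor> + n"
      using floor_add_int[of "x $ i + 1 / 2" n] by (simp add: algebra_simps)
    then show ?thesis by (simp add: wrap_def n)
  qed
  then show ?thesis by (simp add: vec_eq_iff)
qed

lemma contact_mark_lattice: "k \<in> int_lattice \<Longrightarrow> contact_mark \<epsilon> X (y + k, w) = contact_mark \<epsilon> X (y, w)"
proof -
  assume k: "k \<in> int_lattice"
  have c: "contact \<epsilon> X (y + k, w) = contact \<epsilon> X (y, w)"
    by (simp add: contact_def apart_lattice[OF k])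
  have "wrap (y + k + s *\<^sub>R w - X s) = wrap (y + s *\<^sub>R w - X s)" for s
    using wrap_add_lattice[OF k, of "y + s *\<^sub>R w - X s"] by (simp add: algebra_simps)
  then show ?thesis by (simp add: contact_mark_def c)
qed

text \<open>\<open>v\<close> is the velocity of the path after its last collision, which takes place no later than \<open>\<tau>\<close>.\<close>

definition hit :: "real \<Rightarrow> (real \<Rightarrow> vec3) \<Rightarrow> vec3 \<Rightarrow> real \<Rightarrow> real \<Rightarrow> state \<Rightarrow> bool" where
  "hit \<epsilon> X v \<tau> h p \<longleftrightarrow>
    (let c = contact_mark \<epsilon> X p in
      \<tau> < fst c \<and> fst c < \<tau> + h \<and> norm (fst (snd c)) = 1 \<and> 0 < (v - snd p) \<bullet> fst (snd c)
      \<and> unmet_before \<epsilon> X (fst c) p)"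

text \<open>The density of first contacts with respect to \<open>mark_measure\<close>: the Jacobian
  times the initial density at the emitted state. It is 0 where the emitted particle has met the
  path earlier, since the mark is then not that of a first contact.\<close>

definition arrival :: "real \<Rightarrow> (vec3 \<Rightarrow> vec3 \<Rightarrow> real) \<Rightarrow> (real \<Rightarrow> vec3) \<Rightarrow> vec3 \<Rightarrow> mark \<Rightarrow> ennreal" where
  "arrival \<epsilon> g X v c =
    (if unmet_before \<epsilon> X (fst c) (emitted \<epsilon> X c)
     then ennreal (\<epsilon>\<^sup>2 * max ((v - snd (snd c)) \<bullet> fst (snd c)) 0 * g (fst (emitted \<epsilon> X c)) (snd (snd c)))
     else 0)"

abbreviation mark_measure :: "mark measure" where
  "mark_measure \<equiv> lborel \<Otimes>\<^sub>M (sphere_measure \<Otimes>\<^sub>M lborel)"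

lemma hit_lattice: "k \<in> int_lattice \<Longrightarrow> hit \<epsilon> X v \<tau> h (y + k, w) = hit \<epsilon> X v \<tau> h (y, w)"
  by (simp add: hit_def contact_mark_lattice unmet_before_def apart_lattice)

lemma measurable_hit [measurable]:
  assumes [measurable]: "case_prod X \<in> borel_measurable (M \<Otimes>\<^sub>M borel)" "p \<in> borel_measurable M"
    "v \<in> borel_measurable M" "\<tau> \<in> borel_measurable M"
  shows "Measurable.pred M (\<lambda>x. hit \<epsilon> (X x) (v x) (\<tau> x) h (p x))"
proof -
  have [measurable]: "(\<lambda>x. fst (p x)) \<in> borel_measurable M" "(\<lambda>x. snd (p x)) \<in> borel_measurable M"
    using assms(2) by (rule borel_measurable_fst borel_measurable_snd)+
  show ?thesis unfolding hit_def Let_def by measurable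
qed

lemma measurable_emitted [measurable]:
  assumes [measurable]: "case_prod X \<in> borel_measurable (M \<Otimes>\<^sub>M borel)" "c \<in> M \<rightarrow>\<^sub>M borel \<Otimes>\<^sub>M (borel \<Otimes>\<^sub>M borel)"
  shows "(\<lambda>x. emitted \<epsilon> (X x) (c x)) \<in> borel_measurable M"
proof -
  have [measurable]: "(\<lambda>x. X x (fst (c x))) \<in> borel_measurable M"
  proof -
    have "(\<lambda>x. case_prod X (x, fst (c x))) \<in> borel_measurable M" by measurable
    then show ?thesis by simp
  qed
  show ?thesis unfolding emitted_def borel_prod[symmetric] by measurable
qed

lemma measurable_arrival [measurable]:
  assumes g: "(\<lambda>z. g (fst z) (snd z)) \<in> borel_measurable borel"
    and [measurable]: "case_prod X \<in> borel_measurable (M \<Otimes>\<^sub>M borel)" "c \<in> M \<rightarrow>\<^sub>M borel \<Otimes>\<^sub>M (borel \<Otimes>\<^sub>M borel)"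
      "v \<in> borel_measurable M"
  shows "(\<lambda>x. arrival \<epsilon> g (X x) (v x) (c x)) \<in> borel_measurable M"
proof -
  have e: "(\<lambda>x. emitted \<epsilon> (X x) (c x)) \<in> borel_measurable M" by measurable
  have s: "snd (emitted \<epsilon> (X x) (c x)) = snd (snd (c x))" for x by (simp add: emitted_def)
  have [measurable]: "(\<lambda>x. g (fst (emitted \<epsilon> (X x) (c x))) (snd (snd (c x)))) \<in> borel_measurable M"
    using measurable_compose[OF e g] by (simp add: s)
  show ?thesis unfolding arrival_def by measurable
qed

text \<open>After \<tau> the path is straight, so for each particle velocity there is a single
  relative velocity and \<open>nn_integral_swept\<close> applies as it stands. Bends before \<tau>
  enter only through the condition of not having met the path.\<close>

locale path_tail = path +
  fixes \<tau> \<epsilon> :: real and g :: "vec3 \<Rightarrow> vec3 \<Rightarrow> real"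
  assumes C_le: "C \<subseteq> {..\<tau>}" and tau: "0 \<le> \<tau>" and eps: "0 < \<epsilon>" "\<epsilon> < 1 / 2"
    and dens: "torus_density g"
begin

lemma g_measurable: "(\<lambda>z. g (fst z) (snd z)) \<in> borel_measurable borel"
  using dens by (simp add: torus_density_def)

lemma g_nonneg [simp]: "0 \<le> g x v"
  using dens by (simp add: torus_density_def)

lemma g_lattice: "k \<in> int_lattice \<Longrightarrow> g (x + k) v = g x v"
  using dens by (simp add: torus_density_def periodic_def)

lemma tail: "\<tau> \<le> s \<Longrightarrow> X s = X \<tau> + (s - \<tau>) *\<^sub>R V \<tau>"
  using C_le tau by (intro straight) auto

lemma tail_velocity: "\<tau> \<le> s \<Longrightarrow> V s = V \<tau>"
  using C_le tau by (intro steady) auto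

text \<open>At time \<open>s\<close> the emitted particle sits at
  \<open>\<epsilon> *\<^sub>R \<nu>\<close> from the path, so \<open>s\<close> ends its period
  apart. As \<epsilon> is below 1/2, \<open>wrap\<close> leaves this vector unchanged and returns
  the same \<nu>.\<close>

lemma contact_mark_emitted:
  assumes "0 < s" "norm \<nu> = 1" "unmet_before \<epsilon> X s (emitted \<epsilon> X (s, \<nu>, w))"
  shows "contact_mark \<epsilon> X (emitted \<epsilon> X (s, \<nu>, w)) = (s, \<nu>, w)"
proof -
  let ?p = "emitted \<epsilon> X (s, \<nu>, w)"
  have d: "fst ?p + s *\<^sub>R w - X s = \<epsilon> *\<^sub>R \<nu>" by (simp add: emitted_def)
  have "tdist (X s) (fst ?p + s *\<^sub>R snd ?p) \<le> norm (X s - (fst ?p + s *\<^sub>R snd ?p) - 0)"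
    by (rule tdist_le) simp
  also have "\<dots> = \<epsilon>" using assms(2) eps by (simp add: emitted_def)
  finally have c: "contact \<epsilon> X ?p = s" using assms by (intro contact_eq) auto
  have "wrap (\<epsilon> *\<^sub>R \<nu>) = \<epsilon> *\<^sub>R \<nu>" using assms(2) eps by (intro wrap_lattice) auto
  then show ?thesis using eps unfolding contact_mark_def c
    by (simp add: d) (simp add: emitted_def)
qed

text \<open>For fixed particle velocity \<open>w\<close> the contact marks after \<tau> parametrize
  the swept region of \<open>u\<close>, translated by \<open>c\<close>. The positions obtained are
  lifts in \<open>real ^ 3\<close>; summing over the lattice brings them back to the cell.\<close>

lemma fibre_change_of_variables:
  assumes H [measurable]: "H \<in> borel_measurable (borel \<Otimes>\<^sub>M (borel \<Otimes>\<^sub>M borel))" and h: "0 < h"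
  shows "(\<integral>\<^sup>+ y. indicator torus_cell y * ennreal (g y w) *
      (if hit \<epsilon> X (V \<tau>) \<tau> h (y, w) then H (contact_mark \<epsilon> X (y, w)) else 0) \<partial>lborel)
    = (\<integral>\<^sup>+ s. \<integral>\<^sup>+ \<nu>. (if \<tau> < s \<and> s < \<tau> + h then arrival \<epsilon> g X (V \<tau>) (s, \<nu>, w) * H (s, \<nu>, w) else 0)
      \<partial>sphere_measure \<partial>lborel)"
proof -
  note [measurable] = g_measurable
  have [measurable]: "(\<lambda>y. g y w) \<in> borel_measurable borel"
  proof -
    have "(\<lambda>y. (y, w)) \<in> borel_measurable borel"
      by (intro borel_measurable_continuous_onI continuous_intros)
    from measurable_compose[OF this g_measurable] show ?thesis by simp
  qed
  have pw [measurable]: "(\<lambda>y. (y, w)) \<in> borel_measurable borel"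
    by (intro borel_measurable_continuous_onI continuous_intros)
  have [measurable]: "(\<lambda>(x, r). X r) \<in> borel_measurable (M \<Otimes>\<^sub>M borel)" for M :: "'z measure"
    by measurable
  define u where "u = V \<tau> - w"
  define c where "c = X \<tau> - \<tau> *\<^sub>R w"
  \<comment> \<open>All lifts of a torus position have the same mark, so the second condition
    selects the one lift that the mark emits. Without it, each particle would be counted infinitely
    often in the integral over the whole space.\<close>
  define K where "K y = (if hit \<epsilon> X (V \<tau>) \<tau> h (y, w) \<and> y = fst (emitted \<epsilon> X (contact_mark \<epsilon> X (y, w)))
      then ennreal (g y w) * H (contact_mark \<epsilon> X (y, w)) else 0)" for y
  have [measurable]: "(\<lambda>y. fst (emitted \<epsilon> X (contact_mark \<epsilon> X (y, w)))) \<in> borel_measurable borel"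
    by (intro borel_measurable_fst) measurable
  have K_meas [measurable]: "K \<in> borel_measurable borel" unfolding K_def by measurable
  have pos: "X (\<tau> + s) + \<epsilon> *\<^sub>R \<nu> - (\<tau> + s) *\<^sub>R w = c + (\<epsilon> *\<^sub>R \<nu> + s *\<^sub>R u)" if "0 \<le> s" for s \<nu>
    using tail[of "\<tau> + s"] that by (simp add: c_def u_def algebra_simps)
  have K_swept: "z \<in> swept u \<epsilon> h" if "K (c + z) \<noteq> 0" for z
  proof -
    obtain s \<nu> where m: "contact_mark \<epsilon> X (c + z, w) = (s, \<nu>, w)" by (auto simp: contact_mark_def)
    then have "\<tau> < s" "s < \<tau> + h" "norm \<nu> = 1" "0 < u \<bullet> \<nu>" "c + z = X s + \<epsilon> *\<^sub>R \<nu> - s *\<^sub>R w"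
      using that by (auto simp: K_def hit_def u_def emitted_def split: if_splits)
    moreover from this have "c + z = c + (\<epsilon> *\<^sub>R \<nu> + (s - \<tau>) *\<^sub>R u)" using pos[of "s - \<tau>" \<nu>] by simp
    ultimately show ?thesis
      unfolding swept_def by (intro CollectI exI[of _ "s - \<tau>"] exI[of _ \<nu>]) auto
  qed
  \<comment> \<open>Pointwise equality of the two integrands. It needs a unit vector \<nu>, which
    holds almost everywhere for \<open>sphere_measure\<close>.\<close>
  have key: "(if \<tau> < \<tau> + s \<and> \<tau> + s < \<tau> + h then arrival \<epsilon> g X (V \<tau>) (\<tau> + s, \<nu>, w) * H (\<tau> + s, \<nu>, w) else 0)
      = indicator {0<..<h} s * (ennreal (\<epsilon>\<^sup>2 * max (u \<bullet> \<nu>) 0) * K (c + (\<epsilon> *\<^sub>R \<nu> + s *\<^sub>R u)))"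
    if \<nu>: "norm \<nu> = 1" for s \<nu>
  proof (cases "0 < s \<and> s < h \<and> 0 < u \<bullet> \<nu>")
    case True
    then have s: "0 < s" "s < h" "0 < u \<bullet> \<nu>" by auto
    let ?y = "c + (\<epsilon> *\<^sub>R \<nu> + s *\<^sub>R u)"
    have e: "emitted \<epsilon> X (\<tau> + s, \<nu>, w) = (?y, w)" using pos[of s \<nu>] s by (simp add: emitted_def)
    show ?thesis
    proof (cases "unmet_before \<epsilon> X (\<tau> + s) (?y, w)")
      case True
      then have "contact_mark \<epsilon> X (?y, w) = (\<tau> + s, \<nu>, w)"
        using contact_mark_emitted[of "\<tau> + s" \<nu> w] \<nu> s tau e by auto
      then show ?thesis using True s e \<nu>
        by (simp add: K_def hit_def arrival_def u_def ennreal_mult mult_ac)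
    next
      case False
      \<comment> \<open>If \<open>K\<close> did not vanish, \<open>?y\<close> would also be emitted
        by the mark of its first contact. By \<open>sweep_inj\<close> the two marks coincide,
        although the given one is not a first contact.\<close>
      have "K ?y = 0"
      proof (rule ccontr)
        assume K: "K ?y \<noteq> 0"
        obtain s' \<nu>' where m: "contact_mark \<epsilon> X (?y, w) = (s', \<nu>', w)" by (auto simp: contact_mark_def)
        then have s': "\<tau> < s'" "s' < \<tau> + h" "norm \<nu>' = 1" "0 < u \<bullet> \<nu>'" "?y = X s' + \<epsilon> *\<^sub>R \<nu>' - s' *\<^sub>R w"
          "unmet_before \<epsilon> X s' (?y, w)"
          using K by (auto simp: K_def hit_def u_def emitted_def split: if_splits)
        from s'(1,5) have "c + (\<epsilon> *\<^sub>R \<nu> + s *\<^sub>R u) = c + (\<epsilon> *\<^sub>R \<nu>' + (s' - \<tau>) *\<^sub>R u)"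
          using pos[of "s' - \<tau>" \<nu>'] by simp
        then have "\<epsilon> *\<^sub>R \<nu> + s *\<^sub>R u = \<epsilon> *\<^sub>R \<nu>' + (s' - \<tau>) *\<^sub>R u" by simp
        then have "s = s' - \<tau> \<and> \<nu> = \<nu>'"
          using sweep_inj[of \<nu> u \<nu>' \<epsilon> s "s' - \<tau>"] \<nu> s s'(3,4) eps(1) by blast
        with s' False show False by auto
      qed
      then show ?thesis using False e by (simp add: arrival_def)
    qed
  next
    case False
    then show ?thesis by (auto simp: arrival_def u_def max_def)
  qed
  have "(\<integral>\<^sup>+ s. \<integral>\<^sup>+ \<nu>. (if \<tau> < s \<and> s < \<tau> + h then arrival \<epsilon> g X (V \<tau>) (s, \<nu>, w) * H (s, \<nu>, w) else 0)
      \<partial>sphere_measure \<partial>lborel)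
    = (\<integral>\<^sup>+ s. \<integral>\<^sup>+ \<nu>. (if \<tau> < \<tau> + s \<and> \<tau> + s < \<tau> + h then arrival \<epsilon> g X (V \<tau>) (\<tau> + s, \<nu>, w) * H (\<tau> + s, \<nu>, w) else 0)
      \<partial>sphere_measure \<partial>lborel)"
    by (subst nn_integral_real_affine[of _ 1 \<tau>]) (simp_all cong: if_cong)
  also have "\<dots> = (\<integral>\<^sup>+ s. \<integral>\<^sup>+ \<nu>. indicator {0<..<h} s * (ennreal (\<epsilon>\<^sup>2 * max (u \<bullet> \<nu>) 0) * K (c + (\<epsilon> *\<^sub>R \<nu> + s *\<^sub>R u)))
      \<partial>sphere_measure \<partial>lborel)"
    by (intro nn_integral_cong nn_integral_cong_AE eventually_mono[OF AE_sphere_measure]) (rule key)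
  also have "\<dots> = (\<integral>\<^sup>+ s. indicator {0<..<h} s * (\<integral>\<^sup>+ \<nu>. ennreal (\<epsilon>\<^sup>2 * max (u \<bullet> \<nu>) 0) * K (c + (\<epsilon> *\<^sub>R \<nu> + s *\<^sub>R u))
      \<partial>sphere_measure) \<partial>lborel)"
    by (intro nn_integral_cong nn_integral_cmult) auto
  also have "\<dots> = (\<integral>\<^sup>+ z. K (c + z) * indicator (swept u \<epsilon> h) z \<partial>lborel)"
    using eps h by (intro nn_integral_swept) auto
  also have "\<dots> = (\<integral>\<^sup>+ z. K (z + c) \<partial>lborel)"
  proof (rule nn_integral_cong)
    show "K (c + z) * indicator (swept u \<epsilon> h) z = K (z + c)" for z
      using K_swept[of z] by (cases "K (c + z) = 0") (auto simp: add.commute)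
  qed
  also have "\<dots> = (\<integral>\<^sup>+ y. K y \<partial>lborel)" by (rule nn_integral_translate) measurable
  also have "\<dots> = (\<integral>\<^sup>+ y \<in> torus_cell. (\<integral>\<^sup>+ k. K (y + k) \<partial>count_space int_lattice) \<partial>lborel)"
    by (rule nn_integral_fold) measurable
  also have "\<dots> = (\<integral>\<^sup>+ y. indicator torus_cell y * ennreal (g y w) *
      (if hit \<epsilon> X (V \<tau>) \<tau> h (y, w) then H (contact_mark \<epsilon> X (y, w)) else 0) \<partial>lborel)"
  proof (rule nn_integral_cong)
    fix y
    let ?A = "if hit \<epsilon> X (V \<tau>) \<tau> h (y, w) then ennreal (g y w) * H (contact_mark \<epsilon> X (y, w)) else 0"
    let ?m = "contact_mark \<epsilon> X (y, w)"
    \<comment> \<open>The only lattice vector that contributes: \<open>y + ?k\<close> is the lift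
      emitted by the common mark.\<close>
    let ?k = "fst (emitted \<epsilon> X ?m) - y"
    have "(\<integral>\<^sup>+ k. K (y + k) \<partial>count_space int_lattice) = (\<integral>\<^sup>+ k. ?A * indicator {?k} k \<partial>count_space int_lattice)"
    proof (rule nn_integral_cong)
      fix k :: vec3 assume "k \<in> space (count_space int_lattice)"
      then have k: "k \<in> int_lattice" by simp
      have e: "y + k = fst (emitted \<epsilon> X ?m) \<longleftrightarrow> k = ?k" by (auto simp: algebra_simps)
      show "K (y + k) = ?A * indicator {?k} k"
        unfolding K_def hit_lattice[OF k] contact_mark_lattice[OF k] g_lattice[OF k] e by simp
    qed
    also have "\<dots> = ?A * emeasure (count_space int_lattice) ({?k} \<inter> space (count_space int_lattice))"
      by (subst nn_integral_cmult_indicator[symmetric]) (auto intro!: nn_integral_cong simp: indicator_def)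
    also have "?k \<in> int_lattice"
    proof -
      let ?s = "contact \<epsilon> X (y, w)"
      have "?k = - ((y + ?s *\<^sub>R w - X ?s) - wrap (y + ?s *\<^sub>R w - X ?s))"
        using eps by (simp add: emitted_def contact_mark_def)
      then show ?thesis using lattice_wrap lattice_uminus by metis
    qed
    then have "emeasure (count_space int_lattice) ({?k} \<inter> space (count_space int_lattice)) = 1"
      by (simp add: emeasure_count_space Int_absorb2)
    finally show "(\<integral>\<^sup>+ k. K (y + k) \<partial>count_space int_lattice) * indicator torus_cell y
      = indicator torus_cell y * ennreal (g y w) * (if hit \<epsilon> X (V \<tau>) \<tau> h (y, w) then H ?m else 0)"
      by (simp add: mult_ac)
  qed
  finally show ?thesis by (rule sym)
qed

theorem change_of_variables:
  assumes H [measurable]: "H \<in> borel_measurable (borel \<Otimes>\<^sub>M (borel \<Otimes>\<^sub>M borel))" and h: "0 < h"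
  shows "(\<integral>\<^sup>+ p. (if hit \<epsilon> X (V \<tau>) \<tau> h p then H (contact_mark \<epsilon> X p) else 0) \<partial>state_law g)
    = (\<integral>\<^sup>+ c. (if \<tau> < fst c \<and> fst c < \<tau> + h then arrival \<epsilon> g X (V \<tau>) c * H c else 0) \<partial>mark_measure)"
proof -
  have [measurable]: "(\<lambda>(x, r). X r) \<in> borel_measurable (M \<Otimes>\<^sub>M borel)" for M :: "'z measure"
    by measurable
  note [measurable] = measurable_arrival[OF g_measurable]
  let ?F = "\<lambda>c. if \<tau> < fst c \<and> fst c < \<tau> + h then arrival \<epsilon> g X (V \<tau>) c * H c else 0"
  interpret sl: pair_sigma_finite sphere_measure "lborel :: vec3 measure" ..
  have "(\<integral>\<^sup>+ p. (if hit \<epsilon> X (V \<tau>) \<tau> h p then H (contact_mark \<epsilon> X p) else 0) \<partial>state_law g)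
    = (\<integral>\<^sup>+ w. \<integral>\<^sup>+ s. \<integral>\<^sup>+ \<nu>. ?F (s, \<nu>, w) \<partial>sphere_measure \<partial>lborel \<partial>lborel)"
    by (subst nn_integral_state_law[OF g_measurable], measurable)
       (use fibre_change_of_variables[OF H h] in \<open>simp cong: if_cong\<close>)
  also have "\<dots> = (\<integral>\<^sup>+ s. \<integral>\<^sup>+ w. \<integral>\<^sup>+ \<nu>. ?F (s, \<nu>, w) \<partial>sphere_measure \<partial>lborel \<partial>lborel)"
    by (rule lborel_pair.Fubini') measurable
  also have "\<dots> = (\<integral>\<^sup>+ s. \<integral>\<^sup>+ z. ?F (s, z) \<partial>(sphere_measure \<Otimes>\<^sub>M lborel) \<partial>lborel)"
    by (intro nn_integral_cong sl.nn_integral_snd[where f = "\<lambda>z. ?F (s, z)" for s]) measurable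
  also have "\<dots> = (\<integral>\<^sup>+ c. ?F c \<partial>mark_measure)"
    by (rule sigma_finite_measure.nn_integral_fst) (auto intro!: sl.sigma_finite_measure_axioms)
  finally show ?thesis .
qed

end


section \<open>The survival probability\<close>

text \<open>A convex combination of points in two balls lies in the ball whose centre and radius are
  combined in the same way, as both depend affinely on the parameter. Constant radii suffice for
  positions; radii proportional to the parameter arise for velocities, in
  \<open>negligible_grazing\<close>.\<close>

lemma convex_tapered_tube:
  fixes a b :: "'a :: real_normed_vector"
  assumes I: "convex I"
  shows "convex {w. \<exists>\<sigma> \<in> I. norm (w - (a + \<sigma> *\<^sub>R b)) < c * \<sigma> + d}"
proof (rule convexI, clarsimp)
  fix w1 w2 s1 s2 and l1 l2 :: real
  assume l: "0 \<le> l1" "0 \<le> l2" "l1 + l2 = 1" and s: "s1 \<in> I" "s2 \<in> I"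
    and n: "norm (w1 - (a + s1 *\<^sub>R b)) < c * s1 + d" "norm (w2 - (a + s2 *\<^sub>R b)) < c * s2 + d"
  let ?s = "l1 * s1 + l2 * s2"
  have "?s \<in> I" using convexD[OF I s l] by simp
  moreover have "norm (l1 *\<^sub>R w1 + l2 *\<^sub>R w2 - (a + ?s *\<^sub>R b)) < c * ?s + d"
  proof -
    have "l1 *\<^sub>R w1 + l2 *\<^sub>R w2 - (a + ?s *\<^sub>R b) = l1 *\<^sub>R w1 + l2 *\<^sub>R w2 - ((l1 + l2) *\<^sub>R a + ?s *\<^sub>R b)"
      using l(3) by simp
    also have "\<dots> = l1 *\<^sub>R (w1 - (a + s1 *\<^sub>R b)) + l2 *\<^sub>R (w2 - (a + s2 *\<^sub>R b))"
      by (simp add: algebra_simps)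
    finally have "norm (l1 *\<^sub>R w1 + l2 *\<^sub>R w2 - (a + ?s *\<^sub>R b))
        \<le> l1 * norm (w1 - (a + s1 *\<^sub>R b)) + l2 * norm (w2 - (a + s2 *\<^sub>R b))"
      using l norm_triangle_ineq[of "l1 *\<^sub>R (w1 - (a + s1 *\<^sub>R b))" "l2 *\<^sub>R (w2 - (a + s2 *\<^sub>R b))"] by simp
    also have "\<dots> < l1 * (c * s1 + d) + l2 * (c * s2 + d)"
    proof (cases "l1 = 0")
      case True then show ?thesis using l n by simp
    next
      case False
      then have "l1 * norm (w1 - (a + s1 *\<^sub>R b)) < l1 * (c * s1 + d)" using l n by simp
      moreover have "l2 * norm (w2 - (a + s2 *\<^sub>R b)) \<le> l2 * (c * s2 + d)"
        using l n by (intro mult_left_mono) auto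
      ultimately show ?thesis by linarith
    qed
    also have "\<dots> = c * ?s + (l1 + l2) * d" by (simp add: algebra_simps)
    finally show ?thesis using l(3) by simp
  qed
  ultimately show "\<exists>\<sigma> \<in> I. norm (l1 *\<^sub>R w1 + l2 *\<^sub>R w2 - (a + \<sigma> *\<^sub>R b)) < c * \<sigma> + d" by blast
qed

text \<open>A point that touches the tube without entering it lies in the frontier of a convex set.\<close>

lemma negligible_touching:
  fixes a b :: "'a :: euclidean_space"
  assumes I: "convex I"
  shows "negligible {w. (\<exists>\<sigma> \<in> I. norm (w - (a + \<sigma> *\<^sub>R b)) = c * \<sigma> + d \<and> 0 < c * \<sigma> + d) \<and>
    (\<forall>\<sigma> \<in> I. c * \<sigma> + d \<le> norm (w - (a + \<sigma> *\<^sub>R b)))}" (is "negligible ?Z")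
proof -
  let ?O = "{w. \<exists>\<sigma> \<in> I. norm (w - (a + \<sigma> *\<^sub>R b)) < c * \<sigma> + d}"
  have O: "?O = (\<Union>\<sigma> \<in> I. ball (a + \<sigma> *\<^sub>R b) (c * \<sigma> + d))"
    by (auto simp: dist_norm norm_minus_commute)
  have "open ?O" unfolding O by auto
  have "?Z \<subseteq> frontier ?O"
  proof
    fix w assume w: "w \<in> ?Z"
    then obtain \<sigma> where s: "\<sigma> \<in> I" "norm (w - (a + \<sigma> *\<^sub>R b)) = c * \<sigma> + d" "0 < c * \<sigma> + d" by blast
    have "w \<in> cball (a + \<sigma> *\<^sub>R b) (c * \<sigma> + d)" using s by (simp add: dist_norm norm_minus_commute)
    also have "\<dots> = closure (ball (a + \<sigma> *\<^sub>R b) (c * \<sigma> + d))" using s by simp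
    also have "\<dots> \<subseteq> closure ?O" unfolding O using s by (intro closure_mono) auto
    finally have "w \<in> closure ?O" .
    moreover have "w \<notin> ?O" using w by force
    ultimately show "w \<in> frontier ?O" using \<open>open ?O\<close> by (simp add: frontier_def interior_open)
  qed
  moreover have "negligible (frontier ?O)"
    by (intro negligible_convex_frontier convex_tapered_tube I)
  ultimately show ?thesis using negligible_subset by blast
qed

lemma negligible_tdist_eq:
  assumes e: "0 < \<epsilon>"
  shows "negligible {y. tdist x (y + c) = \<epsilon>}"
proof -
  have "{y. tdist x (y + c) = \<epsilon>} \<subseteq> (\<Union>k \<in> int_lattice. sphere (x - c - k) \<epsilon>)"
  proof
    fix y assume y: "y \<in> {y. tdist x (y + c) = \<epsilon>}"
    obtain k where k: "k \<in> int_lattice" "tdist x (y + c) = norm (x - (y + c) - k)"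
      by (rule tdist_attained)
    have "x - (y + c) - k = x - c - k - y" by simp
    with y k have "norm (x - c - k - y) = \<epsilon>" by simp
    then show "y \<in> (\<Union>k \<in> int_lattice. sphere (x - c - k) \<epsilon>)" using k(1) by (auto simp: dist_norm)
  qed
  moreover have "negligible (\<Union>k \<in> int_lattice. sphere (x - c - k) \<epsilon>)"
    using countable_lattice by (intro negligible_countable_Union countable_image) (auto simp: negligible_sphere)
  ultimately show ?thesis using negligible_subset by blast
qed

lemma emeasure_negligible:
  assumes "A \<in> sets borel" "negligible A"
  shows "emeasure lborel A = 0"
  using assms by (simp add: negligible_iff_null_sets null_sets_def)

lemma emeasure_state_law_0:
  assumes g: "(\<lambda>z. g (fst z) (snd z)) \<in> borel_measurable borel" and A: "A \<in> sets borel"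
    and n: "\<And>w. negligible {y. (y, w) \<in> A}"
  shows "emeasure (state_law g) A = 0"
proof -
  have "emeasure (state_law g) A = (\<integral>\<^sup>+ p. indicator A p \<partial>state_law g)"
    using A by (simp add: state_law_def)
  also have "\<dots> = (\<integral>\<^sup>+ w. \<integral>\<^sup>+ y. indicator torus_cell y * ennreal (g y w) * indicator A (y, w) \<partial>lborel \<partial>lborel)"
    using g A by (intro nn_integral_state_law) auto
  also have "\<dots> = (\<integral>\<^sup>+ (w::vec3). 0 \<partial>lborel)"
  proof (rule nn_integral_cong)
    fix w :: vec3
    have s: "{y. (y, w) \<in> A} \<in> sets borel"
    proof -
      have "(\<lambda>y. (y, w)) \<in> borel_measurable borel" by (intro borel_measurable_continuous_onI continuous_intros)
      from measurable_sets[OF this A] show ?thesis by (simp add: vimage_def)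
    qed
    then have "{y. (y, w) \<in> A} \<in> null_sets lborel" using emeasure_negligible[OF s n] by (simp add: null_sets_def)
    from AE_not_in[OF this] have "AE y in lborel. indicator torus_cell y * ennreal (g y w) * indicator A (y, w) = 0"
      by eventually_elim (simp add: indicator_def)
    then show "(\<integral>\<^sup>+ y. indicator torus_cell y * ennreal (g y w) * indicator A (y, w) \<partial>lborel) = 0"
      by (subst nn_integral_cong_AE[where v = "\<lambda>_. 0"]) auto
  qed
  finally show ?thesis by simp
qed

lemma prob_state_law:
  assumes "torus_density g"
  shows "prob_space (state_law g)"
proof
  have [measurable]: "(\<lambda>z. g (fst z) (snd z)) \<in> borel_measurable borel"
    using assms by (simp add: torus_density_def)
  have [measurable]: "torus_cell \<times> (UNIV :: vec3 set) \<in> sets borel"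
    by (simp add: borel_prod[symmetric])
  show "emeasure (state_law g) (space (state_law g)) = 1"
    using assms unfolding state_law_def by (simp add: emeasure_density torus_density_def)
qed

text \<open>An initial overlap counts as a meeting. At time 0 this is therefore 1 minus the mass of
  the ball around the root, which is how the factor \<open>zeta\<close> arises.\<close>

definition survival :: "real \<Rightarrow> (vec3 \<Rightarrow> vec3 \<Rightarrow> real) \<Rightarrow> (real \<Rightarrow> vec3) \<Rightarrow> real \<Rightarrow> real" where
  "survival \<epsilon> g X t = measure (state_law g) {p. apart \<epsilon> X t p}"

lemma sets_state_law [measurable_cong, simp]: "sets (state_law g) = sets borel"
  by (simp add: state_law_def)

lemma space_state_law [simp]: "space (state_law g) = UNIV"
  by (simp add: state_law_def)

context path
begin

lemma apart_antimono: "0 \<le> s \<Longrightarrow> s \<le> t \<Longrightarrow> apart \<epsilon> X t p \<Longrightarrow> apart \<epsilon> X s p"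
  using apart_path_iff[of s] apart_path_iff[of t] by auto

lemma first_contact:
  assumes t: "0 \<le> \<tau>" "\<tau> \<le> t" and a: "apart \<epsilon> X \<tau> p" and na: "\<not> apart \<epsilon> X t p"
  obtains s where "\<tau> < s" "s \<le> t" "unmet_before \<epsilon> X s p" "tdist (X s) (fst p + s *\<^sub>R snd p) = \<epsilon>"
proof -
  let ?d = "\<lambda>s. tdist (X s) (fst p + s *\<^sub>R snd p)"
  let ?B = "{s \<in> {0..t}. ?d s \<le> \<epsilon>}"
  have c: "continuous_on {0..t} ?d"
    by (intro continuous_intros continuous_on_subset[OF continuous_X]) auto
  have "closed ?B" by (rule continuous_on_closed_Collect_le[OF c continuous_on_const closed_atLeastAtMost])
  moreover have "?B \<noteq> {}" using na t apart_path_iff[of t \<epsilon> p] by (auto simp: not_less)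
  moreover have bb: "bdd_below ?B" by (auto intro: bdd_belowI[of _ 0])
  ultimately have "Inf ?B \<in> ?B" by (intro closed_contains_Inf)
  moreover have "\<And>r. r \<in> ?B \<Longrightarrow> Inf ?B \<le> r" by (rule cInf_lower[OF _ bb])
  ultimately obtain S where S: "0 \<le> S" "S \<le> t" "?d S \<le> \<epsilon>"
    and least: "\<And>r. r \<in> ?B \<Longrightarrow> S \<le> r" by auto
  have before: "\<epsilon> < ?d r" if "0 \<le> r" "r < S" for r
  proof (rule ccontr)
    assume "\<not> \<epsilon> < ?d r"
    then have "S \<le> r" using that S by (intro least) auto
    then show False using that by simp
  qed
  have gt: "\<tau> < S"
  proof (rule ccontr)
    assume "\<not> \<tau> < S"
    then have "S \<in> {0..\<tau>}" using S by auto
    then have "\<epsilon> < ?d S" using a t apart_path_iff[of \<tau> \<epsilon> p] by blast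
    with S show False by simp
  qed
  then have s0: "0 < S" using t by simp
  have "\<epsilon> \<le> ?d S"
  proof (rule continuous_ge_on_closure[where S = "{0..<S}" and f = ?d])
    show "continuous_on (closure {0..<S}) ?d" using s0 S by (auto intro: continuous_on_subset[OF c])
    show "S \<in> closure {0..<S}" using s0 by simp
  qed (use before in \<open>auto intro: less_imp_le\<close>)
  then have "?d S = \<epsilon>" using S by simp
  moreover have "unmet_before \<epsilon> X S p" using unmet_before_path_iff[OF s0] before by auto
  ultimately show ?thesis using that[of S] S gt by simp
qed

lemma survival_decreasing:
  assumes "torus_density g" "0 \<le> s" "s \<le> t"
  shows "survival \<epsilon> g X t \<le> survival \<epsilon> g X s"
proof -
  interpret prob_space "state_law g" using assms(1) by (rule prob_state_law)
  show ?thesis unfolding survival_def using apart_antimono[OF assms(2,3)]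
    by (intro finite_measure_mono) auto
qed

text \<open>A particle apart on \<open>{0..t}\<close> either stays apart for one more unit of time
  or has a first contact strictly after \<open>t\<close>; in both cases it is apart slightly longer.
  So the events for times decreasing to \<open>t\<close> increase to the event for
  \<open>t\<close>.\<close>

lemma survival_right_continuous:
  assumes g: "torus_density g" and t: "0 \<le> t"
  shows "continuous (at_right t) (survival \<epsilon> g X)"
proof -
  interpret prob_space "state_law g" using g by (rule prob_state_law)
  let ?t = "\<lambda>n::nat. t + 1 / (real n + 1)"
  have "(\<lambda>n. measure (state_law g) {p. apart \<epsilon> X (?t n) p}) \<longlonglongrightarrow> measure (state_law g) (\<Union>n. {p. apart \<epsilon> X (?t n) p})"
  proof (rule finite_Lim_measure_incseq)
    show "incseq (\<lambda>n. {p. apart \<epsilon> X (?t n) p})"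
    proof (rule incseq_SucI)
      fix n
      have "?t (Suc n) \<le> ?t n" by (simp add: frac_le)
      moreover have "0 \<le> ?t (Suc n)" using t by simp
      ultimately show "{p. apart \<epsilon> X (?t n) p} \<le> {p. apart \<epsilon> X (?t (Suc n)) p}"
        using apart_antimono by blast
    qed
  qed auto
  also have "(\<Union>n. {p. apart \<epsilon> X (?t n) p}) = {p. apart \<epsilon> X t p}"
  proof (intro equalityI subsetI)
    fix p assume "p \<in> (\<Union>n. {p. apart \<epsilon> X (?t n) p})"
    then obtain n where "apart \<epsilon> X (?t n) p" by auto
    then show "p \<in> {p. apart \<epsilon> X t p}" using apart_antimono[of t "?t n"] t by auto
  next
    fix p assume "p \<in> {p. apart \<epsilon> X t p}"
    then have a: "apart \<epsilon> X t p" by simp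
    show "p \<in> (\<Union>n. {p. apart \<epsilon> X (?t n) p})"
    proof (cases "apart \<epsilon> X (?t 0) p")
      case False
      then obtain s where s: "t < s" "unmet_before \<epsilon> X s p"
        using first_contact[OF t _ a, of "?t 0"] by auto
      obtain n where n: "1 / (real n + 1) < s - t"
        using reals_Archimedean[of "s - t"] s by (auto simp: inverse_eq_divide add.commute)
      have "apart \<epsilon> X (?t n) p"
        using s n t unmet_before_path_iff[of s \<epsilon> p] apart_path_iff[of "?t n" \<epsilon> p] by auto
      then show ?thesis by blast
    qed blast
  qed
  finally have L: "(\<lambda>n. survival \<epsilon> g X (?t n)) \<longlonglongrightarrow> survival \<epsilon> g X t"
    unfolding survival_def .
  show ?thesis unfolding continuous_within
  proof (rule order_tendstoI)
    fix a assume "a < survival \<epsilon> g X t"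
    then obtain n where n: "a < survival \<epsilon> g X (?t n)"
      using order_tendstoD(1)[OF L] by (auto simp: eventually_sequentially)
    have "\<forall>\<^sub>F s in at_right t. s < ?t n" 
      unfolding eventually_at_right_field by (intro exI[of _ "?t n"]) auto
    then show "\<forall>\<^sub>F s in at_right t. a < survival \<epsilon> g X s"
      using eventually_at_right_less[of t]
    proof eventually_elim
      case (elim s)
      then have "survival \<epsilon> g X (?t n) \<le> survival \<epsilon> g X s" using t by (intro survival_decreasing[OF g]) auto
      with n show ?case by linarith
    qed
  next
    fix a assume a: "survival \<epsilon> g X t < a"
    show "\<forall>\<^sub>F s in at_right t. survival \<epsilon> g X s < a"
      using eventually_at_right_less[of t]
    proof eventually_elim
      case (elim s)
      then have "survival \<epsilon> g X s \<le> survival \<epsilon> g X t" using t by (intro survival_decreasing[OF g]) auto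
      with a show ?case by linarith
    qed
  qed
qed

end

context path_tail
begin

text \<open>Particles that cease to be apart without counting as a \<open>hit\<close> have their
  contact exactly at time \<open>t\<close>, or have a first contact that is not incoming. Such a
  contact must be tangential, and then the position lies on the boundary of a convex tube.\<close>

lemma no_hit_null:
  assumes t: "\<tau> < t"
  shows "negligible {y. apart \<epsilon> X \<tau> (y, w) \<and> \<not> apart \<epsilon> X t (y, w) \<and> \<not> hit \<epsilon> X (V \<tau>) \<tau> (t - \<tau>) (y, w)}"
    (is "negligible ?Z")
proof -
  let ?u = "w - V \<tau>"
  define a where "a = X \<tau> - \<tau> *\<^sub>R V \<tau>"
  \<comment> \<open>The terms \<open>0 * s\<close> bring the constant radius into the form of
    \<open>negligible_touching\<close>; \<open>k\<close> runs over the lattice images of the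
    root.\<close>
  define G where "G k = {y. (\<exists>s \<in> {\<tau><..<t}. norm (y - (a + k + s *\<^sub>R (V \<tau> - w))) = 0 * s + \<epsilon> \<and> 0 < 0 * s + \<epsilon>) \<and>
    (\<forall>s \<in> {\<tau><..<t}. 0 * s + \<epsilon> \<le> norm (y - (a + k + s *\<^sub>R (V \<tau> - w))))}" for k
  have pos: "y + s *\<^sub>R w - X s - k = y - (a + k + s *\<^sub>R (V \<tau> - w))" if "\<tau> \<le> s" for y s k
    using tail[OF that] by (simp add: a_def algebra_simps)
  have "?Z \<subseteq> {y. tdist (X t) (y + t *\<^sub>R w) = \<epsilon>} \<union> (\<Union>k \<in> int_lattice. G k)"
  proof
    fix y assume y: "y \<in> ?Z"
    then obtain s where s: "\<tau> < s" "s \<le> t" "unmet_before \<epsilon> X s (y, w)" "tdist (X s) (y + s *\<^sub>R w) = \<epsilon>"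
      using first_contact[of \<tau> t \<epsilon> "(y, w)"] tau t by auto
    show "y \<in> {y. tdist (X t) (y + t *\<^sub>R w) = \<epsilon>} \<union> (\<Union>k \<in> int_lattice. G k)"
    proof (cases "s = t")
      case False
      then have st: "s < t" using s by simp
      have c: "contact \<epsilon> X (y, w) = s" using s tau by (intro contact_eq) auto
      define d where "d = wrap (y + s *\<^sub>R w - X s)"
      define k where "k = y + s *\<^sub>R w - X s - d"
      have k: "k \<in> int_lattice" unfolding k_def d_def by (rule lattice_wrap)
      have nd: "norm d = \<epsilon>"
        using s(4) unfolding d_def tdist_wrap[symmetric] by (simp only: tdist_commute[of "X s" "y + s *\<^sub>R w"])
      define \<nu> where "\<nu> = (1 / \<epsilon>) *\<^sub>R d"
      have d: "d = \<epsilon> *\<^sub>R \<nu>" using eps by (simp add: \<nu>_def)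
      have n\<nu>: "norm \<nu> = 1" using eps nd by (simp add: \<nu>_def)
      have m: "contact_mark \<epsilon> X (y, w) = (s, \<nu>, w)" by (simp add: contact_mark_def c \<nu>_def d_def)
      have le: "(V \<tau> - w) \<bullet> \<nu> \<le> 0"
        using y s(1,3) st m n\<nu> by (auto simp: hit_def)
      have shift: "y - (a + k + r *\<^sub>R (V \<tau> - w)) = \<epsilon> *\<^sub>R \<nu> + (s - r) *\<^sub>R (V \<tau> - w)" for r
        using pos[of s y k] s(1) by (simp add: k_def d algebra_simps)
      have sq: "(norm (\<epsilon> *\<^sub>R \<nu> + q *\<^sub>R (V \<tau> - w)))\<^sup>2 = \<epsilon>\<^sup>2 + 2 * \<epsilon> * q * ((V \<tau> - w) \<bullet> \<nu>) + q\<^sup>2 * (norm (V \<tau> - w))\<^sup>2" for q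
        unfolding power2_norm_eq_inner using n\<nu>
        by (simp add: inner_simps norm_eq_1 inner_commute power2_eq_square algebra_simps)
      \<comment> \<open>With a negative product the particle would be on its way out at time
        \<open>s\<close>, hence strictly inside shortly before, although it has not met the path
        before \<open>s\<close>.\<close>
      have "(V \<tau> - w) \<bullet> \<nu> = 0"
      proof (rule ccontr)
        assume "(V \<tau> - w) \<bullet> \<nu> \<noteq> 0"
        then have neg: "(V \<tau> - w) \<bullet> \<nu> < 0" using le by simp
        define n2 where "n2 = (norm (V \<tau> - w))\<^sup>2"
        have n2: "0 \<le> n2" by (simp add: n2_def)
        \<comment> \<open>Chosen so that every \<open>q\<close> in \<open>{0..Q}\<close> satisfies
          \<open>q\<^sup>2 * (n2 + 1) \<le> - 2 * \<epsilon> * q * ((V \<tau> - w) \<bullet>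
          \<nu>)\<close>; the squared distance at time \<open>s - q\<close> is then at most
          \<open>\<epsilon>\<^sup>2 - q\<^sup>2\<close>. The minimum with \<open>s - \<tau>\<close>
          stays on the straight tail.\<close>
        define Q where "Q = - 2 * \<epsilon> * ((V \<tau> - w) \<bullet> \<nu>) / (n2 + 1)"
        define q where "q = min (s - \<tau>) Q"
        have "0 < - 2 * \<epsilon> * ((V \<tau> - w) \<bullet> \<nu>)" using neg eps by (simp add: mult_pos_neg)
        then have "0 < Q" unfolding Q_def using n2 by (intro divide_pos_pos) auto
        then have q0: "0 < q" "q \<le> s - \<tau>" "q \<le> Q" unfolding q_def using s(1) by auto
        then have "q * (n2 + 1) \<le> - 2 * \<epsilon> * ((V \<tau> - w) \<bullet> \<nu>)"
          using n2 unfolding Q_def by (subst (asm) pos_le_divide_eq) auto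
        then have "q * (q * (n2 + 1)) \<le> q * (- 2 * \<epsilon> * ((V \<tau> - w) \<bullet> \<nu>))" using q0 by (intro mult_left_mono) auto
        then have "(norm (\<epsilon> *\<^sub>R \<nu> + q *\<^sub>R (V \<tau> - w)))\<^sup>2 \<le> \<epsilon>\<^sup>2 - q\<^sup>2"
          unfolding sq n2_def[symmetric] by (simp add: power2_eq_square algebra_simps)
        then have "(norm (\<epsilon> *\<^sub>R \<nu> + q *\<^sub>R (V \<tau> - w)))\<^sup>2 < \<epsilon>\<^sup>2" using q0 by (smt (verit) zero_less_power2)
        then have lt: "norm (\<epsilon> *\<^sub>R \<nu> + q *\<^sub>R (V \<tau> - w)) < \<epsilon>" 
          by (rule power2_less_imp_less) (use eps in simp)
        let ?r = "s - q"
        have r: "\<tau> \<le> ?r" "?r < s" using q0 by auto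
        have "tdist (y + ?r *\<^sub>R w) (X ?r) \<le> norm (y + ?r *\<^sub>R w - X ?r - k)" using k by (rule tdist_le)
        also have "\<dots> < \<epsilon>" using lt shift[of ?r] pos[OF r(1), of y k] by simp
        finally have *: "tdist (X ?r) (y + ?r *\<^sub>R w) < \<epsilon>" by (simp only: tdist_commute)
        have "?r \<in> {0..<s}" "0 < s" using s(1) r tau by auto
        then have "\<epsilon> < tdist (X ?r) (y + ?r *\<^sub>R w)"
          using s(3) unmet_before_path_iff[of s \<epsilon> "(y, w)"] by (metis fst_conv snd_conv)
        with * show False by simp
      qed
      then have "\<epsilon>\<^sup>2 \<le> (norm (\<epsilon> *\<^sub>R \<nu> + q *\<^sub>R (V \<tau> - w)))\<^sup>2" for q by (simp add: sq)
      then have ge: "\<epsilon> \<le> norm (\<epsilon> *\<^sub>R \<nu> + q *\<^sub>R (V \<tau> - w))" for q by (rule power2_le_imp_le) simp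
      have "y \<in> G k"
        unfolding G_def using ge s(1) st eps n\<nu> by (intro CollectI conjI bexI[of _ s]) (auto simp: shift)
      then show ?thesis using k by blast
    qed (use s in auto)
  qed
  moreover have "negligible ({y. tdist (X t) (y + t *\<^sub>R w) = \<epsilon>} \<union> (\<Union>k \<in> int_lattice. G k))"
  proof (rule negligible_Un)
    have "negligible (G k)" for k
      unfolding G_def by (rule negligible_touching) (rule convex_real_interval)
    then show "negligible (\<Union>k \<in> int_lattice. G k)"
      using countable_lattice by (intro negligible_countable_Union countable_image) auto
  qed (use eps negligible_tdist_eq in auto)
  ultimately show ?thesis using negligible_subset by blast
qed

text \<open>Up to a null set, the particles lost between \<tau> and \<open>t\<close> are the hits in
  that interval, whose mass is \<open>change_of_variables\<close> with \<open>H\<close> constantly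
  1.\<close>

lemma survival_balance:
  assumes t: "\<tau> < t"
  shows "ennreal (survival \<epsilon> g X \<tau>) = ennreal (survival \<epsilon> g X t)
    + (\<integral>\<^sup>+ c. (if \<tau> < fst c \<and> fst c < t then arrival \<epsilon> g X (V \<tau>) c else 0) \<partial>mark_measure)"
proof -
  interpret S: prob_space "state_law g" using dens by (rule prob_state_law)
  let ?h = "hit \<epsilon> X (V \<tau>) \<tau> (t - \<tau>)"
  let ?A = "{p. apart \<epsilon> X \<tau> p}" and ?B = "{p. apart \<epsilon> X t p}" and ?H = "{p. ?h p}"
  let ?Z = "?A - ?B - ?H"
  have [measurable]: "?H \<in> sets borel" by measurable
  have H: "?H \<subseteq> ?A - ?B"
  proof
    fix p assume "p \<in> ?H"
    then have h: "?h p" by simp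
    obtain y w where p: "p = (y, w)" by fastforce
    obtain s \<nu> where m: "contact_mark \<epsilon> X p = (s, \<nu>, w)" by (auto simp: contact_mark_def p)
    then have s: "\<tau> < s" "s < t" "norm \<nu> = 1" "unmet_before \<epsilon> X s p" using h by (auto simp: hit_def)
    have \<nu>: "\<epsilon> *\<^sub>R \<nu> = wrap (y + s *\<^sub>R w - X s)" "contact \<epsilon> X p = s"
      using m eps by (auto simp: contact_mark_def p)
    have "tdist (X s) (y + s *\<^sub>R w) = norm (\<epsilon> *\<^sub>R \<nu>)" unfolding \<nu>(1) tdist_wrap[symmetric] by (rule tdist_commute)
    then have d: "tdist (X s) (y + s *\<^sub>R w) = \<epsilon>" using s eps by simp
    have "apart \<epsilon> X \<tau> p" using s tau unmet_before_path_iff[of s \<epsilon> p] apart_path_iff[of \<tau> \<epsilon> p] by auto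
    moreover have "\<not> apart \<epsilon> X t p" using s tau d p apart_path_iff[of t \<epsilon> p] by force
    ultimately show "p \<in> ?A - ?B" by simp
  qed
  have BA: "?B \<subseteq> ?A" using apart_antimono[OF tau, of t] t by auto
  have "{y. (y, w) \<in> ?Z} = {y. apart \<epsilon> X \<tau> (y, w) \<and> \<not> apart \<epsilon> X t (y, w) \<and> \<not> ?h (y, w)}" for w by auto
  then have Z: "emeasure (state_law g) ?Z = 0"
    using no_hit_null[OF t] by (intro emeasure_state_law_0 g_measurable) auto
  have "emeasure (state_law g) ?A = emeasure (state_law g) (?B \<union> ?H \<union> ?Z)"
    using H BA by (intro arg_cong[where f = "emeasure (state_law g)"]) blast
  also have "\<dots> = emeasure (state_law g) (?B \<union> ?H)"
    using Z by (intro emeasure_Un_null_set) (auto simp: null_sets_def)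
  also have "\<dots> = emeasure (state_law g) ?B + emeasure (state_law g) ?H"
    using H by (intro plus_emeasure[symmetric]) auto
  also have "emeasure (state_law g) ?H = (\<integral>\<^sup>+ p. indicator ?H p \<partial>state_law g)"
    by (rule nn_integral_indicator[symmetric]) measurable
  also have "\<dots> = (\<integral>\<^sup>+ p. (if ?h p then 1 else 0) \<partial>state_law g)"
    by (intro nn_integral_cong) (simp add: indicator_def)
  also have "\<dots> = (\<integral>\<^sup>+ c. (if \<tau> < fst c \<and> fst c < \<tau> + (t - \<tau>) then arrival \<epsilon> g X (V \<tau>) c * 1 else 0) \<partial>mark_measure)"
    using t by (intro change_of_variables) auto
  finally show ?thesis
    unfolding survival_def S.emeasure_eq_measure[symmetric] by (simp cong: if_cong)
qed

text \<open>\<open>unmet\<close> tests the open time interval and \<open>apart\<close> the closed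
  one. By continuity they differ only for particles at distance exactly \<epsilon> at one of the two
  end points, and these are null.\<close>

lemma unmet_mass_eq:
  assumes X: "\<And>s. 0 < s \<Longrightarrow> s < t \<Longrightarrow> root_pos \<Phi> s = X s" and t: "0 < t"
  shows "unmet_mass \<epsilon> g \<Phi> t = survival \<epsilon> g X t"
proof -
  interpret S: prob_space "state_law g" using dens by (rule prob_state_law)
  note [measurable] = g_measurable
  have [measurable]: "torus_cell \<times> (UNIV :: vec3 set) \<in> sets borel" by (simp add: borel_prod[symmetric])
  let ?d = "\<lambda>p s. tdist (X s) (fst p + s *\<^sub>R snd p)"
  let ?A = "{p. apart \<epsilon> X t p}"
  let ?W = "{p. tdist (X 0) (fst p) = \<epsilon> \<or> ?d p t = \<epsilon>}"
  have [measurable]: "(fst :: state \<Rightarrow> vec3) \<in> borel_measurable borel" "(snd :: state \<Rightarrow> vec3) \<in> borel_measurable borel"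
    by (intro borel_measurable_continuous_onI continuous_intros)+
  have W [measurable]: "?W \<in> sets borel" by measurable
  have "emeasure (state_law g) ?W = 0"
  proof (rule emeasure_state_law_0[OF g_measurable W])
    fix w
    have "{y. (y, w) \<in> ?W} = {y. tdist (X 0) (y + 0) = \<epsilon>} \<union> {y. tdist (X t) (y + t *\<^sub>R w) = \<epsilon>}" by auto
    then show "negligible {y. (y, w) \<in> ?W}" using eps by (simp only: negligible_Un negligible_tdist_eq)
  qed
  then have "AE p in state_law g. p \<notin> ?W" by (intro AE_not_in) (simp add: null_sets_def)
  then have AE: "AE p in lborel. 0 < ennreal (g (fst p) (snd p)) * indicator (torus_cell \<times> UNIV) p \<longrightarrow> p \<notin> ?W"
    unfolding state_law_def by (subst (asm) AE_density) auto
  have un: "p \<in> unmet \<epsilon> \<Phi> t \<longleftrightarrow> apart \<epsilon> X t p" if p: "p \<notin> ?W" for p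
  proof -
    have c: "continuous_on {0..t} (?d p)"
      by (intro continuous_intros continuous_on_subset[OF continuous_X]) auto
    have "p \<in> unmet \<epsilon> \<Phi> t \<longleftrightarrow> (\<forall>s. 0 < s \<and> s < t \<longrightarrow> \<epsilon> < ?d p s)"
      using X by (auto simp: unmet_def case_prod_beta)
    also have "\<dots> \<longleftrightarrow> (\<forall>s \<in> {0..t}. \<epsilon> < ?d p s)"
    proof (intro iffI ballI allI impI)
      fix s assume a: "\<forall>s. 0 < s \<and> s < t \<longrightarrow> \<epsilon> < ?d p s" and s: "s \<in> {0..t}"
      have "closure {0<..<t} = {0..t}" using t by simp
      moreover have "\<epsilon> \<le> ?d p s" if "s \<in> closure {0<..<t}" for s
      proof (rule continuous_ge_on_closure[OF _ that])
        show "continuous_on (closure {0<..<t}) (?d p)" using c t by simp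
        show "\<epsilon> \<le> ?d p r" if "r \<in> {0<..<t}" for r using a that by (simp add: less_imp_le)
      qed
      ultimately have ge: "\<epsilon> \<le> ?d p s" using s by simp
      have "?d p 0 \<noteq> \<epsilon>" "?d p t \<noteq> \<epsilon>" using p by auto
      then show "\<epsilon> < ?d p s" using ge by (cases "s = 0 \<or> s = t") (use a s in auto)
    qed auto
    also have "\<dots> \<longleftrightarrow> apart \<epsilon> X t p" using apart_path_iff[of t] t by simp
    finally show ?thesis .
  qed
  have "unmet_mass \<epsilon> g \<Phi> t = (LINT z|lborel. indicator (torus_cell \<times> UNIV) z * (g (fst z) (snd z) * indicator (unmet \<epsilon> \<Phi> t) z))"
    by (simp add: unmet_mass_def set_lebesgue_integral_def)
  also have "\<dots> = (LINT z|lborel. indicator (torus_cell \<times> UNIV) z * (g (fst z) (snd z) * indicator ?A z))"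
  proof -
    have e: "indicator (torus_cell \<times> UNIV) z * (g (fst z) (snd z) * indicator (unmet \<epsilon> \<Phi> t) z)
      = indicator (torus_cell \<times> UNIV) z * (g (fst z) (snd z) * indicator ?A z)"
      if "0 < ennreal (g (fst z) (snd z)) * indicator (torus_cell \<times> UNIV) z \<longrightarrow> z \<notin> ?W" for z
    proof (cases "z \<in> torus_cell \<times> UNIV \<and> g (fst z) (snd z) \<noteq> 0")
      case True
      then have "0 < ennreal (g (fst z) (snd z)) * indicator (torus_cell \<times> UNIV) z"
        using g_nonneg[of "fst z" "snd z"] by (simp add: less_le ennreal_zero_less_mult_iff)
      with that have "z \<notin> ?W" by blast
      from un[OF this] show ?thesis by (simp add: indicator_def)
    qed auto
    have m: "unmet \<epsilon> \<Phi> t \<in> sets borel"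
    proof -
      \<comment> \<open>The open interval is exhausted by the closed intervals from
        \<open>?a n\<close> to \<open>t - ?a n\<close>; the 3 in the denominator keeps them
        nonempty. Shifting path and particle by \<open>?a n\<close> reduces each of them to
        \<open>apart\<close>.\<close>
      let ?a = "\<lambda>n::nat. t / (real n + 3)"
      have a: "0 < ?a n" "0 \<le> t - 2 * ?a n" for n using t by (auto simp: field_simps)
      have "apart \<epsilon> (\<lambda>s. X (?a n + s)) (t - 2 * ?a n) (fst p + ?a n *\<^sub>R snd p, snd p)
          \<longleftrightarrow> (\<forall>s \<in> {0..t - 2 * ?a n}. \<epsilon> < ?d p (?a n + s))" for n p
      proof -
        have "continuous_on {0..t - 2 * ?a n} (\<lambda>s. X (?a n + s))"
          using a(1)[of n] by (intro continuous_on_compose2[OF continuous_X] continuous_intros) auto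
        from apart_iff[OF this a(2)] show ?thesis by (simp add: algebra_simps)
      qed
      moreover have "(\<forall>s. 0 < s \<and> s < t \<longrightarrow> \<epsilon> < ?d p s) \<longleftrightarrow> (\<forall>n. \<forall>s \<in> {0..t - 2 * ?a n}. \<epsilon> < ?d p (?a n + s))" for p
      proof (intro iffI allI impI ballI)
        fix n s assume *: "\<forall>s. 0 < s \<and> s < t \<longrightarrow> \<epsilon> < ?d p s" "s \<in> {0..t - 2 * ?a n}"
        then have "0 < ?a n + s" "?a n + s < t" using a(1)[of n] by auto
        then show "\<epsilon> < ?d p (?a n + s)" using * by blast
      next
        fix s assume *: "\<forall>n. \<forall>s \<in> {0..t - 2 * ?a n}. \<epsilon> < ?d p (?a n + s)" "0 < s \<and> s < t"
        obtain n :: nat where n: "1 / (real n + 1) < min s (t - s) / t"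
          using reals_Archimedean[of "min s (t - s) / t"] * t by (auto simp: inverse_eq_divide add.commute)
        have "1 / (real n + 3) \<le> 1 / (real n + 1)" by (simp add: frac_le)
        then have "t * (1 / (real n + 3)) \<le> t * (min s (t - s) / t)" using n t by (intro mult_left_mono) auto
        then have "?a n \<le> s" "?a n \<le> t - s" using t by auto
        then have "s - ?a n \<in> {0..t - 2 * ?a n}" by auto
        then have "\<epsilon> < ?d p (?a n + (s - ?a n))" using *(1) by blast
        then show "\<epsilon> < ?d p s" by simp
      qed
      moreover have "unmet \<epsilon> \<Phi> t = {p. \<forall>s. 0 < s \<and> s < t \<longrightarrow> \<epsilon> < ?d p s}"
        using X by (auto simp: unmet_def case_prod_beta)
      ultimately have "unmet \<epsilon> \<Phi> t = {p. \<forall>n. apart \<epsilon> (\<lambda>s. X (?a n + s)) (t - 2 * ?a n) (fst p + ?a n *\<^sub>R snd p, snd p)}"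
        by simp
      also have "\<dots> \<in> sets borel"
      proof -
        have "(\<lambda>p::state. (fst p + ?a n *\<^sub>R snd p, snd p)) \<in> borel_measurable borel" for n
          by (intro borel_measurable_continuous_onI continuous_intros)
        then show ?thesis by measurable
      qed
      finally show ?thesis .
    qed
    then show ?thesis using AE e
      by (intro integral_cong_AE) (auto elim!: eventually_mono)
  qed
  also have "\<dots> = (LINT z|state_law g. indicator ?A z)"
  proof -
    have "state_law g = density lborel (\<lambda>z. ennreal (g (fst z) (snd z) * indicator (torus_cell \<times> UNIV) z))"
      unfolding state_law_def by (intro arg_cong2[where f = density] refl ext) (simp add: indicator_def)
    then show ?thesis by (simp only:) (subst integral_density, auto simp: mult_ac)
  qed
  also have "\<dots> = survival \<epsilon> g X t" by (simp add: survival_def)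
  finally show ?thesis .
qed

end

section \<open>A velocity bound for the background density and dominated convergence\<close>

lemma closure_interior_cell: "torus_cell \<subseteq> closure (box (0::vec3) 1)" "box (0::vec3) 1 \<subseteq> torus_cell"
proof -
  have "torus_cell \<subseteq> cbox (0::vec3) 1"
    by (simp add: torus_cell_def mem_box_cart subset_iff) (metis less_imp_le)
  moreover have "(\<chi> i. 1 / 2) \<in> box (0::vec3) 1" by (simp add: mem_box_cart)
  then have "box (0::vec3) 1 \<noteq> {}" by blast
  ultimately show "torus_cell \<subseteq> closure (box (0::vec3) 1)" by simp
  show "box (0::vec3) 1 \<subseteq> torus_cell" by (auto simp: torus_cell_def mem_box_cart intro: less_imp_le)
qed

text \<open>Where a continuous function exceeds its essential supremum, it does so on an open set,
  which after a lattice shift meets the open cube and so has positive measure.\<close>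

lemma ess_bound_upper:
  assumes p: "periodic (\<lambda>x. g x w)" and c: "continuous_on UNIV (\<lambda>x. g x w)"
  shows "ennreal (g x w) \<le> ess_bound g w"
proof (rule ccontr)
  assume n: "\<not> ennreal (g x w) \<le> ess_bound g w"
  let ?U = "{y. ess_bound g w < ennreal (g y w)}"
  have cU: "continuous_on UNIV (\<lambda>y. ennreal (g y w))" using c unfolding continuous_on by (auto intro!: tendsto_ennrealI)
  then have U: "open ?U" by (intro open_Collect_less continuous_on_const)
  obtain k where k: "k \<in> int_lattice" "x - k \<in> torus_cell" using torus_cell_translate[of x] by metis
  have "g (x - k + k) w = g (x - k) w" using p k(1) unfolding periodic_def by blast
  then have "x - k \<in> ?U" using n by simp
  then have "?U \<inter> box 0 1 \<noteq> {}"
    using k(2) closure_interior_cell(1) open_Int_closure_eq_empty[OF U, of "box 0 1"] by auto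
  moreover have "open (?U \<inter> box 0 1)" using U by auto
  ultimately have nn: "\<not> negligible (?U \<inter> box 0 1)" by (intro open_not_negligible)
  have "AE y in restrict_space lborel torus_cell. ennreal (g y w) \<le> ess_bound g w"
    unfolding ess_bound_def by (rule esssup_AE)
  then have "AE y in lborel. y \<in> torus_cell \<longrightarrow> ennreal (g y w) \<le> ess_bound g w"
    by (subst (asm) AE_restrict_space_iff) auto
  then have "AE y in lborel. y \<notin> ?U \<inter> box 0 1"
    by eventually_elim (use closure_interior_cell(2) in \<open>auto simp: not_less\<close>)
  then have "?U \<inter> box 0 1 \<in> null_sets lborel"
    using U by (subst AE_iff_null_sets) auto
  then have "negligible (?U \<inter> box 0 1)"
    by (simp add: negligible_iff_null_sets null_sets_completionI)
  with nn show False by simp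
qed

text \<open>The Hoelder condition gives continuity in position for almost every velocity. The
  supremum over positions is then a supremum over a countable dense set, hence Borel in
  \<open>w\<close>, and it lies below \<open>ess_bound\<close>, from which it inherits the second
  moment. Pointwise bounds are needed because \<open>g\<close> is evaluated along moving
  positions.\<close>

lemma admissible_bound:
  assumes g: "background_admissible g"
  obtains b :: "vec3 \<Rightarrow> real" where "b \<in> borel_measurable borel" "\<And>w. 0 \<le> b w"
    "integrable lborel (\<lambda>w. b w * (1 + (norm w)\<^sup>2))" "AE w in lborel. \<forall>x. g x w \<le> b w"
    "AE w in lborel. continuous_on UNIV (\<lambda>x. g x w)"
proof -
  have d: "torus_density g" using g by (simp add: background_admissible_def)
  then have gm: "(\<lambda>z. g (fst z) (snd z)) \<in> borel_measurable borel" and g0: "\<And>x v. 0 \<le> g x v"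
    and per: "\<And>v. periodic (\<lambda>x. g x v)" by (auto simp: torus_density_def)
  have gq: "(\<lambda>w. g q w) \<in> borel_measurable borel" for q
  proof -
    have "(\<lambda>w. (q, w)) \<in> borel_measurable borel" by (intro borel_measurable_continuous_onI continuous_intros)
    from measurable_compose[OF this gm] show ?thesis by simp
  qed
  obtain H \<alpha> where H: "0 < H" "0 < \<alpha>" "\<alpha> \<le> 1"
    and hol: "AE v in lborel. \<forall>x y. tdist x y \<noteq> 0 \<longrightarrow> \<bar>g x v - g y v\<bar> < H * tdist x y powr \<alpha>"
    using g unfolding background_admissible_def by blast
  have cont: "AE w in lborel. continuous_on UNIV (\<lambda>x. g x w)"
    using hol
  proof eventually_elim
    case (elim w)
    have le: "\<bar>g x w - g y w\<bar> \<le> H * tdist x y powr \<alpha>" for x y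
    proof (cases "tdist x y = 0")
      case True
      obtain k where "k \<in> int_lattice" "tdist x y = norm (x - y - k)" by (rule tdist_attained)
      then have "x = y + k" "k \<in> int_lattice" using True by (auto simp: algebra_simps)
      then have "g x w = g y w" using per[of w] unfolding periodic_def by blast
      then show ?thesis using H by simp
    qed (use elim in \<open>auto intro: less_imp_le\<close>)
    show ?case
      unfolding continuous_on
    proof
      fix x :: vec3
      have "((\<lambda>y. H * tdist y x powr \<alpha>) \<longlongrightarrow> H * tdist x x powr \<alpha>) (at x)"
        using H by (intro tendsto_intros) auto
      moreover have "tdist x x = 0" using tdist_le[of 0 x x] by (simp add: antisym)
      ultimately have "((\<lambda>y. H * tdist y x powr \<alpha>) \<longlongrightarrow> 0) (at x)" by simp
      then have "((\<lambda>y. g y w - g x w) \<longlongrightarrow> 0) (at x)"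
        by (rule Lim_null_comparison[rotated]) (use le in auto)
      then show "((\<lambda>y. g y w) \<longlongrightarrow> g x w) (at x)" by (simp add: LIM_zero_iff)
    qed
  qed
  obtain D :: "vec3 set" where D: "countable D" "\<And>U. open U \<Longrightarrow> U \<noteq> {} \<Longrightarrow> \<exists>d \<in> D. d \<in> U"
    by (rule countable_dense_setE) blast
  define e where "e w = (SUP q \<in> D. ennreal (g q w))" for w
  have e_meas: "e \<in> borel_measurable borel"
    unfolding e_def using D(1) gq by (intro borel_measurable_SUP) auto
  have e_ge: "AE w in lborel. \<forall>x. ennreal (g x w) \<le> e w"
    using cont
  proof eventually_elim
    case (elim w)
    show ?case
    proof (intro allI, rule ccontr)
      fix x assume "\<not> ennreal (g x w) \<le> e w"
      then have "{y. e w < ennreal (g y w)} \<noteq> {}" by (auto simp: not_le)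
      moreover have "continuous_on UNIV (\<lambda>y. ennreal (g y w))"
        using elim unfolding continuous_on by (auto intro!: tendsto_ennrealI)
      then have "open {y. e w < ennreal (g y w)}"
        by (intro open_Collect_less continuous_on_const)
      ultimately obtain q where "q \<in> D" "e w < ennreal (g q w)" using D(2) by blast
      moreover have "ennreal (g q w) \<le> e w" unfolding e_def using \<open>q \<in> D\<close> by (rule SUP_upper)
      ultimately show False by simp
    qed
  qed
  have e_le: "AE w in lborel. e w \<le> ess_bound g w"
    using cont
  proof eventually_elim
    case (elim w)
    show ?case unfolding e_def by (intro SUP_least ess_bound_upper per elim)
  qed
  have e_int: "(\<integral>\<^sup>+ w. e w * ennreal (1 + (norm w)\<^sup>2) \<partial>lborel) < \<infinity>"
  proof -
    have "(\<integral>\<^sup>+ w. e w * ennreal (1 + (norm w)\<^sup>2) \<partial>lborel) \<le> (\<integral>\<^sup>+ w. ess_bound g w * ennreal (1 + (norm w)\<^sup>2) \<partial>lborel)"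
      by (intro nn_integral_mono_AE eventually_mono[OF e_le] mult_right_mono) auto
    also have "\<dots> < \<infinity>" using g by (simp add: background_admissible_def)
    finally show ?thesis .
  qed
  have e_fin: "AE w in lborel. e w \<noteq> \<infinity>"
  proof -
    have "AE w in lborel. e w * ennreal (1 + (norm w)\<^sup>2) \<noteq> \<infinity>"
      using e_int e_meas by (intro nn_integral_PInf_AE) auto
    then show ?thesis
    proof eventually_elim
      case (elim w)
      have "0 < 1 + (norm w)\<^sup>2" by (simp add: add_pos_nonneg)
      with elim show ?case by (auto simp: ennreal_mult_eq_top_iff)
    qed
  qed
  have bm [measurable]: "(\<lambda>w. enn2real (e w)) \<in> borel_measurable borel" using e_meas by measurable
  show ?thesis
  proof (rule that[of "\<lambda>w. enn2real (e w)"])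
    show "integrable lborel (\<lambda>w. enn2real (e w) * (1 + (norm w)\<^sup>2))"
    proof (rule integrableI_nonneg)
      have "(\<integral>\<^sup>+ w. ennreal (enn2real (e w) * (1 + (norm w)\<^sup>2)) \<partial>lborel) = (\<integral>\<^sup>+ w. e w * ennreal (1 + (norm w)\<^sup>2) \<partial>lborel)"
        using e_fin by (intro nn_integral_cong_AE) (auto elim!: eventually_mono simp: ennreal_mult less_top)
      then show "(\<integral>\<^sup>+ w. ennreal (enn2real (e w) * (1 + (norm w)\<^sup>2)) \<partial>lborel) < \<infinity>" using e_int by simp
    qed (auto intro!: mult_nonneg_nonneg add_nonneg_nonneg)
    show "AE w in lborel. \<forall>x. g x w \<le> enn2real (e w)"
      using e_ge e_fin
    proof eventually_elim
      case (elim w)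
      show ?case
      proof
        fix x
        have "ennreal (enn2real (e w)) = e w" using elim(2) by (simp add: ennreal_enn2real less_top)
        then have "ennreal (g x w) \<le> ennreal (enn2real (e w))" using elim(1) by simp
        then show "g x w \<le> enn2real (e w)" by (rule ennreal_le_iff[THEN iffD1, rotated]) simp
      qed
    qed
  qed (use cont bm in auto)
qed

text \<open>The dominating function does not depend on \<nu>, so the inner integrals are bounded by
  a constant, which is integrable over the finite sphere measure.\<close>

lemma iterated_dominated_convergence:
  fixes F :: "nat \<Rightarrow> vec3 \<Rightarrow> vec3 \<Rightarrow> real"
  assumes F: "\<And>n. case_prod (F n) \<in> borel_measurable (borel \<Otimes>\<^sub>M borel)"
    and G: "case_prod G \<in> borel_measurable (borel \<Otimes>\<^sub>M borel)"
    and h: "integrable lborel h"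
    and bound: "\<And>n \<nu>. norm \<nu> = 1 \<Longrightarrow> AE w in lborel. \<bar>F n \<nu> w\<bar> \<le> h w"
    and conv: "\<And>\<nu>. norm \<nu> = 1 \<Longrightarrow> AE w in lborel. (\<lambda>n. F n \<nu> w) \<longlonglongrightarrow> G \<nu> w"
  shows "(\<lambda>n. LINT \<nu>|sphere_measure. (LINT w|lborel. F n \<nu> w)) \<longlonglongrightarrow> (LINT \<nu>|sphere_measure. (LINT w|lborel. G \<nu> w))"
proof (rule integral_dominated_convergence)
  have [measurable]: "case_prod (F n) \<in> borel_measurable (sphere_measure \<Otimes>\<^sub>M lborel)" for n
    using F[of n] by (simp cong: measurable_cong_sets sets_pair_measure_cong)
  have [measurable]: "case_prod G \<in> borel_measurable (sphere_measure \<Otimes>\<^sub>M lborel)"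
    using G by (simp cong: measurable_cong_sets sets_pair_measure_cong)
  have Fw: "(\<lambda>w. F n \<nu> w) \<in> borel_measurable lborel" for n \<nu>
    using measurable_compose[OF measurable_Pair1'[of \<nu> borel borel] F[of n]] by simp
  have Gw: "(\<lambda>w. G \<nu> w) \<in> borel_measurable lborel" for \<nu>
    using measurable_compose[OF measurable_Pair1'[of \<nu> borel borel] G] by simp
  show "(\<lambda>\<nu>. LINT w|lborel. G \<nu> w) \<in> borel_measurable sphere_measure"
    "\<And>n. (\<lambda>\<nu>. LINT w|lborel. F n \<nu> w) \<in> borel_measurable sphere_measure"
    by measurable
  show "integrable sphere_measure (\<lambda>\<nu>. LINT w|lborel. h w)" by simp
  show "AE \<nu> in sphere_measure. (\<lambda>n. LINT w|lborel. F n \<nu> w) \<longlonglongrightarrow> (LINT w|lborel. G \<nu> w)"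
    using AE_sphere_measure
  proof eventually_elim
    case (elim \<nu>)
    show ?case using bound[OF elim] conv[OF elim] h Fw Gw
      by (intro integral_dominated_convergence[where w = h]) auto
  qed
  fix n
  show "AE \<nu> in sphere_measure. norm (LINT w|lborel. F n \<nu> w) \<le> (LINT w|lborel. h w)"
    using AE_sphere_measure
  proof eventually_elim
    case (elim \<nu>)
    have i: "integrable lborel (F n \<nu>)"
      using bound[OF elim, of n] Fw by (intro Bochner_Integration.integrable_bound[OF h]) (auto elim!: eventually_mono)
    have "norm (LINT w|lborel. F n \<nu> w) \<le> (LINT w|lborel. norm (F n \<nu> w))" by (rule integral_norm_bound)
    also have "\<dots> \<le> (LINT w|lborel. h w)"
      using bound[OF elim, of n] i h by (intro integral_mono_AE) auto
    finally show ?case .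
  qed
qed

section \<open>Incoming flux of fresh and of stale particles\<close>

definition influx :: "real \<Rightarrow> (vec3 \<Rightarrow> vec3 \<Rightarrow> real) \<Rightarrow> (real \<Rightarrow> vec3) \<Rightarrow> vec3 \<Rightarrow> real \<Rightarrow> vec3 \<Rightarrow> vec3 \<Rightarrow> real" where
  "influx \<epsilon> g X v t \<nu> w = g (X t + \<epsilon> *\<^sub>R \<nu> - t *\<^sub>R w) w * max ((v - w) \<bullet> \<nu>) 0"

definition fresh :: "real \<Rightarrow> (real \<Rightarrow> vec3) \<Rightarrow> real \<Rightarrow> vec3 \<Rightarrow> vec3 \<Rightarrow> bool" where
  "fresh \<epsilon> X t \<nu> w \<longleftrightarrow> unmet_before \<epsilon> X t (emitted \<epsilon> X (t, \<nu>, w))"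

definition fresh_rate :: "real \<Rightarrow> (vec3 \<Rightarrow> vec3 \<Rightarrow> real) \<Rightarrow> (real \<Rightarrow> vec3) \<Rightarrow> vec3 \<Rightarrow> real \<Rightarrow> real" where
  "fresh_rate \<epsilon> g X v t = (LINT \<nu>|sphere_measure. (LINT w|lborel. influx \<epsilon> g X v t \<nu> w * (if fresh \<epsilon> X t \<nu> w then 1 else 0)))"

text \<open>The correction in the loss term: the incoming flux of particles that, traced back
  freely, have been in contact with the path before or overlapped it at the start.\<close>

definition stale_rate :: "real \<Rightarrow> (vec3 \<Rightarrow> vec3 \<Rightarrow> real) \<Rightarrow> (real \<Rightarrow> vec3) \<Rightarrow> vec3 \<Rightarrow> real \<Rightarrow> real" where
  "stale_rate \<epsilon> g X v t = (LINT \<nu>|sphere_measure. (LINT w|lborel. influx \<epsilon> g X v t \<nu> w * (if fresh \<epsilon> X t \<nu> w then 0 else 1)))"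

lemma influx_bound:
  assumes "0 \<le> g (X t + \<epsilon> *\<^sub>R \<nu> - t *\<^sub>R w) w" "g (X t + \<epsilon> *\<^sub>R \<nu> - t *\<^sub>R w) w \<le> b" "norm \<nu> = 1"
  shows "\<bar>influx \<epsilon> g X v t \<nu> w\<bar> \<le> (1 + norm v) * (b * (1 + (norm w)\<^sup>2))"
proof -
  have "max ((v - w) \<bullet> \<nu>) 0 \<le> norm (v - w)"
    using Cauchy_Schwarz_ineq2[of "v - w" \<nu>] assms(3) by auto
  also have "\<dots> \<le> norm v + norm w" by (rule norm_triangle_ineq4)
  also have "norm w \<le> 1 + (norm w)\<^sup>2"
    using zero_le_power2[of "norm w - 1/2"] by (simp add: power2_eq_square algebra_simps)
  then have "norm v + norm w \<le> (1 + norm v) * (1 + (norm w)\<^sup>2)"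
  proof -
    have "(1 + norm v) * (1 + (norm w)\<^sup>2) = 1 + (norm w)\<^sup>2 + norm v + norm v * (norm w)\<^sup>2"
      by (simp add: algebra_simps)
    moreover assume "norm w \<le> 1 + (norm w)\<^sup>2"
    ultimately show ?thesis using mult_nonneg_nonneg[OF norm_ge_zero zero_le_power2, of v "norm w"] by linarith
  qed
  finally have "g (X t + \<epsilon> *\<^sub>R \<nu> - t *\<^sub>R w) w * max ((v - w) \<bullet> \<nu>) 0 \<le> b * ((1 + norm v) * (1 + (norm w)\<^sup>2))"
    using assms by (intro mult_mono) auto
  then show ?thesis using assms(1) by (simp add: influx_def mult_ac abs_mult)
qed

lemma measurable_influx:
  assumes g: "(\<lambda>z. g (fst z) (snd z)) \<in> borel_measurable borel"
    and [measurable]: "(\<lambda>x. X (t x)) \<in> borel_measurable M" "t \<in> borel_measurable M" "v \<in> borel_measurable M"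
      "\<nu> \<in> borel_measurable M" "w \<in> borel_measurable M"
  shows "(\<lambda>x. influx \<epsilon> g X (v x) (t x) (\<nu> x) (w x)) \<in> borel_measurable M"
proof -
  have "(\<lambda>x. (X (t x) + \<epsilon> *\<^sub>R \<nu> x - t x *\<^sub>R w x, w x)) \<in> borel_measurable M"
    unfolding borel_prod[symmetric] by measurable
  from measurable_compose[OF this g]
  have [measurable]: "(\<lambda>x. g (X (t x) + \<epsilon> *\<^sub>R \<nu> x - t x *\<^sub>R w x) (w x)) \<in> borel_measurable M" by simp
  show ?thesis unfolding influx_def by measurable
qed

context path
begin

lemma measurable_fresh:
  assumes [measurable]: "t \<in> borel_measurable M" "\<nu> \<in> borel_measurable M" "w \<in> borel_measurable M"
  shows "Measurable.pred M (\<lambda>x. fresh \<epsilon> X (t x) (\<nu> x) (w x))"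
  unfolding fresh_def by measurable

lemma fresh_iff:
  "0 < t \<Longrightarrow> fresh \<epsilon> X t \<nu> w \<longleftrightarrow> (\<forall>r \<in> {0..<t}. \<epsilon> < tdist (X r) (X t + \<epsilon> *\<^sub>R \<nu> - (t - r) *\<^sub>R w))"
  unfolding fresh_def by (subst unmet_before_path_iff) (auto simp: emitted_def algebra_simps)

text \<open>On a straight piece of the path starting at \<open>a\<close>, the equation for a meeting
  at time \<open>r\<close> can be divided by \<open>t - r\<close>. It then says that
  \<open>w\<close> lies on a line through \<open>V a\<close> whose direction does not depend on
  \<open>r\<close>. There are finitely many pieces and countably many lattice images.\<close>

lemma negligible_returning:
  assumes t: "0 < t"
  shows "negligible {w. \<exists>r \<in> {0..<t}. tdist (X r) (X t - (t - r) *\<^sub>R w) = 0}"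
proof -
  let ?B = "insert 0 (C \<inter> {0..t})"
  define Z where "Z a k = (+) (V a) ` span {X t - k - X a - (t - a) *\<^sub>R V a}" for a k
  have "{w. \<exists>r \<in> {0..<t}. tdist (X r) (X t - (t - r) *\<^sub>R w) = 0} \<subseteq> (\<Union>a \<in> ?B. \<Union>k \<in> int_lattice. Z a k)"
  proof
    fix w assume "w \<in> {w. \<exists>r \<in> {0..<t}. tdist (X r) (X t - (t - r) *\<^sub>R w) = 0}"
    then obtain r where r: "0 \<le> r" "r < t" "tdist (X r) (X t - (t - r) *\<^sub>R w) = 0" by auto
    obtain k where k: "k \<in> int_lattice" "X t - (t - r) *\<^sub>R w - X r - k = 0"
    proof -
      obtain k where "k \<in> int_lattice" "tdist (X t - (t - r) *\<^sub>R w) (X r) = norm (X t - (t - r) *\<^sub>R w - X r - k)"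
        by (rule tdist_attained)
      then show ?thesis using that[of k] r(3) by (simp add: tdist_commute[of "X r"])
    qed
    define a where "a = Max (insert 0 (C \<inter> {0..r}))"
    have fa: "finite (insert 0 (C \<inter> {0..r}))" using finite_C by simp
    then have a: "a \<in> insert 0 (C \<inter> {0..r})" unfolding a_def by (rule Max_in) simp
    have "C \<inter> {a<..<r} = {}"
    proof (rule ccontr)
      assume "C \<inter> {a<..<r} \<noteq> {}"
      then obtain c where c: "c \<in> C" "a < c" "c < r" by auto
      have "c \<le> a" unfolding a_def using c fa a by (intro Max_ge) auto
      then show False using c by simp
    qed
    then have Xr: "X r = X a + (r - a) *\<^sub>R V a" using a r by (intro straight) auto
    \<comment> \<open>The gap left at time \<open>a\<close> by a particle that travels with velocity
      \<open>V a\<close> and arrives at \<open>X t\<close>, up to the lattice vector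
      \<open>k\<close>. It gives the direction of the line.\<close>
    define Q where "Q = X t - k - X a - (t - a) *\<^sub>R V a"
    have "(t - r) *\<^sub>R w = X t - k - X a - (r - a) *\<^sub>R V a"
      using k(2) unfolding Xr by (simp add: algebra_simps)
    then have "(t - r) *\<^sub>R w = (t - r) *\<^sub>R V a + (X t - k - X a - (t - a) *\<^sub>R V a)"
      by (simp add: algebra_simps)
    then have eq: "(t - r) *\<^sub>R w = (t - r) *\<^sub>R V a + Q" by (simp add: Q_def)
    have "w = (1 / (t - r)) *\<^sub>R ((t - r) *\<^sub>R w)" using r by simp
    also have "\<dots> = V a + (1 / (t - r)) *\<^sub>R Q" unfolding eq using r(2) by (simp add: scaleR_add_right)
    finally have "w = V a + (1 / (t - r)) *\<^sub>R Q" .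
    then have "w \<in> Z a k" unfolding Z_def Q_def[symmetric]
      by (rule image_eqI) (intro span_mul span_base, simp)
    moreover have "a \<in> ?B" using a r by auto
    ultimately show "w \<in> (\<Union>a \<in> ?B. \<Union>k \<in> int_lattice. Z a k)" using k(1) by blast
  qed
  moreover have "negligible (Z a k)" for a k
  proof -
    have "dim (span {X t - k - X a - (t - a) *\<^sub>R V a}) \<le> 1"
      using dim_le_card'[of "{X t - k - X a - (t - a) *\<^sub>R V a}"] by (simp add: dim_span)
    then show ?thesis unfolding Z_def by (intro negligible_translation negligible_lowdim) (simp add: dim_span)
  qed
  then have "negligible (\<Union>a \<in> ?B. \<Union>k \<in> int_lattice. Z a k)"
    using countable_lattice finite_C
    by (intro negligible_countable_Union countable_image countable_finite) (auto intro!: negligible_countable_Union countable_image)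
  ultimately show ?thesis using negligible_subset by blast
qed

text \<open>On a straight piece, dividing by \<open>t - r\<close> and writing \<sigma> for
  \<open>1 / (t - r)\<close> turns distance \<epsilon> at time \<open>r\<close> into distance
  \<open>\<epsilon> * \<sigma>\<close> of \<open>w\<close> from a point moving affinely in \<sigma>.
  A velocity that touches without entering is on the boundary of a convex tapered tube.\<close>

lemma negligible_grazing:
  assumes t: "0 < t" and e: "0 < \<epsilon>"
  shows "negligible {w. (\<forall>r \<in> {0..<t}. \<epsilon> \<le> tdist (X r) (X t + \<epsilon> *\<^sub>R \<nu> - (t - r) *\<^sub>R w)) \<and>
    (\<exists>r \<in> {0..<t}. tdist (X r) (X t + \<epsilon> *\<^sub>R \<nu> - (t - r) *\<^sub>R w) = \<epsilon>)}" (is "negligible ?Z")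
proof -
  let ?B = "insert 0 (insert t (C \<inter> {0..t}))"
  \<comment> \<open>The values \<open>1 / (t - s)\<close> for times \<open>s < t\<close> between
    \<open>a\<close> and \<open>b\<close>. Writing the bounds as products covers the case
    \<open>b = t\<close>, in which \<sigma> is unbounded.\<close>
  define I where "I a b = {\<sigma>::real. 0 < \<sigma> \<and> 1 \<le> \<sigma> * (t - a) \<and> \<sigma> * (t - b) \<le> 1}" for a b
  define Z where "Z a b k = {w. (\<exists>\<sigma> \<in> I a b. norm (w - (V a + \<sigma> *\<^sub>R (X t + \<epsilon> *\<^sub>R \<nu> - k - X a - (t - a) *\<^sub>R V a))) = \<epsilon> * \<sigma> + 0 \<and> 0 < \<epsilon> * \<sigma> + 0) \<and>
    (\<forall>\<sigma> \<in> I a b. \<epsilon> * \<sigma> + 0 \<le> norm (w - (V a + \<sigma> *\<^sub>R (X t + \<epsilon> *\<^sub>R \<nu> - k - X a - (t - a) *\<^sub>R V a))))}" for a b k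
  have "?Z \<subseteq> (\<Union>a \<in> {a \<in> ?B. a \<le> t}. \<Union>b \<in> {b \<in> ?B. b \<le> t}. \<Union>k \<in> int_lattice. Z a b k)"
  proof
    fix w assume w: "w \<in> ?Z"
    then obtain r where r: "0 \<le> r" "r < t" "tdist (X r) (X t + \<epsilon> *\<^sub>R \<nu> - (t - r) *\<^sub>R w) = \<epsilon>" by auto
    let ?y = "\<lambda>r. X t + \<epsilon> *\<^sub>R \<nu> - (t - r) *\<^sub>R w"
    obtain k where k: "k \<in> int_lattice" "norm (?y r - X r - k) = \<epsilon>"
      using tdist_attained[of "?y r" "X r"] r(3) by (metis tdist_commute)
    have ge: "\<epsilon> \<le> norm (?y s - X s - k)" if "0 \<le> s" "s < t" for s
    proof -
      have "\<epsilon> \<le> tdist (X s) (?y s)" using w that by auto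
      also have "\<dots> \<le> norm (?y s - X s - k)" using tdist_le[OF k(1)] by (metis tdist_commute)
      finally show ?thesis .
    qed
    define a where "a = Max (insert 0 (C \<inter> {0..r}))"
    have fa: "finite (insert 0 (C \<inter> {0..r}))" using finite_C by simp
    then have a: "a \<in> insert 0 (C \<inter> {0..r})" unfolding a_def by (rule Max_in) simp
    define b where "b = Min (insert t (C \<inter> {r<..t}))"
    have fb: "finite (insert t (C \<inter> {r<..t}))" using finite_C by simp
    then have b: "b \<in> insert t (C \<inter> {r<..t})" unfolding b_def by (rule Min_in) simp
    have ar: "0 \<le> a" "a \<le> r" "r < b" "b \<le> t" using a b r by auto
    have C0: "C \<inter> {a<..<b} = {}"
    proof (rule ccontr)
      assume "C \<inter> {a<..<b} \<noteq> {}"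
      then obtain c where c: "c \<in> C" "a < c" "c < b" by auto
      show False
      proof (cases "c \<le> r")
        case True
        then have "c \<le> a" unfolding a_def using c fa ar by (intro Max_ge) auto
        then show False using c by simp
      next
        case False
        then have "b \<le> c" unfolding b_def using c fb ar b by (intro Min_le) auto
        then show False using c by simp
      qed
    qed
    have Xs: "X s = X a + (s - a) *\<^sub>R V a" if "a \<le> s" "s \<le> b" for s
      using ar that C0 by (intro straight) auto
    define q where "q = X t + \<epsilon> *\<^sub>R \<nu> - k - X a - (t - a) *\<^sub>R V a"
    \<comment> \<open>The promised division: positions at time \<open>s\<close> correspond to
      velocities scaled by \<open>t - s\<close>.\<close>
    have rescale: "norm (w - (V a + (1 / (t - s)) *\<^sub>R q)) = (1 / (t - s)) * norm (?y s - X s - k)"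
      if "a \<le> s" "s \<le> b" "s < t" for s
    proof -
      have "(t - s) *\<^sub>R (V a + (1 / (t - s)) *\<^sub>R q - w) = (t - s) *\<^sub>R V a + q - (t - s) *\<^sub>R w"
        using that(3) by (simp add: scaleR_diff_right scaleR_add_right)
      also have "\<dots> = ?y s - X s - k"
        unfolding Xs[OF that(1,2)] q_def by (simp add: algebra_simps)
      finally have "?y s - X s - k = (t - s) *\<^sub>R (V a + (1 / (t - s)) *\<^sub>R q - w)" by (rule sym)
      then have "norm (?y s - X s - k) = (t - s) * norm (w - (V a + (1 / (t - s)) *\<^sub>R q))"
        using that(3) by (simp add: norm_minus_commute)
      then show ?thesis using that by simp
    qed
    have "w \<in> Z a b k"
      unfolding Z_def q_def[symmetric]
    proof (intro CollectI conjI ballI)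
      show "\<exists>\<sigma> \<in> I a b. norm (w - (V a + \<sigma> *\<^sub>R q)) = \<epsilon> * \<sigma> + 0 \<and> 0 < \<epsilon> * \<sigma> + 0"
      proof (rule bexI[of _ "1 / (t - r)"])
        show "1 / (t - r) \<in> I a b" using ar r by (simp add: I_def pos_le_divide_eq pos_divide_le_eq)
        show "norm (w - (V a + (1 / (t - r)) *\<^sub>R q)) = \<epsilon> * (1 / (t - r)) + 0 \<and> 0 < \<epsilon> * (1 / (t - r)) + 0"
          using rescale[of r] ar r k e by simp
      qed
      fix \<sigma> assume s: "\<sigma> \<in> I a b"
      define s where "s = t - 1 / \<sigma>"
      have ss: "a \<le> s" "s \<le> b" "s < t" "\<sigma> = 1 / (t - s)"
        using s by (auto simp: I_def s_def field_simps)
      then show "\<epsilon> * \<sigma> + 0 \<le> norm (w - (V a + \<sigma> *\<^sub>R q))"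
        using rescale[of s] ge[of s] ar mult_left_mono[of \<epsilon> "norm (?y s - X s - k)" "1 / (t - s)"] by (simp add: mult.commute)
    qed
    moreover have "a \<in> {a \<in> ?B. a \<le> t}" "b \<in> {b \<in> ?B. b \<le> t}" using a b r ar by auto
    ultimately show "w \<in> (\<Union>a \<in> {a \<in> ?B. a \<le> t}. \<Union>b \<in> {b \<in> ?B. b \<le> t}. \<Union>k \<in> int_lattice. Z a b k)"
      using k(1) by blast
  qed
  moreover have "negligible (\<Union>a \<in> {a \<in> ?B. a \<le> t}. \<Union>b \<in> {b \<in> ?B. b \<le> t}. \<Union>k \<in> int_lattice. Z a b k)"
  proof -
    have Z: "negligible (Z a b k)" if "a \<le> t" "b \<le> t" for a b k
      unfolding Z_def
    proof (rule negligible_touching)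
      have "is_interval (I a b)"
        unfolding is_interval_1 I_def
      proof (intro allI ballI impI, clarsimp)
        fix x y z :: real
        assume "0 < x" "1 \<le> x * (t - a)" "y * (t - b) \<le> 1" "x \<le> z" "z \<le> y"
        then show "1 \<le> z * (t - a) \<and> z * (t - b) \<le> 1"
          using mult_right_mono[of x z "t - a"] mult_right_mono[of z y "t - b"] that by auto
      qed
      then show "convex (I a b)" by (simp add: is_interval_convex_1)
    qed
    have D: "countable {a \<in> ?B. a \<le> t}" using finite_C by (intro countable_finite) simp
    have 1: "negligible (\<Union>k \<in> int_lattice. Z a b k)" if "a \<le> t" "b \<le> t" for a b
      using Z[OF that] countable_lattice by (intro negligible_countable_Union countable_image) auto
    have 2: "negligible (\<Union>b \<in> {b \<in> ?B. b \<le> t}. \<Union>k \<in> int_lattice. Z a b k)" if "a \<le> t" for a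
      using 1[OF that] countable_image[OF D] by (intro negligible_countable_Union) blast+
    show ?thesis
      using 2 countable_image[OF D] by (intro negligible_countable_Union) blast+
  qed
  ultimately show ?thesis using negligible_subset by blast
qed

end

lemma AE_not_negligible:
  assumes "negligible (A :: vec3 set)"
  shows "AE w in lborel. w \<notin> A"
proof -
  have "A \<in> null_sets lebesgue" using assms by (simp add: negligible_iff_null_sets)
  then obtain B where "B \<in> null_sets lborel" "A \<subseteq> B"
    unfolding null_sets_completion_iff2 by (elim bexE) (rule that)
  from AE_not_in[OF this(1)] show ?thesis by eventually_elim (use \<open>A \<subseteq> B\<close> in blast)
qed

context path
begin

text \<open>On the straight tail, \<open>sweep_norm\<close> excludes an earlier contact with the
  same image of the root. The bound 1/2 makes the torus distance equal to the norm, so that no other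
  lattice image is closer.\<close>

lemma recently_apart:
  assumes C: "C \<subseteq> {..\<tau>}" "0 \<le> \<tau>" and t: "\<tau> \<le> t - q" "0 < q"
    and n: "norm \<nu> = 1" "0 < (V \<tau> - w) \<bullet> \<nu>" and e: "0 < \<epsilon>" "\<epsilon> + q * norm (V \<tau> - w) < 1 / 2"
  shows "\<epsilon> < tdist (X (t - q)) (X t + \<epsilon> *\<^sub>R \<nu> - q *\<^sub>R w)"
proof -
  have Xs: "X s = X \<tau> + (s - \<tau>) *\<^sub>R V \<tau>" if "\<tau> \<le> s" for s
    using C that by (intro straight) auto
  have d: "X t + \<epsilon> *\<^sub>R \<nu> - q *\<^sub>R w - X (t - q) = \<epsilon> *\<^sub>R \<nu> + q *\<^sub>R (V \<tau> - w)"
  proof -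
    have 1: "X t = X \<tau> + (t - \<tau>) *\<^sub>R V \<tau>" "X (t - q) = X \<tau> + (t - q - \<tau>) *\<^sub>R V \<tau>"
      using t by (intro Xs; simp)+
    show ?thesis unfolding 1 by (simp add: algebra_simps)
  qed
  have "norm (\<epsilon> *\<^sub>R \<nu> + q *\<^sub>R (V \<tau> - w)) \<le> norm (\<epsilon> *\<^sub>R \<nu>) + norm (q *\<^sub>R (V \<tau> - w))" by (rule norm_triangle_ineq)
  also have "\<dots> < 1 / 2" using n e t by simp
  finally have "tdist (X t + \<epsilon> *\<^sub>R \<nu> - q *\<^sub>R w) (X (t - q)) = norm (\<epsilon> *\<^sub>R \<nu> + q *\<^sub>R (V \<tau> - w))"
    using tdist_eq_norm[of "X t + \<epsilon> *\<^sub>R \<nu> - q *\<^sub>R w" "X (t - q)"] by (simp add: d)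
  moreover have "\<epsilon> < norm (\<epsilon> *\<^sub>R \<nu> + q *\<^sub>R (V \<tau> - w))" using n e t by (intro sweep_norm) auto
  ultimately show ?thesis by (simp only: tdist_commute)
qed

text \<open>Moving the contact time from \<open>t\<close> to \<open>s\<close> changes all past
  distances by at most \<open>\<eta> s\<close>, uniformly. If the past path enters the tube
  strictly, this persists. Otherwise the absence of grazing leaves a positive margin on
  \<open>{0..t - d}\<close>, and \<open>recently_apart\<close> covers the time close to the
  contact.\<close>

lemma fresh_continuous:
  assumes C: "C \<subseteq> {..\<tau>}" "0 \<le> \<tau>" and t: "\<tau> < t" and u: "u \<longlonglongrightarrow> t" "\<And>n. \<tau> < u n"
    and n: "norm \<nu> = 1" "0 < (V \<tau> - w) \<bullet> \<nu>" and e: "0 < \<epsilon>" "\<epsilon> < 1 / 2"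
    and ng: "\<not> ((\<forall>r \<in> {0..<t}. \<epsilon> \<le> tdist (X r) (X t + \<epsilon> *\<^sub>R \<nu> - (t - r) *\<^sub>R w)) \<and>
      (\<exists>r \<in> {0..<t}. tdist (X r) (X t + \<epsilon> *\<^sub>R \<nu> - (t - r) *\<^sub>R w) = \<epsilon>))"
  shows "\<forall>\<^sub>F n in sequentially. fresh \<epsilon> X (u n) \<nu> w \<longleftrightarrow> fresh \<epsilon> X t \<nu> w"
proof -
  define q where "q s r = tdist (X r) (X s + \<epsilon> *\<^sub>R \<nu> - (s - r) *\<^sub>R w)" for s r
  define \<eta> where "\<eta> s = norm (X s - X t - (s - t) *\<^sub>R w)" for s
  have fr: "fresh \<epsilon> X s \<nu> w \<longleftrightarrow> (\<forall>r \<in> {0..<s}. \<epsilon> < q s r)" if "\<tau> < s" for s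
    using fresh_iff[of s \<epsilon> \<nu> w] that C by (simp add: q_def)
  have close: "\<bar>q s r - q t r\<bar> \<le> \<eta> s" for s r
  proof -
    have "\<bar>q s r - q t r\<bar> \<le> norm ((X r - (X s + \<epsilon> *\<^sub>R \<nu> - (s - r) *\<^sub>R w)) - (X r - (X t + \<epsilon> *\<^sub>R \<nu> - (t - r) *\<^sub>R w)))"
      unfolding q_def by (rule tdist_lipschitz)
    also have "(X r - (X s + \<epsilon> *\<^sub>R \<nu> - (s - r) *\<^sub>R w)) - (X r - (X t + \<epsilon> *\<^sub>R \<nu> - (t - r) *\<^sub>R w)) = - (X s - X t - (s - t) *\<^sub>R w)"
      by (simp add: algebra_simps)
    finally show ?thesis by (simp only: norm_minus_cancel \<eta>_def)
  qed
  have "(\<lambda>n. X (u n)) \<longlonglongrightarrow> X t"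
    using continuous_on_tendsto_compose[OF continuous_X u(1)] u(2) C t
    by (auto intro!: always_eventually less_imp_le[OF le_less_trans])
  then have "(\<lambda>n. \<eta> (u n)) \<longlonglongrightarrow> norm (X t - X t - (t - t) *\<^sub>R w)"
    unfolding \<eta>_def using u(1) by (intro tendsto_intros)
  then have \<eta>0: "(\<lambda>n. \<eta> (u n)) \<longlonglongrightarrow> 0" by simp
  show ?thesis
  proof (cases "\<exists>r \<in> {0..<t}. q t r < \<epsilon>")
    case True
    then obtain r where r: "0 \<le> r" "r < t" "q t r < \<epsilon>" by auto
    have "\<forall>\<^sub>F n in sequentially. \<eta> (u n) < \<epsilon> - q t r" using r by (intro order_tendstoD(2)[OF \<eta>0]) simp
    moreover have "\<forall>\<^sub>F n in sequentially. r < u n" using r by (intro order_tendstoD(1)[OF u(1)])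
    ultimately show ?thesis
    proof eventually_elim
      case (elim n)
      then have "q (u n) r < \<epsilon>" using close[of "u n" r] by linarith
      then have "\<not> fresh \<epsilon> X (u n) \<nu> w" using fr[OF u(2)] r elim by force
      moreover have "\<not> fresh \<epsilon> X t \<nu> w" using fr[OF t] r by force
      ultimately show ?case by simp
    qed
  next
    case False
    then have gt: "\<epsilon> < q t r" if "0 \<le> r" "r < t" for r
      using ng that unfolding q_def by (metis atLeastLessThan_iff less_le not_le)
    \<comment> \<open>For contact times below \<open>t + d\<close> the look-back beyond
      \<open>t - d\<close> is shorter than \<open>2 * d\<close>, so
      \<open>2 * d * norm (V \<tau> - w) < 1 / 2 - \<epsilon>\<close> is what
      \<open>recently_apart\<close> asks for. The added 1 avoids division by zero.\<close>
    define d where "d = min (t - \<tau>) ((1 / 2 - \<epsilon>) / (4 * (norm (V \<tau> - w) + 1)))"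
    have nn: "0 < 4 * (norm (V \<tau> - w) + 1)" by (simp add: add_nonneg_pos)
    have d: "0 < d" "d \<le> t - \<tau>" unfolding d_def using t e nn by auto
    have "d * (4 * (norm (V \<tau> - w) + 1)) \<le> 1 / 2 - \<epsilon>"
      using pos_le_divide_eq[OF nn, of d "1 / 2 - \<epsilon>"] by (simp add: d_def)
    then have dn: "2 * d * norm (V \<tau> - w) < 1 / 2 - \<epsilon>"
    proof -
      have "0 \<le> d * norm (V \<tau> - w)" using d by simp
      moreover have "d * (4 * (norm (V \<tau> - w) + 1)) = 4 * (d * norm (V \<tau> - w)) + 4 * d"
        "2 * d * norm (V \<tau> - w) = 2 * (d * norm (V \<tau> - w))" by (simp_all add: algebra_simps)
      moreover assume "d * (4 * (norm (V \<tau> - w) + 1)) \<le> 1 / 2 - \<epsilon>"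
      ultimately show ?thesis using d by linarith
    qed
    have c: "continuous_on {0..t - d} (q t)"
      unfolding q_def by (intro continuous_intros continuous_on_subset[OF continuous_X]) auto
    obtain r0 where r0: "r0 \<in> {0..t - d}" "\<And>r. r \<in> {0..t - d} \<Longrightarrow> q t r0 \<le> q t r"
      using continuous_attains_inf[OF compact_Icc _ c] d C by (metis atLeastatMost_empty_iff diff_ge_0_iff_ge le_diff_eq not_le order.trans add.commute)
    have m: "\<epsilon> < q t r0" using r0 d by (intro gt) auto
    have "\<forall>\<^sub>F n in sequentially. \<eta> (u n) < q t r0 - \<epsilon>" using m by (intro order_tendstoD(2)[OF \<eta>0]) simp
    moreover have "\<forall>\<^sub>F n in sequentially. t - d < u n" using d by (intro order_tendstoD(1)[OF u(1)]) simp
    moreover have "\<forall>\<^sub>F n in sequentially. u n < t + d" using d by (intro order_tendstoD(2)[OF u(1)]) simp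
    ultimately show ?thesis
    proof eventually_elim
      case (elim n)
      have "\<epsilon> < q (u n) r" if r: "0 \<le> r" "r < u n" for r
      proof (cases "r \<le> t - d")
        case True
        then have "q t r0 \<le> q t r" using r by (intro r0) auto
        then show ?thesis using close[of "u n" r] elim(1) by linarith
      next
        case False
        let ?p = "u n - r"
        have "?p < 2 * d" "0 < ?p" using elim False r by auto
        then have "?p * norm (V \<tau> - w) \<le> 2 * d * norm (V \<tau> - w)" by (intro mult_right_mono) auto
        then have "\<epsilon> < tdist (X (u n - ?p)) (X (u n) + \<epsilon> *\<^sub>R \<nu> - ?p *\<^sub>R w)"
          using dn n e C False d \<open>0 < ?p\<close> by (intro recently_apart[of \<tau>]) auto
        then show ?thesis by (simp add: q_def)
      qed
      then have "fresh \<epsilon> X (u n) \<nu> w" using fr[OF u(2)] by auto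
      moreover have "fresh \<epsilon> X t \<nu> w" using fr[OF t] gt by auto
      ultimately show ?case by simp
    qed
  qed
qed

text \<open>The same division of the past as in \<open>fresh_continuous\<close>: the distance for
  radius 0 has a positive minimum on \<open>{0..t - d}\<close>, which small radii cannot use up, and
  the last stretch is left to \<open>recently_apart\<close>.\<close>

lemma eventually_fresh:
  assumes C: "C \<subseteq> {..\<tau>}" "0 \<le> \<tau>" and t: "\<tau> < t" and e: "\<epsilon> \<longlonglongrightarrow> 0" "\<forall>\<^sub>F n in sequentially. 0 < \<epsilon> n"
    and n: "norm \<nu> = 1" "0 < (V \<tau> - w) \<bullet> \<nu>"
    and nr: "\<not> (\<exists>r \<in> {0..<t}. tdist (X r) (X t - (t - r) *\<^sub>R w) = 0)"
  shows "\<forall>\<^sub>F n in sequentially. fresh (\<epsilon> n) X t \<nu> w"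
proof -
  define q where "q r = tdist (X r) (X t - (t - r) *\<^sub>R w)" for r
  have gt: "0 < q r" if "0 \<le> r" "r < t" for r
    using nr that tdist_nonneg[of "X r" "X t - (t - r) *\<^sub>R w"] unfolding q_def
    by (metis atLeastLessThan_iff less_le)
  define d where "d = min (t - \<tau>) (1 / (4 * (norm (V \<tau> - w) + 1)))"
  have nn: "0 < 4 * (norm (V \<tau> - w) + 1)" by (simp add: add_nonneg_pos)
  have d: "0 < d" "d \<le> t - \<tau>" unfolding d_def using t nn by auto
  have "d * (4 * (norm (V \<tau> - w) + 1)) \<le> 1"
    using pos_le_divide_eq[OF nn, of d 1] by (simp add: d_def)
  then have dn: "d * norm (V \<tau> - w) < 1 / 4"
    using d by (simp add: algebra_simps)
  have c: "continuous_on {0..t - d} q"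
    unfolding q_def by (intro continuous_intros continuous_on_subset[OF continuous_X]) auto
  obtain r0 where r0: "r0 \<in> {0..t - d}" "\<And>r. r \<in> {0..t - d} \<Longrightarrow> q r0 \<le> q r"
    using continuous_attains_inf[OF compact_Icc _ c] d C by (metis atLeastatMost_empty_iff diff_ge_0_iff_ge le_diff_eq not_le order.trans add.commute)
  have m: "0 < q r0" using r0 d by (intro gt) auto
  have "\<forall>\<^sub>F n in sequentially. \<epsilon> n < q r0 / 2" using m by (intro order_tendstoD(2)[OF e(1)]) simp
  moreover have "\<forall>\<^sub>F n in sequentially. \<epsilon> n < 1 / 4" by (intro order_tendstoD(2)[OF e(1)]) simp
  ultimately show ?thesis using e(2)
  proof eventually_elim
    case (elim n)
    have "\<epsilon> n < tdist (X r) (X t + \<epsilon> n *\<^sub>R \<nu> - (t - r) *\<^sub>R w)" if r: "0 \<le> r" "r < t" for r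
    proof (cases "r \<le> t - d")
      case True
      then have "q r0 \<le> q r" using r by (intro r0) auto
      moreover have "\<bar>tdist (X r) (X t + \<epsilon> n *\<^sub>R \<nu> - (t - r) *\<^sub>R w) - q r\<bar> \<le> \<epsilon> n"
      proof -
        have "\<bar>tdist (X r) (X t + \<epsilon> n *\<^sub>R \<nu> - (t - r) *\<^sub>R w) - q r\<bar>
          \<le> norm ((X r - (X t + \<epsilon> n *\<^sub>R \<nu> - (t - r) *\<^sub>R w)) - (X r - (X t - (t - r) *\<^sub>R w)))"
          unfolding q_def by (rule tdist_lipschitz)
        also have "(X r - (X t + \<epsilon> n *\<^sub>R \<nu> - (t - r) *\<^sub>R w)) - (X r - (X t - (t - r) *\<^sub>R w)) = - (\<epsilon> n *\<^sub>R \<nu>)"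
          by (simp add: algebra_simps)
        finally show ?thesis using n elim by simp
      qed
      ultimately show ?thesis using elim(1) by linarith
    next
      case False
      let ?p = "t - r"
      have "?p < d" "0 < ?p" using False r by auto
      then have "?p * norm (V \<tau> - w) \<le> d * norm (V \<tau> - w)" by (intro mult_right_mono) auto
      then have "\<epsilon> n < tdist (X (t - ?p)) (X t + \<epsilon> n *\<^sub>R \<nu> - ?p *\<^sub>R w)"
        using dn n elim C False d \<open>0 < ?p\<close> by (intro recently_apart[of \<tau>]) auto
      then show ?thesis by simp
    qed
    then show ?case using fresh_iff[of t] t C by simp
  qed
qed

lemma measurable_influx_fresh:
  assumes "(\<lambda>z. g (fst z) (snd z)) \<in> borel_measurable borel"
  shows "(\<lambda>(\<nu>, w). influx \<epsilon> g X v t \<nu> w * (if fresh \<epsilon> X t \<nu> w then a else b)) \<in> borel_measurable (borel \<Otimes>\<^sub>M borel)"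
proof -
  have [measurable]: "(\<lambda>z. influx \<epsilon> g X v t (fst z) (snd z)) \<in> borel_measurable (borel \<Otimes>\<^sub>M borel)"
    by (rule measurable_influx[OF assms]) measurable
  have [measurable]: "Measurable.pred (borel \<Otimes>\<^sub>M borel) (\<lambda>z. fresh \<epsilon> X t (fst z) (snd z))"
    by (rule measurable_fresh) measurable
  show ?thesis unfolding case_prod_beta by measurable
qed

end

lemma influx_integrand_bound:
  assumes g: "background_admissible g"
  obtains h where "integrable lborel h" "\<forall>w. 0 \<le> h w"
    "\<forall>\<epsilon> X v t \<nu> k. norm \<nu> = 1 \<longrightarrow> (\<forall>w. \<bar>k w\<bar> \<le> 1) \<longrightarrow> (AE w in lborel. \<bar>influx \<epsilon> g X v t \<nu> w * k w\<bar> \<le> (1 + norm v) * h w)"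
proof -
  obtain b :: "vec3 \<Rightarrow> real" where b: "b \<in> borel_measurable borel" "\<And>w. 0 \<le> b w"
    "integrable lborel (\<lambda>w. b w * (1 + (norm w)\<^sup>2))" "AE w in lborel. \<forall>x. g x w \<le> b w"
    by (rule admissible_bound[OF g]) (rule that; assumption)
  have g0: "\<And>x v. 0 \<le> g x v" using g by (simp add: background_admissible_def torus_density_def)
  show ?thesis
  proof (rule that[of "\<lambda>w. b w * (1 + (norm w)\<^sup>2)"])
    show "\<forall>\<epsilon> X v t \<nu> k. norm \<nu> = 1 \<longrightarrow> (\<forall>w. \<bar>k w\<bar> \<le> 1) \<longrightarrow>
      (AE w in lborel. \<bar>influx \<epsilon> g X v t \<nu> w * k w\<bar> \<le> (1 + norm v) * (b w * (1 + (norm w)\<^sup>2)))"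
    proof (intro allI impI)
    fix \<epsilon> t :: real and X and v \<nu> :: vec3 and k :: "vec3 \<Rightarrow> real" assume "norm \<nu> = 1" and k: "\<forall>w. \<bar>k w\<bar> \<le> 1"
    show "AE w in lborel. \<bar>influx \<epsilon> g X v t \<nu> w * k w\<bar> \<le> (1 + norm v) * (b w * (1 + (norm w)\<^sup>2))"
      using b(4)
    proof eventually_elim
      case (elim w)
      have "\<bar>influx \<epsilon> g X v t \<nu> w\<bar> \<le> (1 + norm v) * (b w * (1 + (norm w)\<^sup>2))"
        using elim g0 \<open>norm \<nu> = 1\<close> by (intro influx_bound) auto
      moreover have "\<bar>influx \<epsilon> g X v t \<nu> w\<bar> * \<bar>k w\<bar> \<le> \<bar>influx \<epsilon> g X v t \<nu> w\<bar> * 1"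
        using k by (intro mult_left_mono) auto
      ultimately show ?case by (simp add: abs_mult)
    qed
    qed
  qed (use b in \<open>auto intro!: mult_nonneg_nonneg add_nonneg_nonneg\<close>)
qed

context path
begin

text \<open>By \<open>negligible_returning\<close>, almost every incoming velocity is eventually
  fresh, while outgoing velocities carry no influx. The bound from
  \<open>influx_integrand_bound\<close> does not depend on \<epsilon>, so the limit may be taken
  inside.\<close>

lemma stale_rate_tendsto:
  assumes g: "background_admissible g"
    and C: "C \<subseteq> {..\<tau>}" "0 \<le> \<tau>" and t: "\<tau> < t" and e: "\<epsilon> \<longlonglongrightarrow> 0" "\<forall>\<^sub>F n in sequentially. 0 < \<epsilon> n"
  shows "(\<lambda>n. stale_rate (\<epsilon> n) g X (V \<tau>) t) \<longlonglongrightarrow> 0"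
proof -
  have gm: "(\<lambda>z. g (fst z) (snd z)) \<in> borel_measurable borel"
    using g by (simp add: background_admissible_def torus_density_def)
  obtain h where h: "integrable lborel h" "\<forall>w. 0 \<le> h w"
    "\<forall>\<epsilon> X v t \<nu> k. norm \<nu> = 1 \<longrightarrow> (\<forall>w. \<bar>k w\<bar> \<le> 1) \<longrightarrow> (AE w in lborel. \<bar>influx \<epsilon> g X v t \<nu> w * k w\<bar> \<le> (1 + norm v) * h w)"
    by (rule influx_integrand_bound[OF g])
  have "(\<lambda>n. LINT \<nu>|sphere_measure. (LINT w|lborel. influx (\<epsilon> n) g X (V \<tau>) t \<nu> w * (if fresh (\<epsilon> n) X t \<nu> w then 0 else 1)))
    \<longlonglongrightarrow> (LINT \<nu>|sphere_measure. (LINT (w::vec3)|lborel. 0))"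
  proof (rule iterated_dominated_convergence[where h = "\<lambda>w. (1 + norm (V \<tau>)) * h w"])
    show "AE w in lborel. (\<lambda>n. influx (\<epsilon> n) g X (V \<tau>) t \<nu> w * (if fresh (\<epsilon> n) X t \<nu> w then 0 else 1)) \<longlonglongrightarrow> 0"
      if \<nu>: "norm \<nu> = 1" for \<nu>
    proof -
      have "0 < t" using t C by simp
      from AE_not_negligible[OF negligible_returning[OF this]] show ?thesis
      proof eventually_elim
        case (elim w)
        show ?case
        proof (cases "0 < (V \<tau> - w) \<bullet> \<nu>")
          case True
          then have "\<forall>\<^sub>F n in sequentially. fresh (\<epsilon> n) X t \<nu> w"
            using elim by (intro eventually_fresh[OF C t e \<nu>]) auto
          then have "\<forall>\<^sub>F n in sequentially. influx (\<epsilon> n) g X (V \<tau>) t \<nu> w * (if fresh (\<epsilon> n) X t \<nu> w then 0 else 1) = 0"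
            by eventually_elim simp
          then show ?thesis by (rule tendsto_eventually)
        qed (simp add: influx_def max_def)
      qed
    qed
    show "integrable lborel (\<lambda>w. (1 + norm (V \<tau>)) * h w)" using h(1) by (rule integrable_mult_right)
    show "AE w in lborel. \<bar>influx (\<epsilon> n) g X (V \<tau>) t \<nu> w * (if fresh (\<epsilon> n) X t \<nu> w then 0 else 1)\<bar> \<le> (1 + norm (V \<tau>)) * h w"
      if "norm \<nu> = 1" for n \<nu>
      using that by (intro h(3)[rule_format]) auto
  qed (rule measurable_influx_fresh[OF gm], simp)
  then show ?thesis by (simp add: stale_rate_def)
qed

text \<open>Almost every velocity does not graze, and for these the indicator of freshness is
  locally constant in time as long as they are incoming. Continuity is what turns the integrated
  balance into a derivative at every time.\<close>

lemma fresh_rate_continuous: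
  assumes g: "background_admissible g"
    and C: "C \<subseteq> {..\<tau>}" "0 \<le> \<tau>" and e: "0 < \<epsilon>" "\<epsilon> < 1 / 2"
  shows "continuous_on {\<tau><..} (fresh_rate \<epsilon> g X (V \<tau>))"
  unfolding continuous_on_sequentially
proof (intro allI ballI impI, elim conjE)
  fix u t assume "t \<in> {\<tau><..}" and un: "\<forall>n. u n \<in> {\<tau><..}" and u: "u \<longlonglongrightarrow> t"
  then have t: "\<tau> < t" by simp
  have gm: "(\<lambda>z. g (fst z) (snd z)) \<in> borel_measurable borel"
    using g by (simp add: background_admissible_def torus_density_def)
  obtain h where h: "integrable lborel h" "\<forall>w. 0 \<le> h w"
    "\<forall>\<epsilon> X v t \<nu> k. norm \<nu> = 1 \<longrightarrow> (\<forall>w. \<bar>k w\<bar> \<le> 1) \<longrightarrow> (AE w in lborel. \<bar>influx \<epsilon> g X v t \<nu> w * k w\<bar> \<le> (1 + norm v) * h w)"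
    by (rule influx_integrand_bound[OF g])
  obtain b where cont: "AE w in lborel. continuous_on UNIV (\<lambda>x. g x w)"
    by (rule admissible_bound[OF g]) (rule that; assumption)
  have Xu: "(\<lambda>n. X (u n)) \<longlonglongrightarrow> X t"
  proof (rule continuous_on_tendsto_compose[OF continuous_X u])
    show "t \<in> {0..}" using t C by simp
    have "u n \<in> {0..}" for n using un[rule_format, of n] C by simp
    then show "\<forall>\<^sub>F n in sequentially. u n \<in> {0..}" by simp
  qed
  have "(\<lambda>n. LINT \<nu>|sphere_measure. (LINT w|lborel. influx \<epsilon> g X (V \<tau>) (u n) \<nu> w * (if fresh \<epsilon> X (u n) \<nu> w then 1 else 0)))
    \<longlonglongrightarrow> (LINT \<nu>|sphere_measure. (LINT w|lborel. influx \<epsilon> g X (V \<tau>) t \<nu> w * (if fresh \<epsilon> X t \<nu> w then 1 else 0)))"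
  proof (rule iterated_dominated_convergence[where h = "\<lambda>w. (1 + norm (V \<tau>)) * h w"])
    show "AE w in lborel. (\<lambda>n. influx \<epsilon> g X (V \<tau>) (u n) \<nu> w * (if fresh \<epsilon> X (u n) \<nu> w then 1 else 0))
        \<longlonglongrightarrow> influx \<epsilon> g X (V \<tau>) t \<nu> w * (if fresh \<epsilon> X t \<nu> w then 1 else 0)"
      if \<nu>: "norm \<nu> = 1" for \<nu>
    proof -
      have "0 < t" using t C by simp
      from AE_not_negligible[OF negligible_grazing[OF this e(1), of \<nu>]] cont show ?thesis
      proof eventually_elim
        case (elim w)
        show ?case
        proof (cases "0 < (V \<tau> - w) \<bullet> \<nu>")
          case True
          then have "\<forall>\<^sub>F n in sequentially. fresh \<epsilon> X (u n) \<nu> w \<longleftrightarrow> fresh \<epsilon> X t \<nu> w"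
            using elim(1) un by (intro fresh_continuous[OF C t u _ \<nu> _ e]) auto
          then have ev: "\<forall>\<^sub>F n in sequentially. influx \<epsilon> g X (V \<tau>) (u n) \<nu> w * (if fresh \<epsilon> X t \<nu> w then 1 else 0)
              = influx \<epsilon> g X (V \<tau>) (u n) \<nu> w * (if fresh \<epsilon> X (u n) \<nu> w then 1 else 0)"
            by eventually_elim simp
          have "(\<lambda>n. g (X (u n) + \<epsilon> *\<^sub>R \<nu> - u n *\<^sub>R w) w) \<longlonglongrightarrow> g (X t + \<epsilon> *\<^sub>R \<nu> - t *\<^sub>R w) w"
            using elim(2) Xu u by (intro continuous_on_tendsto_compose[of UNIV "\<lambda>x. g x w"] tendsto_intros) auto
          then have "(\<lambda>n. influx \<epsilon> g X (V \<tau>) (u n) \<nu> w * (if fresh \<epsilon> X t \<nu> w then 1 else 0))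
              \<longlonglongrightarrow> influx \<epsilon> g X (V \<tau>) t \<nu> w * (if fresh \<epsilon> X t \<nu> w then 1 else 0)"
            unfolding influx_def by (intro tendsto_intros)
          then show ?thesis using ev by (rule Lim_transform_eventually)
        qed (simp add: influx_def max_def)
      qed
    qed
    show "integrable lborel (\<lambda>w. (1 + norm (V \<tau>)) * h w)" using h(1) by (rule integrable_mult_right)
    show "AE w in lborel. \<bar>influx \<epsilon> g X (V \<tau>) (u n) \<nu> w * (if fresh \<epsilon> X (u n) \<nu> w then 1 else 0)\<bar> \<le> (1 + norm (V \<tau>)) * h w"
      if "norm \<nu> = 1" for n \<nu>
      using that by (intro h(3)[rule_format]) auto
  qed (rule measurable_influx_fresh[OF gm])+
  then show "(fresh_rate \<epsilon> g X (V \<tau>) \<circ> u) \<longlonglongrightarrow> fresh_rate \<epsilon> g X (V \<tau>) t"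
    by (simp add: fresh_rate_def o_def)
qed

end

context path
begin

lemma integrable_influx_fresh:
  assumes g: "background_admissible g" and ab: "\<bar>a\<bar> \<le> 1" "\<bar>b\<bar> \<le> 1"
  shows "norm \<nu> = 1 \<Longrightarrow> integrable lborel (\<lambda>w. influx \<epsilon> g X v t \<nu> w * (if fresh \<epsilon> X t \<nu> w then a else b))"
    and "integrable sphere_measure (\<lambda>\<nu>. LINT w|lborel. influx \<epsilon> g X v t \<nu> w * (if fresh \<epsilon> X t \<nu> w then a else b))"
proof -
  let ?F = "\<lambda>\<nu> w. influx \<epsilon> g X v t \<nu> w * (if fresh \<epsilon> X t \<nu> w then a else b)"
  have gm: "(\<lambda>z. g (fst z) (snd z)) \<in> borel_measurable borel"
    using g by (simp add: background_admissible_def torus_density_def)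
  have m: "case_prod ?F \<in> borel_measurable (borel \<Otimes>\<^sub>M borel)" by (rule measurable_influx_fresh[OF gm])
  have mw: "?F \<nu> \<in> borel_measurable lborel" for \<nu>
    using measurable_compose[OF measurable_Pair1'[of \<nu> borel borel] m] by simp
  have [measurable]: "case_prod ?F \<in> borel_measurable (sphere_measure \<Otimes>\<^sub>M lborel)"
    using m by (simp cong: measurable_cong_sets sets_pair_measure_cong)
  obtain h where h: "integrable lborel h" "\<forall>w. 0 \<le> h w"
    "\<forall>\<epsilon> X v t \<nu> k. norm \<nu> = 1 \<longrightarrow> (\<forall>w. \<bar>k w\<bar> \<le> 1) \<longrightarrow> (AE w in lborel. \<bar>influx \<epsilon> g X v t \<nu> w * k w\<bar> \<le> (1 + norm v) * h w)"
    by (rule influx_integrand_bound[OF g])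
  have b: "AE w in lborel. \<bar>?F \<nu> w\<bar> \<le> (1 + norm v) * h w" if "norm \<nu> = 1" for \<nu>
    using that ab by (intro h(3)[rule_format]) auto
  have hi: "integrable lborel (\<lambda>w. (1 + norm v) * h w)" using h(1) by (rule integrable_mult_right)
  show i: "integrable lborel (?F \<nu>)" if "norm \<nu> = 1" for \<nu>
    using b[OF that] by (intro Bochner_Integration.integrable_bound[OF hi mw]) (auto elim!: eventually_mono)
  show "integrable sphere_measure (\<lambda>\<nu>. LINT w|lborel. ?F \<nu> w)"
  proof (rule sphere.integrable_const_bound)
    show "AE \<nu> in sphere_measure. norm (LINT w|lborel. ?F \<nu> w) \<le> (LINT w|lborel. (1 + norm v) * h w)"
      using AE_sphere_measure
    proof eventually_elim
      case (elim \<nu>)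
      have "norm (LINT w|lborel. ?F \<nu> w) \<le> (LINT w|lborel. norm (?F \<nu> w))" by (rule integral_norm_bound)
      also have "\<dots> \<le> (LINT w|lborel. (1 + norm v) * h w)"
        using b[OF elim] i[OF elim] hi by (intro integral_mono_AE) auto
      finally show ?case .
    qed
  qed measurable
qed

lemma influx_nonneg:
  assumes "torus_density g"
  shows "0 \<le> influx \<epsilon> g X v t \<nu> w"
  using assms by (simp add: influx_def torus_density_def)

lemma rates_nonneg:
  assumes "torus_density g"
  shows "0 \<le> fresh_rate \<epsilon> g X v t" "0 \<le> stale_rate \<epsilon> g X v t"
  using influx_nonneg[OF assms] unfolding fresh_rate_def stale_rate_def
  by (auto intro!: Bochner_Integration.integral_nonneg mult_nonneg_nonneg)

lemma fresh_plus_stale: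
  assumes g: "background_admissible g"
  shows "fresh_rate \<epsilon> g X v t + stale_rate \<epsilon> g X v t
    = (LINT \<nu>|sphere_measure. (LINT w|lborel. transported g t (X t + \<epsilon> *\<^sub>R \<nu>) w * max ((v - w) \<bullet> \<nu>) 0))"
proof -
  have "fresh_rate \<epsilon> g X v t + stale_rate \<epsilon> g X v t
    = (LINT \<nu>|sphere_measure. (LINT w|lborel. influx \<epsilon> g X v t \<nu> w * (if fresh \<epsilon> X t \<nu> w then 1 else 0))
        + (LINT w|lborel. influx \<epsilon> g X v t \<nu> w * (if fresh \<epsilon> X t \<nu> w then 0 else 1)))"
    unfolding fresh_rate_def stale_rate_def
    by (intro Bochner_Integration.integral_add[symmetric] integrable_influx_fresh(2)[OF g]) auto
  also have "\<dots> = (LINT \<nu>|sphere_measure. (LINT w|lborel. influx \<epsilon> g X v t \<nu> w * (if fresh \<epsilon> X t \<nu> w then 1 else 1)))"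
  proof (rule integral_cong_AE)
    show "AE \<nu> in sphere_measure. (LINT w|lborel. influx \<epsilon> g X v t \<nu> w * (if fresh \<epsilon> X t \<nu> w then 1 else 0))
        + (LINT w|lborel. influx \<epsilon> g X v t \<nu> w * (if fresh \<epsilon> X t \<nu> w then 0 else 1))
      = (LINT w|lborel. influx \<epsilon> g X v t \<nu> w * (if fresh \<epsilon> X t \<nu> w then 1 else 1))"
      using AE_sphere_measure
    proof eventually_elim
      case (elim \<nu>)
      show ?case
        by (subst Bochner_Integration.integral_add[symmetric])
           (auto intro!: integrable_influx_fresh(1)[OF g] elim Bochner_Integration.integral_cong)
    qed
  qed (intro borel_measurable_add borel_measurable_integrable integrable_influx_fresh(2)[OF g]; simp)+
  also have "\<dots> = (LINT \<nu>|sphere_measure. (LINT w|lborel. transported g t (X t + \<epsilon> *\<^sub>R \<nu>) w * max ((v - w) \<bullet> \<nu>) 0))"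
    by (simp add: influx_def transported_def)
  finally show ?thesis .
qed

end

section \<open>The derivative of the survival probability\<close>

context path_tail
begin

lemma nn_integral_arrival:
  assumes g: "background_admissible g"
  shows "(\<integral>\<^sup>+ c. (if \<tau> < fst c \<and> fst c < t then arrival \<epsilon> g X (V \<tau>) c else 0) \<partial>mark_measure)
    = (\<integral>\<^sup>+ s. ennreal (\<epsilon>\<^sup>2 * fresh_rate \<epsilon> g X (V \<tau>) s) * indicator {\<tau><..<t} s \<partial>lborel)"
proof -
  note [measurable] = measurable_arrival[OF g_measurable]
  interpret sl: pair_sigma_finite sphere_measure "lborel :: vec3 measure" ..
  let ?A = "arrival \<epsilon> g X (V \<tau>)"
  let ?G = "\<lambda>c. if \<tau> < fst c \<and> fst c < t then ?A c else 0"
  let ?F = "\<lambda>s \<nu> w. influx \<epsilon> g X (V \<tau>) s \<nu> w * (if fresh \<epsilon> X s \<nu> w then 1 else 0)"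
  have A: "?A (s, \<nu>, w) = ennreal (\<epsilon>\<^sup>2 * ?F s \<nu> w)" for s \<nu> w
    by (simp add: arrival_def fresh_def influx_def emitted_def mult_ac)
  have F0: "0 \<le> ?F s \<nu> w" for s \<nu> w using influx_nonneg[OF dens] by simp
  have rate: "(\<integral>\<^sup>+ \<nu>. \<integral>\<^sup>+ w. ?A (s, \<nu>, w) \<partial>lborel \<partial>sphere_measure) = ennreal (\<epsilon>\<^sup>2 * fresh_rate \<epsilon> g X (V \<tau>) s)" for s
  proof -
    have "(\<integral>\<^sup>+ \<nu>. \<integral>\<^sup>+ w. ?A (s, \<nu>, w) \<partial>lborel \<partial>sphere_measure)
      = (\<integral>\<^sup>+ \<nu>. ennreal (\<epsilon>\<^sup>2 * (LINT w|lborel. ?F s \<nu> w)) \<partial>sphere_measure)"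
    proof (rule nn_integral_cong_AE)
      show "AE \<nu> in sphere_measure. (\<integral>\<^sup>+ w. ?A (s, \<nu>, w) \<partial>lborel) = ennreal (\<epsilon>\<^sup>2 * (LINT w|lborel. ?F s \<nu> w))"
        using AE_sphere_measure
      proof eventually_elim
        case (elim \<nu>)
        have "(\<integral>\<^sup>+ w. ?A (s, \<nu>, w) \<partial>lborel) = ennreal (LINT w|lborel. \<epsilon>\<^sup>2 * ?F s \<nu> w)"
          unfolding A using F0
          by (intro nn_integral_eq_integral integrable_mult_right integrable_influx_fresh(1)[OF g] elim) auto
        then show ?case by simp
      qed
    qed
    also have "\<dots> = ennreal (LINT \<nu>|sphere_measure. \<epsilon>\<^sup>2 * (LINT w|lborel. ?F s \<nu> w))"
      using F0 by (intro nn_integral_eq_integral integrable_mult_right integrable_influx_fresh(2)[OF g])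
        (auto intro!: Bochner_Integration.integral_nonneg mult_nonneg_nonneg)
    finally show ?thesis by (simp add: fresh_rate_def)
  qed
  have "(\<integral>\<^sup>+ c. ?G c \<partial>mark_measure) = (\<integral>\<^sup>+ s. \<integral>\<^sup>+ z. ?G (s, z) \<partial>(sphere_measure \<Otimes>\<^sub>M lborel) \<partial>lborel)"
    by (rule sigma_finite_measure.nn_integral_fst[symmetric]) (auto intro!: sl.sigma_finite_measure_axioms)
  also have "\<dots> = (\<integral>\<^sup>+ s. \<integral>\<^sup>+ \<nu>. \<integral>\<^sup>+ w. ?G (s, \<nu>, w) \<partial>lborel \<partial>sphere_measure \<partial>lborel)"
    by (intro nn_integral_cong lborel.nn_integral_fst[where f = "\<lambda>z. ?G (s, z)" for s, symmetric]) measurable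
  also have "\<dots> = (\<integral>\<^sup>+ s. ennreal (\<epsilon>\<^sup>2 * fresh_rate \<epsilon> g X (V \<tau>) s) * indicator {\<tau><..<t} s \<partial>lborel)"
  proof (rule nn_integral_cong)
    fix s
    show "(\<integral>\<^sup>+ \<nu>. \<integral>\<^sup>+ w. ?G (s, \<nu>, w) \<partial>lborel \<partial>sphere_measure) = ennreal (\<epsilon>\<^sup>2 * fresh_rate \<epsilon> g X (V \<tau>) s) * indicator {\<tau><..<t} s"
      using rate[of s] by (cases "\<tau> < s \<and> s < t") auto
  qed
  finally show ?thesis .
qed

lemma later_tail: "\<tau> \<le> t0 \<Longrightarrow> path_tail C X V t0 \<epsilon> g"
  using C_le tau eps dens by unfold_locales auto

text \<open>The path is also straight after any later \<open>t0\<close>, so the balance may be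
  started there. Starting strictly after \<tau> keeps the closed interval inside the open half-line
  on which the rate is known to be continuous.\<close>

lemma survival_integral:
  assumes g: "background_admissible g" and t: "\<tau> < t0" "t0 < t"
  shows "survival \<epsilon> g X t0 = survival \<epsilon> g X t + integral {t0..t} (\<lambda>s. \<epsilon>\<^sup>2 * fresh_rate \<epsilon> g X (V \<tau>) s)"
proof -
  interpret later: path_tail C X V t0 \<epsilon> g using t by (intro later_tail) simp
  have V: "V t0 = V \<tau>" using t by (intro tail_velocity) simp
  let ?f = "\<lambda>s. \<epsilon>\<^sup>2 * fresh_rate \<epsilon> g X (V \<tau>) s"
  have c: "continuous_on {t0..t} ?f"
    using t by (intro continuous_intros continuous_on_subset[OF fresh_rate_continuous[OF g C_le tau eps]]) auto
  have f0: "0 \<le> ?f s" for s using rates_nonneg(1)[OF dens] by simp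
  have "ennreal (survival \<epsilon> g X t0) = ennreal (survival \<epsilon> g X t) + (\<integral>\<^sup>+ s. ennreal (?f s) * indicator {t0<..<t} s \<partial>lborel)"
    using later.survival_balance[OF t(2)] later.nn_integral_arrival[OF g, of t] by (simp only: V)
  also have "(\<integral>\<^sup>+ s. ennreal (?f s) * indicator {t0<..<t} s \<partial>lborel) = (\<integral>\<^sup>+ s. ennreal (?f s) * indicator {t0..t} s \<partial>lborel)"
  proof (rule nn_integral_cong_AE)
    have "AE s in lborel. s \<noteq> t0" "AE s in lborel. s \<noteq> t" by (rule AE_lborel_singleton)+
    then show "AE s in lborel. ennreal (?f s) * indicator {t0<..<t} s = ennreal (?f s) * indicator {t0..t} s"
      by eventually_elim (auto simp: indicator_def)
  qed
  also have "\<dots> = ennreal (integral {t0..t} ?f)"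
    using f0 by (rule nn_integral_has_integral_lebesgue'[OF _ integrable_integral[OF integrable_continuous_interval[OF c]]])
  finally have eq: "ennreal (survival \<epsilon> g X t0) = ennreal (survival \<epsilon> g X t) + ennreal (integral {t0..t} ?f)" .
  define J where "J = integral {t0..t} ?f"
  have J: "0 \<le> J" unfolding J_def using integrable_continuous_interval[OF c] f0 by (rule integral_nonneg)
  have s0: "0 \<le> survival \<epsilon> g X s" for s by (simp add: survival_def)
  have "ennreal (survival \<epsilon> g X t0) = ennreal (survival \<epsilon> g X t + J)"
    using eq unfolding J_def[symmetric] by (simp only: ennreal_plus[OF s0 J])
  then have "survival \<epsilon> g X t0 = survival \<epsilon> g X t + J"
    using s0 J by (subst (asm) ennreal_inj) (auto intro: add_nonneg_nonneg)
  then show ?thesis by (simp only: J_def)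
qed

theorem survival_derivative:
  assumes g: "background_admissible g" and t: "\<tau> < t"
  shows "(survival \<epsilon> g X has_real_derivative - (\<epsilon>\<^sup>2 * fresh_rate \<epsilon> g X (V \<tau>) t)) (at t)"
proof -
  let ?f = "\<lambda>s. \<epsilon>\<^sup>2 * fresh_rate \<epsilon> g X (V \<tau>) s"
  \<comment> \<open>Any base point strictly between \<tau> and \<open>t\<close> would do for the
    fundamental theorem of calculus.\<close>
  let ?a = "(\<tau> + t) / 2"
  have c: "continuous_on {?a..t + 1} ?f"
    using t by (intro continuous_intros continuous_on_subset[OF fresh_rate_continuous[OF g C_le tau eps]]) auto
  have "((\<lambda>s. integral {?a..s} ?f) has_real_derivative ?f t) (at t within {?a..t + 1})"
    using t by (intro integral_has_real_derivative[OF c]) auto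
  then have "((\<lambda>s. integral {?a..s} ?f) has_real_derivative ?f t) (at t within {?a<..<t + 1})"
    by (rule DERIV_subset) auto
  then have "((\<lambda>s. integral {?a..s} ?f) has_real_derivative ?f t) (at t)"
    using t by (subst (asm) at_within_open) auto
  then have D: "((\<lambda>s. survival \<epsilon> g X ?a - integral {?a..s} ?f) has_real_derivative - ?f t) (at t)"
    using DERIV_diff[OF DERIV_const[of "survival \<epsilon> g X ?a"]] by (simp only: diff_0)
  have E: "\<forall>\<^sub>F s in nhds t. survival \<epsilon> g X ?a - integral {?a..s} ?f = survival \<epsilon> g X s"
  proof -
    have "\<forall>\<^sub>F s in nhds t. s \<in> {?a<..}" using t by (intro eventually_nhds_in_open) auto
    then show ?thesis
    proof eventually_elim
      case (elim s)
      then show ?case using survival_integral[OF g, of ?a s] t by simp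
    qed
  qed
  show ?thesis by (rule iffD1[OF DERIV_cong_ev[OF refl E refl] D])
qed

end

section \<open>The probability that a background particle meets the path\<close>

lemma emeasure_torus_tube_slice:
  "emeasure lborel {y \<in> torus_cell. tdist x (y + c) \<le> r} \<le> emeasure lborel (cball (0::vec3) r)"
proof -
  let ?B = "cball (x - c) r"
  have "emeasure lborel {y \<in> torus_cell. tdist x (y + c) \<le> r} = (\<integral>\<^sup>+ y. indicator {y \<in> torus_cell. tdist x (y + c) \<le> r} y \<partial>lborel)"
    by (rule nn_integral_indicator[symmetric]) measurable
  also have "\<dots> \<le> (\<integral>\<^sup>+ y \<in> torus_cell. (\<integral>\<^sup>+ k. indicator ?B (y + k) \<partial>count_space int_lattice) \<partial>lborel)"
  proof (rule nn_integral_mono)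
    fix y
    show "indicator {y \<in> torus_cell. tdist x (y + c) \<le> r} y \<le> (\<integral>\<^sup>+ k. indicator ?B (y + k) \<partial>count_space int_lattice) * indicator torus_cell y"
    proof (cases "y \<in> torus_cell \<and> tdist x (y + c) \<le> r")
      case True
      \<comment> \<open>Some lift of \<open>y\<close> lies in the ball, so the number of lifts in
        the ball is at least 1 on the slice. Integrated over the cell, this number gives the volume
        of the ball, for every radius.\<close>
      then obtain k where k: "k \<in> int_lattice" "norm (x - (y + c) - k) \<le> r" by (auto simp: tdist_le_iff)
      have "x - (y + c) - k = x - c - (y + k)" by simp
      then have "y + k \<in> ?B" using k(2) by (simp only: mem_cball dist_norm)
      then have "(1::ennreal) \<le> (\<integral>\<^sup>+ l. indicator {k} l \<partial>count_space int_lattice)"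
        using k(1) by (subst nn_integral_indicator) auto
      also have "\<dots> \<le> (\<integral>\<^sup>+ k. indicator ?B (y + k) \<partial>count_space int_lattice)"
        using \<open>y + k \<in> ?B\<close> by (intro nn_integral_mono) (auto simp: indicator_def)
      finally show ?thesis using True by simp
    qed auto
  qed
  also have "\<dots> = (\<integral>\<^sup>+ y. indicator ?B y \<partial>lborel)" 
    by (rule nn_integral_fold[symmetric]) (rule borel_measurable_indicator, rule borel_closed, rule closed_cball)
  also have "\<dots> = emeasure lborel ?B" by simp
  also have "\<dots> = emeasure lborel (cball (0::vec3) r)"
  proof (cases "0 \<le> r")
    case True then show ?thesis by (simp add: emeasure_cball)
  qed simp
  finally show ?thesis .
qed

text \<open>The set of meeting positions is covered by balls of radius
  \<open>2 * \<epsilon>\<close>, one for each multiple of a time step during which particle and path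
  move at most \<epsilon> relative to each other.\<close>

lemma (in path) emeasure_tube:
  assumes V: "\<And>s. 0 \<le> s \<Longrightarrow> s \<le> T \<Longrightarrow> norm (V s) \<le> L" and L: "0 \<le> L" and t: "0 \<le> t" "t \<le> T" and e: "0 < \<epsilon>"
  shows "emeasure lborel {y \<in> torus_cell. \<not> apart \<epsilon> X t (y, w)}
    \<le> ennreal ((T * (L + norm w + 1) / \<epsilon> + 1) * ((2 * \<epsilon>) ^ 3 * unit_ball_vol 3))"
proof -
  let ?K = "L + norm w + 1"
  \<comment> \<open>The relative speed is at most \<open>L + norm w\<close>; the added 1 keeps the
    denominator positive.\<close>
  define \<delta> where "\<delta> = \<epsilon> / ?K"
  have K: "0 < ?K" using L by (simp add: add_nonneg_pos)
  then have d: "0 < \<delta>" using e by (simp add: \<delta>_def)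
  define n where "n = nat \<lfloor>T / \<delta>\<rfloor>"
  let ?S = "\<lambda>i::nat. {y \<in> torus_cell. tdist (X (i * \<delta>)) (y + (i * \<delta>) *\<^sub>R w) \<le> 2 * \<epsilon>}"
  have [measurable]: "?S i \<in> sets borel" for i by measurable
  have "{y \<in> torus_cell. \<not> apart \<epsilon> X t (y, w)} \<subseteq> (\<Union>i \<in> {..n}. ?S i)"
  proof
    fix y assume "y \<in> {y \<in> torus_cell. \<not> apart \<epsilon> X t (y, w)}"
    then have y: "y \<in> torus_cell" and "\<not> (\<forall>s \<in> {0..t}. \<epsilon> < tdist (X s) (y + s *\<^sub>R w))"
      using apart_path_iff[OF t(1), of \<epsilon> "(y, w)"] by auto
    then obtain s where s: "0 \<le> s" "s \<le> t" "tdist (X s) (y + s *\<^sub>R w) \<le> \<epsilon>"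
      by (auto simp: not_less)
    define i where "i = nat \<lfloor>s / \<delta>\<rfloor>"
    have "0 \<le> s / \<delta>" using s d by simp
    then have i: "real i \<le> s / \<delta>" "s / \<delta> < real i + 1" unfolding i_def by linarith+
    then have r: "i * \<delta> \<le> s" "s < i * \<delta> + \<delta>" using d by (auto simp: field_simps)
    have "s / \<delta> \<le> T / \<delta>" using s t d by (simp add: divide_right_mono)
    then have "i \<le> n" unfolding i_def n_def by (intro nat_mono floor_mono)
    have "norm (X s - X (i * \<delta>)) \<le> L * (s - i * \<delta>)"
    proof (rule displacement_le)
      show "0 \<le> i * \<delta>" using d by simp
      then show "norm (V q) \<le> L" if "i * \<delta> \<le> q" "q \<le> s" for q
        using that s t by (intro V) auto
    qed (rule r)
    then have "norm (X s - X (i * \<delta>)) \<le> L * \<delta>"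
      using L r mult_left_mono[of "s - i * \<delta>" \<delta> L] by linarith
    moreover have "norm ((s - i * \<delta>) *\<^sub>R w) \<le> \<delta> * norm w"
      using r by (simp add: mult_right_mono)
    moreover have eq: "(X (i * \<delta>) - (y + (i * \<delta>) *\<^sub>R w)) - (X s - (y + s *\<^sub>R w)) = (s - i * \<delta>) *\<^sub>R w - (X s - X (i * \<delta>))"
      by (simp add: algebra_simps)
    ultimately have "norm ((X (i * \<delta>) - (y + (i * \<delta>) *\<^sub>R w)) - (X s - (y + s *\<^sub>R w))) \<le> \<delta> * norm w + L * \<delta>"
      unfolding eq using norm_triangle_ineq4[of "(s - i * \<delta>) *\<^sub>R w" "X s - X (i * \<delta>)"] by linarith
    also have "\<dots> \<le> \<delta> * ?K" using d by (simp add: algebra_simps)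
    also have "\<dots> = \<epsilon>" using K by (simp add: \<delta>_def)
    finally have "tdist (X (i * \<delta>)) (y + (i * \<delta>) *\<^sub>R w) \<le> 2 * \<epsilon>"
      using s(3) tdist_lipschitz[of "X (i * \<delta>)" "y + (i * \<delta>) *\<^sub>R w" "X s" "y + s *\<^sub>R w"] by linarith
    then show "y \<in> (\<Union>i \<in> {..n}. ?S i)" using y \<open>i \<le> n\<close> by blast
  qed
  then have "emeasure lborel {y \<in> torus_cell. \<not> apart \<epsilon> X t (y, w)} \<le> emeasure lborel (\<Union>i \<in> {..n}. ?S i)"
    by (intro emeasure_mono) auto
  also have "\<dots> \<le> (\<Sum>i \<in> {..n}. emeasure lborel (?S i))" by (intro emeasure_subadditive_finite) auto
  also have "\<dots> \<le> (\<Sum>i \<in> {..n}. emeasure lborel (cball (0::vec3) (2 * \<epsilon>)))"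
    by (intro sum_mono emeasure_torus_tube_slice)
  also have "\<dots> = ennreal ((real n + 1) * ((2 * \<epsilon>) ^ 3 * unit_ball_vol 3))"
  proof -
    have "emeasure lborel (cball (0::vec3) (2 * \<epsilon>)) = ennreal ((2 * \<epsilon>) ^ 3 * unit_ball_vol 3)"
      using e by (subst emeasure_cball) (simp_all add: mult.commute)
    then have "(\<Sum>i \<in> {..n}. emeasure lborel (cball (0::vec3) (2 * \<epsilon>))) = of_nat (Suc n) * ennreal ((2 * \<epsilon>) ^ 3 * unit_ball_vol 3)"
      by (simp only: sum_constant card_atMost)
    also have "of_nat (Suc n) = ennreal (real n + 1)"
      by (subst ennreal_of_nat_eq_real_of_nat) (simp add: add.commute)
    finally show ?thesis using e by (simp only: ennreal_mult')
  qed
  also have "\<dots> \<le> ennreal ((T * ?K / \<epsilon> + 1) * ((2 * \<epsilon>) ^ 3 * unit_ball_vol 3))"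
  proof (intro ennreal_leI mult_right_mono add_right_mono)
    have "0 \<le> T / \<delta>" using t d by simp
    then have "real n \<le> T / \<delta>" unfolding n_def by linarith
    then show "real n \<le> T * ?K / \<epsilon>" by (simp add: \<delta>_def)
  qed (use e in auto)
  finally show ?thesis .
qed

text \<open>About \<open>1 / \<epsilon>\<close> balls of volume of order
  \<open>\<epsilon> ^ 3\<close> give \<open>\<epsilon>\<^sup>2\<close>, and the dependence on the
  particle speed is absorbed by the second moment of the background. \<open>B\<close> is uniform
  over all paths of speed at most \<open>L\<close>; this will make the survival probability positive
  for all good trees at once.\<close>

lemma encounter_probability:
  assumes g: "background_admissible g" and T: "0 \<le> T"
  obtains B where "0 \<le> B"
    "\<forall>\<epsilon> C X V L t. path C X V \<longrightarrow> (\<forall>s. 0 \<le> s \<and> s \<le> T \<longrightarrow> norm (V s) \<le> L) \<longrightarrow> 0 \<le> L \<longrightarrow> 0 \<le> t \<longrightarrow> t \<le> T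
      \<longrightarrow> 0 < \<epsilon> \<longrightarrow> \<epsilon> < 1 / 2 \<longrightarrow> 1 - survival \<epsilon> g X t \<le> B * \<epsilon>\<^sup>2 * (L + 2)"
proof -
  obtain b :: "vec3 \<Rightarrow> real" where b: "b \<in> borel_measurable borel" "\<And>w. 0 \<le> b w"
    "integrable lborel (\<lambda>w. b w * (1 + (norm w)\<^sup>2))" "AE w in lborel. \<forall>x. g x w \<le> b w"
    by (rule admissible_bound[OF g]) (rule that; assumption)
  have dens: "torus_density g" using g by (simp add: background_admissible_def)
  then have gm: "(\<lambda>z. g (fst z) (snd z)) \<in> borel_measurable borel" and g0: "\<And>x v. 0 \<le> g x v"
    by (auto simp: torus_density_def)
  interpret S: prob_space "state_law g" using dens by (rule prob_state_law)
  note [measurable] = b(1)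
  define I where "I = (LINT w|lborel. b w * (1 + (norm w)\<^sup>2))"
  have I: "0 \<le> I" unfolding I_def using b(2) by (intro Bochner_Integration.integral_nonneg) (simp add: add_nonneg_nonneg)
  \<comment> \<open>The 8 comes from the doubled radius, and \<open>T + 1\<close> from the number of
    time steps, since \<open>T * s + \<epsilon> \<le> (T + 1) * s\<close> for \<open>s\<close> at
    least \<epsilon>.\<close>
  define B where "B = 8 * unit_ball_vol 3 * (T + 1) * I"
  have B: "0 \<le> B" unfolding B_def using T I by simp
  show ?thesis
  proof (rule that[OF B], intro allI impI)
    fix \<epsilon> :: real and C X V and L t :: real
    assume p: "path C X V" and V: "\<forall>s. 0 \<le> s \<and> s \<le> T \<longrightarrow> norm (V s) \<le> L" and L: "0 \<le> L"
      and t: "0 \<le> t" "t \<le> T" and e: "0 < \<epsilon>" "\<epsilon> < 1 / 2"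
    interpret path C X V by fact
    let ?N = "{p. \<not> apart \<epsilon> X t p}"
    have N [measurable]: "?N \<in> sets borel" by measurable
    have vol: "emeasure lborel {y \<in> torus_cell. \<not> apart \<epsilon> X t (y, w)}
        \<le> ennreal (8 * unit_ball_vol 3 * (T + 1) * \<epsilon>\<^sup>2 * (L + 2) * (1 + (norm w)\<^sup>2))" for w
    proof -
      have w: "norm w \<le> 1 + (norm w)\<^sup>2"
        using zero_le_power2[of "norm w - 1/2"] by (simp add: power2_eq_square algebra_simps)
      have "L + norm w + 1 \<le> L + (1 + (norm w)\<^sup>2) + 1" using w by simp
      also have "\<dots> \<le> (L + 2) * (1 + (norm w)\<^sup>2)" using L mult_nonneg_nonneg[OF L zero_le_power2[of "norm w"]] by (simp add: algebra_simps)
      finally have 1: "L + norm w + 1 \<le> (L + 2) * (1 + (norm w)\<^sup>2)" .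
      have "1 \<le> L + norm w + 1" using L by simp
      then have "\<epsilon> \<le> (L + 2) * (1 + (norm w)\<^sup>2)" using 1 e by linarith
      moreover have "T * (L + norm w + 1) \<le> T * ((L + 2) * (1 + (norm w)\<^sup>2))" using 1 T by (intro mult_left_mono)
      ultimately have "T * (L + norm w + 1) + \<epsilon> \<le> (T + 1) * ((L + 2) * (1 + (norm w)\<^sup>2))" by (simp only: distrib_right mult_1_left)
      then have 2: "(T * (L + norm w + 1) + \<epsilon>) * (8 * \<epsilon>\<^sup>2 * unit_ball_vol 3) \<le> ((T + 1) * ((L + 2) * (1 + (norm w)\<^sup>2))) * (8 * \<epsilon>\<^sup>2 * unit_ball_vol 3)"
        by (intro mult_right_mono) auto
      have "(T * (L + norm w + 1) / \<epsilon> + 1) * ((2 * \<epsilon>) ^ 3 * unit_ball_vol 3) = (T * (L + norm w + 1) + \<epsilon>) * (8 * \<epsilon>\<^sup>2 * unit_ball_vol 3)"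
        using e by (simp add: field_simps power2_eq_square power3_eq_cube)
      also note 2
      also have "((T + 1) * ((L + 2) * (1 + (norm w)\<^sup>2))) * (8 * \<epsilon>\<^sup>2 * unit_ball_vol 3) = 8 * unit_ball_vol 3 * (T + 1) * \<epsilon>\<^sup>2 * (L + 2) * (1 + (norm w)\<^sup>2)"
        by (simp only: mult_ac)
      finally have "(T * (L + norm w + 1) / \<epsilon> + 1) * ((2 * \<epsilon>) ^ 3 * unit_ball_vol 3) \<le> 8 * unit_ball_vol 3 * (T + 1) * \<epsilon>\<^sup>2 * (L + 2) * (1 + (norm w)\<^sup>2)" .
      then show ?thesis using emeasure_tube[of T L t \<epsilon> w] V L t e by (meson ennreal_leI order.trans)
    qed
    have "ennreal (S.prob ?N) = (\<integral>\<^sup>+ p. indicator ?N p \<partial>state_law g)"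
      by (simp add: S.emeasure_eq_measure[symmetric])
    also have "\<dots> = (\<integral>\<^sup>+ w. \<integral>\<^sup>+ y. indicator torus_cell y * ennreal (g y w) * indicator ?N (y, w) \<partial>lborel \<partial>lborel)"
      by (rule nn_integral_state_law[OF gm]) simp
    also have "\<dots> \<le> (\<integral>\<^sup>+ w. ennreal (b w) * ennreal (8 * unit_ball_vol 3 * (T + 1) * \<epsilon>\<^sup>2 * (L + 2) * (1 + (norm w)\<^sup>2)) \<partial>lborel)"
    proof (rule nn_integral_mono_AE)
      show "AE w in lborel. (\<integral>\<^sup>+ y. indicator torus_cell y * ennreal (g y w) * indicator ?N (y, w) \<partial>lborel)
          \<le> ennreal (b w) * ennreal (8 * unit_ball_vol 3 * (T + 1) * \<epsilon>\<^sup>2 * (L + 2) * (1 + (norm w)\<^sup>2))"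
        using b(4)
      proof eventually_elim
        case (elim w)
        have m: "{y \<in> torus_cell. \<not> apart \<epsilon> X t (y, w)} \<in> sets borel"
        proof -
          have [measurable]: "(\<lambda>y. (y, w)) \<in> borel_measurable borel" by (intro borel_measurable_continuous_onI continuous_intros)
          show ?thesis by measurable
        qed
        have "(\<integral>\<^sup>+ y. indicator torus_cell y * ennreal (g y w) * indicator ?N (y, w) \<partial>lborel)
          \<le> (\<integral>\<^sup>+ y. ennreal (b w) * indicator {y \<in> torus_cell. \<not> apart \<epsilon> X t (y, w)} y \<partial>lborel)"
          using elim by (intro nn_integral_mono) (auto simp: indicator_def ennreal_leI)
        also have "\<dots> = ennreal (b w) * emeasure lborel {y \<in> torus_cell. \<not> apart \<epsilon> X t (y, w)}"
          using m by (intro nn_integral_cmult_indicator) simp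
        finally show ?case using mult_left_mono[OF vol[of w], of "ennreal (b w)"] by (meson order.trans zero_le)
      qed
    qed
    also have "\<dots> = (\<integral>\<^sup>+ w. ennreal ((8 * unit_ball_vol 3 * (T + 1) * \<epsilon>\<^sup>2 * (L + 2)) * (b w * (1 + (norm w)\<^sup>2))) \<partial>lborel)"
      using b(2) T L by (intro nn_integral_cong) (simp add: ennreal_mult[symmetric] mult_ac)
    also have "\<dots> = ennreal (LINT w|lborel. (8 * unit_ball_vol 3 * (T + 1) * \<epsilon>\<^sup>2 * (L + 2)) * (b w * (1 + (norm w)\<^sup>2)))"
      using b(2) T L by (intro nn_integral_eq_integral integrable_mult_right b(3)) (auto intro!: mult_nonneg_nonneg add_nonneg_nonneg)
    also have "\<dots> = ennreal (B * \<epsilon>\<^sup>2 * (L + 2))"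
      unfolding integral_mult_right_zero B_def I_def by (simp only: mult_ac)
    finally have "S.prob ?N \<le> B * \<epsilon>\<^sup>2 * (L + 2)"
      using B L by (subst (asm) ennreal_le_iff) auto
    moreover have "S.prob ?N = 1 - survival \<epsilon> g X t"
    proof -
      have "?N = space (state_law g) - {p. apart \<epsilon> X t p}" by auto
      then show ?thesis unfolding survival_def by (simp only:) (rule S.prob_compl, simp)
    qed
    ultimately show "1 - survival \<epsilon> g X t \<le> B * \<epsilon>\<^sup>2 * (L + 2)" by simp
  qed
qed


section \<open>Root paths and collision chains\<close>

lemma root_from_start: "(\<And>c. c \<in> set cs \<Longrightarrow> r < fst c) \<Longrightarrow> root_from r z cs r = z"
proof (cases cs)
  case (Cons c cs')
  assume "\<And>c. c \<in> set cs \<Longrightarrow> r < fst c"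
  then have "r < fst c" using Cons by simp
  then show ?thesis using Cons by (cases z; cases c) simp
qed (cases z, simp)

lemma root_from_flight:
  assumes "sorted_wrt (<) (map fst cs)" "\<And>c. c \<in> set cs \<Longrightarrow> r0 \<le> fst c" "r0 \<le> r" "r \<le> s"
  shows "(fst ` set cs \<inter> {r<..<s} = {} \<longrightarrow>
      fst (root_from r0 z cs s) = fst (root_from r0 z cs r) + (s - r) *\<^sub>R snd (root_from r0 z cs r)) \<and>
    (fst ` set cs \<inter> {r<..s} = {} \<longrightarrow> snd (root_from r0 z cs s) = snd (root_from r0 z cs r))"
  using assms
proof (induction cs arbitrary: r0 z r s)
  case Nil
  then show ?case by (cases z) (simp add: algebra_simps)
next
  case (Cons c cs)
  obtain x v where z: "z = (x, v)" by fastforce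
  obtain t \<nu> w where c: "c = (t, \<nu>, w)" by (metis prod.exhaust)
  have t: "r0 \<le> t" using Cons.prems(2)[of c] by (simp add: c)
  have gt: "t < fst d" if "d \<in> set cs" for d using Cons.prems(1) that by (auto simp: c)
  have so: "sorted_wrt (<) (map fst cs)" using Cons.prems(1) by simp
  let ?z' = "(x + (t - r0) *\<^sub>R v, tagged_after \<nu> v w)"
  have st: "root_from t ?z' cs t = ?z'" using gt by (intro root_from_start)
  show ?case
  proof (cases "s < t")
    case True
    then show ?thesis using Cons.prems(4) by (simp add: z c algebra_simps)
  next
    case False
    show ?thesis
    proof (cases "r < t")
      case True
      show ?thesis
      proof (cases "s = t")
        case True
        then show ?thesis using \<open>r < t\<close> st by (simp add: z c algebra_simps)
      next
        case False
        then have "t \<in> fst ` set (c # cs) \<inter> {r<..<s}" "t \<in> fst ` set (c # cs) \<inter> {r<..s}"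
          using \<open>\<not> s < t\<close> \<open>r < t\<close> by (auto simp: c)
        then show ?thesis by blast
      qed
    next
      case False
      then have "t \<le> r" by simp
      from Cons.IH[OF so less_imp_le[OF gt] this Cons.prems(4), of ?z'] show ?thesis
        using \<open>\<not> s < t\<close> False by (auto simp: z c)
    qed
  qed
qed

text \<open>\<open>root_from\<close> recurses from the first collision, whereas parents and
  truncations remove collisions at the end. This is the recursion from that side.\<close>

lemma root_from_append:
  assumes "sorted_wrt (<) (map fst (cs @ [(t, \<nu>, w)]))"
  shows "root_from r z (cs @ [(t, \<nu>, w)]) s =
    (if s < t then root_from r z cs s
     else (fst (root_from r z cs t) + (s - t) *\<^sub>R tagged_after \<nu> (snd (root_from r z cs t)) w,
           tagged_after \<nu> (snd (root_from r z cs t)) w))"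
  using assms
proof (induction cs arbitrary: r z)
  case Nil
  then show ?case by (cases z) simp
next
  case (Cons c cs)
  obtain x v where z: "z = (x, v)" by fastforce
  obtain t1 \<nu>1 w1 where c: "c = (t1, \<nu>1, w1)" by (metis prod.exhaust)
  have "t1 < t" using Cons.prems by (simp add: c)
  moreover have "sorted_wrt (<) (map fst (cs @ [(t, \<nu>, w)]))" using Cons.prems by simp
  ultimately show ?case using Cons.IH by (simp add: z c)
qed

lemma measurable_root_from:
  assumes c: "\<And>j. j < n \<Longrightarrow> (\<lambda>k. c k j) \<in> K \<rightarrow>\<^sub>M borel \<Otimes>\<^sub>M (borel \<Otimes>\<^sub>M borel)"
    and "r \<in> borel_measurable K" "x \<in> borel_measurable K" "v \<in> borel_measurable K" "s \<in> borel_measurable K"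
  shows "(\<lambda>k. root_from (r k) (x k, v k) (map (c k) [m..<n]) (s k)) \<in> K \<rightarrow>\<^sub>M borel \<Otimes>\<^sub>M borel"
  using assms(2-)
proof (induction "n - m" arbitrary: m r x v)
  case 0
  note [measurable] = "0.prems"
  have e: "[m..<n] = []" using 0 by simp
  show ?case unfolding e by simp
next
  case (Suc d)
  note [measurable] = Suc.prems
  have m: "m < n" using Suc.hyps(2) by simp
  then have [measurable]: "(\<lambda>k. c k m) \<in> K \<rightarrow>\<^sub>M borel \<Otimes>\<^sub>M (borel \<Otimes>\<^sub>M borel)" by (rule c)
  have e: "[m..<n] = m # [Suc m..<n]" using m by (rule upt_conv_Cons)
  have [measurable]: "(\<lambda>k. tagged_after (fst (snd (c k m))) (v k) (snd (snd (c k m)))) \<in> borel_measurable K"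
    unfolding tagged_after_def by measurable
  have [measurable]: "(\<lambda>k. root_from (fst (c k m)) (x k + (fst (c k m) - r k) *\<^sub>R v k,
      tagged_after (fst (snd (c k m))) (v k) (snd (snd (c k m)))) (map (c k) [Suc m..<n]) (s k)) \<in> K \<rightarrow>\<^sub>M borel \<Otimes>\<^sub>M borel"
    using Suc.hyps(2) by (intro Suc.hyps(1)) measurable
  have r: "root_from (r k) (x k, v k) (map (c k) [m..<n]) (s k) =
     (if s k < fst (c k m) then (x k + (s k - r k) *\<^sub>R v k, v k)
      else root_from (fst (c k m)) (x k + (fst (c k m) - r k) *\<^sub>R v k,
      tagged_after (fst (snd (c k m))) (v k) (snd (snd (c k m)))) (map (c k) [Suc m..<n]) (s k))" for k
    unfolding e by (cases "c k m") simp
  show ?case unfolding r by measurable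
qed

lemma measurable_root:
  assumes z: "z \<in> borel_measurable K"
    and c: "\<And>j. j < n \<Longrightarrow> (\<lambda>k. c k j) \<in> K \<rightarrow>\<^sub>M borel \<Otimes>\<^sub>M (borel \<Otimes>\<^sub>M borel)"
    and s: "s \<in> borel_measurable K"
  shows "(\<lambda>k. root_pos (mk_tree n (z k, c k)) (s k)) \<in> borel_measurable K"
    and "(\<lambda>k. root_vel (mk_tree n (z k, c k)) (s k)) \<in> borel_measurable K"
proof -
  have "(\<lambda>k. root_from 0 (fst (z k), snd (z k)) (map (c k) [0..<n]) (s k)) \<in> K \<rightarrow>\<^sub>M borel \<Otimes>\<^sub>M borel"
    using c s borel_measurable_fst[OF z] borel_measurable_snd[OF z] by (intro measurable_root_from) auto
  then show "(\<lambda>k. root_pos (mk_tree n (z k, c k)) (s k)) \<in> borel_measurable K"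
    "(\<lambda>k. root_vel (mk_tree n (z k, c k)) (s k)) \<in> borel_measurable K"
    unfolding root_pos_def root_vel_def mk_tree_def by simp_all
qed

lemma mk_tree_sel [simp]: "fst (mk_tree n y) = fst y" "n_coll (mk_tree n y) = n"
  by (simp_all add: mk_tree_def n_coll_def)

lemma coll_mk_tree [simp]:
  assumes "j < n"
  shows "coll_time (mk_tree n y) j = fst (snd y j)" "coll_param (mk_tree n y) j = fst (snd (snd y j))"
    "coll_vel (mk_tree n y) j = snd (snd (snd y j))"
  using assms by (simp_all add: mk_tree_def coll_time_def coll_param_def coll_vel_def)

lemma truncate_mk_tree: "j \<le> n \<Longrightarrow> truncate_tree j (mk_tree n y) = mk_tree j y"
  by (simp add: truncate_tree_def mk_tree_def take_map)

lemma last_time_mk_tree: "last_time (mk_tree n y) = (if n = 0 then 0 else fst (snd y (n - 1)))"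
  by (simp add: last_time_def)

lemma mk_tree_Suc: "mk_tree (Suc n) (z, c) = (z, snd (mk_tree n (z, c)) @ [c n])"
  by (simp add: mk_tree_def)

lemma mk_tree_upd: "mk_tree n (z, c(n := m)) = mk_tree n (z, c)"
  by (simp add: mk_tree_def)

lemma mk_tree_cong: "(\<And>j. j < n \<Longrightarrow> c j = d j) \<Longrightarrow> mk_tree n (z, c) = mk_tree n (z, d)"
  by (simp add: mk_tree_def)

text \<open>What the path of a tree needs. Unlike \<open>collision_trees\<close> it asks neither for
  a start in the cell nor for an upper bound on times, so it also applies to trees built up from
  particles in a chain.\<close>

definition timely :: "tree \<Rightarrow> bool" where
  "timely \<Phi> \<longleftrightarrow> sorted_wrt (<) (map fst (snd \<Phi>)) \<and> (\<forall>c \<in> set (snd \<Phi>). 0 \<le> fst c)"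

lemma measurable_mark_borel: "f \<in> M \<rightarrow>\<^sub>M borel \<Otimes>\<^sub>M (borel \<Otimes>\<^sub>M borel) \<longleftrightarrow> f \<in> M \<rightarrow>\<^sub>M mark_measure"
  by (intro iffI; simp cong: measurable_cong_sets sets_pair_measure_cong)

lemma tree_mk: "\<Phi> = mk_tree (n_coll \<Phi>) (fst \<Phi>, \<lambda>j. snd \<Phi> ! j)"
  by (simp add: mk_tree_def n_coll_def map_nth prod_eq_iff)

lemma measurable_root_pos [measurable]: "root_pos \<Phi> \<in> borel_measurable borel"
  by (subst tree_mk, rule measurable_root(1)) (auto simp: space_pair_measure)

lemma path_root:
  assumes "timely \<Phi>"
  shows "path (fst ` set (snd \<Phi>)) (root_pos \<Phi>) (root_vel \<Phi>)"
proof
  show "free_flight t (fst ` set (snd \<Phi>)) (root_pos \<Phi>) (root_vel \<Phi>)" for t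
    using root_from_flight[of "snd \<Phi>" 0] assms
    unfolding free_flight_def root_pos_def root_vel_def timely_def by blast
qed auto

lemma timely_truncate: "timely \<Phi> \<Longrightarrow> timely (truncate_tree j \<Phi>)"
  unfolding timely_def truncate_tree_def
  by (auto simp: take_map[symmetric] dest: in_set_takeD intro: sorted_wrt_take)

lemma sorted_coll_time: "timely \<Phi> \<Longrightarrow> i < j \<Longrightarrow> j < n_coll \<Phi> \<Longrightarrow> coll_time \<Phi> i < coll_time \<Phi> j"
  unfolding timely_def coll_time_def n_coll_def by (auto simp: sorted_wrt_iff_nth_less)

lemma coll_times: "fst ` set (snd \<Phi>) = coll_time \<Phi> ` {..<n_coll \<Phi>}"
  by (auto simp: coll_time_def n_coll_def set_conv_nth image_iff)

lemma coll_time_nonneg: "timely \<Phi> \<Longrightarrow> j < n_coll \<Phi> \<Longrightarrow> 0 \<le> coll_time \<Phi> j"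
  by (auto simp: timely_def coll_time_def n_coll_def)

lemma last_time_nonneg: "timely \<Phi> \<Longrightarrow> 0 \<le> last_time \<Phi>"
  by (simp add: last_time_def coll_time_nonneg)

lemma coll_time_le_last: "timely \<Phi> \<Longrightarrow> j < n_coll \<Phi> \<Longrightarrow> coll_time \<Phi> j \<le> last_time \<Phi>"
proof -
  assume a: "timely \<Phi>" "j < n_coll \<Phi>"
  then consider "j = n_coll \<Phi> - 1" | "j < n_coll \<Phi> - 1" by linarith
  then show ?thesis
    using sorted_coll_time[of \<Phi> j "n_coll \<Phi> - 1"] a by cases (auto simp: last_time_def less_imp_le)
qed

lemma path_tail_root:
  assumes "timely \<Phi>" "0 < \<epsilon>" "\<epsilon> < 1 / 2" "torus_density g"
  shows "path_tail (fst ` set (snd \<Phi>)) (root_pos \<Phi>) (root_vel \<Phi>) (last_time \<Phi>) \<epsilon> g"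
proof -
  interpret path "fst ` set (snd \<Phi>)" "root_pos \<Phi>" "root_vel \<Phi>" using assms(1) by (rule path_root)
  show ?thesis
    using assms coll_time_le_last[OF assms(1)] last_time_nonneg[OF assms(1)]
    by unfold_locales (auto simp: coll_times)
qed

text \<open>Positions agree up to and including the removed collision, velocities only strictly
  before it, because the velocity is continuous from the right.\<close>

lemma root_truncate:
  assumes "timely \<Phi>" "j < n_coll \<Phi>"
  shows "s < coll_time \<Phi> j \<Longrightarrow> root_pos (truncate_tree j \<Phi>) s = root_pos \<Phi> s \<and> root_vel (truncate_tree j \<Phi>) s = root_vel \<Phi> s"
    and "s \<le> coll_time \<Phi> j \<Longrightarrow> root_pos (truncate_tree j \<Phi>) s = root_pos \<Phi> s"
    and "root_vel \<Phi> (coll_time \<Phi> j) = tagged_after (coll_param \<Phi> j) (pre_vel \<Phi> j) (coll_vel \<Phi> j)"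
proof -
  \<comment> \<open>Stated for all prefixes of length at least \<open>j\<close>, so that induction
    can append one collision at a time; the full tree is the last case.\<close>
  have gen: "(s < coll_time \<Phi> j \<longrightarrow> root_from 0 (fst \<Phi>) (take j (snd \<Phi>)) s = root_from 0 (fst \<Phi>) (take m (snd \<Phi>)) s) \<and>
    (s \<le> coll_time \<Phi> j \<longrightarrow> fst (root_from 0 (fst \<Phi>) (take j (snd \<Phi>)) s) = fst (root_from 0 (fst \<Phi>) (take m (snd \<Phi>)) s)) \<and>
    (j < m \<longrightarrow> snd (root_from 0 (fst \<Phi>) (take m (snd \<Phi>)) (coll_time \<Phi> j)) = tagged_after (coll_param \<Phi> j) (pre_vel \<Phi> j) (coll_vel \<Phi> j))"
    if "j \<le> m" "m \<le> n_coll \<Phi>" for m s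
    using that
  proof (induction m rule: dec_induct)
    case base
    then show ?case by simp
  next
    case (step m)
    have m: "m < length (snd \<Phi>)" using step by (simp add: n_coll_def)
    obtain t \<nu> w where c: "snd \<Phi> ! m = (t, \<nu>, w)" by (metis prod.exhaust)
    have tk: "take (Suc m) (snd \<Phi>) = take m (snd \<Phi>) @ [(t, \<nu>, w)]" using take_Suc_conv_app_nth[OF m] c by simp
    have so: "sorted_wrt (<) (map fst (take m (snd \<Phi>) @ [(t, \<nu>, w)]))"
      using timely_truncate[OF assms(1), of "Suc m"] unfolding timely_def truncate_tree_def by (simp add: tk)
    note ap = root_from_append[OF so, of 0 "fst \<Phi>"]
    have t: "t = coll_time \<Phi> m" by (simp add: coll_time_def c)
    show ?case
    proof (cases "j = m")
      case True
      then show ?thesis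
        unfolding tk ap using c t
        by (auto simp: pre_vel_def truncate_tree_def root_vel_def coll_param_def coll_vel_def)
    next
      case False
      then have "coll_time \<Phi> j < t" unfolding t using step assms by (intro sorted_coll_time) (auto simp: n_coll_def)
      then show ?thesis unfolding tk ap using step False by (auto simp: n_coll_def)
    qed
  qed
  have a: "take (n_coll \<Phi>) (snd \<Phi>) = snd \<Phi>" by (simp add: n_coll_def)
  note G = gen[OF less_imp_le[OF assms(2)] order.refl, unfolded a]
  show "s < coll_time \<Phi> j \<Longrightarrow> root_pos (truncate_tree j \<Phi>) s = root_pos \<Phi> s \<and> root_vel (truncate_tree j \<Phi>) s = root_vel \<Phi> s"
    "s \<le> coll_time \<Phi> j \<Longrightarrow> root_pos (truncate_tree j \<Phi>) s = root_pos \<Phi> s"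
    "root_vel \<Phi> (coll_time \<Phi> j) = tagged_after (coll_param \<Phi> j) (pre_vel \<Phi> j) (coll_vel \<Phi> j)"
    using G[of s] G[of 0] assms(2) by (auto simp: truncate_tree_def root_pos_def root_vel_def)
qed

lemma pre_vel_tail:
  assumes "timely \<Phi>" "j < n_coll \<Phi>"
  shows "pre_vel \<Phi> j = root_vel (truncate_tree j \<Phi>) (last_time (truncate_tree j \<Phi>))"
proof -
  let ?\<Psi> = "truncate_tree j \<Phi>"
  have t: "timely ?\<Psi>" using assms(1) by (rule timely_truncate)
  interpret path "fst ` set (snd ?\<Psi>)" "root_pos ?\<Psi>" "root_vel ?\<Psi>" using t by (rule path_root)
  have n: "n_coll ?\<Psi> = j" using assms(2) by (simp add: truncate_tree_def n_coll_def)
  have ct: "coll_time ?\<Psi> i = coll_time \<Phi> i" if "i < j" for i using that by (simp add: truncate_tree_def coll_time_def)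
  have l: "last_time ?\<Psi> \<le> coll_time \<Phi> j"
    using n ct sorted_coll_time[OF assms(1), of "j - 1" j] assms coll_time_nonneg[OF assms]
    by (auto simp: last_time_def intro: less_imp_le)
  have "root_vel ?\<Psi> (coll_time \<Phi> j) = root_vel ?\<Psi> (last_time ?\<Psi>)"
    using l last_time_nonneg[OF t] coll_time_le_last[OF t]
    by (intro steady) (force simp: coll_times)+
  then show ?thesis by (simp add: pre_vel_def)
qed

text \<open>
  Successive collisions of a root in state \<open>z\<close> with the free particles \<open>p 0\<close>, \<open>p 1\<close>, ...: the mark of
  collision \<open>j\<close> is the first contact of \<open>p j\<close> with the root that has suffered the earlier collisions.
\<close>

primrec chain :: "real \<Rightarrow> nat \<Rightarrow> state \<Rightarrow> (nat \<Rightarrow> state) \<Rightarrow> nat \<Rightarrow> mark" where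
  "chain \<epsilon> 0 z p = (\<lambda>_. undefined)"
| "chain \<epsilon> (Suc n) z p =
    (chain \<epsilon> n z p)(n := contact_mark \<epsilon> (root_pos (mk_tree n (z, chain \<epsilon> n z p))) (p n))"

definition tree_hit :: "real \<Rightarrow> real \<Rightarrow> tree \<Rightarrow> state \<Rightarrow> bool" where
  "tree_hit \<epsilon> h \<Phi> = hit \<epsilon> (root_pos \<Phi>) (root_vel \<Phi> (last_time \<Phi>)) (last_time \<Phi>) h"

primrec chain_ok :: "real \<Rightarrow> real \<Rightarrow> nat \<Rightarrow> state \<Rightarrow> (nat \<Rightarrow> state) \<Rightarrow> bool" where
  "chain_ok \<epsilon> h 0 z p = True"
| "chain_ok \<epsilon> h (Suc n) z p \<longleftrightarrow> chain_ok \<epsilon> h n z p \<and> tree_hit \<epsilon> h (mk_tree n (z, chain \<epsilon> n z p)) (p n)"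

text \<open>The window of length \<open>h\<close> after the previous collision is open at both ends.
  It will be used with \<open>h = T + 1\<close>, so that a collision at time \<open>T\<close> itself
  is still inside.\<close>

definition marks_ok :: "real \<Rightarrow> nat \<Rightarrow> state \<Rightarrow> (nat \<Rightarrow> mark) \<Rightarrow> bool" where
  "marks_ok h n z c \<longleftrightarrow>
    (\<forall>j<n. last_time (mk_tree j (z, c)) < fst (c j) \<and> fst (c j) < last_time (mk_tree j (z, c)) + h)"

definition marks_weight :: "real \<Rightarrow> (vec3 \<Rightarrow> vec3 \<Rightarrow> real) \<Rightarrow> nat \<Rightarrow> state \<Rightarrow> (nat \<Rightarrow> mark) \<Rightarrow> ennreal" where
  "marks_weight \<epsilon> g n z c =
    (\<Prod>j<n. arrival \<epsilon> g (root_pos (mk_tree j (z, c))) (root_vel (mk_tree j (z, c)) (last_time (mk_tree j (z, c)))) (c j))"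

lemma chain_cong: "(\<And>j. j < n \<Longrightarrow> p j = q j) \<Longrightarrow> chain \<epsilon> n z p = chain \<epsilon> n z q"
  by (induction n) auto

lemma chain_ok_cong: "(\<And>j. j < n \<Longrightarrow> p j = q j) \<Longrightarrow> chain_ok \<epsilon> h n z p = chain_ok \<epsilon> h n z q"
proof (induction n)
  case (Suc n)
  moreover have "chain \<epsilon> n z p = chain \<epsilon> n z q" using Suc.prems by (intro chain_cong) auto
  ultimately show ?case by simp
qed simp

lemma chain_prefix: "j \<le> n \<Longrightarrow> mk_tree j (z, chain \<epsilon> n z p) = mk_tree j (z, chain \<epsilon> j z p)"
proof (induction n)
  case (Suc n)
  show ?case
  proof (cases "j = Suc n")
    case False
    then have "j \<le> n" using Suc.prems by simp
    then have "mk_tree j (z, chain \<epsilon> (Suc n) z p) = mk_tree j (z, chain \<epsilon> n z p)"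
      by (intro mk_tree_cong) auto
    then show ?thesis using Suc.IH[OF \<open>j \<le> n\<close>] by (rule trans)
  qed simp
qed simp

lemma chain_at: "j < n \<Longrightarrow> chain \<epsilon> n z p j = contact_mark \<epsilon> (root_pos (mk_tree j (z, chain \<epsilon> j z p))) (p j)"
  by (induction n) (auto simp: less_Suc_eq)

lemma marks_ok_Suc:
  "marks_ok h (Suc n) z c \<longleftrightarrow> marks_ok h n z c \<and> last_time (mk_tree n (z, c)) < fst (c n) \<and> fst (c n) < last_time (mk_tree n (z, c)) + h"
  by (auto simp: marks_ok_def less_Suc_eq)

lemma marks_ok_upd: "marks_ok h n z (c(n := m)) = marks_ok h n z c"
proof -
  have "mk_tree j (z, c(n := m)) = mk_tree j (z, c)" if "j < n" for j
    using that by (intro mk_tree_cong) auto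
  then show ?thesis by (simp add: marks_ok_def)
qed

lemma marks_weight_upd: "marks_weight \<epsilon> g n z (c(n := m)) = marks_weight \<epsilon> g n z c"
proof -
  have "mk_tree j (z, c(n := m)) = mk_tree j (z, c)" if "j < n" for j
    using that by (intro mk_tree_cong) auto
  then show ?thesis by (simp add: marks_weight_def)
qed

lemma timely_marks: "marks_ok h n z c \<Longrightarrow> timely (mk_tree n (z, c))"
proof (induction n)
  case 0
  then show ?case by (simp add: timely_def mk_tree_def)
next
  case (Suc n)
  then have t: "timely (mk_tree n (z, c))" and l: "last_time (mk_tree n (z, c)) < fst (c n)"
    by (auto simp: marks_ok_Suc)
  have "fst d < fst (c n)" if "d \<in> set (snd (mk_tree n (z, c)))" for d
  proof -
    have "fst d \<in> fst ` set (snd (mk_tree n (z, c)))" using that by simp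
    then obtain j where "j < n" "fst d = coll_time (mk_tree n (z, c)) j" by (auto simp: coll_times)
    then show ?thesis using coll_time_le_last[OF t, of j] l by simp
  qed
  then show ?case
    using t l last_time_nonneg[OF t]
    unfolding mk_tree_Suc timely_def by (auto simp: sorted_wrt_append)
qed

lemma chain_marks_ok: "chain_ok \<epsilon> h n z p \<Longrightarrow> marks_ok h n z (chain \<epsilon> n z p)"
proof (induction n)
  case 0
  then show ?case by (simp add: marks_ok_def)
next
  case (Suc n)
  then have "marks_ok h n z (chain \<epsilon> n z p)" "tree_hit \<epsilon> h (mk_tree n (z, chain \<epsilon> n z p)) (p n)" by auto
  then show ?case
    unfolding chain.simps marks_ok_Suc marks_ok_upd mk_tree_upd
    by (auto simp: tree_hit_def hit_def Let_def)
qed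

lemma measurable_tree_root:
  assumes z: "z \<in> borel_measurable K" and c: "c \<in> K \<rightarrow>\<^sub>M (\<Pi>\<^sub>M j\<in>{..<n}. mark_measure)" and m: "m \<le> n"
  shows "s \<in> borel_measurable K \<Longrightarrow> (\<lambda>k. root_pos (mk_tree m (z k, c k)) (s k)) \<in> borel_measurable K"
    and "(\<lambda>k. last_time (mk_tree m (z k, c k))) \<in> borel_measurable K"
    and "(\<lambda>k. root_vel (mk_tree m (z k, c k)) (last_time (mk_tree m (z k, c k)))) \<in> borel_measurable K"
    and "case_prod (\<lambda>k. root_pos (mk_tree m (z k, c k))) \<in> borel_measurable (K \<Otimes>\<^sub>M borel)"
proof -
  have cj: "(\<lambda>k. c k j) \<in> K \<rightarrow>\<^sub>M borel \<Otimes>\<^sub>M (borel \<Otimes>\<^sub>M borel)" if "j < n" for j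
    unfolding measurable_mark_borel using c that by (auto intro: measurable_component_singleton[THEN measurable_compose[rotated]])
  show "(\<lambda>k. root_pos (mk_tree m (z k, c k)) (s k)) \<in> borel_measurable K" if "s \<in> borel_measurable K"
    using that m cj by (intro measurable_root(1) z) auto
  show l: "(\<lambda>k. last_time (mk_tree m (z k, c k))) \<in> borel_measurable K"
  proof (cases m)
    case (Suc i)
    then have [measurable]: "(\<lambda>k. c k i) \<in> K \<rightarrow>\<^sub>M borel \<Otimes>\<^sub>M (borel \<Otimes>\<^sub>M borel)" using m by (intro cj) auto
    have "(\<lambda>k. fst (c k i)) \<in> borel_measurable K" by measurable
    then show ?thesis by (simp add: Suc last_time_mk_tree)
  qed (simp add: last_time_mk_tree)
  show "(\<lambda>k. root_vel (mk_tree m (z k, c k)) (last_time (mk_tree m (z k, c k)))) \<in> borel_measurable K"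
    using m cj l by (intro measurable_root(2) z) auto
  have "(\<lambda>x. root_pos (mk_tree m (z (fst x), c (fst x))) (snd x)) \<in> borel_measurable (K \<Otimes>\<^sub>M borel)"
  proof (rule measurable_root(1)[where z = "\<lambda>x. z (fst x)" and c = "\<lambda>x. c (fst x)"])
    show "(\<lambda>x. z (fst x)) \<in> borel_measurable (K \<Otimes>\<^sub>M borel)" using z by measurable
    show "(\<lambda>x. c (fst x) j) \<in> K \<Otimes>\<^sub>M borel \<rightarrow>\<^sub>M borel \<Otimes>\<^sub>M (borel \<Otimes>\<^sub>M borel)" if "j < m" for j
      using measurable_compose[OF measurable_fst cj[of j]] that m by simp
  qed measurable
  then show "case_prod (\<lambda>k. root_pos (mk_tree m (z k, c k))) \<in> borel_measurable (K \<Otimes>\<^sub>M borel)"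
    by (simp add: case_prod_beta')
qed

lemma measurable_chain:
  assumes z: "z \<in> borel_measurable K" and p: "\<And>j. j < n \<Longrightarrow> (\<lambda>k. p k j) \<in> borel_measurable K"
  shows "(\<lambda>k. chain \<epsilon> n (z k) (p k)) \<in> K \<rightarrow>\<^sub>M (\<Pi>\<^sub>M j\<in>{..<n}. mark_measure)"
    and "Measurable.pred K (\<lambda>k. chain_ok \<epsilon> h n (z k) (p k))"
  using p
proof (induction n)
  case 0
  { case 1 show ?case by (auto intro!: measurable_PiM_single' simp: space_PiM PiE_def extensional_def) }
  { case 2 show ?case by simp }
next
  case (Suc n)
  have p: "(\<lambda>k. p k n) \<in> borel_measurable K" if "\<And>j. j < Suc n \<Longrightarrow> (\<lambda>k. p k j) \<in> borel_measurable K" using that by simp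
  have IH: "(\<lambda>k. chain \<epsilon> n (z k) (p k)) \<in> K \<rightarrow>\<^sub>M (\<Pi>\<^sub>M j\<in>{..<n}. mark_measure)"
    "Measurable.pred K (\<lambda>k. chain_ok \<epsilon> h n (z k) (p k))"
    if "\<And>j. j < Suc n \<Longrightarrow> (\<lambda>k. p k j) \<in> borel_measurable K"
    using Suc.IH that by auto
  { case 1
    note r = measurable_tree_root(4)[OF z IH(1)[OF 1] order.refl]
    have m: "(\<lambda>k. contact_mark \<epsilon> (root_pos (mk_tree n (z k, chain \<epsilon> n (z k) (p k)))) (p k n)) \<in> K \<rightarrow>\<^sub>M mark_measure"
      unfolding measurable_mark_borel[symmetric] by (rule measurable_contact_mark[OF r p[OF 1]])
    show ?case unfolding chain.simps
      by (rule measurable_fun_upd[OF _ IH(1)[OF 1] m]) auto }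
  { case 2
    note r = measurable_tree_root[OF z IH(1)[OF 2] order.refl]
    have "Measurable.pred K (\<lambda>k. tree_hit \<epsilon> h (mk_tree n (z k, chain \<epsilon> n (z k) (p k))) (p k n))"
      unfolding tree_hit_def by (rule measurable_hit[OF r(4) p[OF 2] r(3) r(2)])
    then show ?case using IH(2)[OF 2] by simp }
qed

lemma sigma_finite_mark: "sigma_finite_measure mark_measure"
proof -
  interpret sl: pair_sigma_finite sphere_measure "lborel :: vec3 measure" ..
  interpret pair_sigma_finite "lborel :: real measure" "sphere_measure \<Otimes>\<^sub>M (lborel :: vec3 measure)" ..
  show ?thesis by (rule sigma_finite_measure_axioms)
qed

lemma measurable_marks_ok:
  assumes z: "z \<in> borel_measurable K" and c: "c \<in> K \<rightarrow>\<^sub>M (\<Pi>\<^sub>M j\<in>{..<n}. mark_measure)"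
  shows "Measurable.pred K (\<lambda>k. marks_ok h n (z k) (c k))"
    and "(\<lambda>z. g (fst z) (snd z)) \<in> borel_measurable borel \<Longrightarrow> (\<lambda>k. marks_weight \<epsilon> g n (z k) (c k)) \<in> borel_measurable K"
proof -
  have cj: "(\<lambda>k. c k j) \<in> K \<rightarrow>\<^sub>M borel \<Otimes>\<^sub>M (borel \<Otimes>\<^sub>M borel)" if "j < n" for j
    unfolding measurable_mark_borel using c that by (auto intro: measurable_component_singleton[THEN measurable_compose[rotated]])
  have "Measurable.pred K (\<lambda>k. last_time (mk_tree j (z k, c k)) < fst (c k j) \<and> fst (c k j) < last_time (mk_tree j (z k, c k)) + h)"
    if "j < n" for j
  proof -
    have [measurable]: "(\<lambda>k. last_time (mk_tree j (z k, c k))) \<in> borel_measurable K"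
      using that by (intro measurable_tree_root(2)[OF z c]) simp
    note [measurable] = cj[OF that]
    show ?thesis by measurable
  qed
  then have "Measurable.pred K (\<lambda>k. \<forall>j \<in> {..<n}. last_time (mk_tree j (z k, c k)) < fst (c k j) \<and> fst (c k j) < last_time (mk_tree j (z k, c k)) + h)"
    by (intro pred_intros_finite) auto
  then show "Measurable.pred K (\<lambda>k. marks_ok h n (z k) (c k))" 
    unfolding marks_ok_def by (simp only: Ball_def lessThan_iff)
  assume g: "(\<lambda>z. g (fst z) (snd z)) \<in> borel_measurable borel"
  show "(\<lambda>k. marks_weight \<epsilon> g n (z k) (c k)) \<in> borel_measurable K"
    unfolding marks_weight_def
  proof (rule borel_measurable_prod_ennreal)
    fix j assume "j \<in> {..<n}"
    then have j: "j \<le> n" "j < n" by auto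
    note r = measurable_tree_root[OF z c j(1)]
    show "(\<lambda>k. arrival \<epsilon> g (root_pos (mk_tree j (z k, c k))) (root_vel (mk_tree j (z k, c k)) (last_time (mk_tree j (z k, c k)))) (c k j)) \<in> borel_measurable K"
      by (rule measurable_arrival[OF g r(4) cj[OF j(2)] r(3)])
  qed
qed

text \<open>The dependence is triangular: the mark of particle \<open>n\<close> involves only the
  path made by the earlier ones. The last particle is integrated first, with that path fixed, by
  \<open>change_of_variables\<close>; the result is again a function of the earlier marks, to which
  the induction hypothesis applies.\<close>

theorem chain_change_of_variables:
  assumes g: "torus_density g" and e: "0 < \<epsilon>" "\<epsilon> < 1 / 2" and h: "0 < h"
    and K: "K \<in> borel_measurable (\<Pi>\<^sub>M j\<in>{..<n}. mark_measure)"
  shows "(\<integral>\<^sup>+ p. (if chain_ok \<epsilon> h n z p then K (chain \<epsilon> n z p) else 0) \<partial>(\<Pi>\<^sub>M j\<in>{..<n}. state_law g))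
    = (\<integral>\<^sup>+ c. (if marks_ok h n z c then marks_weight \<epsilon> g n z c * K c else 0) \<partial>(\<Pi>\<^sub>M j\<in>{..<n}. mark_measure))"
  using K
proof (induction n arbitrary: K)
  case 0
  interpret mk: product_sigma_finite "\<lambda>_::nat. mark_measure" by (simp add: product_sigma_finite_def sigma_finite_mark)
  interpret S: prob_space "state_law g" using g by (rule prob_state_law)
  interpret st: product_sigma_finite "\<lambda>_::nat. state_law g" by unfold_locales
  have "emeasure (\<Pi>\<^sub>M j\<in>({}::nat set). state_law g) (space (\<Pi>\<^sub>M j\<in>({}::nat set). state_law g)) = 1" by (simp add: PiM_empty)
  then show ?case by (simp add: mk.nn_integral_empty marks_ok_def marks_weight_def)
next
  case (Suc n)
  interpret mk: product_sigma_finite "\<lambda>_::nat. mark_measure" by (simp add: product_sigma_finite_def sigma_finite_mark)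
  interpret S: prob_space "state_law g" using g by (rule prob_state_law)
  interpret st: product_sigma_finite "\<lambda>_::nat. state_law g" by unfold_locales
  have gm: "(\<lambda>z. g (fst z) (snd z)) \<in> borel_measurable borel" using g by (simp add: torus_density_def)
  have ins: "{..<Suc n} = insert n {..<n}" by (rule lessThan_Suc)
  \<comment> \<open>The integrand in the last mark when the earlier marks are held fixed; its
    integral \<open>K'\<close> is the function handed to the induction hypothesis.\<close>
  define L where "L c m = (if last_time (mk_tree n (z, c)) < fst m \<and> fst m < last_time (mk_tree n (z, c)) + h
      then arrival \<epsilon> g (root_pos (mk_tree n (z, c))) (root_vel (mk_tree n (z, c)) (last_time (mk_tree n (z, c)))) m * K (c(n := m)) else 0)" for c m
  define K' where "K' c = (\<integral>\<^sup>+ m. L c m \<partial>mark_measure)" for c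
  have up: "(\<lambda>x. (fst x)(n := snd x)) \<in> (\<Pi>\<^sub>M j\<in>{..<n}. mark_measure) \<Otimes>\<^sub>M mark_measure \<rightarrow>\<^sub>M (\<Pi>\<^sub>M j\<in>insert n {..<n}. mark_measure)"
    using measurable_add_dim[of n "{..<n}" "\<lambda>_. mark_measure"] by (simp add: case_prod_beta')
  have Kup: "(\<lambda>x. K ((fst x)(n := snd x))) \<in> borel_measurable ((\<Pi>\<^sub>M j\<in>{..<n}. mark_measure) \<Otimes>\<^sub>M mark_measure)"
    using measurable_compose[OF up, of K borel] Suc.prems by (simp add: ins)
  have Lm: "(\<lambda>x. L (fst x) (snd x)) \<in> borel_measurable ((\<Pi>\<^sub>M j\<in>{..<n}. mark_measure) \<Otimes>\<^sub>M mark_measure)"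
  proof -
    note r = measurable_tree_root[where z = "\<lambda>_. z" and K = "(\<Pi>\<^sub>M j\<in>{..<n}. mark_measure) \<Otimes>\<^sub>M mark_measure" and c = fst, OF _ measurable_fst order.refl]
    have s: "snd \<in> (\<Pi>\<^sub>M j\<in>{..<n}. mark_measure) \<Otimes>\<^sub>M mark_measure \<rightarrow>\<^sub>M borel \<Otimes>\<^sub>M (borel \<Otimes>\<^sub>M borel)"
      unfolding measurable_mark_borel by measurable
    have [measurable]: "(\<lambda>x. arrival \<epsilon> g (root_pos (mk_tree n (z, fst x))) (root_vel (mk_tree n (z, fst x)) (last_time (mk_tree n (z, fst x)))) (snd x))
        \<in> borel_measurable ((\<Pi>\<^sub>M j\<in>{..<n}. mark_measure) \<Otimes>\<^sub>M mark_measure)"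
      by (rule measurable_arrival[OF gm r(4) s r(3)]) auto
    have [measurable]: "(\<lambda>x. last_time (mk_tree n (z, fst x))) \<in> borel_measurable ((\<Pi>\<^sub>M j\<in>{..<n}. mark_measure) \<Otimes>\<^sub>M mark_measure)"
      by (rule r(2)) auto
    note [measurable] = Kup
    show ?thesis unfolding L_def by measurable
  qed
  have K'm: "K' \<in> borel_measurable (\<Pi>\<^sub>M j\<in>{..<n}. mark_measure)"
    unfolding K'_def using Lm
    by (intro sigma_finite_measure.borel_measurable_nn_integral[OF sigma_finite_mark]) (simp add: case_prod_beta')
  have step: "(\<integral>\<^sup>+ q. (if chain_ok \<epsilon> h (Suc n) z (p(n := q)) then K (chain \<epsilon> (Suc n) z (p(n := q))) else 0) \<partial>state_law g)
      = (if chain_ok \<epsilon> h n z p then K' (chain \<epsilon> n z p) else 0)"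
    if p: "p \<in> space (\<Pi>\<^sub>M j\<in>{..<n}. state_law g)" for p
  proof -
    have eq: "chain \<epsilon> n z (p(n := q)) = chain \<epsilon> n z p" "chain_ok \<epsilon> h n z (p(n := q)) = chain_ok \<epsilon> h n z p" for q
      by (intro chain_cong chain_ok_cong; simp)+
    show ?thesis
    proof (cases "chain_ok \<epsilon> h n z p")
      case True
      let ?c = "chain \<epsilon> n z p"
      let ?\<Psi> = "mk_tree n (z, ?c)"
      have tm: "timely ?\<Psi>" using chain_marks_ok[OF True] by (rule timely_marks)
      interpret path_tail "fst ` set (snd ?\<Psi>)" "root_pos ?\<Psi>" "root_vel ?\<Psi>" "last_time ?\<Psi>" \<epsilon> g
        using tm e g by (rule path_tail_root)
      have cs: "?c \<in> space (\<Pi>\<^sub>M j\<in>{..<n}. mark_measure)"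
        using measurable_space[OF measurable_chain(1)[where K = "\<Pi>\<^sub>M j\<in>{..<n}. state_law g" and z = "\<lambda>_. z" and p = "\<lambda>p. p"] p]
        by (auto intro: measurable_component_singleton)
      have "(\<lambda>m. (?c, m)) \<in> mark_measure \<rightarrow>\<^sub>M (\<Pi>\<^sub>M j\<in>{..<n}. mark_measure) \<Otimes>\<^sub>M mark_measure"
        using cs by (rule measurable_Pair1')
      from measurable_compose[OF this Kup]
      have "(\<lambda>m. K (?c(n := m))) \<in> borel_measurable mark_measure" by simp
      then have Hm: "(\<lambda>m. K (?c(n := m))) \<in> borel_measurable (borel \<Otimes>\<^sub>M (borel \<Otimes>\<^sub>M borel))"
        by (simp cong: measurable_cong_sets sets_pair_measure_cong)
      show ?thesis
        using change_of_variables[OF Hm h] True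
        by (simp add: eq tree_hit_def K'_def L_def cong: if_cong)
    qed (simp add: eq)
  qed
  have m1: "(\<lambda>p. if chain_ok \<epsilon> h (Suc n) z p then K (chain \<epsilon> (Suc n) z p) else 0) \<in> borel_measurable (\<Pi>\<^sub>M j\<in>insert n {..<n}. state_law g)"
  proof -
    have pj: "(\<lambda>p. p j) \<in> borel_measurable (\<Pi>\<^sub>M j\<in>insert n {..<n}. state_law g)" if "j < Suc n" for j
      using measurable_component_singleton[of j "insert n {..<n}" "\<lambda>_. state_law g"] that
      by (auto simp: less_Suc_eq cong: measurable_cong_sets)
    note mc = measurable_chain[where K = "\<Pi>\<^sub>M j\<in>insert n {..<n}. state_law g" and z = "\<lambda>_. z" and p = "\<lambda>p. p", OF _ pj]
    have [measurable]: "(\<lambda>p. K (chain \<epsilon> (Suc n) z p)) \<in> borel_measurable (\<Pi>\<^sub>M j\<in>insert n {..<n}. state_law g)"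
      by (rule measurable_compose[OF mc(1) Suc.prems]) auto
    have [measurable]: "Measurable.pred (\<Pi>\<^sub>M j\<in>insert n {..<n}. state_law g) (\<lambda>p. chain_ok \<epsilon> h (Suc n) z p)"
      by (rule mc(2)) auto
    show ?thesis by measurable
  qed
  have "(\<integral>\<^sup>+ p. (if chain_ok \<epsilon> h (Suc n) z p then K (chain \<epsilon> (Suc n) z p) else 0) \<partial>(\<Pi>\<^sub>M j\<in>{..<Suc n}. state_law g))
    = (\<integral>\<^sup>+ p. \<integral>\<^sup>+ q. (if chain_ok \<epsilon> h (Suc n) z (p(n := q)) then K (chain \<epsilon> (Suc n) z (p(n := q))) else 0) \<partial>state_law g \<partial>(\<Pi>\<^sub>M j\<in>{..<n}. state_law g))"
    unfolding ins by (rule st.product_nn_integral_insert[OF _ _ m1]) auto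
  also have "\<dots> = (\<integral>\<^sup>+ p. (if chain_ok \<epsilon> h n z p then K' (chain \<epsilon> n z p) else 0) \<partial>(\<Pi>\<^sub>M j\<in>{..<n}. state_law g))"
    by (intro nn_integral_cong step)
  also have "\<dots> = (\<integral>\<^sup>+ c. (if marks_ok h n z c then marks_weight \<epsilon> g n z c * K' c else 0) \<partial>(\<Pi>\<^sub>M j\<in>{..<n}. mark_measure))"
    by (rule Suc.IH[OF K'm])
  also have "\<dots> = (\<integral>\<^sup>+ c. \<integral>\<^sup>+ m. (if marks_ok h (Suc n) z (c(n := m)) then marks_weight \<epsilon> g (Suc n) z (c(n := m)) * K (c(n := m)) else 0)
      \<partial>mark_measure \<partial>(\<Pi>\<^sub>M j\<in>{..<n}. mark_measure))"
  proof (rule nn_integral_cong)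
    fix c assume c: "c \<in> space (\<Pi>\<^sub>M j\<in>{..<n}. mark_measure)"
    have Lc: "L c \<in> borel_measurable mark_measure"
      using measurable_compose[OF measurable_Pair1'[OF c] Lm] by simp
    have w: "marks_weight \<epsilon> g (Suc n) z (c(n := m)) = marks_weight \<epsilon> g n z c *
        arrival \<epsilon> g (root_pos (mk_tree n (z, c))) (root_vel (mk_tree n (z, c)) (last_time (mk_tree n (z, c)))) m" for m
      using marks_weight_upd[of \<epsilon> g n z c m] by (simp add: marks_weight_def mk_tree_upd)
    have "(if marks_ok h n z c then marks_weight \<epsilon> g n z c * K' c else 0) = (\<integral>\<^sup>+ m. (if marks_ok h n z c then marks_weight \<epsilon> g n z c * L c m else 0) \<partial>mark_measure)"
      using nn_integral_cmult[OF Lc, of "marks_weight \<epsilon> g n z c"] by (simp add: K'_def)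
    also have "\<dots> = (\<integral>\<^sup>+ m. (if marks_ok h (Suc n) z (c(n := m)) then marks_weight \<epsilon> g (Suc n) z (c(n := m)) * K (c(n := m)) else 0) \<partial>mark_measure)"
      by (intro nn_integral_cong) (simp add: w marks_ok_Suc marks_ok_upd mk_tree_upd L_def mult.assoc)
    finally show "(if marks_ok h n z c then marks_weight \<epsilon> g n z c * K' c else 0)
      = (\<integral>\<^sup>+ m. (if marks_ok h (Suc n) z (c(n := m)) then marks_weight \<epsilon> g (Suc n) z (c(n := m)) * K (c(n := m)) else 0) \<partial>mark_measure)" .
  qed
  also have "\<dots> = (\<integral>\<^sup>+ c. (if marks_ok h (Suc n) z c then marks_weight \<epsilon> g (Suc n) z c * K c else 0) \<partial>(\<Pi>\<^sub>M j\<in>{..<Suc n}. mark_measure))"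
  proof -
    note mm = measurable_marks_ok[where z = "\<lambda>_. z" and c = "\<lambda>c. c" and n = "Suc n" and K = "\<Pi>\<^sub>M j\<in>{..<Suc n}. mark_measure"]
    have [measurable]: "Measurable.pred (\<Pi>\<^sub>M j\<in>{..<Suc n}. mark_measure) (\<lambda>c. marks_ok h (Suc n) z c)" by (rule mm(1)) auto
    have [measurable]: "(\<lambda>c. marks_weight \<epsilon> g (Suc n) z c) \<in> borel_measurable (\<Pi>\<^sub>M j\<in>{..<Suc n}. mark_measure)" by (rule mm(2)[OF _ _ gm]) auto
    note [measurable] = Suc.prems
    have "(\<lambda>c. if marks_ok h (Suc n) z c then marks_weight \<epsilon> g (Suc n) z c * K c else 0) \<in> borel_measurable (\<Pi>\<^sub>M j\<in>{..<Suc n}. mark_measure)"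
      by measurable
    then show ?thesis unfolding ins by (intro mk.product_nn_integral_insert[symmetric]) auto
  qed
  finally show ?case .
qed


section \<open>Collision histories\<close>

text \<open>\<open>\<sigma> j\<close> is the background particle that takes part in collision \<open>j\<close>.\<close>

definition realizes :: "real \<Rightarrow> nat \<Rightarrow> real \<Rightarrow> (nat \<Rightarrow> nat) \<Rightarrow> config \<Rightarrow> tree \<Rightarrow> bool" where
  "realizes \<epsilon> N t \<sigma> \<omega> \<Phi> \<longleftrightarrow>
    inj_on \<sigma> {..<n_coll \<Phi>} \<and> \<sigma> ` {..<n_coll \<Phi>} \<subseteq> {..<N} \<and> fst \<omega> = fst \<Phi> \<and> last_time \<Phi> \<le> t \<and>
    (\<forall>j < n_coll \<Phi>. snd (snd \<omega> (\<sigma> j)) = coll_vel \<Phi> j \<and> fst (snd \<omega> (\<sigma> j)) - partner_pos \<epsilon> \<Phi> j 0 \<in> int_lattice) \<and>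
    (\<forall>i < N. i \<notin> \<sigma> ` {..<n_coll \<Phi>} \<longrightarrow> apart \<epsilon> (root_pos \<Phi>) t (snd \<omega> i))"

lemma Lim_at_left_const:
  fixes f :: "real \<Rightarrow> vec3"
  assumes "a < s" "\<And>r. a < r \<Longrightarrow> r < s \<Longrightarrow> f r = l"
  shows "Lim (at_left s) f = l"
proof -
  have "\<forall>\<^sub>F r in at_left s. f r = l"
    unfolding eventually_at_left_field using assms by blast
  then have "(f \<longlongrightarrow> l) (at_left s)" by (rule tendsto_eventually)
  then show ?thesis by (intro tendsto_Lim) auto
qed

lemma tdist_impact: "norm \<nu> = 1 \<Longrightarrow> 0 < \<epsilon> \<Longrightarrow> \<epsilon> < 1 / 2 \<Longrightarrow> tdist x (x + \<epsilon> *\<^sub>R \<nu>) = \<epsilon>"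
  using tdist_eq_norm[of x "x + \<epsilon> *\<^sub>R \<nu>"] by simp

lemma impact_unique:
  assumes "impact \<epsilon> x y \<nu>" "impact \<epsilon> x y \<nu>'" "0 < \<epsilon>" "\<epsilon> < 1 / 2"
  shows "\<nu> = \<nu>'"
proof -
  have "(y - (x + \<epsilon> *\<^sub>R \<nu>')) - (y - (x + \<epsilon> *\<^sub>R \<nu>)) \<in> int_lattice"
    using assms lattice_diff unfolding impact_def by blast
  moreover have "(y - (x + \<epsilon> *\<^sub>R \<nu>')) - (y - (x + \<epsilon> *\<^sub>R \<nu>)) = \<epsilon> *\<^sub>R \<nu> - \<epsilon> *\<^sub>R \<nu>'" by simp
  moreover have "norm (\<epsilon> *\<^sub>R \<nu> - \<epsilon> *\<^sub>R \<nu>') \<le> norm (\<epsilon> *\<^sub>R \<nu>) + norm (\<epsilon> *\<^sub>R \<nu>')" by (rule norm_triangle_ineq4)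
  moreover have "norm (\<epsilon> *\<^sub>R \<nu>) + norm (\<epsilon> *\<^sub>R \<nu>') < 1" using assms unfolding impact_def by simp
  ultimately have "\<epsilon> *\<^sub>R \<nu> - \<epsilon> *\<^sub>R \<nu>' = 0" by (intro lattice_small) auto
  then show ?thesis using assms(3) by simp
qed

locale regular =
  fixes T \<epsilon> t :: real and \<Phi> :: tree
  assumes reg: "\<Phi> \<in> regular_trees T \<epsilon> t" and eps: "0 < \<epsilon>" "\<epsilon> < 1 / 2" and t_nonneg: "0 \<le> t"
begin

abbreviation n where "n \<equiv> n_coll \<Phi>"
abbreviation ct where "ct \<equiv> coll_time \<Phi>"

lemma timely: "timely \<Phi>"
  using reg by (auto simp: regular_trees_def collision_trees_def timely_def case_prod_beta)

lemma norm_param: "j < n \<Longrightarrow> norm (coll_param \<Phi> j) = 1"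
  using reg unfolding regular_trees_def collision_trees_def coll_param_def n_coll_def
  by (fastforce simp: case_prod_beta dest: nth_mem)

text \<open>A collision at time 0 would start with the partner at distance exactly \<epsilon>, which
  \<open>partners_apart\<close> excludes. This matters because contact times are positive by
  definition.\<close>

lemma ct_pos: "j < n \<Longrightarrow> 0 < ct j"
proof (rule ccontr)
  assume j: "j < n" and "\<not> 0 < ct j"
  then have "ct j = 0" using coll_time_nonneg[OF timely j] by simp
  then have "partner_pos \<epsilon> \<Phi> j 0 = root_pos \<Phi> 0 + \<epsilon> *\<^sub>R coll_param \<Phi> j" by (simp add: partner_pos_def)
  then have "tdist (root_pos \<Phi> 0) (partner_pos \<epsilon> \<Phi> j 0) = \<epsilon>" using norm_param[OF j] eps by (simp add: tdist_impact)
  moreover have "\<epsilon> < tdist (root_pos \<Phi> 0) (partner_pos \<epsilon> \<Phi> j 0)"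
    using reg j by (simp add: regular_trees_def partners_apart_def)
  ultimately show False by simp
qed

lemma recollision: "j < n \<Longrightarrow> 0 \<le> s \<Longrightarrow> s \<le> t \<Longrightarrow> s \<noteq> ct j \<Longrightarrow> \<epsilon> < tdist (root_pos \<Phi> s) (partner_pos \<epsilon> \<Phi> j s)"
  using reg by (simp add: regular_trees_def recollision_free_def)

lemma partner_contact: "j < n \<Longrightarrow> partner_pos \<epsilon> \<Phi> j (ct j) = root_pos \<Phi> (ct j) + \<epsilon> *\<^sub>R coll_param \<Phi> j"
  by (simp add: partner_pos_def)

lemma ct_less: "i < j \<Longrightarrow> j < n \<Longrightarrow> ct i < ct j"
  by (rule sorted_coll_time[OF timely])

lemma ct_inj: "i < n \<Longrightarrow> j < n \<Longrightarrow> ct i = ct j \<Longrightarrow> i = j"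
  using ct_less[of i j] ct_less[of j i] by (metis less_irrefl nat_neq_iff)

sublocale path "fst ` set (snd \<Phi>)" "root_pos \<Phi>" "root_vel \<Phi>"
  by (rule path_root[OF timely])

lemma marks_eq: "fst ` set (snd \<Phi>) = ct ` {..<n}"
  by (rule coll_times)

lemma mark_mem: "j < n \<Longrightarrow> (ct j, coll_param \<Phi> j, coll_vel \<Phi> j) \<in> set (snd \<Phi>)"
  by (simp add: coll_time_def coll_param_def coll_vel_def n_coll_def)

lemma mark_ex: "(s, \<nu>, w) \<in> set (snd \<Phi>) \<Longrightarrow> \<exists>j<n. s = ct j \<and> \<nu> = coll_param \<Phi> j \<and> w = coll_vel \<Phi> j"
  by (auto simp: coll_time_def coll_param_def coll_vel_def n_coll_def in_set_conv_nth)

lemma root_start: "root_pos \<Phi> 0 = fst (fst \<Phi>)" "root_vel \<Phi> 0 = snd (fst \<Phi>)"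
proof -
  have "0 < fst c" if "c \<in> set (snd \<Phi>)" for c
  proof -
    have "fst c \<in> ct ` {..<n}" using that marks_eq by blast
    then show ?thesis using ct_pos by auto
  qed
  then have "root_from 0 (fst \<Phi>) (snd \<Phi>) 0 = fst \<Phi>" by (intro root_from_start)
  then show "root_pos \<Phi> 0 = fst (fst \<Phi>)" "root_vel \<Phi> 0 = snd (fst \<Phi>)" by (simp_all add: root_pos_def root_vel_def)
qed

definition prev :: "nat \<Rightarrow> real" where "prev j = (if j = 0 then 0 else ct (j - 1))"

lemma prev: "j < n \<Longrightarrow> 0 \<le> prev j" "j < n \<Longrightarrow> prev j < ct j" "j < n \<Longrightarrow> ct ` {..<n} \<inter> {prev j<..<ct j} = {}"
proof -
  assume j: "j < n"
  show "0 \<le> prev j" using ct_pos[of "j - 1"] j by (simp add: prev_def less_imp_le)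
  show "prev j < ct j" using ct_pos[OF j] ct_less[of "j - 1" j] j by (cases "j = 0") (auto simp: prev_def)
  show "ct ` {..<n} \<inter> {prev j<..<ct j} = {}"
  proof (rule ccontr)
    assume "ct ` {..<n} \<inter> {prev j<..<ct j} \<noteq> {}"
    then obtain k where k: "k < n" "prev j < ct k" "ct k < ct j" by auto
    have "k < j" using k j ct_less[of j k] by (metis less_asym linorder_neqE_nat)
    then have "j \<noteq> 0" "k \<le> j - 1" by auto
    then have "ct k \<le> prev j" using ct_less[of k "j - 1"] j by (cases "k = j - 1") (auto simp: prev_def less_imp_le)
    then show False using k by simp
  qed
qed

lemma root_vel_before: "j < n \<Longrightarrow> prev j \<le> r \<Longrightarrow> r < ct j \<Longrightarrow> root_vel \<Phi> r = pre_vel \<Phi> j"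
proof -
  assume j: "j < n" and r: "prev j \<le> r" "r < ct j"
  let ?\<Psi> = "truncate_tree j \<Phi>"
  have t: "timely ?\<Psi>" using timely by (rule timely_truncate)
  interpret tr: path "fst ` set (snd ?\<Psi>)" "root_pos ?\<Psi>" "root_vel ?\<Psi>" using t by (rule path_root)
  have n: "n_coll ?\<Psi> = j" using j by (simp add: truncate_tree_def n_coll_def)
  have c: "coll_time ?\<Psi> i = ct i" if "i < j" for i using that by (simp add: truncate_tree_def coll_time_def)
  have le: "ct i \<le> prev j" if "i < j" for i
  proof -
    have "i = j - 1 \<or> i < j - 1" using that by linarith
    then show ?thesis using that ct_less[of i "j - 1"] j by (auto simp: prev_def less_imp_le)
  qed
  have "fst ` set (snd ?\<Psi>) \<inter> {r<..ct j} = {}" using n c le r by (force simp: coll_times)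
  then have "root_vel ?\<Psi> (ct j) = root_vel ?\<Psi> r" using r prev(1)[OF j] by (intro tr.steady) auto
  then show ?thesis using root_truncate(1)[OF timely j r(2)] by (simp add: pre_vel_def)
qed

lemma partner_flight: "j < n \<Longrightarrow> free_flight t {ct j} (\<lambda>s. partner_pos \<epsilon> \<Phi> j s + k) (partner_vel \<Phi> j)"
  unfolding free_flight_def
proof (intro allI impI)
  fix r s assume j: "j < n" and rs: "0 \<le> r \<and> r \<le> s \<and> s \<le> t"
  consider "s < ct j" | "ct j \<le> r" | "r < ct j" "ct j < s" | "r < ct j" "ct j = s" using rs by linarith
  then show "({ct j} \<inter> {r<..<s} = {} \<longrightarrow> partner_pos \<epsilon> \<Phi> j s + k = partner_pos \<epsilon> \<Phi> j r + k + (s - r) *\<^sub>R partner_vel \<Phi> j r) \<and>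
    ({ct j} \<inter> {r<..s} = {} \<longrightarrow> partner_vel \<Phi> j s = partner_vel \<Phi> j r)"
    using rs by cases (auto simp: partner_pos_def partner_vel_def algebra_simps)
qed

text \<open>A motion is assembled from the tree: the root path, the partner trajectories of the
  tree, and free flight for everyone else. Absence of re-collisions makes each partner's set of
  contact times a single point, and bystanders have none, so the collision laws need to be checked
  only at the recorded collisions.\<close>

lemma realizes_history:
  assumes r: "realizes \<epsilon> N t \<sigma> \<omega> \<Phi>"
  shows "collision_history \<epsilon> N t \<omega> \<Phi> \<and> no_initial_overlap \<epsilon> N \<omega>"
proof -
  have inj: "inj_on \<sigma> {..<n}" and ran: "\<sigma> ` {..<n} \<subseteq> {..<N}" and st: "fst \<omega> = fst \<Phi>" and last: "last_time \<Phi> \<le> t"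
    and part: "\<And>j. j < n \<Longrightarrow> snd (snd \<omega> (\<sigma> j)) = coll_vel \<Phi> j" "\<And>j. j < n \<Longrightarrow> fst (snd \<omega> (\<sigma> j)) - partner_pos \<epsilon> \<Phi> j 0 \<in> int_lattice"
    and ap: "\<And>i. i < N \<Longrightarrow> i \<notin> \<sigma> ` {..<n} \<Longrightarrow> apart \<epsilon> (root_pos \<Phi>) t (snd \<omega> i)"
    using r unfolding realizes_def by auto
  define J where "J = inv_into {..<n} \<sigma>"
  have J: "J (\<sigma> j) = j" if "j < n" for j unfolding J_def using inj that by simp
  \<comment> \<open>Configuration and tree may use different lifts of the same torus point. For
    partners this constant shift is a lattice vector, invisible to \<open>tdist\<close> and
    \<open>impact\<close>.\<close>
  define \<kappa> where "\<kappa> i = fst (snd \<omega> i) - partner_pos \<epsilon> \<Phi> (J i) 0" for i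
  define Y where "Y i s = (if i \<in> \<sigma> ` {..<n} then partner_pos \<epsilon> \<Phi> (J i) s + \<kappa> i else fst (snd \<omega> i) + s *\<^sub>R snd (snd \<omega> i))" for i s
  define W where "W i s = (if i \<in> \<sigma> ` {..<n} then partner_vel \<Phi> (J i) s else snd (snd \<omega> i))" for i s
  have Y\<sigma>: "Y (\<sigma> j) = (\<lambda>s. partner_pos \<epsilon> \<Phi> j s + \<kappa> (\<sigma> j))" "W (\<sigma> j) = partner_vel \<Phi> j" "\<kappa> (\<sigma> j) \<in> int_lattice" if "j < n" for j
    using that part J by (auto simp: Y_def W_def \<kappa>_def fun_eq_iff)
  have Yo: "Y i = (\<lambda>s. fst (snd \<omega> i) + s *\<^sub>R snd (snd \<omega> i))" "W i = (\<lambda>_. snd (snd \<omega> i))" if "i \<notin> \<sigma> ` {..<n}" for i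
    using that by (auto simp: Y_def W_def)
  have ct_le: "ct j \<le> t" if "j < n" for j using coll_time_le_last[OF timely that] last by simp
  have dY: "tdist (root_pos \<Phi> s) (Y (\<sigma> j) s) = tdist (root_pos \<Phi> s) (partner_pos \<epsilon> \<Phi> j s)" if "j < n" for j s
    using Y\<sigma>[OF that] by (intro tdist_lattice) simp
  have CT\<sigma>: "contact_times \<epsilon> t (root_pos \<Phi>) (Y (\<sigma> j)) = {ct j}" if j: "j < n" for j
  proof (intro equalityI subsetI)
    fix s assume "s \<in> contact_times \<epsilon> t (root_pos \<Phi>) (Y (\<sigma> j))"
    then have "0 < s" "s \<le> t" "tdist (root_pos \<Phi> s) (partner_pos \<epsilon> \<Phi> j s) = \<epsilon>"
      using dY[OF j] by (auto simp: contact_times_def)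
    then show "s \<in> {ct j}" using recollision[OF j, of s] by force
  next
    fix s assume "s \<in> {ct j}"
    then have s: "s = ct j" by simp
    have "tdist (root_pos \<Phi> s) (Y (\<sigma> j) s) = \<epsilon>"
      unfolding dY[OF j] unfolding s partner_contact[OF j] using norm_param[OF j] eps by (simp add: tdist_impact)
    moreover have "\<forall>\<^sub>F r in at_left s. \<epsilon> < tdist (root_pos \<Phi> r) (Y (\<sigma> j) r)"
      unfolding eventually_at_left_field dY[OF j] s
      using ct_pos[OF j] ct_le[OF j] by (intro exI[of _ 0]) (auto intro!: recollision[OF j])
    ultimately show "s \<in> contact_times \<epsilon> t (root_pos \<Phi>) (Y (\<sigma> j))"
      using s ct_pos[OF j] ct_le[OF j] by (simp add: contact_times_def)
  qed
  have CTo: "contact_times \<epsilon> t (root_pos \<Phi>) (Y i) = {}" if i: "i < N" "i \<notin> \<sigma> ` {..<n}" for i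
    using ap[OF i] apart_path_iff[OF t_nonneg] by (auto simp: contact_times_def Yo[OF i(2)])
  have CTu: "(\<Union>i<N. contact_times \<epsilon> t (root_pos \<Phi>) (Y i)) = ct ` {..<n}"
  proof (intro equalityI subsetI)
    fix s assume "s \<in> (\<Union>i<N. contact_times \<epsilon> t (root_pos \<Phi>) (Y i))"
    then obtain i where i: "i < N" "s \<in> contact_times \<epsilon> t (root_pos \<Phi>) (Y i)" by auto
    then have "i \<in> \<sigma> ` {..<n}" using CTo by blast
    then show "s \<in> ct ` {..<n}" using i CT\<sigma> by auto
  next
    fix s assume "s \<in> ct ` {..<n}"
    then obtain j where "j < n" "s = ct j" by auto
    then show "s \<in> (\<Union>i<N. contact_times \<epsilon> t (root_pos \<Phi>) (Y i))" using CT\<sigma> ran by (intro UN_I[of "\<sigma> j"]) auto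
  qed
  have limV: "Lim (at_left (ct j)) (root_vel \<Phi>) = pre_vel \<Phi> j" if "j < n" for j
    using prev[OF that] root_vel_before[OF that] by (intro Lim_at_left_const[of "prev j"]) auto
  have limW: "Lim (at_left (ct j)) (partner_vel \<Phi> j) = coll_vel \<Phi> j" if "j < n" for j
    by (intro Lim_at_left_const[of "ct j - 1"]) (auto simp: partner_vel_def)
  have imp: "impact \<epsilon> (root_pos \<Phi> (ct j)) (Y (\<sigma> j) (ct j)) (coll_param \<Phi> j)" if "j < n" for j
    using Y\<sigma>[OF that] norm_param[OF that] by (simp add: impact_def partner_contact[OF that])
  have pm: "particle_motion \<epsilon> N t \<omega> (root_pos \<Phi>) (root_vel \<Phi>) Y W"
    unfolding particle_motion_def CTu
  proof (intro conjI allI impI ballI)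
    show "(root_pos \<Phi> 0, root_vel \<Phi> 0) = fst \<omega>" using root_start st by simp
    show "(Y i 0, W i 0) = snd \<omega> i" if "i < N" for i
    proof (cases "i \<in> \<sigma> ` {..<n}")
      case True
      then obtain j where j: "j < n" "i = \<sigma> j" by auto
      then show ?thesis
        using Y\<sigma>[OF j(1)] part(1)[OF j(1)] J[OF j(1)] ct_pos[OF j(1)]
        by (simp add: \<kappa>_def partner_vel_def prod_eq_iff)
    qed (simp add: Yo)
    show "finite (ct ` {..<n})" by simp
    show "contact_times \<epsilon> t (root_pos \<Phi>) (Y i) \<inter> contact_times \<epsilon> t (root_pos \<Phi>) (Y j) = {}"
      if ij: "i < N" "j < N" "i \<noteq> j" for i j
    proof (cases "i \<in> \<sigma> ` {..<n} \<and> j \<in> \<sigma> ` {..<n}")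
      case True
      then obtain k l where "k < n" "l < n" "i = \<sigma> k" "j = \<sigma> l" by auto
      then show ?thesis using CT\<sigma> ij ct_inj[of k l] by auto
    qed (use CTo ij in auto)
    show "free_flight t (ct ` {..<n}) (root_pos \<Phi>) (root_vel \<Phi>)" using flight[of t] by (simp only: marks_eq)
    show "free_flight t (contact_times \<epsilon> t (root_pos \<Phi>) (Y i)) (Y i) (W i)" if i: "i < N" for i
    proof (cases "i \<in> \<sigma> ` {..<n}")
      case True
      then obtain j where j: "j < n" "i = \<sigma> j" by auto
      then show ?thesis using partner_flight[OF j(1)] CT\<sigma> Y\<sigma> by simp
    next
      case False
      then show ?thesis by (simp add: free_flight_def Yo algebra_simps)
    qed
    fix i s assume i: "i < N" and s: "s \<in> contact_times \<epsilon> t (root_pos \<Phi>) (Y i)"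
    then obtain j where j: "j < n" "i = \<sigma> j" using CTo by blast
    then have "s = ct j" using s CT\<sigma> by auto
    then show "\<exists>\<nu>. impact \<epsilon> (root_pos \<Phi> s) (Y i s) \<nu> \<and>
        root_vel \<Phi> s = tagged_after \<nu> (Lim (at_left s) (root_vel \<Phi>)) (Lim (at_left s) (W i)) \<and>
        W i s = background_after \<nu> (Lim (at_left s) (root_vel \<Phi>)) (Lim (at_left s) (W i))"
      using imp[OF j(1)] j limV[OF j(1)] limW[OF j(1)] Y\<sigma>[OF j(1)] root_truncate(3)[OF timely j(1)]
      by (intro exI[of _ "coll_param \<Phi> j"]) (simp add: partner_vel_def)
  qed
  have "collision_history \<epsilon> N t \<omega> \<Phi>"
    unfolding collision_history_def
  proof (intro conjI exI)
    show "fst \<Phi> = fst \<omega>" using st by simp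
    show "sorted_wrt (<) (map fst (snd \<Phi>))" using timely by (simp add: timely_def)
    show "particle_motion \<epsilon> N t \<omega> (root_pos \<Phi>) (root_vel \<Phi>) Y W" by (rule pm)
    show "fst ` set (snd \<Phi>) = (\<Union>i<N. contact_times \<epsilon> t (root_pos \<Phi>) (Y i))" by (simp only: CTu marks_eq)
    show "\<forall>(s, \<nu>, w) \<in> set (snd \<Phi>). \<exists>i<N. s \<in> contact_times \<epsilon> t (root_pos \<Phi>) (Y i) \<and>
           impact \<epsilon> (root_pos \<Phi> s) (Y i s) \<nu> \<and> w = Lim (at_left s) (W i)"
    proof (clarify)
      fix s \<nu> w assume "(s, \<nu>, w) \<in> set (snd \<Phi>)"
      then obtain j where j: "j < n" "s = ct j" "\<nu> = coll_param \<Phi> j" "w = coll_vel \<Phi> j" using mark_ex by blast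
      then show "\<exists>i<N. s \<in> contact_times \<epsilon> t (root_pos \<Phi>) (Y i) \<and> impact \<epsilon> (root_pos \<Phi> s) (Y i s) \<nu> \<and> w = Lim (at_left s) (W i)"
        using imp[OF j(1)] limW[OF j(1)] CT\<sigma>[OF j(1)] Y\<sigma>[OF j(1)] ran by (intro exI[of _ "\<sigma> j"]) auto
    qed
  qed
  moreover have "no_initial_overlap \<epsilon> N \<omega>"
    unfolding no_initial_overlap_def
  proof (intro allI impI)
    fix i assume i: "i < N"
    show "\<epsilon> < tdist (fst (fst \<omega>)) (fst (snd \<omega> i))"
    proof (cases "i \<in> \<sigma> ` {..<n}")
      case True
      then obtain j where j: "j < n" "i = \<sigma> j" by auto
      have "tdist (fst (fst \<omega>)) (fst (snd \<omega> i)) = tdist (root_pos \<Phi> 0) (partner_pos \<epsilon> \<Phi> j 0)"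
        using part(2)[OF j(1)] lattice_uminus[of "fst (snd \<omega> i) - partner_pos \<epsilon> \<Phi> j 0"] j st root_start by (intro tdist_lattice) simp
      then show ?thesis using recollision[OF j(1), of 0] ct_pos[OF j(1)] t_nonneg by simp
    next
      case False
      then show ?thesis using ap[OF i False] apart_path_iff[OF t_nonneg, of \<epsilon> "snd \<omega> i"] t_nonneg root_start st by force
    qed
  qed
  ultimately show ?thesis by simp
qed

text \<open>The converse: any motion with this history follows the root path of the tree, so its
  particles can be compared with the trajectories of the tree. A particle with two collisions would
  be a re-collision in the tree; hence each collision has its own partner, free until then.\<close>

lemma history_realizes:
  assumes h: "collision_history \<epsilon> N t \<omega> \<Phi>" and no: "no_initial_overlap \<epsilon> N \<omega>"
  obtains \<sigma> where "realizes \<epsilon> N t \<sigma> \<omega> \<Phi>"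
proof -
  obtain X V Y W where st: "fst \<Phi> = fst \<omega>" and pm: "particle_motion \<epsilon> N t \<omega> X V Y W"
    and CTu: "fst ` set (snd \<Phi>) = (\<Union>i<N. contact_times \<epsilon> t X (Y i))"
    and rec: "\<forall>(s, \<nu>, w) \<in> set (snd \<Phi>). \<exists>i<N. s \<in> contact_times \<epsilon> t X (Y i) \<and> impact \<epsilon> (X s) (Y i s) \<nu> \<and> w = Lim (at_left s) (W i)"
    using h unfolding collision_history_def by blast
  let ?CT = "\<lambda>i. contact_times \<epsilon> t X (Y i)"
  have X0: "(X 0, V 0) = fst \<omega>" and Y0: "\<And>i. i < N \<Longrightarrow> (Y i 0, W i 0) = snd \<omega> i"
    and disj: "\<And>i j. i < N \<Longrightarrow> j < N \<Longrightarrow> i \<noteq> j \<Longrightarrow> ?CT i \<inter> ?CT j = {}"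
    and fX: "free_flight t (ct ` {..<n}) X V" and fY: "\<And>i. i < N \<Longrightarrow> free_flight t (?CT i) (Y i) (W i)"
    and col: "\<And>i s. i < N \<Longrightarrow> s \<in> ?CT i \<Longrightarrow> \<exists>\<nu>. impact \<epsilon> (X s) (Y i s) \<nu> \<and>
        V s = tagged_after \<nu> (Lim (at_left s) V) (Lim (at_left s) (W i)) \<and>
        W i s = background_after \<nu> (Lim (at_left s) V) (Lim (at_left s) (W i))"
    using pm unfolding particle_motion_def CTu[symmetric] marks_eq by auto
  have "\<forall>j \<in> {..<n}. \<exists>i. i < N \<and> ct j \<in> ?CT i \<and> impact \<epsilon> (X (ct j)) (Y i (ct j)) (coll_param \<Phi> j) \<and> coll_vel \<Phi> j = Lim (at_left (ct j)) (W i)"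
    using rec mark_mem by fastforce
  then obtain \<sigma> where \<sigma>: "\<And>j. j < n \<Longrightarrow> \<sigma> j < N" "\<And>j. j < n \<Longrightarrow> ct j \<in> ?CT (\<sigma> j)"
    "\<And>j. j < n \<Longrightarrow> impact \<epsilon> (X (ct j)) (Y (\<sigma> j) (ct j)) (coll_param \<Phi> j)"
    "\<And>j. j < n \<Longrightarrow> coll_vel \<Phi> j = Lim (at_left (ct j)) (W (\<sigma> j))"
    by (metis bchoice lessThan_iff)
  have ct_le: "ct j \<le> t" if "j < n" for j using \<sigma>(2)[OF that] by (simp add: contact_times_def)
  have colj: "V (ct j) = tagged_after (coll_param \<Phi> j) (Lim (at_left (ct j)) V) (coll_vel \<Phi> j) \<and>
      W (\<sigma> j) (ct j) = background_after (coll_param \<Phi> j) (Lim (at_left (ct j)) V) (coll_vel \<Phi> j)" if j: "j < n" for j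
  proof -
    obtain \<nu> where \<nu>: "impact \<epsilon> (X (ct j)) (Y (\<sigma> j) (ct j)) \<nu>"
      "V (ct j) = tagged_after \<nu> (Lim (at_left (ct j)) V) (Lim (at_left (ct j)) (W (\<sigma> j)))"
      "W (\<sigma> j) (ct j) = background_after \<nu> (Lim (at_left (ct j)) V) (Lim (at_left (ct j)) (W (\<sigma> j)))"
      using col[OF \<sigma>(1,2)[OF j]] by blast
    have "\<nu> = coll_param \<Phi> j" using impact_unique[OF \<nu>(1) \<sigma>(3)[OF j] eps] .
    then show ?thesis using \<nu> \<sigma>(4)[OF j] by simp
  qed
  have straightX: "X s = X a + (s - a) *\<^sub>R V a" if "0 \<le> a" "a \<le> s" "s \<le> t" "ct ` {..<n} \<inter> {a<..<s} = {}" for a s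
    using fX that unfolding free_flight_def by blast
  have steadyV: "V s = V a" if "0 \<le> a" "a \<le> s" "s \<le> t" "ct ` {..<n} \<inter> {a<..s} = {}" for a s
    using fX that unfolding free_flight_def by blast
  have same: "X a = root_pos \<Phi> a \<and> V a = root_vel \<Phi> a \<Longrightarrow> 0 \<le> a \<Longrightarrow> a \<le> s \<Longrightarrow> s \<le> t \<Longrightarrow> ct ` {..<n} \<inter> {a<..<s} = {} \<Longrightarrow> X s = root_pos \<Phi> s" for a s
    using straightX[of a s] straight[of a s] unfolding marks_eq by simp
  have sameV: "X a = root_pos \<Phi> a \<and> V a = root_vel \<Phi> a \<Longrightarrow> 0 \<le> a \<Longrightarrow> a \<le> s \<Longrightarrow> s \<le> t \<Longrightarrow> ct ` {..<n} \<inter> {a<..s} = {} \<Longrightarrow> V s = root_vel \<Phi> s" for a s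
    using steadyV[of a s] steady[of a s] unfolding marks_eq by simp
  have zero: "X 0 = root_pos \<Phi> 0 \<and> V 0 = root_vel \<Phi> 0" using X0 st root_start by (metis fst_conv snd_conv)
  \<comment> \<open>The induction carries the left limit of the velocity along with the state,
    because the collision law is expressed through left limits.\<close>
  have at_ct: "X (ct j) = root_pos \<Phi> (ct j) \<and> V (ct j) = root_vel \<Phi> (ct j) \<and> Lim (at_left (ct j)) V = pre_vel \<Phi> j" if "j < n" for j
    using that
  proof (induction j)
    case (0)
    have p: "X (prev 0) = root_pos \<Phi> (prev 0) \<and> V (prev 0) = root_vel \<Phi> (prev 0)" using zero by (simp add: prev_def)
    have L: "Lim (at_left (ct 0)) V = pre_vel \<Phi> 0"
    proof (rule Lim_at_left_const[OF prev(2)[OF 0]])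
      fix r assume r: "prev 0 < r" "r < ct 0"
      then have "V r = root_vel \<Phi> r" using prev[OF 0] ct_le[OF 0] by (intro sameV[OF p]) auto
      then show "V r = pre_vel \<Phi> 0" using root_vel_before[OF 0] r by simp
    qed
    show ?case using same[OF p prev(1)[OF 0] less_imp_le[OF prev(2)[OF 0]] ct_le[OF 0] prev(3)[OF 0]] L colj[OF 0] root_truncate(3)[OF timely 0] by simp
  next
    case (Suc i)
    note j = Suc.prems
    have p: "X (prev (Suc i)) = root_pos \<Phi> (prev (Suc i)) \<and> V (prev (Suc i)) = root_vel \<Phi> (prev (Suc i))"
      using Suc.IH j by (simp add: prev_def)
    have L: "Lim (at_left (ct (Suc i))) V = pre_vel \<Phi> (Suc i)"
    proof (rule Lim_at_left_const[OF prev(2)[OF j]])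
      fix r assume r: "prev (Suc i) < r" "r < ct (Suc i)"
      then have "V r = root_vel \<Phi> r" using prev[OF j] ct_le[OF j] by (intro sameV[OF p]) auto
      then show "V r = pre_vel \<Phi> (Suc i)" using root_vel_before[OF j] r by simp
    qed
    show ?case using same[OF p prev(1)[OF j] less_imp_le[OF prev(2)[OF j]] ct_le[OF j] prev(3)[OF j]] L colj[OF j] root_truncate(3)[OF timely j] by simp
  qed
  have XR: "X s = root_pos \<Phi> s" if s: "0 \<le> s" "s \<le> t" for s
  proof -
    define a where "a = Max (insert 0 (ct ` {..<n} \<inter> {0..s}))"
    have fa: "finite (insert 0 (ct ` {..<n} \<inter> {0..s}))" by simp
    then have a: "a \<in> insert 0 (ct ` {..<n} \<inter> {0..s})" unfolding a_def by (rule Max_in) simp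
    have "ct ` {..<n} \<inter> {a<..<s} = {}"
    proof (rule ccontr)
      assume "ct ` {..<n} \<inter> {a<..<s} \<noteq> {}"
      then obtain j where j: "j < n" "a < ct j" "ct j < s" by auto
      then have "ct j \<le> a" unfolding a_def using fa ct_pos[OF j(1)] by (intro Max_ge) auto
      then show False using j by simp
    qed
    moreover have "X a = root_pos \<Phi> a \<and> V a = root_vel \<Phi> a" using a zero at_ct by auto
    ultimately show ?thesis using a s by (intro same[of a s]) auto
  qed
  have straightY: "Y i s = Y i a + (s - a) *\<^sub>R W i a" if "i < N" "0 \<le> a" "a \<le> s" "s \<le> t" "?CT i \<inter> {a<..<s} = {}" for i a s
    using fY[OF that(1)] that unfolding free_flight_def by blast
  have steadyW: "W i s = W i a" if "i < N" "0 \<le> a" "a \<le> s" "s \<le> t" "?CT i \<inter> {a<..s} = {}" for i a s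
    using fY[OF that(1)] that unfolding free_flight_def by blast
  have owner: "\<exists>j<n. s = ct j \<and> i = \<sigma> j" if "i < N" "s \<in> ?CT i" for i s
  proof -
    have "s \<in> ct ` {..<n}" using that CTu marks_eq by blast
    then obtain j where j: "j < n" "s = ct j" by auto
    then have "i = \<sigma> j" using disj[OF that(1) \<sigma>(1)[OF j(1)]] that \<sigma>(2)[OF j(1)] by blast
    then show ?thesis using j by blast
  qed
  have fin: "finite (?CT i)" if "i < N" for i
  proof (rule finite_subset)
    show "?CT i \<subseteq> ct ` {..<n}" using owner[OF that] by auto
  qed simp
  \<comment> \<open>Up to its next contact the particle moves like partner \<open>k\<close> of the
    tree after the collision, so the first further contact would contradict
    \<open>recollision\<close>. The minimum is taken because free flight is known only up to that
    contact.\<close>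
  have no_later: "?CT (\<sigma> k) \<inter> {ct k<..} = {}" if k: "k < n" for k
  proof (rule ccontr)
    assume ne: "?CT (\<sigma> k) \<inter> {ct k<..} \<noteq> {}"
    let ?i = "\<sigma> k"
    have f: "finite (?CT ?i \<inter> {ct k<..})" using fin[OF \<sigma>(1)[OF k]] by simp
    define c where "c = Min (?CT ?i \<inter> {ct k<..})"
    have c: "c \<in> ?CT ?i" "ct k < c" using Min_in[OF f ne] by (auto simp: c_def)
    have "?CT ?i \<inter> {ct k<..<c} = {}"
    proof (rule ccontr)
      assume "?CT ?i \<inter> {ct k<..<c} \<noteq> {}"
      then obtain d where d: "d \<in> ?CT ?i" "ct k < d" "d < c" by auto
      then have "c \<le> d" unfolding c_def using f by (intro Min_le) auto
      then show False using d by simp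
    qed
    moreover have ct: "c \<le> t" "0 < c" "tdist (X c) (Y ?i c) = \<epsilon>" using c by (auto simp: contact_times_def)
    ultimately have "Y ?i c = Y ?i (ct k) + (c - ct k) *\<^sub>R W ?i (ct k)"
      using c ct_pos[OF k] \<sigma>(1)[OF k] by (intro straightY) auto
    also have "W ?i (ct k) = partner_vel \<Phi> k c"
      using colj[OF k] at_ct[OF k] c by (simp add: partner_vel_def)
    finally have "Y ?i c - partner_pos \<epsilon> \<Phi> k c = Y ?i (ct k) - (X (ct k) + \<epsilon> *\<^sub>R coll_param \<Phi> k)"
      using at_ct[OF k] by (simp add: partner_pos_def)
    also have "\<dots> \<in> int_lattice" using \<sigma>(3)[OF k] by (simp add: impact_def)
    finally have l: "Y ?i c - partner_pos \<epsilon> \<Phi> k c \<in> int_lattice" .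
    have "tdist (X c) (Y ?i c) = tdist (root_pos \<Phi> c) (partner_pos \<epsilon> \<Phi> k c)"
      using l lattice_uminus[of "Y ?i c - partner_pos \<epsilon> \<Phi> k c"] XR[of c] ct by (intro tdist_lattice) simp
    then show False using recollision[OF k, of c] ct c by simp
  qed
  have single: "?CT (\<sigma> j) = {ct j}" if j: "j < n" for j
  proof -
    have "s = ct j" if s: "s \<in> ?CT (\<sigma> j)" for s
    proof -
      obtain k where k: "k < n" "s = ct k" "\<sigma> j = \<sigma> k" using owner[OF \<sigma>(1)[OF j] s] by auto
      have "\<not> ct j < s" using no_later[OF j] s by auto
      moreover have "\<not> s < ct j" using no_later[OF k(1)] \<sigma>(2)[OF j] k by auto
      ultimately show ?thesis by simp
    qed
    then show ?thesis using \<sigma>(2)[OF j] by blast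
  qed
  have inj: "inj_on \<sigma> {..<n}"
    using single ct_inj by (intro inj_onI) (metis lessThan_iff singleton_inject)
  have "realizes \<epsilon> N t \<sigma> \<omega> \<Phi>"
    unfolding realizes_def
  proof (intro conjI allI impI)
    show "\<sigma> ` {..<n} \<subseteq> {..<N}" using \<sigma>(1) by auto
    show "last_time \<Phi> \<le> t" using ct_le[of "n - 1"] t_nonneg by (simp add: last_time_def)
    show "snd (snd \<omega> (\<sigma> j)) = coll_vel \<Phi> j" if j: "j < n" for j
    proof -
      have "Lim (at_left (ct j)) (W (\<sigma> j)) = W (\<sigma> j) 0"
      proof (rule Lim_at_left_const[OF ct_pos[OF j]])
        show "W (\<sigma> j) r = W (\<sigma> j) 0" if "0 < r" "r < ct j" for r
          using that ct_le[OF j] single[OF j] by (intro steadyW \<sigma>(1)[OF j]) auto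
      qed
      then show ?thesis using \<sigma>(4)[OF j] Y0[OF \<sigma>(1)[OF j]] by (metis snd_conv)
    qed
    then have vel: "W (\<sigma> j) 0 = coll_vel \<Phi> j" if "j < n" for j using Y0[OF \<sigma>(1)[OF that]] that by (metis snd_conv)
    show "fst (snd \<omega> (\<sigma> j)) - partner_pos \<epsilon> \<Phi> j 0 \<in> int_lattice" if j: "j < n" for j
    proof -
      have "Y (\<sigma> j) (ct j) = Y (\<sigma> j) 0 + (ct j - 0) *\<^sub>R W (\<sigma> j) 0"
        using ct_pos[OF j] ct_le[OF j] single[OF j] by (intro straightY \<sigma>(1)[OF j]) auto
      then have "Y (\<sigma> j) 0 - partner_pos \<epsilon> \<Phi> j 0 = Y (\<sigma> j) (ct j) - (X (ct j) + \<epsilon> *\<^sub>R coll_param \<Phi> j)"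
        using at_ct[OF j] vel[OF j] ct_pos[OF j] by (simp add: partner_pos_def partner_vel_def)
      also have "\<dots> \<in> int_lattice" using \<sigma>(3)[OF j] by (simp add: impact_def)
      finally show ?thesis using Y0[OF \<sigma>(1)[OF j]] by (metis fst_conv)
    qed
    fix i assume i: "i < N" "i \<notin> \<sigma> ` {..<n}"
    have CT: "?CT i = {}" using owner[OF i(1)] i(2) by blast
    have Ys: "Y i s = fst (snd \<omega> i) + s *\<^sub>R snd (snd \<omega> i)" if "0 \<le> s" "s \<le> t" for s
      using straightY[OF i(1), of 0 s] that CT Y0[OF i(1)] by (metis Int_empty_left diff_zero fst_conv order.refl snd_conv)
    \<comment> \<open>The absence of contact times alone would not suffice: an overlapping particle
      leaves the root without any contact. The flag excludes it at time 0.\<close>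
    have a0: "apart \<epsilon> (root_pos \<Phi>) 0 (snd \<omega> i)"
      using no i(1) root_start st by (subst apart_path_iff) (auto simp: no_initial_overlap_def)
    show "apart \<epsilon> (root_pos \<Phi>) t (snd \<omega> i)"
    proof (rule ccontr)
      assume "\<not> apart \<epsilon> (root_pos \<Phi>) t (snd \<omega> i)"
      then obtain s where s: "0 < s" "s \<le> t" "unmet_before \<epsilon> (root_pos \<Phi>) s (snd \<omega> i)"
        "tdist (root_pos \<Phi> s) (fst (snd \<omega> i) + s *\<^sub>R snd (snd \<omega> i)) = \<epsilon>"
        by (rule first_contact[OF order.refl t_nonneg a0])
      have "\<forall>\<^sub>F r in at_left s. \<epsilon> < tdist (X r) (Y i r)"
        unfolding eventually_at_left_field
      proof (intro exI conjI allI impI)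
        fix r assume r: "0 < r" "r < s"
        then show "\<epsilon> < tdist (X r) (Y i r)"
          using XR[of r] Ys[of r] s unmet_before_path_iff[OF s(1), of \<epsilon> "snd \<omega> i"] by simp
      qed (rule s(1))
      then have "s \<in> ?CT i" using s XR[of s] Ys[of s] by (simp add: contact_times_def)
      then show False using CT by simp
    qed
  qed (use inj st in auto)
  then show ?thesis by (rule that)
qed

end


section \<open>The density of the empirical distribution\<close>

lemma space_component_measure: "space (component_measure n) = UNIV \<times> ({..<n} \<rightarrow>\<^sub>E UNIV)"
  by (simp add: component_measure_def space_pair_measure space_PiM)

lemma measurable_component:
  shows "fst \<in> borel_measurable (component_measure n)"
    and "snd \<in> component_measure n \<rightarrow>\<^sub>M (\<Pi>\<^sub>M j\<in>{..<n}. mark_measure)"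
    and "j < n \<Longrightarrow> (\<lambda>y. snd y j) \<in> component_measure n \<rightarrow>\<^sub>M borel \<Otimes>\<^sub>M (borel \<Otimes>\<^sub>M borel)"
proof -
  show "fst \<in> borel_measurable (component_measure n)"
    unfolding component_measure_def by (simp cong: measurable_cong_sets)
  show s: "snd \<in> component_measure n \<rightarrow>\<^sub>M (\<Pi>\<^sub>M j\<in>{..<n}. mark_measure)"
    unfolding component_measure_def by simp
  show "(\<lambda>y. snd y j) \<in> component_measure n \<rightarrow>\<^sub>M borel \<Otimes>\<^sub>M (borel \<Otimes>\<^sub>M borel)" if "j < n"
    unfolding measurable_mark_borel using s that
    by (auto intro: measurable_component_singleton[THEN measurable_compose[rotated]])
qed

lemma component_part_trees: "component_part n (collision_trees T) \<in> sets (component_measure n)"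
proof -
  note [measurable] = measurable_component(1)
  have f [measurable]: "(\<lambda>y. fst (fst y)) \<in> borel_measurable (component_measure n)"
    by (rule borel_measurable_fst) measurable
  have m [measurable]: "(\<lambda>y. fst (snd y j)) \<in> borel_measurable (component_measure n)"
    "(\<lambda>y. fst (snd (snd y j))) \<in> borel_measurable (component_measure n)" if "j < n" for j
    using measurable_component(3)[OF that] by measurable
  have "Measurable.pred (component_measure n) (\<lambda>y. \<forall>i \<in> {..<n}. \<forall>j \<in> {..<n}. i < j \<longrightarrow> fst (snd y i) < fst (snd y j))"
    by (intro pred_intros_finite pred_intros_logic finite_lessThan borel_measurable_pred_less m) auto
  moreover have "Measurable.pred (component_measure n) (\<lambda>y. \<forall>j \<in> {..<n}. 0 \<le> fst (snd y j) \<and> fst (snd y j) \<le> T \<and> norm (fst (snd (snd y j))) = 1)"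
  proof (intro pred_intros_finite finite_lessThan)
    fix j assume "j \<in> {..<n}"
    then have "j < n" by simp
    note [measurable] = m[OF this]
    show "Measurable.pred (component_measure n) (\<lambda>y. 0 \<le> fst (snd y j) \<and> fst (snd y j) \<le> T \<and> norm (fst (snd (snd y j))) = 1)"
      by measurable
  qed
  moreover have "Measurable.pred (component_measure n) (\<lambda>y. fst (fst y) \<in> torus_cell)" by measurable
  ultimately have "Measurable.pred (component_measure n) (\<lambda>y. fst (fst y) \<in> torus_cell \<and>
      (\<forall>i \<in> {..<n}. \<forall>j \<in> {..<n}. i < j \<longrightarrow> fst (snd y i) < fst (snd y j)) \<and>
      (\<forall>j \<in> {..<n}. 0 \<le> fst (snd y j) \<and> fst (snd y j) \<le> T \<and> norm (fst (snd (snd y j))) = 1))"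
    by (intro pred_intros_logic)
  moreover have "component_part n (collision_trees T) = {y \<in> space (component_measure n). fst (fst y) \<in> torus_cell \<and>
      (\<forall>i \<in> {..<n}. \<forall>j \<in> {..<n}. i < j \<longrightarrow> fst (snd y i) < fst (snd y j)) \<and>
      (\<forall>j \<in> {..<n}. 0 \<le> fst (snd y j) \<and> fst (snd y j) \<le> T \<and> norm (fst (snd (snd y j))) = 1)}"
    by (auto simp: component_part_def collision_trees_def mk_tree_def sorted_wrt_iff_nth_less case_prod_beta)
  ultimately show ?thesis by (simp add: pred_def)
qed

lemma
  shows space_tree_measure [simp]: "space (tree_measure T) = collision_trees T"
    and sets_tree_measure: "sets (tree_measure T) =
      {A. A \<subseteq> collision_trees T \<and> (\<forall>n. component_part n A \<in> sets (component_measure n))}"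
proof -
  let ?S = "{A. A \<subseteq> collision_trees T \<and> (\<forall>n. component_part n A \<in> sets (component_measure n))}"
  have sa: "sigma_algebra (collision_trees T) ?S"
  proof (rule sigma_algebra_iff2[THEN iffD2], intro conjI ballI allI impI)
    show "?S \<subseteq> Pow (collision_trees T)" by auto
    show "{} \<in> ?S" by (simp add: component_part_def)
    fix A assume A: "A \<in> ?S"
    have "component_part n (collision_trees T - A) = component_part n (collision_trees T) - component_part n A" for n
      by (auto simp: component_part_def)
    then show "collision_trees T - A \<in> ?S" using A component_part_trees by auto
  next
    fix A :: "nat \<Rightarrow> tree set" assume A: "range A \<subseteq> ?S"
    have u: "component_part n (\<Union>i. A i) = (\<Union>i. component_part n (A i))" for n
      by (auto simp: component_part_def)
    have s: "component_part n (A i) \<in> sets (component_measure n)" "A i \<subseteq> collision_trees T" for n i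
      using A by auto
    show "(\<Union>i. A i) \<in> ?S"
    proof (intro CollectI conjI allI)
      show "(\<Union>i. A i) \<subseteq> collision_trees T" using s(2) by blast
      show "component_part n (\<Union>i. A i) \<in> sets (component_measure n)" for n
        unfolding u using s(1) by (intro sets.countable_UN) auto
    qed
  qed
  show "space (tree_measure T) = collision_trees T"
    unfolding tree_measure_def by (intro space_measure_of) auto
  show "sets (tree_measure T) = ?S"
    unfolding tree_measure_def by (rule sigma_algebra.sets_measure_of_eq[OF sa])
qed

lemma emeasure_tree_measure:
  assumes A: "A \<in> sets (tree_measure T)"
  shows "emeasure (tree_measure T) A = (\<Sum>n. emeasure (component_measure n) (component_part n A))"
proof (rule emeasure_measure_of[OF tree_measure_def _ _ _ A])
  let ?\<mu> = "\<lambda>A. \<Sum>n. emeasure (component_measure n) (component_part n A)"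
  show "{A. A \<subseteq> collision_trees T \<and> (\<forall>n. component_part n A \<in> sets (component_measure n))} \<subseteq> Pow (collision_trees T)" by auto
  show "positive (sets (tree_measure T)) ?\<mu>" by (simp add: positive_def component_part_def)
  show "countably_additive (sets (tree_measure T)) ?\<mu>"
  proof (rule countably_additiveI)
    fix B :: "nat \<Rightarrow> tree set" assume B: "range B \<subseteq> sets (tree_measure T)" and d: "disjoint_family B"
    have u: "component_part n (\<Union>i. B i) = (\<Union>i. component_part n (B i))" for n by (auto simp: component_part_def)
    have s: "component_part n (B i) \<in> sets (component_measure n)" for n i using B by (auto simp: sets_tree_measure)
    have dd: "disjoint_family (\<lambda>i. component_part n (B i))" for n
      using d unfolding disjoint_family_on_def component_part_def by blast
    have "(\<Sum>i. \<Sum>n. emeasure (component_measure n) (component_part n (B i)))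
      = (\<integral>\<^sup>+ i. \<integral>\<^sup>+ n. emeasure (component_measure n) (component_part n (B i)) \<partial>count_space UNIV \<partial>count_space UNIV)"
      by (simp add: nn_integral_count_space_nat)
    also have "\<dots> = (\<integral>\<^sup>+ n. \<integral>\<^sup>+ i. emeasure (component_measure n) (component_part n (B i)) \<partial>count_space UNIV \<partial>count_space UNIV)"
      by (rule nn_integral_count_space_nn_integral) auto
    also have "\<dots> = (\<Sum>n. \<Sum>i. emeasure (component_measure n) (component_part n (B i)))"
      by (simp add: nn_integral_count_space_nat)
    also have "\<dots> = (\<Sum>n. emeasure (component_measure n) (component_part n (\<Union>i. B i)))"
      unfolding u using s dd by (intro suminf_cong suminf_emeasure) auto
    finally show "(\<Sum>i. ?\<mu> (B i)) = ?\<mu> (\<Union>i. B i)" .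
  qed
qed

lemma measurable_tree_measure:
  fixes F :: "tree \<Rightarrow> 'b :: topological_space"
  assumes "\<And>n. (\<lambda>y. F (mk_tree n y)) \<in> borel_measurable (component_measure n)"
  shows "F \<in> borel_measurable (tree_measure T)"
proof (rule measurableI)
  fix B :: "'b set" assume B: "B \<in> sets borel"
  have eq: "component_part n (F -` B \<inter> collision_trees T)
      = ((\<lambda>y. F (mk_tree n y)) -` B \<inter> space (component_measure n)) \<inter> component_part n (collision_trees T)" for n
    by (auto simp: component_part_def)
  have "component_part n (F -` B \<inter> collision_trees T) \<in> sets (component_measure n)" for n
    unfolding eq by (rule sets.Int[OF measurable_sets[OF assms B] component_part_trees])
  then show "F -` B \<inter> space (tree_measure T) \<in> sets (tree_measure T)"
    by (auto simp: sets_tree_measure)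
qed simp

lemma measurable_component_restrict:
  fixes F :: "tree \<Rightarrow> ennreal"
  assumes F: "F \<in> borel_measurable (tree_measure T)"
  shows "(\<lambda>y. indicator (component_part n (collision_trees T)) y * F (mk_tree n y)) \<in> borel_measurable (component_measure n)"
proof -
  let ?A = "component_part n (collision_trees T)"
  have "(\<lambda>y. F (mk_tree n y)) \<in> borel_measurable (restrict_space (component_measure n) ?A)"
  proof (rule measurableI)
    fix B :: "ennreal set" assume B: "B \<in> sets borel"
    have "component_part n (F -` B \<inter> collision_trees T) \<in> sets (component_measure n)"
      using measurable_sets[OF F B] by (simp add: sets_tree_measure)
    moreover have "(\<lambda>y. F (mk_tree n y)) -` B \<inter> space (restrict_space (component_measure n) ?A) = component_part n (F -` B \<inter> collision_trees T)"
      by (auto simp: component_part_def space_restrict_space)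
    ultimately show "(\<lambda>y. F (mk_tree n y)) -` B \<inter> space (restrict_space (component_measure n) ?A) \<in> sets (restrict_space (component_measure n) ?A)"
      using component_part_trees[of n T] by (subst sets_restrict_space_iff) (auto simp: component_part_def)
  qed simp
  then have "(\<lambda>y. F (mk_tree n y) * indicator ?A y) \<in> borel_measurable (component_measure n)"
    using component_part_trees[of n T] by (subst (asm) borel_measurable_restrict_space_iff_ennreal) auto
  then show ?thesis by (simp add: mult.commute)
qed

text \<open>Built up from indicators as usual. The indicator of the component is needed because
  measurability of \<open>F\<close> says nothing about values of \<open>mk_tree\<close> outside
  \<open>collision_trees\<close>.\<close>

lemma nn_integral_tree_measure:
  assumes "F \<in> borel_measurable (tree_measure T)"
  shows "(\<integral>\<^sup>+ \<Phi>. F \<Phi> \<partial>tree_measure T)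
    = (\<Sum>n. \<integral>\<^sup>+ y. indicator (component_part n (collision_trees T)) y * F (mk_tree n y) \<partial>component_measure n)"
  using assms
proof (induction rule: borel_measurable_induct)
  case (cong f g)
  have "(\<integral>\<^sup>+ \<Phi>. f \<Phi> \<partial>tree_measure T) = (\<integral>\<^sup>+ \<Phi>. g \<Phi> \<partial>tree_measure T)" using cong by (intro nn_integral_cong) auto
  moreover have "(\<integral>\<^sup>+ y. indicator (component_part n (collision_trees T)) y * f (mk_tree n y) \<partial>component_measure n)
     = (\<integral>\<^sup>+ y. indicator (component_part n (collision_trees T)) y * g (mk_tree n y) \<partial>component_measure n)" for n
    using cong(3) by (intro nn_integral_cong) (auto simp: indicator_def component_part_def)
  ultimately show ?case using cong by simp
next
  case (set A)
  have "(\<integral>\<^sup>+ y. indicator (component_part n (collision_trees T)) y * indicator A (mk_tree n y) \<partial>component_measure n)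
    = (\<integral>\<^sup>+ y. indicator (component_part n A) y \<partial>component_measure n)" for n
    using set by (intro nn_integral_cong) (auto simp: indicator_def component_part_def sets_tree_measure)
  then show ?case using set by (simp add: emeasure_tree_measure sets_tree_measure)
next
  case (mult u c)
  have "(\<integral>\<^sup>+ y. indicator (component_part n (collision_trees T)) y * (c * u (mk_tree n y)) \<partial>component_measure n)
     = c * (\<integral>\<^sup>+ y. indicator (component_part n (collision_trees T)) y * u (mk_tree n y) \<partial>component_measure n)" for n
    using measurable_component_restrict[OF mult(2)] by (subst nn_integral_cmult[symmetric]) (auto simp: mult_ac)
  then show ?case using mult by (simp add: nn_integral_cmult ennreal_suminf_cmult)
next
  case (add u v)
  have "(\<integral>\<^sup>+ y. indicator (component_part n (collision_trees T)) y * (v (mk_tree n y) + u (mk_tree n y)) \<partial>component_measure n)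
     = (\<integral>\<^sup>+ y. indicator (component_part n (collision_trees T)) y * v (mk_tree n y) \<partial>component_measure n)
      + (\<integral>\<^sup>+ y. indicator (component_part n (collision_trees T)) y * u (mk_tree n y) \<partial>component_measure n)" for n
    using measurable_component_restrict[of u T n] measurable_component_restrict[of v T n] add
    by (subst nn_integral_add[symmetric]) (auto simp: distrib_left)
  then show ?case using add by (simp add: nn_integral_add suminf_add)
next
  case (seq U)
  have m: "(\<lambda>y. indicator (component_part n (collision_trees T)) y * U i (mk_tree n y)) \<in> borel_measurable (component_measure n)" for n i
    using seq(1) by (rule measurable_component_restrict)
  have inc: "incseq (\<lambda>i. \<integral>\<^sup>+ y. indicator (component_part n (collision_trees T)) y * U i (mk_tree n y) \<partial>component_measure n)" for n
    by (intro incseq_SucI nn_integral_mono mult_left_mono le_funD[OF incseq_SucD[OF seq(3)]]) simp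
  have "(\<integral>\<^sup>+ y. indicator (component_part n (collision_trees T)) y * (SUP i. U i (mk_tree n y)) \<partial>component_measure n)
     = (SUP i. \<integral>\<^sup>+ y. indicator (component_part n (collision_trees T)) y * U i (mk_tree n y) \<partial>component_measure n)" for n
    unfolding SUP_mult_left_ennreal
    by (intro nn_integral_monotone_convergence_SUP m incseq_SucI le_funI mult_left_mono le_funD[OF incseq_SucD[OF seq(3)]]) simp
  moreover have "(\<integral>\<^sup>+ \<Phi>. (SUP i. U i \<Phi>) \<partial>tree_measure T) = (SUP i. \<integral>\<^sup>+ \<Phi>. U i \<Phi> \<partial>tree_measure T)"
    using seq by (intro nn_integral_monotone_convergence_SUP) auto
  ultimately show ?case using seq inc by (simp add: SUP_apply image_comp ennreal_suminf_SUP_eq)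
qed

lemma survival_measurable:
  assumes g: "torus_density g" and X: "case_prod X \<in> borel_measurable (M \<Otimes>\<^sub>M borel)"
  shows "(\<lambda>k. survival \<epsilon> g (X k) t) \<in> borel_measurable M"
proof -
  interpret S: prob_space "state_law g" using g by (rule prob_state_law)
  have f: "(\<lambda>z. (fst (fst z), snd z)) \<in> (M \<Otimes>\<^sub>M state_law g) \<Otimes>\<^sub>M borel \<rightarrow>\<^sub>M M \<Otimes>\<^sub>M borel" by measurable
  have X': "case_prod (\<lambda>z. X (fst z)) \<in> borel_measurable ((M \<Otimes>\<^sub>M state_law g) \<Otimes>\<^sub>M borel)"
    using measurable_compose[OF f X] by (simp add: case_prod_beta')
  have [measurable]: "Measurable.pred (M \<Otimes>\<^sub>M state_law g) (\<lambda>z. apart \<epsilon> (X (fst z)) t (snd z))"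
    by (rule measurable_apart[OF X']) (auto cong: measurable_cong_sets)
  have "(\<lambda>k. \<integral>\<^sup>+ p. (if apart \<epsilon> (X k) t p then 1 else 0) \<partial>state_law g) \<in> borel_measurable M"
    by (rule S.borel_measurable_nn_integral) (simp add: case_prod_beta')
  then have "(\<lambda>k. enn2real (\<integral>\<^sup>+ p. (if apart \<epsilon> (X k) t p then 1 else 0) \<partial>state_law g)) \<in> borel_measurable M" by measurable
  also have "?this \<longleftrightarrow> ?thesis"
  proof (rule measurable_cong)
    fix k assume k: "k \<in> space M"
    have "(\<lambda>s. (k, s)) \<in> borel \<rightarrow>\<^sub>M M \<Otimes>\<^sub>M borel" using k by measurable
    from measurable_compose[OF this X] have "X k \<in> borel_measurable borel" by simp
    then have [measurable]: "case_prod (\<lambda>_::state. X k) \<in> borel_measurable (borel \<Otimes>\<^sub>M borel)" by measurable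
    have A: "{p. apart \<epsilon> (X k) t p} \<in> sets (state_law g)"
    proof -
      have "Measurable.pred borel (\<lambda>p. apart \<epsilon> (X k) t p)" by (rule measurable_apart) measurable
      then show ?thesis by (simp add: pred_def)
    qed
    have "(\<integral>\<^sup>+ p. (if apart \<epsilon> (X k) t p then 1 else 0) \<partial>state_law g) = (\<integral>\<^sup>+ p. indicator {p. apart \<epsilon> (X k) t p} p \<partial>state_law g)"
      by (intro nn_integral_cong) (simp add: indicator_def)
    also have "\<dots> = emeasure (state_law g) {p. apart \<epsilon> (X k) t p}" using A by (rule nn_integral_indicator)
    finally show "enn2real (\<integral>\<^sup>+ p. (if apart \<epsilon> (X k) t p then 1 else 0) \<partial>state_law g) = survival \<epsilon> g (X k) t"
      by (simp add: survival_def measure_def)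
  qed
  finally show ?thesis .
qed

lemma n_coll_truncate: "n_coll (truncate_tree j \<Phi>) = min (n_coll \<Phi>) j"
  by (simp add: n_coll_def truncate_tree_def min.commute)

lemma last_time_truncate:
  assumes "timely \<Phi>" "j < n_coll \<Phi>"
  shows "last_time (truncate_tree j \<Phi>) \<le> coll_time \<Phi> j"
    and "0 < coll_time \<Phi> j \<Longrightarrow> last_time (truncate_tree j \<Phi>) < coll_time \<Phi> j"
proof -
  have "last_time (truncate_tree j \<Phi>) = (if j = 0 then 0 else coll_time \<Phi> (j - 1))"
  proof -
    have "n_coll (truncate_tree j \<Phi>) = j" using assms(2) by (simp add: n_coll_truncate)
    moreover have "coll_time (truncate_tree j \<Phi>) (j - 1) = coll_time \<Phi> (j - 1)" if "j \<noteq> 0"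
      using that by (simp add: coll_time_def truncate_tree_def)
    ultimately show ?thesis by (simp add: last_time_def)
  qed
  then show "last_time (truncate_tree j \<Phi>) \<le> coll_time \<Phi> j"
    "0 < coll_time \<Phi> j \<Longrightarrow> last_time (truncate_tree j \<Phi>) < coll_time \<Phi> j"
    using sorted_coll_time[OF assms(1), of "j - 1" j] assms coll_time_nonneg[OF assms] by (auto simp: less_imp_le)
qed

section \<open>Realizations of a tree as chains of first contacts\<close>

context regular
begin

lemma mark_eq: "j < n \<Longrightarrow> snd \<Phi> ! j = (ct j, coll_param \<Phi> j, coll_vel \<Phi> j)"
  by (simp add: coll_time_def coll_param_def coll_vel_def)

lemma emitted_partner:
  assumes j: "j < n"
  shows "emitted \<epsilon> (root_pos (truncate_tree j \<Phi>)) (snd \<Phi> ! j) = (partner_pos \<epsilon> \<Phi> j 0, coll_vel \<Phi> j)"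
  using root_truncate(2)[OF timely j, of "ct j"] ct_pos[OF j]
  by (simp add: emitted_def mark_eq[OF j] partner_pos_def partner_vel_def)

lemma partner_before:
  assumes j: "j < n" and s: "s \<le> ct j"
  shows "partner_pos \<epsilon> \<Phi> j s = partner_pos \<epsilon> \<Phi> j 0 + s *\<^sub>R coll_vel \<Phi> j"
  using ct_pos[OF j] s by (cases "s = ct j") (auto simp: partner_pos_def partner_vel_def algebra_simps)

text \<open>Before its collision the partner is free and by regularity has not met the root, which
  up to then moves as in the truncated tree. Hence the condition inside \<open>arrival\<close> holds
  automatically at regular trees.\<close>

lemma unmet_regular:
  assumes j: "j < n" and le: "ct j \<le> t"
  shows "unmet_before \<epsilon> (root_pos (truncate_tree j \<Phi>)) (ct j) (emitted \<epsilon> (root_pos (truncate_tree j \<Phi>)) (snd \<Phi> ! j))"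
proof -
  interpret tr: path "fst ` set (snd (truncate_tree j \<Phi>))" "root_pos (truncate_tree j \<Phi>)" "root_vel (truncate_tree j \<Phi>)"
    by (rule path_root[OF timely_truncate[OF timely]])
  show ?thesis
    unfolding tr.unmet_before_path_iff[OF ct_pos[OF j]] emitted_partner[OF j] fst_conv snd_conv
  proof
    fix s assume s: "s \<in> {0..<ct j}"
    then have "\<epsilon> < tdist (root_pos \<Phi> s) (partner_pos \<epsilon> \<Phi> j s)" using le by (intro recollision[OF j]) auto
    then show "\<epsilon> < tdist (root_pos (truncate_tree j \<Phi>) s) (partner_pos \<epsilon> \<Phi> j 0 + s *\<^sub>R coll_vel \<Phi> j)"
      using root_truncate(2)[OF timely j, of s] partner_before[OF j, of s] s by simp
  qed
qed

lemma incoming: "j < n \<Longrightarrow> 0 < (root_vel (truncate_tree j \<Phi>) (last_time (truncate_tree j \<Phi>)) - coll_vel \<Phi> j) \<bullet> coll_param \<Phi> j"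
  using reg pre_vel_tail[OF timely] by (simp add: regular_trees_def non_grazing_def inner_commute)

lemma ct_le_T: "j < n \<Longrightarrow> ct j \<le> T"
  using reg mark_mem[of j] by (fastforce simp: regular_trees_def collision_trees_def)

text \<open>By induction the first \<open>m\<close> partners reproduce the first \<open>m\<close>
  collisions. The next partner is a lattice translate of the state emitted by the next mark, and
  \<open>unmet_regular\<close> makes that contact its first.\<close>

lemma chain_realizes:
  assumes r: "realizes \<epsilon> N t \<sigma> \<omega> \<Phi>" and g: "torus_density g" and T: "0 < T"
  shows "chain_ok \<epsilon> (T + 1) n (fst \<omega>) (snd \<omega> \<circ> \<sigma>)"
    and "m \<le> n \<Longrightarrow> mk_tree m (fst \<omega>, chain \<epsilon> m (fst \<omega>) (snd \<omega> \<circ> \<sigma>)) = truncate_tree m \<Phi>"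
proof -
  have st: "fst \<omega> = fst \<Phi>" and last: "last_time \<Phi> \<le> t"
    and part: "\<And>j. j < n \<Longrightarrow> snd (snd \<omega> (\<sigma> j)) = coll_vel \<Phi> j" "\<And>j. j < n \<Longrightarrow> fst (snd \<omega> (\<sigma> j)) - partner_pos \<epsilon> \<Phi> j 0 \<in> int_lattice"
    using r unfolding realizes_def by auto
  let ?c = "\<lambda>m. chain \<epsilon> m (fst \<omega>) (snd \<omega> \<circ> \<sigma>)"
  have *: "chain_ok \<epsilon> (T + 1) m (fst \<omega>) (snd \<omega> \<circ> \<sigma>) \<and> mk_tree m (fst \<omega>, ?c m) = truncate_tree m \<Phi>" if "m \<le> n" for m
    using that
  proof (induction m)
    case 0
    then show ?case by (simp add: mk_tree_def truncate_tree_def st)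
  next
    case (Suc m)
    then have m: "m < n" by simp
    note IH = Suc.IH[OF less_imp_le[OF m], THEN conjunct1] Suc.IH[OF less_imp_le[OF m], THEN conjunct2]
    let ?\<Psi> = "truncate_tree m \<Phi>"
    let ?p = "snd \<omega> (\<sigma> m)"
    have tm: "timely ?\<Psi>" using timely by (rule timely_truncate)
    interpret tr: path_tail "fst ` set (snd ?\<Psi>)" "root_pos ?\<Psi>" "root_vel ?\<Psi>" "last_time ?\<Psi>" \<epsilon> g
      using tm eps g by (rule path_tail_root)
    have le: "ct m \<le> t" using coll_time_le_last[OF timely m] last by simp
    let ?k = "fst ?p - partner_pos \<epsilon> \<Phi> m 0"
    have p: "?p = (partner_pos \<epsilon> \<Phi> m 0 + ?k, coll_vel \<Phi> m)" using part(1)[OF m] by (simp add: prod_eq_iff)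
    have e: "emitted \<epsilon> (root_pos ?\<Psi>) (ct m, coll_param \<Phi> m, coll_vel \<Phi> m) = (partner_pos \<epsilon> \<Phi> m 0, coll_vel \<Phi> m)"
      using emitted_partner[OF m] mark_eq[OF m] by simp
    have um: "unmet_before \<epsilon> (root_pos ?\<Psi>) (ct m) (partner_pos \<epsilon> \<Phi> m 0, coll_vel \<Phi> m)"
      using unmet_regular[OF m le] emitted_partner[OF m] by simp
    have "contact_mark \<epsilon> (root_pos ?\<Psi>) (partner_pos \<epsilon> \<Phi> m 0, coll_vel \<Phi> m) = (ct m, coll_param \<Phi> m, coll_vel \<Phi> m)"
      using tr.contact_mark_emitted[OF ct_pos[OF m] norm_param[OF m], of "coll_vel \<Phi> m"] um unfolding e by simp
    then have cm: "contact_mark \<epsilon> (root_pos ?\<Psi>) ?p = (ct m, coll_param \<Phi> m, coll_vel \<Phi> m)"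
      using contact_mark_lattice[OF part(2)[OF m]] p by metis
    have "unmet_before \<epsilon> (root_pos ?\<Psi>) (ct m) ?p"
      using um apart_lattice[OF part(2)[OF m]] p unfolding unmet_before_def by metis
    then have th: "tree_hit \<epsilon> (T + 1) ?\<Psi> ?p"
      unfolding tree_hit_def hit_def Let_def cm
      using last_time_truncate(2)[OF timely m ct_pos[OF m]] last_time_nonneg[OF tm] ct_le_T[OF m] norm_param[OF m] incoming[OF m] part(1)[OF m]
      by simp
    have mt: "mk_tree (Suc m) (fst \<omega>, ?c (Suc m)) = truncate_tree (Suc m) \<Phi>"
    proof -
      have "mk_tree (Suc m) (fst \<omega>, ?c (Suc m)) = (fst \<omega>, snd (mk_tree m (fst \<omega>, ?c m)) @ [contact_mark \<epsilon> (root_pos ?\<Psi>) ?p])"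
        unfolding mk_tree_Suc chain.simps mk_tree_upd IH(2) by (simp only: o_apply fun_upd_same)
      also have "\<dots> = (fst \<Phi>, take m (snd \<Phi>) @ [snd \<Phi> ! m])"
        unfolding IH(2) cm mark_eq[OF m] unfolding st by (simp only: truncate_tree_def snd_conv)
      also have "\<dots> = truncate_tree (Suc m) \<Phi>"
        using m by (simp add: truncate_tree_def take_Suc_conv_app_nth n_coll_def)
      finally show ?thesis .
    qed
    have "chain_ok \<epsilon> (T + 1) (Suc m) (fst \<omega>) (snd \<omega> \<circ> \<sigma>)"
      by (subst chain_ok.simps, rule conjI, rule IH(1), subst IH(2), subst o_apply, rule th)
    then show ?case using mt by (rule conjI)
  qed
  show "chain_ok \<epsilon> (T + 1) n (fst \<omega>) (snd \<omega> \<circ> \<sigma>)" by (rule *[OF order.refl, THEN conjunct1])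
  show "m \<le> n \<Longrightarrow> mk_tree m (fst \<omega>, ?c m) = truncate_tree m \<Phi>" by (rule *[THEN conjunct2])
qed

lemma truncate_all: "truncate_tree n \<Phi> = \<Phi>"
  by (simp add: truncate_tree_def n_coll_def)

text \<open>Each mark of the chain determines the initial state of its particle up to the lattice,
  by undoing \<open>contact_mark\<close>; this is the condition on partners in
  \<open>realizes\<close>.\<close>

lemma realizes_chain:
  assumes \<Phi>: "\<Phi> = mk_tree n (fst \<omega>, chain \<epsilon> n (fst \<omega>) (snd \<omega> \<circ> \<sigma>))"
    and inj: "inj_on \<sigma> {..<n}" "\<sigma> ` {..<n} \<subseteq> {..<N}" and last: "last_time \<Phi> \<le> t"
    and ap: "\<forall>i < N. i \<notin> \<sigma> ` {..<n} \<longrightarrow> apart \<epsilon> (root_pos \<Phi>) t (snd \<omega> i)"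
  shows "realizes \<epsilon> N t \<sigma> \<omega> \<Phi>"
  unfolding realizes_def
proof (intro conjI allI impI)
  show "fst \<omega> = fst \<Phi>" by (subst \<Phi>) simp
  have mark: "snd \<Phi> ! j = contact_mark \<epsilon> (root_pos (truncate_tree j \<Phi>)) (snd \<omega> (\<sigma> j))" if j: "j < n" for j
  proof -
    have "truncate_tree j \<Phi> = mk_tree j (fst \<omega>, chain \<epsilon> j (fst \<omega>) (snd \<omega> \<circ> \<sigma>))"
      by (subst \<Phi>, subst truncate_mk_tree[OF less_imp_le[OF j]], rule chain_prefix[OF less_imp_le[OF j]])
    moreover have "snd \<Phi> ! j = chain \<epsilon> n (fst \<omega>) (snd \<omega> \<circ> \<sigma>) j"
      using j by (subst \<Phi>) (simp add: mk_tree_def)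
    ultimately show ?thesis using chain_at[OF j] by simp
  qed
  show v: "snd (snd \<omega> (\<sigma> j)) = coll_vel \<Phi> j" if "j < n" for j
    using mark[OF that] by (simp add: coll_vel_def contact_mark_def)
  show "fst (snd \<omega> (\<sigma> j)) - partner_pos \<epsilon> \<Phi> j 0 \<in> int_lattice" if j: "j < n" for j
  proof -
    let ?X = "root_pos (truncate_tree j \<Phi>)" and ?p = "snd \<omega> (\<sigma> j)"
    have c: "contact \<epsilon> ?X ?p = ct j" "(1 / \<epsilon>) *\<^sub>R wrap (fst ?p + ct j *\<^sub>R snd ?p - ?X (ct j)) = coll_param \<Phi> j"
      using mark[OF j] by (simp_all add: coll_time_def coll_param_def contact_mark_def)
    have "\<epsilon> *\<^sub>R coll_param \<Phi> j = wrap (fst ?p + ct j *\<^sub>R snd ?p - ?X (ct j))"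
      using eps unfolding c(2)[symmetric] by simp
    moreover have "?X (ct j) = root_pos \<Phi> (ct j)" using root_truncate(2)[OF timely j] by simp
    moreover have "partner_pos \<epsilon> \<Phi> j 0 = root_pos \<Phi> (ct j) + \<epsilon> *\<^sub>R coll_param \<Phi> j - ct j *\<^sub>R snd ?p"
      using ct_pos[OF j] v[OF j] by (simp add: partner_pos_def partner_vel_def)
    ultimately have "fst ?p - partner_pos \<epsilon> \<Phi> j 0 = (fst ?p + ct j *\<^sub>R snd ?p - ?X (ct j)) - wrap (fst ?p + ct j *\<^sub>R snd ?p - ?X (ct j))"
      by simp
    then show ?thesis using lattice_wrap by metis
  qed
qed (use assms in auto)

lemma realized_partner_dist:
  assumes r: "realizes \<epsilon> N t \<sigma> \<omega> \<Phi>" and j: "j < n" and s: "s \<le> ct j"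
  shows "tdist x (fst (snd \<omega> (\<sigma> j)) + s *\<^sub>R snd (snd \<omega> (\<sigma> j))) = tdist x (partner_pos \<epsilon> \<Phi> j s)"
proof -
  have "snd (snd \<omega> (\<sigma> j)) = coll_vel \<Phi> j" "fst (snd \<omega> (\<sigma> j)) - partner_pos \<epsilon> \<Phi> j 0 \<in> int_lattice"
    using r j unfolding realizes_def by auto
  then show ?thesis
    using partner_before[OF j s] lattice_uminus[of "fst (snd \<omega> (\<sigma> j)) - partner_pos \<epsilon> \<Phi> j 0"]
    by (intro tdist_lattice) simp
qed

end

text \<open>Two realizations that agree before collision \<open>j\<close> have the same root path
  until the earlier of their next collisions. The particle involved there is at distance \<epsilon>
  from the other root as well, so the other tree must record the same collision.\<close>

lemma realizes_step:
  assumes R: "regular T \<epsilon> t \<Phi>" "regular T \<epsilon> t \<Phi>'" and T: "0 < T" and g: "torus_density g"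
    and r: "realizes \<epsilon> N t \<sigma> \<omega> \<Phi>" "realizes \<epsilon> N t \<sigma>' \<omega> \<Phi>'"
    and agree: "\<forall>i<j. i < n_coll \<Phi>' \<and> \<sigma> i = \<sigma>' i" and j: "j < n_coll \<Phi>"
    and first: "j < n_coll \<Phi>' \<Longrightarrow> coll_time \<Phi> j \<le> coll_time \<Phi>' j"
  shows "j < n_coll \<Phi>' \<and> \<sigma> j = \<sigma>' j"
proof (rule ccontr)
  assume no: "\<not> (j < n_coll \<Phi>' \<and> \<sigma> j = \<sigma>' j)"
  interpret A: regular T \<epsilon> t \<Phi> by fact
  interpret B: regular T \<epsilon> t \<Phi>' by fact
  let ?s = "coll_time \<Phi> j" and ?i = "\<sigma> j"
  have j': "j \<le> n_coll \<Phi>'" using agree by (metis Suc_pred le_eq_less_or_eq less_imp_le_nat lessI linorder_not_le zero_le)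
  have inj: "inj_on \<sigma> {..<n_coll \<Phi>}" "\<sigma> ` {..<n_coll \<Phi>} \<subseteq> {..<N}" and last: "last_time \<Phi> \<le> t"
    and ap: "\<And>i. i < N \<Longrightarrow> i \<notin> \<sigma>' ` {..<n_coll \<Phi>'} \<Longrightarrow> apart \<epsilon> (root_pos \<Phi>') t (snd \<omega> i)"
    using r unfolding realizes_def by auto
  have s: "0 < ?s" "?s \<le> t" using A.ct_pos[OF j] coll_time_le_last[OF A.timely j] last by auto
  have "truncate_tree j \<Phi> = mk_tree j (fst \<omega>, chain \<epsilon> j (fst \<omega>) (snd \<omega> \<circ> \<sigma>))"
    using A.chain_realizes(2)[OF r(1) g T] j by simp
  also have "chain \<epsilon> j (fst \<omega>) (snd \<omega> \<circ> \<sigma>) = chain \<epsilon> j (fst \<omega>) (snd \<omega> \<circ> \<sigma>')"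
    using agree by (intro chain_cong) simp
  also have "mk_tree j (fst \<omega>, \<dots>) = truncate_tree j \<Phi>'" using B.chain_realizes(2)[OF r(2) g T j'] .
  finally have tr: "truncate_tree j \<Phi> = truncate_tree j \<Phi>'" .
  have "root_pos \<Phi>' ?s = root_pos (truncate_tree j \<Phi>') ?s"
  proof (cases "j < n_coll \<Phi>'")
    case True
    then show ?thesis using root_truncate(2)[OF B.timely True first[OF True]] by simp
  next
    case False
    then show ?thesis using j' B.truncate_all by (metis le_antisym not_le)
  qed
  also have "\<dots> = root_pos \<Phi> ?s" using root_truncate(2)[OF A.timely j, of ?s] tr by simp
  finally have root: "root_pos \<Phi>' ?s = root_pos \<Phi> ?s" .
  have "tdist (root_pos \<Phi>' ?s) (fst (snd \<omega> ?i) + ?s *\<^sub>R snd (snd \<omega> ?i)) = tdist (root_pos \<Phi> ?s) (partner_pos \<epsilon> \<Phi> j ?s)"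
    unfolding root using A.realized_partner_dist[OF r(1) j] by simp
  also have "\<dots> = \<epsilon>" using A.partner_contact[OF j] A.norm_param[OF j] A.eps by (simp add: tdist_impact)
  finally have eq: "tdist (root_pos \<Phi>' ?s) (fst (snd \<omega> ?i) + ?s *\<^sub>R snd (snd \<omega> ?i)) = \<epsilon>" .
  show False
  \<comment> \<open>If the particle collides later in the other tree, regularity keeps it away from
    the root until then; if it is a bystander there, it is apart on the whole interval. Either way
    distance \<epsilon> is impossible.\<close>
  proof (cases "?i \<in> \<sigma>' ` {..<n_coll \<Phi>'}")
    case True
    then obtain k where k: "k < n_coll \<Phi>'" "?i = \<sigma>' k" by auto
    have "\<not> k < j"
    proof
      assume "k < j"
      then have "\<sigma> k = \<sigma> j" using agree k by simp
      then show False using inj(1) \<open>k < j\<close> j by (auto dest: inj_onD)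
    qed
    moreover have "k \<noteq> j" using no k by auto
    ultimately have jk: "j < k" by simp
    then have "coll_time \<Phi>' j < coll_time \<Phi>' k" using k(1) by (rule B.ct_less)
    then have lt: "?s < coll_time \<Phi>' k" using first jk k(1) by simp
    have "\<epsilon> < tdist (root_pos \<Phi>' ?s) (partner_pos \<epsilon> \<Phi>' k ?s)" using s lt by (intro B.recollision[OF k(1)]) auto
    then show False using eq B.realized_partner_dist[OF r(2) k(1) less_imp_le[OF lt]] k(2) by simp
  next
    case False
    then have "apart \<epsilon> (root_pos \<Phi>') t (snd \<omega> ?i)" using inj(2) j by (intro ap) auto
    then show False using eq s B.apart_path_iff[OF B.t_nonneg, of \<epsilon> "snd \<omega> ?i"] by force
  qed
qed

text \<open>Strong induction on \<open>j\<close>, applying \<open>realizes_step\<close> to whichever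
  tree has the earlier collision \<open>j\<close>. Uniqueness of the labels makes the labelled
  events disjoint, so no configuration is counted twice.\<close>

lemma realizes_unique:
  assumes R: "regular T \<epsilon> t \<Phi>" "regular T \<epsilon> t \<Phi>'" and T: "0 < T" and g: "torus_density g"
    and r: "realizes \<epsilon> N t \<sigma> \<omega> \<Phi>" "realizes \<epsilon> N t \<sigma>' \<omega> \<Phi>'"
  shows "\<Phi> = \<Phi>' \<and> (\<forall>j < n_coll \<Phi>. \<sigma> j = \<sigma>' j)"
proof -
  interpret A: regular T \<epsilon> t \<Phi> by fact
  interpret B: regular T \<epsilon> t \<Phi>' by fact
  have *: "(j < n_coll \<Phi> \<longleftrightarrow> j < n_coll \<Phi>') \<and> (j < n_coll \<Phi> \<longrightarrow> \<sigma> j = \<sigma>' j)" for j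
  proof (induction j rule: less_induct)
    case (less j)
    show ?case
    proof (cases "j < n_coll \<Phi> \<or> j < n_coll \<Phi>'")
      case True
      have ag: "\<forall>i<j. i < n_coll \<Phi>' \<and> \<sigma> i = \<sigma>' i" "\<forall>i<j. i < n_coll \<Phi> \<and> \<sigma>' i = \<sigma> i"
        using less True by (metis order.strict_trans)+
      show ?thesis
      proof (cases "j < n_coll \<Phi> \<and> (j < n_coll \<Phi>' \<longrightarrow> coll_time \<Phi> j \<le> coll_time \<Phi>' j)")
        case True
        then show ?thesis using realizes_step[OF R T g r ag(1)] by blast
      next
        case False
        then have "j < n_coll \<Phi>'" "j < n_coll \<Phi> \<Longrightarrow> coll_time \<Phi>' j \<le> coll_time \<Phi> j" using True by auto
        from realizes_step[OF R(2,1) T g r(2,1) ag(2) this] show ?thesis using \<open>j < n_coll \<Phi>'\<close> by simp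
      qed
    qed simp
  qed
  then have n: "n_coll \<Phi> = n_coll \<Phi>'" by (metis linorder_neqE_nat less_irrefl)
  have "\<Phi> = mk_tree (n_coll \<Phi>) (fst \<omega>, chain \<epsilon> (n_coll \<Phi>) (fst \<omega>) (snd \<omega> \<circ> \<sigma>))"
    using A.chain_realizes(2)[OF r(1) g T order.refl] by (simp add: A.truncate_all)
  also have "chain \<epsilon> (n_coll \<Phi>) (fst \<omega>) (snd \<omega> \<circ> \<sigma>) = chain \<epsilon> (n_coll \<Phi>) (fst \<omega>) (snd \<omega> \<circ> \<sigma>')"
    using * by (intro chain_cong) simp
  also have "mk_tree (n_coll \<Phi>) (fst \<omega>, \<dots>) = \<Phi>'"
    using B.chain_realizes(2)[OF r(2) g T order.refl] by (simp add: B.truncate_all n)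
  finally show ?thesis using * by blast
qed

text \<open>The factors \<open>N - j\<close> count the choices of the partner in collision \<open>j\<close>.\<close>

definition collision_factor :: "real \<Rightarrow> (vec3 \<Rightarrow> vec3 \<Rightarrow> real) \<Rightarrow> tree \<Rightarrow> nat \<Rightarrow> real" where
  "collision_factor \<epsilon> g \<Phi> j =
    g (fst (emitted \<epsilon> (root_pos (truncate_tree j \<Phi>)) (snd \<Phi> ! j))) (coll_vel \<Phi> j)
    * max ((root_vel (truncate_tree j \<Phi>) (last_time (truncate_tree j \<Phi>)) - coll_vel \<Phi> j) \<bullet> coll_param \<Phi> j) 0"

text \<open>The factors use real subtraction: for more than \<open>N\<close> collisions the factor
  with \<open>j = N\<close> is 0, so the truncated exponent \<open>N - n_coll \<Phi>\<close> does no
  harm there.\<close>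

definition history_density ::
    "real \<Rightarrow> nat \<Rightarrow> (vec3 \<Rightarrow> vec3 \<Rightarrow> real) \<Rightarrow> (vec3 \<Rightarrow> vec3 \<Rightarrow> real) \<Rightarrow> real \<Rightarrow> tree \<Rightarrow> real" where
  "history_density \<epsilon> N f g t \<Phi> =
    (if last_time \<Phi> \<le> t
     then f (fst (fst \<Phi>)) (snd (fst \<Phi>)) * (\<Prod>j < n_coll \<Phi>. (real N - real j) * (\<epsilon>\<^sup>2 * collision_factor \<epsilon> g \<Phi> j))
       * survival \<epsilon> g (root_pos \<Phi>) t ^ (N - n_coll \<Phi>)
     else 0)"

lemma collision_factor_nonneg: "torus_density g \<Longrightarrow> 0 \<le> collision_factor \<epsilon> g \<Phi> j"
  by (simp add: collision_factor_def torus_density_def)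

lemma history_density_nonneg:
  assumes "torus_density f" "torus_density g"
  shows "0 \<le> history_density \<epsilon> N f g t \<Phi>"
proof -
  have "0 \<le> (\<Prod>j < n_coll \<Phi>. (real N - real j) * (\<epsilon>\<^sup>2 * collision_factor \<epsilon> g \<Phi> j))"
  proof (cases "n_coll \<Phi> \<le> N")
    case True
    then show ?thesis using collision_factor_nonneg[OF assms(2)] by (intro prod_nonneg mult_nonneg_nonneg) auto
  next
    case False
    then have "(\<Prod>j < n_coll \<Phi>. (real N - real j) * (\<epsilon>\<^sup>2 * collision_factor \<epsilon> g \<Phi> j)) = 0"
      by (intro prod_zero bexI[of _ N]) auto
    then show ?thesis by (rule eq_refl[OF sym])
  qed
  moreover have "0 \<le> f (fst (fst \<Phi>)) (snd (fst \<Phi>))" using assms by (simp add: torus_density_def)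
  ultimately show ?thesis by (simp add: history_density_def survival_def)
qed

lemma history_density_measurable:
  assumes f: "torus_density f" and g: "torus_density g"
  shows "(\<lambda>y. history_density \<epsilon> N f g t (mk_tree n y)) \<in> borel_measurable (component_measure n)"
proof -
  let ?M = "component_measure n"
  have fm: "(\<lambda>z. f (fst z) (snd z)) \<in> borel_measurable borel" and gm: "(\<lambda>z. g (fst z) (snd z)) \<in> borel_measurable borel"
    using f g by (auto simp: torus_density_def)
  note c = measurable_component
  have r: "(\<lambda>y. last_time (mk_tree m y)) \<in> borel_measurable ?M"
    "(\<lambda>y. root_vel (mk_tree m y) (last_time (mk_tree m y))) \<in> borel_measurable ?M"
    "case_prod (\<lambda>y. root_pos (mk_tree m y)) \<in> borel_measurable (?M \<Otimes>\<^sub>M borel)" if "m \<le> n" for m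
    using measurable_tree_root(2-4)[OF c(1,2) that] by simp_all
  have [measurable]: "(\<lambda>y. last_time (mk_tree n y)) \<in> borel_measurable ?M" by (rule r) simp
  have [measurable]: "(\<lambda>y. survival \<epsilon> g (root_pos (mk_tree n y)) t) \<in> borel_measurable ?M"
    by (rule survival_measurable[OF g r(3)]) simp
  have [measurable]: "(\<lambda>y. f (fst (fst y)) (snd (fst y))) \<in> borel_measurable ?M"
    using measurable_compose[OF c(1) fm] .
  have cf: "(\<lambda>y. collision_factor \<epsilon> g (mk_tree n y) j) \<in> borel_measurable ?M" if j: "j < n" for j
  proof -
    have e: "(\<lambda>y. emitted \<epsilon> (root_pos (mk_tree j y)) (snd y j)) \<in> borel_measurable ?M"
      using j by (intro measurable_emitted r(3) c(3)) auto
    have se: "snd (emitted \<epsilon> (root_pos (mk_tree j y)) (snd y j)) = snd (snd (snd y j))" for y by (simp add: emitted_def)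
    have [measurable]: "(\<lambda>y. g (fst (emitted \<epsilon> (root_pos (mk_tree j y)) (snd y j))) (snd (snd (snd y j)))) \<in> borel_measurable ?M"
      using measurable_compose[OF e gm] by (simp add: se)
    note [measurable] = c(3)[OF j] r(2)[OF less_imp_le[OF j]]
    have "collision_factor \<epsilon> g (mk_tree n y) j = g (fst (emitted \<epsilon> (root_pos (mk_tree j y)) (snd y j))) (snd (snd (snd y j)))
        * max ((root_vel (mk_tree j y) (last_time (mk_tree j y)) - snd (snd (snd y j))) \<bullet> fst (snd (snd y j))) 0" for y
      using j by (simp add: collision_factor_def truncate_mk_tree) (simp add: mk_tree_def)
    then show ?thesis by simp
  qed
  have [measurable]: "(\<lambda>y. \<Prod>j<n. (real N - real j) * (\<epsilon>\<^sup>2 * collision_factor \<epsilon> g (mk_tree n y) j)) \<in> borel_measurable ?M"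
    using cf by (intro borel_measurable_prod borel_measurable_times) auto
  show ?thesis unfolding history_density_def mk_tree_sel by measurable
qed

text \<open>The falling factorial: choose the value at \<open>x\<close>, then inject the rest into
  the remaining points.\<close>

lemma card_injections:
  fixes S :: "'a set" and U :: "'b set"
  assumes "finite S" "finite U"
  shows "card {f \<in> S \<rightarrow>\<^sub>E U. inj_on f S} = (\<Prod>j<card S. card U - j)"
  using assms
proof (induction S arbitrary: U rule: finite_induct)
  case empty
  then show ?case by (simp add: PiE_empty_domain)
next
  case (insert x S)
  let ?P = "SIGMA y : U. {g \<in> S \<rightarrow>\<^sub>E (U - {y}). inj_on g S}"
  have P: "?P = {(y, g). y \<in> U \<and> g \<in> S \<rightarrow>\<^sub>E (U - {y}) \<and> inj_on g S}" by blast
  have fin: "finite {g \<in> S \<rightarrow>\<^sub>E (U - {y}). inj_on g S}" for y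
    using insert by (intro finite_subset[OF _ finite_PiE[of S "\<lambda>_. U - {y}"]]) auto
  have "{f \<in> insert x S \<rightarrow>\<^sub>E U. inj_on f (insert x S)} = (\<lambda>(y, g). g(x := y)) ` ?P"
    unfolding P by (rule extensional_funcset_extend_domain_inj_on_eq[OF insert(2)])
  moreover have "inj_on (\<lambda>(y, g). g(x := y)) ?P"
    unfolding P by (rule extensional_funcset_extend_domain_inj_onI[OF insert(2)])
  ultimately have "card {f \<in> insert x S \<rightarrow>\<^sub>E U. inj_on f (insert x S)} = card ?P" by (simp add: card_image)
  also have "\<dots> = (\<Sum>y\<in>U. card {g \<in> S \<rightarrow>\<^sub>E (U - {y}). inj_on g S})"
    using insert fin by (intro card_SigmaI) auto
  also have "\<dots> = (\<Sum>y\<in>U. \<Prod>j<card S. card U - Suc j)"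
    using insert by (intro sum.cong refl) simp
  also have "\<dots> = (\<Prod>j<card (insert x S). card U - j)"
    using insert by (simp add: prod.lessThan_Suc_shift del: prod.lessThan_Suc)
  finally show ?case .
qed

lemma chain_extensional: "chain \<epsilon> n z p \<in> {..<n} \<rightarrow>\<^sub>E UNIV"
  by (induction n) (auto simp: PiE_def extensional_def)

lemma realizes_cong:
  assumes "\<And>j. j < n_coll \<Phi> \<Longrightarrow> \<sigma> j = \<sigma>' j"
  shows "realizes \<epsilon> N t \<sigma> \<omega> \<Phi> = realizes \<epsilon> N t \<sigma>' \<omega> \<Phi>"
proof -
  have "\<sigma> ` {..<n_coll \<Phi>} = \<sigma>' ` {..<n_coll \<Phi>}" using assms by (intro image_cong) auto
  moreover have "inj_on \<sigma> {..<n_coll \<Phi>} = inj_on \<sigma>' {..<n_coll \<Phi>}" using assms by (intro inj_on_cong) auto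
  ultimately show ?thesis using assms by (simp add: realizes_def)
qed

section \<open>Probabilities of labelled collision histories\<close>

locale law_setup =
  fixes T \<epsilon> t :: real and N :: nat and f g :: "vec3 \<Rightarrow> vec3 \<Rightarrow> real" and A :: "tree set"
  assumes T: "0 < T" and f: "torus_density f" and g: "torus_density g" and e: "0 < \<epsilon>" "\<epsilon> < 1 / 2"
    and t: "0 \<le> t" "t \<le> T" and A: "A \<in> sets (tree_measure T)" and A_reg: "A \<subseteq> regular_trees T \<epsilon> t"
begin

lemma fm: "(\<lambda>z. f (fst z) (snd z)) \<in> borel_measurable borel" and gm: "(\<lambda>z. g (fst z) (snd z)) \<in> borel_measurable borel"
  using f g by (auto simp: torus_density_def)

sublocale S: prob_space "state_law g" using g by (rule prob_state_law)
sublocale F: prob_space "state_law f" using f by (rule prob_state_law)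
sublocale mk: product_sigma_finite "\<lambda>_::nat. mark_measure" by (simp add: product_sigma_finite_def sigma_finite_mark)
sublocale st: product_sigma_finite "\<lambda>_::nat. state_law g" by unfold_locales

lemma regular: "\<Phi> \<in> A \<Longrightarrow> regular T \<epsilon> t \<Phi>"
  using A_reg e t by unfold_locales auto

lemma part_sets: "component_part n A \<in> sets (component_measure n)"
  using A by (simp add: sets_tree_measure)

abbreviation M where "M \<equiv> initial_law N f g"

definition event :: "nat \<Rightarrow> (nat \<Rightarrow> nat) \<Rightarrow> config set" where
  "event n \<sigma> = {\<omega> \<in> space M. \<exists>\<Phi> \<in> A. n_coll \<Phi> = n \<and> realizes \<epsilon> N t \<sigma> \<omega> \<Phi>}"

text \<open>Extensionality outside \<open>{..<n}\<close> makes the set finite and gives each choice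
  of partners exactly one representative.\<close>

definition injections :: "nat \<Rightarrow> (nat \<Rightarrow> nat) set" where
  "injections n = {\<sigma> \<in> {..<n} \<rightarrow>\<^sub>E {..<N}. inj_on \<sigma> {..<n}}"

text \<open>The partners alone determine the tree; given the tree, the other particles are independent.\<close>

definition marks_in :: "nat \<Rightarrow> state \<Rightarrow> (nat \<Rightarrow> mark) \<Rightarrow> bool" where
  "marks_in n z c \<longleftrightarrow> (z, c) \<in> component_part n A \<and> last_time (mk_tree n (z, c)) \<le> t"

definition bystanders :: "nat \<Rightarrow> state \<Rightarrow> (nat \<Rightarrow> mark) \<Rightarrow> ennreal" where
  "bystanders n z c = (if marks_in n z c then ennreal (survival \<epsilon> g (root_pos (mk_tree n (z, c))) t) ^ (N - n) else 0)"

lemma measurable_marks_in: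
  assumes z: "z \<in> borel_measurable K" and c: "c \<in> K \<rightarrow>\<^sub>M (\<Pi>\<^sub>M j\<in>{..<n}. mark_measure)"
  shows "Measurable.pred K (\<lambda>k. marks_in n (z k) (c k))"
    and "(\<lambda>k. bystanders n (z k) (c k)) \<in> borel_measurable K"
proof -
  note r = measurable_tree_root[OF z c order.refl]
  have "(\<lambda>k. (z k, c k)) \<in> K \<rightarrow>\<^sub>M component_measure n"
    unfolding component_measure_def using z c by (intro measurable_Pair) (auto cong: measurable_cong_sets)
  from measurable_sets[OF this part_sets]
  have [measurable]: "Measurable.pred K (\<lambda>k. (z k, c k) \<in> component_part n A)"
    by (simp add: pred_def vimage_def Int_def conj_commute)
  note [measurable] = r(2)
  show [measurable]: "Measurable.pred K (\<lambda>k. marks_in n (z k) (c k))" unfolding marks_in_def by measurable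
  have [measurable]: "(\<lambda>k. survival \<epsilon> g (root_pos (mk_tree n (z k, c k))) t) \<in> borel_measurable K"
    by (rule survival_measurable[OF g r(4)])
  show "(\<lambda>k. bystanders n (z k) (c k)) \<in> borel_measurable K" unfolding bystanders_def by measurable
qed

text \<open>The existential quantifier over trees disappears, since the partners determine the only
  candidate through \<open>chain\<close>. What remains is a measurable condition on partners and
  bystanders.\<close>

lemma event_eq:
  assumes \<sigma>: "\<sigma> \<in> injections n"
  shows "event n \<sigma> = {\<omega> \<in> space M. chain_ok \<epsilon> (T + 1) n (fst \<omega>) (snd \<omega> \<circ> \<sigma>) \<and> marks_in n (fst \<omega>) (chain \<epsilon> n (fst \<omega>) (snd \<omega> \<circ> \<sigma>)) \<and>
    (\<forall>i \<in> {..<N} - \<sigma> ` {..<n}. apart \<epsilon> (root_pos (mk_tree n (fst \<omega>, chain \<epsilon> n (fst \<omega>) (snd \<omega> \<circ> \<sigma>)))) t (snd \<omega> i))}"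
  unfolding event_def
proof (intro Collect_cong conj_cong refl iffI)
  fix \<omega> assume "\<exists>\<Phi> \<in> A. n_coll \<Phi> = n \<and> realizes \<epsilon> N t \<sigma> \<omega> \<Phi>"
  then obtain \<Phi> where \<Phi>: "\<Phi> \<in> A" "n_coll \<Phi> = n" "realizes \<epsilon> N t \<sigma> \<omega> \<Phi>" by auto
  interpret R: regular T \<epsilon> t \<Phi> using \<Phi>(1) by (rule regular)
  have ok: "chain_ok \<epsilon> (T + 1) n (fst \<omega>) (snd \<omega> \<circ> \<sigma>)" using R.chain_realizes(1)[OF \<Phi>(3) g T] \<Phi>(2) by simp
  have eq: "mk_tree n (fst \<omega>, chain \<epsilon> n (fst \<omega>) (snd \<omega> \<circ> \<sigma>)) = \<Phi>"
    using R.chain_realizes(2)[OF \<Phi>(3) g T order.refl] unfolding \<Phi>(2) R.truncate_all[unfolded \<Phi>(2)] .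
  have "marks_in n (fst \<omega>) (chain \<epsilon> n (fst \<omega>) (snd \<omega> \<circ> \<sigma>))"
    unfolding marks_in_def component_part_def space_component_measure vimage_def
    using eq \<Phi> chain_extensional[of \<epsilon> n "fst \<omega>" "snd \<omega> \<circ> \<sigma>"] by (simp add: realizes_def)
  moreover have "\<forall>i \<in> {..<N} - \<sigma> ` {..<n}. apart \<epsilon> (root_pos \<Phi>) t (snd \<omega> i)"
    using \<Phi> by (auto simp: realizes_def)
  ultimately show "chain_ok \<epsilon> (T + 1) n (fst \<omega>) (snd \<omega> \<circ> \<sigma>) \<and> marks_in n (fst \<omega>) (chain \<epsilon> n (fst \<omega>) (snd \<omega> \<circ> \<sigma>)) \<and>
    (\<forall>i \<in> {..<N} - \<sigma> ` {..<n}. apart \<epsilon> (root_pos (mk_tree n (fst \<omega>, chain \<epsilon> n (fst \<omega>) (snd \<omega> \<circ> \<sigma>)))) t (snd \<omega> i))"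
    using ok unfolding eq by blast
next
  fix \<omega>
  assume a: "chain_ok \<epsilon> (T + 1) n (fst \<omega>) (snd \<omega> \<circ> \<sigma>) \<and> marks_in n (fst \<omega>) (chain \<epsilon> n (fst \<omega>) (snd \<omega> \<circ> \<sigma>)) \<and>
    (\<forall>i \<in> {..<N} - \<sigma> ` {..<n}. apart \<epsilon> (root_pos (mk_tree n (fst \<omega>, chain \<epsilon> n (fst \<omega>) (snd \<omega> \<circ> \<sigma>)))) t (snd \<omega> i))"
  define \<Phi> where "\<Phi> = mk_tree n (fst \<omega>, chain \<epsilon> n (fst \<omega>) (snd \<omega> \<circ> \<sigma>))"
  have n: "n_coll \<Phi> = n" by (simp add: \<Phi>_def)
  have \<Phi>A: "\<Phi> \<in> A" "last_time \<Phi> \<le> t" using a by (auto simp: marks_in_def component_part_def \<Phi>_def)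
  interpret R: regular T \<epsilon> t \<Phi> using \<Phi>A(1) by (rule regular)
  have "realizes \<epsilon> N t \<sigma> \<omega> \<Phi>"
  proof (rule R.realizes_chain)
    show "\<Phi> = mk_tree (n_coll \<Phi>) (fst \<omega>, chain \<epsilon> (n_coll \<Phi>) (fst \<omega>) (snd \<omega> \<circ> \<sigma>))" unfolding n by (rule \<Phi>_def)
    show "inj_on \<sigma> {..<n_coll \<Phi>}" "\<sigma> ` {..<n_coll \<Phi>} \<subseteq> {..<N}" using \<sigma> by (auto simp: n injections_def)
    show "\<forall>i < N. i \<notin> \<sigma> ` {..<n_coll \<Phi>} \<longrightarrow> apart \<epsilon> (root_pos \<Phi>) t (snd \<omega> i)" using a by (auto simp: n \<Phi>_def)
  qed (rule \<Phi>A(2))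
  then show "\<exists>\<Phi> \<in> A. n_coll \<Phi> = n \<and> realizes \<epsilon> N t \<sigma> \<omega> \<Phi>" using \<Phi>A(1) n by blast
qed

lemma event_integrand_measurable:
  assumes \<sigma>: "\<sigma> \<in> injections n"
    and z: "z \<in> borel_measurable K" and p: "\<And>i. i < N \<Longrightarrow> (\<lambda>k. p k i) \<in> borel_measurable K"
  shows "Measurable.pred K (\<lambda>k. chain_ok \<epsilon> (T + 1) n (z k) (p k \<circ> \<sigma>) \<and> marks_in n (z k) (chain \<epsilon> n (z k) (p k \<circ> \<sigma>)) \<and>
    (\<forall>i \<in> {..<N} - \<sigma> ` {..<n}. apart \<epsilon> (root_pos (mk_tree n (z k, chain \<epsilon> n (z k) (p k \<circ> \<sigma>)))) t (p k i)))"
proof -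
  have p\<sigma>: "(\<lambda>k. (p k \<circ> \<sigma>) j) \<in> borel_measurable K" if "j < n" for j
    using \<sigma> that p[of "\<sigma> j"] by (auto simp: injections_def)
  note ch = measurable_chain[where p = "\<lambda>k. p k \<circ> \<sigma>", OF z p\<sigma>]
  note r = measurable_tree_root[OF z ch(1) order.refl]
  have "Measurable.pred K (\<lambda>k. \<forall>i \<in> {..<N} - \<sigma> ` {..<n}. apart \<epsilon> (root_pos (mk_tree n (z k, chain \<epsilon> n (z k) (p k \<circ> \<sigma>)))) t (p k i))"
    by (intro pred_intros_finite measurable_apart r(4) p) auto
  then show ?thesis
    by (intro pred_intros_logic ch(2) measurable_marks_in(1)[OF z ch(1)])
qed

lemma event_sets:
  assumes \<sigma>: "\<sigma> \<in> injections n"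
  shows "event n \<sigma> \<in> sets M"
proof -
  have "(\<lambda>\<omega>. snd \<omega> i) \<in> borel_measurable M" if "i < N" for i
  proof -
    have "snd \<in> M \<rightarrow>\<^sub>M (\<Pi>\<^sub>M i\<in>{..<N}. state_law g)" unfolding initial_law_def by simp
    from measurable_compose[OF this measurable_component_singleton[of i]] that
    show ?thesis by (simp cong: measurable_cong_sets)
  qed
  moreover have "fst \<in> borel_measurable M" unfolding initial_law_def by (simp cong: measurable_cong_sets)
  ultimately show ?thesis
    unfolding event_eq[OF \<sigma>] by (intro predE event_integrand_measurable[OF \<sigma>]) auto
qed

text \<open>The product law is split into partners and bystanders. For given partners the path is
  fixed and the bystanders contribute independent factors; the partners are then relabelled by their
  order of collision and \<open>chain_change_of_variables\<close> applies.\<close>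

lemma emeasure_event:
  assumes \<sigma>: "\<sigma> \<in> injections n"
  shows "emeasure M (event n \<sigma>) = (\<integral>\<^sup>+ z. \<integral>\<^sup>+ c. (if marks_ok (T + 1) n z c then marks_weight \<epsilon> g n z c * bystanders n z c else 0)
    \<partial>(\<Pi>\<^sub>M j\<in>{..<n}. mark_measure) \<partial>state_law f)"
proof -
  let ?P = "\<Pi>\<^sub>M i\<in>{..<N}. state_law g"
  let ?J = "\<sigma> ` {..<n}" and ?I = "{..<N} - \<sigma> ` {..<n}"
  have inj: "inj_on \<sigma> {..<n}" and J: "?J \<subseteq> {..<N}" using \<sigma> by (auto simp: injections_def)
  have cardI: "card ?I = N - n" using J card_image[OF inj] by (subst card_Diff_subset) auto
  interpret P: finite_measure ?P
    by (intro prob_space.finite_measure prob_space_PiM S.prob_space_axioms)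
  let ?G = "\<lambda>z p. chain_ok \<epsilon> (T + 1) n z (p \<circ> \<sigma>) \<and> marks_in n z (chain \<epsilon> n z (p \<circ> \<sigma>))"
  let ?a = "\<lambda>z p q. (if apart \<epsilon> (root_pos (mk_tree n (z, chain \<epsilon> n z (p \<circ> \<sigma>)))) t q then 1 else 0 :: ennreal)"
  let ?F = "\<lambda>z p. (if ?G z p then \<Prod>i\<in>?I. ?a z p (p i) else 0)"
  have Fprod: "?F z p = indicator (event n \<sigma>) (z, p)" if "(z, p) \<in> space M" for z p
    using that unfolding event_eq[OF \<sigma>] by (auto simp: indicator_def prod_zero_iff)
  have Fm: "(\<lambda>x. ?F (fst x) (snd x)) \<in> borel_measurable M"
    using borel_measurable_indicator[OF event_sets[OF \<sigma>], where 'b = ennreal]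
    by (subst measurable_cong[where g = "indicator (event n \<sigma>)"]) (simp_all add: Fprod)
  have "emeasure M (event n \<sigma>) = (\<integral>\<^sup>+ x. ?F (fst x) (snd x) \<partial>M)"
  proof (subst nn_integral_indicator[OF event_sets[OF \<sigma>], symmetric], rule nn_integral_cong)
    fix x assume "x \<in> space M"
    then show "indicator (event n \<sigma>) x = ?F (fst x) (snd x)" using Fprod[of "fst x" "snd x"] by (simp only: prod.collapse)
  qed
  also have "\<dots> = (\<integral>\<^sup>+ z. \<integral>\<^sup>+ p. ?F z p \<partial>?P \<partial>state_law f)"
    using Fm unfolding initial_law_def by (subst P.nn_integral_fst[symmetric]) (simp_all only: fst_conv snd_conv)
  also have "\<dots> = (\<integral>\<^sup>+ z. \<integral>\<^sup>+ c. (if marks_ok (T + 1) n z c then marks_weight \<epsilon> g n z c * bystanders n z c else 0)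
    \<partial>(\<Pi>\<^sub>M j\<in>{..<n}. mark_measure) \<partial>state_law f)"
  proof (rule nn_integral_cong)
    fix z :: state
    have Fz: "?F z \<in> borel_measurable ?P"
    proof -
      have "(\<lambda>p. (z, p)) \<in> ?P \<rightarrow>\<^sub>M M" unfolding initial_law_def by (rule measurable_Pair1') simp
      from measurable_compose[OF this Fm] show ?thesis by (simp only: fst_conv snd_conv)
    qed
    have split: "{..<N} = ?J \<union> ?I" using J by auto
    define H where "H p = (if chain_ok \<epsilon> (T + 1) n z p then bystanders n z (chain \<epsilon> n z p) else 0)" for p
    have Hm: "H \<in> borel_measurable (\<Pi>\<^sub>M j\<in>{..<n}. state_law g)"
    proof -
      have pj: "(\<lambda>p. p j) \<in> borel_measurable (\<Pi>\<^sub>M j\<in>{..<n}. state_law g)" if "j < n" for j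
        using measurable_component_singleton[of j "{..<n}" "\<lambda>_. state_law g"] that by (simp cong: measurable_cong_sets)
      note ch = measurable_chain[where K = "\<Pi>\<^sub>M j\<in>{..<n}. state_law g" and z = "\<lambda>_. z" and p = "\<lambda>p. p", OF _ pj]
      have [measurable]: "Measurable.pred (\<Pi>\<^sub>M j\<in>{..<n}. state_law g) (\<lambda>p. chain_ok \<epsilon> (T + 1) n z p)" by (rule ch(2)) auto
      have [measurable]: "(\<lambda>p. bystanders n z (chain \<epsilon> n z p)) \<in> borel_measurable (\<Pi>\<^sub>M j\<in>{..<n}. state_law g)"
        by (rule measurable_marks_in(2)[where z = "\<lambda>_. z"], simp, rule ch(1)) auto
      show ?thesis unfolding H_def by measurable
    qed
    \<comment> \<open>The chain depends on the merged configuration through the coordinates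
      \<open>x (\<sigma> j)\<close> only, so in this integral the path is constant and the product
      over bystanders factorizes.\<close>
    have inner: "(\<integral>\<^sup>+ y. ?F z (merge ?J ?I (x, y)) \<partial>(\<Pi>\<^sub>M i\<in>?I. state_law g)) = H (\<lambda>j\<in>{..<n}. x (\<sigma> j))" for x
    proof -
      let ?q = "\<lambda>j\<in>{..<n}. x (\<sigma> j)"
      have c: "chain \<epsilon> n z (merge ?J ?I (x, y) \<circ> \<sigma>) = chain \<epsilon> n z ?q"
        "chain_ok \<epsilon> (T + 1) n z (merge ?J ?I (x, y) \<circ> \<sigma>) = chain_ok \<epsilon> (T + 1) n z ?q" for y
        by (intro chain_cong chain_ok_cong; auto simp: merge_def)+
      let ?X = "root_pos (mk_tree n (z, chain \<epsilon> n z ?q))"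
      have Fy: "?F z (merge ?J ?I (x, y)) = (if chain_ok \<epsilon> (T + 1) n z ?q \<and> marks_in n z (chain \<epsilon> n z ?q)
          then \<Prod>i\<in>?I. (if apart \<epsilon> ?X t (y i) then 1 else 0) else 0)" for y
        unfolding c by (intro if_cong prod.cong refl) (auto simp: merge_def)
      have am: "Measurable.pred borel (\<lambda>q. apart \<epsilon> ?X t q)"
        by (rule measurable_apart) measurable
      have one: "(\<integral>\<^sup>+ q. (if apart \<epsilon> ?X t q then 1 else 0) \<partial>state_law g) = ennreal (survival \<epsilon> g ?X t)"
      proof -
        have "(\<integral>\<^sup>+ q. (if apart \<epsilon> ?X t q then 1 else 0) \<partial>state_law g) = (\<integral>\<^sup>+ q. indicator {q. apart \<epsilon> ?X t q} q \<partial>state_law g)"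
          by (intro nn_integral_cong) (simp add: indicator_def)
        also have "\<dots> = emeasure (state_law g) {q. apart \<epsilon> ?X t q}" using am by (intro nn_integral_indicator) (simp add: pred_def)
        finally show ?thesis by (simp add: survival_def S.emeasure_eq_measure)
      qed
      have "(\<integral>\<^sup>+ y. (\<Prod>i\<in>?I. (if apart \<epsilon> ?X t (y i) then 1 else 0 :: ennreal)) \<partial>(\<Pi>\<^sub>M i\<in>?I. state_law g))
        = (\<Prod>i\<in>?I. \<integral>\<^sup>+ q. (if apart \<epsilon> ?X t q then 1 else 0) \<partial>state_law g)"
        using am by (intro st.product_nn_integral_prod) auto
      also have "\<dots> = ennreal (survival \<epsilon> g ?X t) ^ (N - n)" unfolding one using cardI by simp
      finally show ?thesis unfolding Fy H_def bystanders_def by simp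
    qed
    have "(\<integral>\<^sup>+ p. ?F z p \<partial>?P) = (\<integral>\<^sup>+ x. \<integral>\<^sup>+ y. ?F z (merge ?J ?I (x, y)) \<partial>(\<Pi>\<^sub>M i\<in>?I. state_law g) \<partial>(\<Pi>\<^sub>M i\<in>?J. state_law g))"
    proof -
      have "?F z \<in> borel_measurable (\<Pi>\<^sub>M i\<in>?J \<union> ?I. state_law g)" using Fz by (simp only: split[symmetric])
      from st.product_nn_integral_fold[OF _ _ _ this] show ?thesis by (simp only: split[symmetric]) auto
    qed
    also have "\<dots> = (\<integral>\<^sup>+ x. H (\<lambda>j\<in>{..<n}. x (\<sigma> j)) \<partial>(\<Pi>\<^sub>M i\<in>?J. state_law g))"
      by (intro nn_integral_cong inner)
    also have "\<dots> = (\<integral>\<^sup>+ p. H p \<partial>distr (\<Pi>\<^sub>M i\<in>?J. state_law g) (\<Pi>\<^sub>M j\<in>{..<n}. state_law g) (\<lambda>x. \<lambda>j\<in>{..<n}. x (\<sigma> j)))"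
      using Hm by (intro nn_integral_distr[symmetric] measurable_restrict measurable_component_singleton) auto
    \<comment> \<open>All background particles have the same law, so renaming coordinates along the
      injection \<sigma> gives the same product measure.\<close>
    also have "distr (\<Pi>\<^sub>M i\<in>?J. state_law g) (\<Pi>\<^sub>M j\<in>{..<n}. state_law g) (\<lambda>x. \<lambda>j\<in>{..<n}. x (\<sigma> j)) = (\<Pi>\<^sub>M j\<in>{..<n}. state_law g)"
      using distr_PiM_reindex[where K = ?J and M = "\<lambda>_. state_law g" and f = \<sigma> and I = "{..<n}", OF S.prob_space_axioms inj] by auto
    also have "(\<integral>\<^sup>+ p. H p \<partial>\<dots>) = (\<integral>\<^sup>+ c. (if marks_ok (T + 1) n z c then marks_weight \<epsilon> g n z c * bystanders n z c else 0) \<partial>(\<Pi>\<^sub>M j\<in>{..<n}. mark_measure))"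
      unfolding H_def using T e by (intro chain_change_of_variables[OF g] measurable_marks_in(2)[where z = "\<lambda>_. z"]) auto
    finally show "(\<integral>\<^sup>+ p. ?F z p \<partial>?P) = \<dots>" .
  qed
  finally show ?thesis .
qed

text \<open>At trees of \<open>A\<close> regularity supplies the side conditions of the chain
  formula: \<open>marks_ok\<close> holds, the start lies in the cell, and \<open>arrival\<close> is
  not cut off. For other marks both sides vanish.\<close>

lemma component_density:
  assumes n: "n \<le> N" and y: "(z, c) \<in> space (component_measure n)"
  shows "(\<Prod>j<n. ennreal (real N - real j)) *
      (ennreal (f (fst z) (snd z)) * indicator (torus_cell \<times> UNIV) z *
        (if marks_ok (T + 1) n z c then marks_weight \<epsilon> g n z c * bystanders n z c else 0))
    = indicator (component_part n (collision_trees T)) (z, c) *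
       (ennreal (history_density \<epsilon> N f g t (mk_tree n (z, c))) * indicator A (mk_tree n (z, c)))"
proof (cases "marks_in n z c")
  case False
  then have "\<not> (mk_tree n (z, c) \<in> A \<and> last_time (mk_tree n (z, c)) \<le> t)" using y by (auto simp: marks_in_def component_part_def)
  then show ?thesis using False by (auto simp: bystanders_def history_density_def)
next
  case True
  let ?\<Phi> = "mk_tree n (z, c)"
  have \<Phi>: "?\<Phi> \<in> A" "last_time ?\<Phi> \<le> t" using True by (auto simp: marks_in_def component_part_def)
  interpret R: regular T \<epsilon> t ?\<Phi> using \<Phi>(1) by (rule regular)
  have tr: "?\<Phi> \<in> collision_trees T" using R.reg by (simp add: regular_trees_def)
  then have cell: "z \<in> torus_cell \<times> UNIV" by (cases z) (simp add: collision_trees_def mk_tree_def)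
  have ct: "coll_time ?\<Phi> j = fst (c j)" if "j < n" for j using that by simp
  have tj: "truncate_tree j ?\<Phi> = mk_tree j (z, c)" if "j < n" for j using that by (simp add: truncate_mk_tree)
  have ok: "marks_ok (T + 1) n z c"
    unfolding marks_ok_def
  proof (intro allI impI)
    fix j assume j: "j < n"
    have "last_time (mk_tree j (z, c)) < fst (c j)"
      using last_time_truncate(2)[OF R.timely, of j] R.ct_pos[of j] j by (simp add: tj)
    moreover have "0 \<le> last_time (mk_tree j (z, c))"
      using last_time_nonneg[OF timely_truncate[OF R.timely, of j]] j by (simp add: tj)
    moreover have "fst (c j) \<le> T" using R.ct_le_T[of j] j by simp
    ultimately show "last_time (mk_tree j (z, c)) < fst (c j) \<and> fst (c j) < last_time (mk_tree j (z, c)) + (T + 1)" by simp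
  qed
  have arr: "arrival \<epsilon> g (root_pos (mk_tree j (z, c))) (root_vel (mk_tree j (z, c)) (last_time (mk_tree j (z, c)))) (c j)
      = ennreal (\<epsilon>\<^sup>2 * collision_factor \<epsilon> g ?\<Phi> j)" if j: "j < n" for j
  proof -
    have m: "snd ?\<Phi> ! j = c j" using j by (simp add: mk_tree_def)
    have "fst (c j) \<le> t" using coll_time_le_last[OF R.timely, of j] \<Phi>(2) j by simp
    then have "unmet_before \<epsilon> (root_pos (mk_tree j (z, c))) (fst (c j)) (emitted \<epsilon> (root_pos (mk_tree j (z, c))) (c j))"
      using R.unmet_regular[of j] j m by (simp add: tj)
    then show ?thesis
      using j m by (simp add: arrival_def collision_factor_def tj mult_ac)
  qed
  have w: "marks_weight \<epsilon> g n z c = (\<Prod>j<n. ennreal (\<epsilon>\<^sup>2 * collision_factor \<epsilon> g ?\<Phi> j))"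
    unfolding marks_weight_def by (intro prod.cong refl arr) simp
  have cf: "0 \<le> \<epsilon>\<^sup>2 * collision_factor \<epsilon> g ?\<Phi> j" for j using collision_factor_nonneg[OF g] by simp
  have Nj: "0 \<le> real N - real j" if "j < n" for j using that n by simp
  have s0: "0 \<le> survival \<epsilon> g (root_pos ?\<Phi>) t" by (simp add: survival_def)
  have f0: "0 \<le> f (fst z) (snd z)" using f by (simp add: torus_density_def)
  have "ennreal (history_density \<epsilon> N f g t ?\<Phi>) = ennreal (f (fst z) (snd z)) *
      (\<Prod>j<n. ennreal ((real N - real j) * (\<epsilon>\<^sup>2 * collision_factor \<epsilon> g ?\<Phi> j))) * ennreal (survival \<epsilon> g (root_pos ?\<Phi>) t) ^ (N - n)"
  proof -
    have p: "0 \<le> (\<Prod>j<n. (real N - real j) * (\<epsilon>\<^sup>2 * collision_factor \<epsilon> g ?\<Phi> j))"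
      by (intro prod_nonneg mult_nonneg_nonneg[OF Nj cf]) simp
    have "history_density \<epsilon> N f g t ?\<Phi> = f (fst z) (snd z) * (\<Prod>j<n. (real N - real j) * (\<epsilon>\<^sup>2 * collision_factor \<epsilon> g ?\<Phi> j)) * survival \<epsilon> g (root_pos ?\<Phi>) t ^ (N - n)"
      using \<Phi>(2) by (simp add: history_density_def)
    then have "ennreal (history_density \<epsilon> N f g t ?\<Phi>) = ennreal (f (fst z) (snd z)) *
      ennreal (\<Prod>j<n. (real N - real j) * (\<epsilon>\<^sup>2 * collision_factor \<epsilon> g ?\<Phi> j)) * ennreal (survival \<epsilon> g (root_pos ?\<Phi>) t ^ (N - n))"
      using f0 p s0 by (simp only: ennreal_mult mult_nonneg_nonneg zero_le_power)
    moreover have "ennreal (\<Prod>j<n. (real N - real j) * (\<epsilon>\<^sup>2 * collision_factor \<epsilon> g ?\<Phi> j)) = (\<Prod>j<n. ennreal ((real N - real j) * (\<epsilon>\<^sup>2 * collision_factor \<epsilon> g ?\<Phi> j)))"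
      by (intro prod_ennreal[symmetric] mult_nonneg_nonneg[OF Nj cf]) simp
    ultimately show ?thesis using s0 by (simp only: ennreal_power)
  qed
  also have "(\<Prod>j<n. ennreal ((real N - real j) * (\<epsilon>\<^sup>2 * collision_factor \<epsilon> g ?\<Phi> j))) = (\<Prod>j<n. ennreal (real N - real j)) * marks_weight \<epsilon> g n z c"
    unfolding w prod.distrib[symmetric] by (intro prod.cong refl ennreal_mult cf Nj) simp
  finally have h: "ennreal (history_density \<epsilon> N f g t ?\<Phi>) = ennreal (f (fst z) (snd z)) *
      ((\<Prod>j<n. ennreal (real N - real j)) * marks_weight \<epsilon> g n z c) * ennreal (survival \<epsilon> g (root_pos ?\<Phi>) t) ^ (N - n)" .
  have "(z, c) \<in> component_part n (collision_trees T)" using y tr by (simp add: component_part_def)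
  then show ?thesis
    unfolding h using ok cell \<Phi>(1) True by (simp add: bystanders_def mult_ac)
qed

text \<open>The probability in \<open>emeasure_event\<close> does not depend on \<sigma>, so the sum
  multiplies it by the number of injections.\<close>

lemma sum_events:
  assumes n: "n \<le> N"
  shows "(\<Sum>\<sigma>\<in>injections n. emeasure M (event n \<sigma>))
    = (\<integral>\<^sup>+ y. indicator (component_part n (collision_trees T)) y *
       (ennreal (history_density \<epsilon> N f g t (mk_tree n y)) * indicator A (mk_tree n y)) \<partial>component_measure n)"
proof -
  interpret mf: sigma_finite_measure "\<Pi>\<^sub>M j\<in>{..<n}. mark_measure" by (rule mk.sigma_finite) simp
  let ?W = "\<lambda>z c. if marks_ok (T + 1) n z c then marks_weight \<epsilon> g n z c * bystanders n z c else 0"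
  let ?C = "\<Prod>j<n. ennreal (real N - real j)"
  have card: "of_nat (card (injections n)) = ?C"
  proof -
    have "card (injections n) = (\<Prod>j<n. N - j)" unfolding injections_def by (subst card_injections) auto
    then have "(of_nat (card (injections n)) :: ennreal) = (\<Prod>j<n. of_nat (N - j))" by simp
    also have "\<dots> = ?C" using n by (intro prod.cong refl) (simp add: of_nat_diff ennreal_of_nat_eq_real_of_nat)
    finally show ?thesis .
  qed
  note mc = measurable_component
  have Wm: "(\<lambda>y. ?W (fst y) (snd y)) \<in> borel_measurable (component_measure n)"
  proof -
    have [measurable]: "Measurable.pred (component_measure n) (\<lambda>y. marks_ok (T + 1) n (fst y) (snd y))"
      by (rule measurable_marks_ok(1)[OF mc(1,2)])
    have [measurable]: "(\<lambda>y. marks_weight \<epsilon> g n (fst y) (snd y)) \<in> borel_measurable (component_measure n)"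
      by (rule measurable_marks_ok(2)[OF mc(1,2) gm])
    have [measurable]: "(\<lambda>y. bystanders n (fst y) (snd y)) \<in> borel_measurable (component_measure n)"
      by (rule measurable_marks_in(2)[OF mc(1,2)])
    show ?thesis by measurable
  qed
  have fz [measurable]: "(\<lambda>z. ennreal (f (fst z) (snd z)) * indicator (torus_cell \<times> UNIV) z) \<in> borel_measurable borel"
  proof -
    note [measurable] = fm
    have [measurable]: "torus_cell \<times> (UNIV :: vec3 set) \<in> sets borel" by (simp add: borel_prod[symmetric])
    show ?thesis by measurable
  qed
  have Wz: "(\<lambda>z. \<integral>\<^sup>+ c. ?W z c \<partial>(\<Pi>\<^sub>M j\<in>{..<n}. mark_measure)) \<in> borel_measurable lborel"
    using Wm unfolding component_measure_def by (intro mf.borel_measurable_nn_integral) (simp add: case_prod_beta')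
  have Wc: "?W z \<in> borel_measurable (\<Pi>\<^sub>M j\<in>{..<n}. mark_measure)" for z
    using measurable_compose[OF measurable_Pair1'[of z lborel "\<Pi>\<^sub>M j\<in>{..<n}. mark_measure"], of "\<lambda>y. ?W (fst y) (snd y)" borel] Wm
    unfolding component_measure_def by (simp only: fst_conv snd_conv space_lborel space_borel UNIV_I simp_thms triv_forall_equality)
  let ?f = "\<lambda>z. ennreal (f (fst z) (snd z)) * indicator (torus_cell \<times> UNIV) z"
  have "(\<Sum>\<sigma>\<in>injections n. emeasure M (event n \<sigma>)) = ?C * (\<integral>\<^sup>+ z. \<integral>\<^sup>+ c. ?W z c \<partial>(\<Pi>\<^sub>M j\<in>{..<n}. mark_measure) \<partial>state_law f)"
    using emeasure_event by (simp add: card)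
  also have "(\<integral>\<^sup>+ z. \<integral>\<^sup>+ c. ?W z c \<partial>(\<Pi>\<^sub>M j\<in>{..<n}. mark_measure) \<partial>state_law f)
    = (\<integral>\<^sup>+ z. ?f z * (\<integral>\<^sup>+ c. ?W z c \<partial>(\<Pi>\<^sub>M j\<in>{..<n}. mark_measure)) \<partial>lborel)"
    unfolding state_law_def using fz Wz by (intro nn_integral_density) auto
  also have "\<dots> = (\<integral>\<^sup>+ z. \<integral>\<^sup>+ c. ?f z * ?W z c \<partial>(\<Pi>\<^sub>M j\<in>{..<n}. mark_measure) \<partial>lborel)"
    using Wc by (intro nn_integral_cong nn_integral_cmult[symmetric])
  also have "\<dots> = (\<integral>\<^sup>+ y. ?f (fst y) * ?W (fst y) (snd y) \<partial>component_measure n)"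
  proof -
    have "(\<lambda>y. ?f (fst y) * ?W (fst y) (snd y)) \<in> borel_measurable (component_measure n)"
      by (rule borel_measurable_times_ennreal[OF measurable_compose[OF mc(1) fz] Wm])
    then show ?thesis unfolding component_measure_def by (subst mf.nn_integral_fst[symmetric]) (simp_all only: fst_conv snd_conv)
  qed
  also have "?C * \<dots> = (\<integral>\<^sup>+ y. ?C * (?f (fst y) * ?W (fst y) (snd y)) \<partial>component_measure n)"
    using borel_measurable_times_ennreal[OF measurable_compose[OF mc(1) fz] Wm] by (rule nn_integral_cmult[symmetric])
  also have "\<dots> = (\<integral>\<^sup>+ y. indicator (component_part n (collision_trees T)) y *
       (ennreal (history_density \<epsilon> N f g t (mk_tree n y)) * indicator A (mk_tree n y)) \<partial>component_measure n)"
  proof (rule nn_integral_cong)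
    fix y assume "y \<in> space (component_measure n)"
    then show "?C * (?f (fst y) * ?W (fst y) (snd y)) = indicator (component_part n (collision_trees T)) y *
       (ennreal (history_density \<epsilon> N f g t (mk_tree n y)) * indicator A (mk_tree n y))"
      using component_density[OF n, of "fst y" "snd y"] by simp
  qed
  finally show ?thesis .
qed

text \<open>By \<open>realizes_history\<close> and \<open>history_realizes\<close>, the observed
  event is the union of the labelled events, which is disjoint by \<open>realizes_unique\<close>. It
  is thereby measurable, so the completion assigns it the same value.\<close>

theorem law_eq:
  "empirical_law \<epsilon> N f g t ({True} \<times> A) = (\<integral>\<^sup>+ \<Phi> \<in> A. ennreal (history_density \<epsilon> N f g t \<Phi>) \<partial>tree_measure T)"
proof -
  let ?E = "{\<omega> \<in> space M. \<exists>\<Phi>. collision_history \<epsilon> N t \<omega> \<Phi> \<and> (no_initial_overlap \<epsilon> N \<omega>, \<Phi>) \<in> {True} \<times> A}"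
  let ?U = "\<Union>n\<in>{..N}. \<Union>\<sigma>\<in>injections n. event n \<sigma>"
  have finj: "finite (injections n)" for n
    unfolding injections_def by (intro finite_subset[OF _ finite_PiE[of "{..<n}" "\<lambda>_. {..<N}"]]) auto
  have E: "?E = ?U"
  proof (intro equalityI subsetI)
    fix \<omega> assume "\<omega> \<in> ?E"
    then obtain \<Phi> where w: "\<omega> \<in> space M" and \<Phi>: "\<Phi> \<in> A" "collision_history \<epsilon> N t \<omega> \<Phi>" "no_initial_overlap \<epsilon> N \<omega>" by auto
    interpret R: regular T \<epsilon> t \<Phi> using \<Phi>(1) by (rule regular)
    obtain \<sigma> where \<sigma>: "realizes \<epsilon> N t \<sigma> \<omega> \<Phi>" using R.history_realizes[OF \<Phi>(2,3)] .
    \<comment> \<open>The labels beyond the last collision are arbitrary; restriction fixes them to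
      obtain an element of \<open>injections\<close>.\<close>
    let ?s = "restrict \<sigma> {..<n_coll \<Phi>}"
    have s: "realizes \<epsilon> N t ?s \<omega> \<Phi>" using \<sigma> by (subst realizes_cong[of \<Phi> ?s \<sigma>]) auto
    then have inj: "inj_on ?s {..<n_coll \<Phi>}" "?s ` {..<n_coll \<Phi>} \<subseteq> {..<N}" by (auto simp: realizes_def)
    then have "?s \<in> injections (n_coll \<Phi>)" by (auto simp: injections_def)
    moreover have "n_coll \<Phi> \<le> N" using card_inj_on_le[OF inj] by simp
    moreover have "\<omega> \<in> event (n_coll \<Phi>) ?s" using w \<Phi>(1) s by (auto simp: event_def)
    ultimately show "\<omega> \<in> ?U" by blast
  next
    fix \<omega> assume "\<omega> \<in> ?U"
    then obtain n \<sigma> \<Phi> where w: "\<omega> \<in> space M" and \<Phi>: "\<Phi> \<in> A" "realizes \<epsilon> N t \<sigma> \<omega> \<Phi>" by (auto simp: event_def)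
    interpret R: regular T \<epsilon> t \<Phi> using \<Phi>(1) by (rule regular)
    have "collision_history \<epsilon> N t \<omega> \<Phi>" "no_initial_overlap \<epsilon> N \<omega>" using R.realizes_history[OF \<Phi>(2)] by auto
    then have "collision_history \<epsilon> N t \<omega> \<Phi> \<and> (no_initial_overlap \<epsilon> N \<omega>, \<Phi>) \<in> {True} \<times> A" using \<Phi>(1) by simp
    then show "\<omega> \<in> ?E" using w by blast
  qed
  have uniq: "n = n' \<and> \<sigma> = \<sigma>'" if "\<sigma> \<in> injections n" "\<sigma>' \<in> injections n'" "\<omega> \<in> event n \<sigma>" "\<omega> \<in> event n' \<sigma>'" for n n' \<sigma> \<sigma>' \<omega>
  proof -
    obtain \<Phi> \<Phi>' where \<Phi>: "\<Phi> \<in> A" "n_coll \<Phi> = n" "realizes \<epsilon> N t \<sigma> \<omega> \<Phi>" "\<Phi>' \<in> A" "n_coll \<Phi>' = n'" "realizes \<epsilon> N t \<sigma>' \<omega> \<Phi>'"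
      using \<open>\<omega> \<in> event n \<sigma>\<close> \<open>\<omega> \<in> event n' \<sigma>'\<close> by (auto simp: event_def)
    have *: "\<Phi> = \<Phi>' \<and> (\<forall>j < n_coll \<Phi>. \<sigma> j = \<sigma>' j)"
      using realizes_unique[OF regular[OF \<Phi>(1)] regular[OF \<Phi>(4)] T g \<Phi>(3,6)] .
    then have "n = n'" using \<Phi> by simp
    moreover have "\<sigma> = \<sigma>'"
    proof (rule extensionalityI)
      show "\<sigma> \<in> extensional {..<n}" "\<sigma>' \<in> extensional {..<n}" using that(1,2) \<open>n = n'\<close> by (auto simp: injections_def PiE_def)
    qed (use * \<Phi> in auto)
    ultimately show ?thesis by simp
  qed
  have es: "(\<Union>\<sigma>\<in>injections n. event n \<sigma>) \<in> sets M" for n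
    using finj event_sets by (intro sets.finite_UN) auto
  have "empirical_law \<epsilon> N f g t ({True} \<times> A) = emeasure (completion M) ?U"
    unfolding empirical_law_def E ..
  also have "\<dots> = emeasure M ?U" using es by (subst emeasure_completion) (auto simp: main_part_sets)
  also have "\<dots> = (\<Sum>n\<in>{..N}. emeasure M (\<Union>\<sigma>\<in>injections n. event n \<sigma>))"
  proof (rule sum_emeasure[symmetric])
    show "disjoint_family_on (\<lambda>n. \<Union>\<sigma>\<in>injections n. event n \<sigma>) {..N}"
      unfolding disjoint_family_on_def using uniq by blast
  qed (use es in auto)
  also have "\<dots> = (\<Sum>n\<in>{..N}. \<Sum>\<sigma>\<in>injections n. emeasure M (event n \<sigma>))"
  proof (intro sum.cong refl sum_emeasure[symmetric])
    fix n
    show "disjoint_family_on (event n) (injections n)" unfolding disjoint_family_on_def using uniq by blast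
    show "event n ` injections n \<subseteq> sets M" using event_sets by auto
  qed (rule finj)
  also have "\<dots> = (\<Sum>n\<in>{..N}. \<integral>\<^sup>+ y. indicator (component_part n (collision_trees T)) y *
       (ennreal (history_density \<epsilon> N f g t (mk_tree n y)) * indicator A (mk_tree n y)) \<partial>component_measure n)"
    by (intro sum.cong refl sum_events) simp
  also have "\<dots> = (\<Sum>n. \<integral>\<^sup>+ y. indicator (component_part n (collision_trees T)) y *
       (ennreal (history_density \<epsilon> N f g t (mk_tree n y)) * indicator A (mk_tree n y)) \<partial>component_measure n)"
  \<comment> \<open>Components with more than \<open>N\<close> collisions carry the density 0, as
    one factor of the product vanishes.\<close>
  proof (rule suminf_finite[symmetric])
    fix n assume "n \<notin> {..N}"
    then have "(\<Prod>j<n. (real N - real j) * (\<epsilon>\<^sup>2 * collision_factor \<epsilon> g (mk_tree n y) j)) = 0" for y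
      by (intro prod_zero bexI[of _ N]) auto
    then have "history_density \<epsilon> N f g t (mk_tree n y) = 0" for y by (simp only: history_density_def mk_tree_sel mult_zero_right mult_zero_left if_cancel)
    then show "(\<integral>\<^sup>+ y. indicator (component_part n (collision_trees T)) y *
       (ennreal (history_density \<epsilon> N f g t (mk_tree n y)) * indicator A (mk_tree n y)) \<partial>component_measure n) = 0" by simp
  qed simp
  also have "\<dots> = (\<integral>\<^sup>+ \<Phi> \<in> A. ennreal (history_density \<epsilon> N f g t \<Phi>) \<partial>tree_measure T)"
  proof (rule nn_integral_tree_measure[symmetric])
    have "history_density \<epsilon> N f g t \<in> borel_measurable (tree_measure T)"
      by (rule measurable_tree_measure) (rule history_density_measurable[OF f g])
    then show "(\<lambda>\<Phi>. ennreal (history_density \<epsilon> N f g t \<Phi>) * indicator A \<Phi>) \<in> borel_measurable (tree_measure T)"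
      using A by measurable
  qed
  finally show ?thesis .
qed

end


section \<open>The evolution equation\<close>

lemma parent_truncate: "parent \<Phi> = truncate_tree (n_coll \<Phi> - 1) \<Phi>"
  by (simp add: parent_def truncate_tree_def n_coll_def butlast_conv_take)

lemma collision_factor_truncate:
  assumes "j < k"
  shows "collision_factor \<epsilon> g (truncate_tree k \<Phi>) j = collision_factor \<epsilon> g \<Phi> j"
proof -
  have "truncate_tree j (truncate_tree k \<Phi>) = truncate_tree j \<Phi>" "snd (truncate_tree k \<Phi>) ! j = snd \<Phi> ! j"
    using assms by (simp_all add: truncate_tree_def min_def)
  then show ?thesis by (simp add: collision_factor_def coll_vel_def coll_param_def)
qed

context path_tail
begin

text \<open>\<open>torus_ball\<close> is open while failing to be \<open>apart\<close> includes
  distance exactly \<epsilon>; the sphere between the two is null.\<close>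

lemma survival_start: "survival \<epsilon> g X 0 = 1 - (LINT y:torus_ball \<epsilon> (X 0)|lborel. (LINT w|lborel. g y w))"
proof -
  interpret S: prob_space "state_law g" using dens by (rule prob_state_law)
  note [measurable] = g_measurable
  have [measurable]: "(fst :: state \<Rightarrow> vec3) \<in> borel_measurable borel"
    by (intro borel_measurable_continuous_onI continuous_intros)
  have [measurable]: "torus_cell \<times> (UNIV :: vec3 set) \<in> sets borel" by (simp add: borel_prod[symmetric])
  let ?B = "{p :: state. tdist (X 0) (fst p) < \<epsilon>}" and ?N = "{p. \<not> apart \<epsilon> X 0 p}" and ?Z = "{p :: state. tdist (X 0) (fst p) = \<epsilon>}"
  let ?F = "\<lambda>y w. indicator (torus_ball \<epsilon> (X 0)) y * g y w"
  have [measurable]: "?B \<in> sets borel" "?Z \<in> sets borel" "?N \<in> sets borel" by measurable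
  have ball [measurable]: "torus_ball \<epsilon> (X 0) \<in> sets borel" unfolding torus_ball_def by measurable
  have "emeasure (state_law g) ?Z = 0"
    using negligible_tdist_eq[OF eps(1), of "X 0" 0] by (intro emeasure_state_law_0 g_measurable) auto
  moreover have "?N = ?B \<union> ?Z" by (auto simp: apart_path_iff)
  ultimately have N: "S.prob ?N = S.prob ?B"
    by (simp only:) (rule measure_Un_null_set, simp_all add: null_sets_def)
  have "?N = space (state_law g) - {p. apart \<epsilon> X 0 p}" by auto
  then have "S.prob ?N = 1 - survival \<epsilon> g X 0"
    unfolding survival_def by (simp only:) (rule S.prob_compl, simp)
  then have s: "survival \<epsilon> g X 0 = 1 - S.prob ?B" using N by simp
  have Fm: "(\<lambda>z. ?F (fst z) (snd z)) \<in> borel_measurable lborel" by measurable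
  have F: "emeasure (state_law g) ?B = (\<integral>\<^sup>+ z. ennreal (?F (fst z) (snd z)) \<partial>lborel)"
    unfolding state_law_def by (subst emeasure_density) (auto intro!: nn_integral_cong simp: torus_ball_def indicator_def)
  have int: "integrable lborel (\<lambda>z. ?F (fst z) (snd z))"
    using Fm S.emeasure_finite[of ?B] by (intro integrableI_nonneg) (auto simp: F[symmetric] less_top[symmetric])
  have "S.prob ?B = (LINT z|lborel. ?F (fst z) (snd z))"
    unfolding measure_def F using Fm by (subst integral_eq_nn_integral) auto
  also have "\<dots> = (LINT y|lborel. LINT w|lborel. ?F y w)"
    using lborel_pair.integral_fst[of ?F] int by (simp add: lborel_prod case_prod_beta')
  also have "\<dots> = (LINT y:torus_ball \<epsilon> (X 0)|lborel. (LINT w|lborel. g y w))"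
    by (simp add: set_lebesgue_integral_def)
  finally show ?thesis using s by simp
qed

end

text \<open>Positivity of the survival probability is an assumption here so that the equation can be
  derived for one tree at a time; it is supplied uniformly over good trees by
  \<open>encounter_probability\<close>.\<close>

locale good_history = regular T \<epsilon> T \<Phi> for T \<epsilon> \<Phi> +
  fixes N :: nat and f g :: "vec3 \<Rightarrow> vec3 \<Rightarrow> real"
  assumes g: "background_admissible g" and Ne: "real N * \<epsilon>\<^sup>2 = 1" and nN: "n \<le> N"
    and positive: "\<And>t. 0 \<le> t \<Longrightarrow> t \<le> T \<Longrightarrow> 0 < survival \<epsilon> g (root_pos \<Phi>) t"
begin

abbreviation \<tau> where "\<tau> \<equiv> last_time \<Phi>"
abbreviation P where "P \<equiv> history_density \<epsilon> N f g"
abbreviation S where "S \<equiv> survival \<epsilon> g (root_pos \<Phi>)"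

lemma dens: "torus_density g"
  using g by (simp add: background_admissible_def)

sublocale tail: path_tail "fst ` set (snd \<Phi>)" "root_pos \<Phi>" "root_vel \<Phi>" "last_time \<Phi>" \<epsilon> g
  by (rule path_tail_root[OF timely eps dens])

definition weight :: real where
  "weight = f (fst (fst \<Phi>)) (snd (fst \<Phi>)) * (\<Prod>j < n. (real N - real j) * (\<epsilon>\<^sup>2 * collision_factor \<epsilon> g \<Phi> j))"

lemma density_late: "\<tau> \<le> s \<Longrightarrow> P s \<Phi> = weight * S s ^ (N - n)"
  by (simp add: history_density_def weight_def)

lemma density_early: "s < \<tau> \<Longrightarrow> P s \<Phi> = 0"
  by (simp add: history_density_def)

lemma last_time_pos: "n \<ge> 1 \<Longrightarrow> 0 < \<tau>"
  using ct_pos[of "n - 1"] by (auto simp: last_time_def)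

lemma last_time_le: "\<tau> \<le> T"
  using ct_le_T[of "n - 1"] t_nonneg by (auto simp: last_time_def)

lemma density_start:
  "P 0 \<Phi> = zeta \<epsilon> N g \<Phi> * f (fst (fst \<Phi>)) (snd (fst \<Phi>)) * (if n = 0 then 1 else 0)"
proof (cases "n = 0")
  case True
  then have "\<tau> = 0" by (simp add: last_time_def)
  then show ?thesis
    using True density_late[of 0] tail.survival_start by (simp add: weight_def zeta_def root_start)
next
  case False
  then show ?thesis using last_time_pos density_early[of 0] by simp
qed

lemma density_right_continuous:
  assumes t: "0 \<le> t"
  shows "continuous (at_right t) (\<lambda>s. P s \<Phi>)"
proof (cases "t < \<tau>")
  case True
  have "\<forall>\<^sub>F s in at_right t. P s \<Phi> = 0"
    unfolding eventually_at_right_field using True density_early by blast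
  then show ?thesis using density_early[OF True] by (simp add: continuous_within tendsto_eventually)
next
  case False
  have "((\<lambda>s. weight * S s ^ (N - n)) \<longlongrightarrow> weight * S t ^ (N - n)) (at_right t)"
    using survival_right_continuous[OF dens t, of \<epsilon>] unfolding continuous_within by (intro tendsto_intros)
  moreover have "\<forall>\<^sub>F s in at_right t. weight * S s ^ (N - n) = P s \<Phi>"
    unfolding eventually_at_right_field using False density_late by (intro exI[of _ "t + 1"]) auto
  ultimately show ?thesis
    using density_late[of t] False unfolding continuous_within by (simp add: Lim_transform_eventually)
qed

lemma unmet_mass_survival: "0 < t \<Longrightarrow> unmet_mass \<epsilon> g \<Phi> t = S t"
  by (rule tail.unmet_mass_eq) auto

lemma unmet_mass_positive:
  assumes t: "0 \<le> t" "t \<le> T"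
  shows "0 < unmet_mass \<epsilon> g \<Phi> t"
proof (cases "t = 0")
  \<comment> \<open>At time 0 the open interval in \<open>unmet\<close> is empty, so the mass is 1
    and differs from the survival probability, which already excludes overlaps.\<close>
  case True
  then have u: "unmet \<epsilon> \<Phi> t = UNIV" by (auto simp: unmet_def)
  note [measurable] = tail.g_measurable
  have [measurable]: "torus_cell \<times> (UNIV :: vec3 set) \<in> sets borel" by (simp add: borel_prod[symmetric])
  have "unmet_mass \<epsilon> g \<Phi> t = enn2real (\<integral>\<^sup>+ z. ennreal (indicator (torus_cell \<times> UNIV) z * g (fst z) (snd z)) \<partial>lborel)"
    unfolding unmet_mass_def u set_lebesgue_integral_def by (subst integral_eq_nn_integral) auto
  also have "(\<integral>\<^sup>+ z. ennreal (indicator (torus_cell \<times> UNIV) z * g (fst z) (snd z)) \<partial>lborel)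
      = (\<integral>\<^sup>+ z \<in> torus_cell \<times> UNIV. ennreal (g (fst z) (snd z)) \<partial>lborel)"
    by (intro nn_integral_cong) (simp add: indicator_def)
  also have "\<dots> = 1" using dens by (simp add: torus_density_def)
  finally show ?thesis by simp
next
  case False
  then show ?thesis using t positive unmet_mass_survival by simp
qed

text \<open>Parent and tree have the same path up to \<tau>, hence the same survival probability
  there. The parent has one more bystander, and this extra factor is cancelled by the denominator.
  The remaining combinatorial factor \<open>(real N - real l) * \<epsilon>\<^sup>2\<close> is one
  minus \<open>gamma_coeff\<close> because \<open>real N * \<epsilon>\<^sup>2 = 1\<close>.\<close>

lemma density_gain:
  assumes n1: "n \<ge> 1"
  shows "P \<tau> \<Phi> = (1 - gamma_coeff \<epsilon> \<Phi> \<tau>) * gain_coeff \<epsilon> g (P \<tau>) \<Phi>"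
proof -
  define l where "l = n - 1"
  define \<Psi> where "\<Psi> = truncate_tree l \<Phi>"
  have l: "l < n" "n = Suc l" using n1 by (auto simp: l_def)
  have \<Psi>: "parent \<Phi> = \<Psi>" by (simp add: parent_truncate \<Psi>_def l_def)
  have t: "\<tau> = ct l" using l by (simp add: last_time_def)
  have n\<Psi>: "n_coll \<Psi> = l" using l by (simp add: \<Psi>_def n_coll_truncate)
  have ear: "last_time \<Psi> \<le> \<tau>" unfolding \<Psi>_def t using l by (intro last_time_truncate(1) timely)
  interpret \<Psi>: path "fst ` set (snd \<Psi>)" "root_pos \<Psi>" "root_vel \<Psi>"
    unfolding \<Psi>_def by (rule path_root[OF timely_truncate[OF timely]])
  have pos: "root_pos \<Psi> s = root_pos \<Phi> s" if "s \<le> \<tau>" for s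
    using root_truncate(2)[OF timely l(1)] that unfolding \<Psi>_def t by blast
  have "apart \<epsilon> (root_pos \<Psi>) \<tau> p = apart \<epsilon> (root_pos \<Phi>) \<tau> p" for p
    using pos by (simp add: apart_path_iff \<Psi>.apart_path_iff tail.tau)
  then have S\<Psi>: "survival \<epsilon> g (root_pos \<Psi>) \<tau> = S \<tau>" by (simp add: survival_def)
  have S0: "0 < S \<tau>" using positive tail.tau last_time_le by blast
  define K where "K = f (fst (fst \<Phi>)) (snd (fst \<Phi>)) * (\<Prod>j < l. (real N - real j) * (\<epsilon>\<^sup>2 * collision_factor \<epsilon> g \<Phi> j))"
  have "(\<Prod>j < l. (real N - real j) * (\<epsilon>\<^sup>2 * collision_factor \<epsilon> g \<Psi> j)) = (\<Prod>j < l. (real N - real j) * (\<epsilon>\<^sup>2 * collision_factor \<epsilon> g \<Phi> j))"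
    by (intro prod.cong refl) (simp add: \<Psi>_def collision_factor_truncate)
  moreover have "fst \<Psi> = fst \<Phi>" by (simp add: \<Psi>_def truncate_tree_def)
  \<comment> \<open>This needs \<open>n \<le> N\<close>; it produces the extra power of the survival
    probability in the density of the parent.\<close>
  moreover have "N - l = Suc (N - n)" using l nN by simp
  ultimately have P\<Psi>: "P \<tau> \<Psi> = K * S \<tau> ^ Suc (N - n)"
    using ear by (simp add: history_density_def n\<Psi> K_def S\<Psi> del: power_Suc)
  define c where "c = collision_factor \<epsilon> g \<Phi> l"
  have P\<Phi>: "P \<tau> \<Phi> = K * ((real N - real l) * (\<epsilon>\<^sup>2 * c)) * S \<tau> ^ (N - n)"
    unfolding density_late[OF order.refl] weight_def K_def c_def by (simp add: l(2))
  have "pre_vel \<Phi> l = root_vel (truncate_tree l \<Phi>) (last_time (truncate_tree l \<Phi>))" by (rule pre_vel_tail[OF timely l(1)])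
  moreover have "fst (emitted \<epsilon> (root_pos (truncate_tree l \<Phi>)) (snd \<Phi> ! l)) = root_pos \<Phi> \<tau> + \<epsilon> *\<^sub>R coll_param \<Phi> l - \<tau> *\<^sub>R coll_vel \<Phi> l"
    using pos[of \<tau>] by (simp add: emitted_def mark_eq[OF l(1)] t \<Psi>_def)
  ultimately have c: "c = transported g \<tau> (root_pos \<Phi> \<tau> + \<epsilon> *\<^sub>R coll_param \<Phi> l) (coll_vel \<Phi> l)
      * max ((pre_vel \<Phi> l - coll_vel \<Phi> l) \<bullet> coll_param \<Phi> l) 0"
    by (simp add: c_def collision_factor_def transported_def)
  have "gain_coeff \<epsilon> g (P \<tau>) \<Phi> = P \<tau> \<Psi> * (c / S \<tau>)"
    using n1 unmet_mass_survival[OF last_time_pos[OF n1]] unfolding c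
    by (simp add: gain_coeff_def Let_def \<Psi> l_def)
  also have "\<dots> = K * S \<tau> ^ (N - n) * c" unfolding P\<Psi> using S0 by simp
  finally have gain: "gain_coeff \<epsilon> g (P \<tau>) \<Phi> = K * S \<tau> ^ (N - n) * c" .
  have "1 - gamma_coeff \<epsilon> \<Phi> \<tau> = (real N - real l) * \<epsilon>\<^sup>2"
    using Ne by (simp add: gamma_coeff_def \<Psi> n\<Psi> left_diff_distrib)
  then show ?thesis unfolding gain P\<Phi> by (simp only: mult_ac)
qed

text \<open>Only the power of the survival probability depends on time. Its derivative brings down
  \<open>real (N - n)\<close>, which together with \<open>\<epsilon>\<^sup>2\<close> is one minus
  \<open>gamma_coeff\<close>, and the missing power accounts for the denominator. By
  \<open>fresh_plus_stale\<close>, the full flux minus the correction is the fresh rate.\<close>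

lemma density_derivative:
  assumes t: "\<tau> < t" "t \<le> T"
  shows "((\<lambda>s. P s \<Phi>) has_real_derivative
    - (1 - gamma_coeff \<epsilon> \<Phi> t) * loss \<epsilon> g (stale_rate \<epsilon> g (root_pos \<Phi>) (root_vel \<Phi> \<tau>) t) t (P t) \<Phi>) (at t within {0..T})"
proof -
  define R where "R = fresh_rate \<epsilon> g (root_pos \<Phi>) (root_vel \<Phi> \<tau>) t"
  have t0: "0 < t" using t tail.tau by simp
  have S0: "0 < S t" using positive t t0 by simp
  have "(S has_real_derivative - (\<epsilon>\<^sup>2 * R)) (at t)"
    unfolding R_def by (rule tail.survival_derivative[OF g t(1)])
  then have "((\<lambda>s. weight * S s ^ (N - n)) has_real_derivative weight * (real (N - n) * (- (\<epsilon>\<^sup>2 * R) * S t ^ (N - n - 1)))) (at t)"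
    by (intro DERIV_cmult) (auto intro!: derivative_eq_intros)
  then have D: "((\<lambda>s. P s \<Phi>) has_real_derivative weight * (real (N - n) * (- (\<epsilon>\<^sup>2 * R) * S t ^ (N - n - 1)))) (at t)"
    by (rule has_field_derivative_transform_within_open[where S = "{\<tau><..}"]) (use t density_late in auto)
  have "loss \<epsilon> g (stale_rate \<epsilon> g (root_pos \<Phi>) (root_vel \<Phi> \<tau>) t) t (P t) \<Phi> = weight * S t ^ (N - n) * (R / S t)"
    unfolding loss_def unmet_mass_survival[OF t0] fresh_plus_stale[OF g, symmetric] R_def
    using density_late[of t] t by simp
  moreover have "1 - gamma_coeff \<epsilon> \<Phi> t = real (N - n) * \<epsilon>\<^sup>2"
    using t Ne nN by (simp add: gamma_coeff_def of_nat_diff left_diff_distrib)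
  \<comment> \<open>The factor in front makes this true also for \<open>N = n\<close>, when the
    exponent cannot be lowered.\<close>
  moreover have "real (N - n) * S t ^ (N - n) = real (N - n) * (S t ^ (N - n - 1) * S t)"
    by (cases "N - n") auto
  ultimately have "- (1 - gamma_coeff \<epsilon> \<Phi> t) * loss \<epsilon> g (stale_rate \<epsilon> g (root_pos \<Phi>) (root_vel \<Phi> \<tau>) t) t (P t) \<Phi>
      = weight * (real (N - n) * (- (\<epsilon>\<^sup>2 * R) * S t ^ (N - n - 1)))"
    using S0 by (cases "N - n") auto
  then show ?thesis using has_field_derivative_at_within[OF D] by simp
qed

end

text \<open>The last bound compares the cutoff on the number of collisions with the number of
  particles: for \<epsilon> equal to \<open>real N powr (- 1 / 2)\<close> the former is at most
  \<open>real N powr (1 / 4)\<close>.\<close>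

lemma diameter_scaling:
  assumes "1 \<le> N"
  shows "0 < real N powr (- 1 / 2)" "real N * (real N powr (- 1 / 2))\<^sup>2 = 1"
    "(real N powr (- 1 / 2)) powr (- 1 / 2) \<le> real N"
proof -
  show "0 < real N powr (- 1 / 2)" using assms by simp
  have "(real N powr (- 1 / 2))\<^sup>2 = real N powr (- 1)"
    using assms by (simp add: power2_eq_square powr_add[symmetric])
  then show "real N * (real N powr (- 1 / 2))\<^sup>2 = 1" using assms by (simp add: powr_minus)
  have "(real N powr (- 1 / 2)) powr (- 1 / 2) = real N powr (1 / 4)" by (simp add: powr_powr)
  also have "\<dots> \<le> real N powr 1" using assms by (intro powr_mono) auto
  finally show "(real N powr (- 1 / 2)) powr (- 1 / 2) \<le> real N" using assms by simp
qed

text \<open>From the cubic cutoff, \<open>\<epsilon> * V \<epsilon> \<le> 1\<close>: for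
  \<open>V \<epsilon>\<close> at least 1 the cube dominates, otherwise \<epsilon> below 1 suffices.
  With this, the encounter probability along good trees is at most
  \<open>3 * B * \<epsilon>\<close>.\<close>

lemma cutoff_bound:
  assumes "cutoffs V M" and e: "0 < \<epsilon>" "\<epsilon> < 1"
  shows "\<epsilon>\<^sup>2 * (V \<epsilon> + 2) \<le> 3 * \<epsilon>"
proof -
  have V: "0 \<le> V \<epsilon>" "\<epsilon> * V \<epsilon> ^ 3 \<le> 1 / 8" using assms by (auto simp: cutoffs_def)
  have "\<epsilon> * V \<epsilon> \<le> 1"
  proof (cases "1 \<le> V \<epsilon>")
    case True
    then have "V \<epsilon> ^ 1 \<le> V \<epsilon> ^ 3" by (intro power_increasing) auto
    then have "\<epsilon> * V \<epsilon> \<le> \<epsilon> * V \<epsilon> ^ 3" using e by simp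
    then show ?thesis using V by simp
  next
    case False
    then have "\<epsilon> * V \<epsilon> \<le> 1 * 1" using e V by (intro mult_mono) auto
    then show ?thesis by simp
  qed
  then have "\<epsilon> * V \<epsilon> + 2 * \<epsilon> \<le> 3" using e by simp
  then have "\<epsilon> * (\<epsilon> * V \<epsilon> + 2 * \<epsilon>) \<le> \<epsilon> * 3" using e by (intro mult_left_mono) auto
  then show ?thesis by (simp add: power2_eq_square algebra_simps)
qed

theorem theorem4p10:
  fixes T :: real and f\<^sub>0 g\<^sub>0 :: "vec3 \<Rightarrow> vec3 \<Rightarrow> real" and V M :: "real \<Rightarrow> real"
  assumes "0 < T" and "tagged_admissible f\<^sub>0" and "background_admissible g\<^sub>0" and "cutoffs V M"
  shows "\<exists>(P :: nat \<Rightarrow> real \<Rightarrow> tree \<Rightarrow> real) (C :: nat \<Rightarrow> real \<Rightarrow> tree \<Rightarrow> real).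
    (\<forall>\<Phi> \<in> collision_trees T. \<forall>t \<in> {last_time \<Phi><..T}. (\<lambda>N. C N t \<Phi>) \<longlonglongrightarrow> 0) \<and>
    (\<forall>\<^sub>F N in sequentially. let \<epsilon> = real N powr (- 1 / 2) in
      empirical_density T V M \<epsilon> N f\<^sub>0 g\<^sub>0 (P N) \<and>
      (\<forall>\<Phi> \<in> good_trees T V M \<epsilon>.
        P N 0 \<Phi> = zeta \<epsilon> N g\<^sub>0 \<Phi> * f\<^sub>0 (fst (fst \<Phi>)) (snd (fst \<Phi>)) * (if n_coll \<Phi> = 0 then 1 else 0) \<and>
        (n_coll \<Phi> \<ge> 1 \<longrightarrow>
          (\<forall>t \<in> {0..<last_time \<Phi>}. P N t \<Phi> = 0) \<and>
          P N (last_time \<Phi>) \<Phi> =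
            (1 - gamma_coeff \<epsilon> \<Phi> (last_time \<Phi>)) * gain_coeff \<epsilon> g\<^sub>0 (P N (last_time \<Phi>)) \<Phi>) \<and>
        (\<forall>t \<in> {last_time \<Phi>..T}. unmet_mass \<epsilon> g\<^sub>0 \<Phi> t > 0) \<and>
        (\<forall>t \<in> {last_time \<Phi><..T}.
          0 \<le> C N t \<Phi> \<and>
          ((\<lambda>s. P N s \<Phi>) has_real_derivative
            - (1 - gamma_coeff \<epsilon> \<Phi> t) * loss \<epsilon> g\<^sub>0 (C N t \<Phi>) t (P N t) \<Phi>) (at t within {0..T}))))"
proof -
  define e where "e N = real N powr (- 1 / 2)" for N
  define P where "P N = history_density (e N) N f\<^sub>0 g\<^sub>0" for N
  \<comment> \<open>The correction is the stale flux, evaluated with the velocity of the root after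
    its last collision.\<close>
  define C where "C N t \<Phi> = stale_rate (e N) g\<^sub>0 (root_pos \<Phi>) (root_vel \<Phi> (last_time \<Phi>)) t" for N t \<Phi>
  have f: "torus_density f\<^sub>0" and g: "torus_density g\<^sub>0"
    using assms(2,3) by (auto simp: tagged_admissible_def background_admissible_def)
  have e0: "e \<longlonglongrightarrow> 0" unfolding e_def by real_asymp
  have e_pos: "\<forall>\<^sub>F N in sequentially. 0 < e N"
    using eventually_ge_at_top[of 1] by eventually_elim (simp add: e_def)
  \<comment> \<open>The limit is taken with the tree fixed and uses its path only, so it holds for
    every collision tree.\<close>
  have limit: "(\<lambda>N. C N t \<Phi>) \<longlonglongrightarrow> 0" if \<Phi>: "\<Phi> \<in> collision_trees T" and t: "last_time \<Phi> < t" for \<Phi> t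
  proof -
    have tm: "timely \<Phi>" using \<Phi> by (auto simp: collision_trees_def timely_def case_prod_beta)
    interpret path "fst ` set (snd \<Phi>)" "root_pos \<Phi>" "root_vel \<Phi>" by (rule path_root[OF tm])
    show ?thesis
      unfolding C_def using coll_time_le_last[OF tm] last_time_nonneg[OF tm]
      by (intro stale_rate_tendsto[OF assms(3) _ _ t e0 e_pos]) (auto simp: coll_times)
  qed
  obtain B where B: "0 \<le> B"
    "\<forall>\<epsilon> C X V L t. path C X V \<longrightarrow> (\<forall>s. 0 \<le> s \<and> s \<le> T \<longrightarrow> norm (V s) \<le> L) \<longrightarrow> 0 \<le> L \<longrightarrow> 0 \<le> t \<longrightarrow> t \<le> T
      \<longrightarrow> 0 < \<epsilon> \<longrightarrow> \<epsilon> < 1 / 2 \<longrightarrow> 1 - survival \<epsilon> g\<^sub>0 X t \<le> B * \<epsilon>\<^sup>2 * (L + 2)"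
    using encounter_probability[OF assms(3), of T] assms(1) by (metis less_imp_le)
  \<comment> \<open>Below 1/2 for the geometry of the torus, and small enough that
    \<open>3 * B * e N < 1\<close>; the added 1 covers \<open>B = 0\<close>.\<close>
  have small: "\<forall>\<^sub>F N in sequentially. e N < min (1 / 2) (1 / (3 * B + 1))"
    using B(1) by (intro order_tendstoD(2)[OF e0]) auto
  have main: "empirical_density T V M (e N) N f\<^sub>0 g\<^sub>0 (P N) \<and>
      (\<forall>\<Phi> \<in> good_trees T V M (e N).
        P N 0 \<Phi> = zeta (e N) N g\<^sub>0 \<Phi> * f\<^sub>0 (fst (fst \<Phi>)) (snd (fst \<Phi>)) * (if n_coll \<Phi> = 0 then 1 else 0) \<and>
        (n_coll \<Phi> \<ge> 1 \<longrightarrow>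
          (\<forall>t \<in> {0..<last_time \<Phi>}. P N t \<Phi> = 0) \<and>
          P N (last_time \<Phi>) \<Phi> =
            (1 - gamma_coeff (e N) \<Phi> (last_time \<Phi>)) * gain_coeff (e N) g\<^sub>0 (P N (last_time \<Phi>)) \<Phi>) \<and>
        (\<forall>t \<in> {last_time \<Phi>..T}. unmet_mass (e N) g\<^sub>0 \<Phi> t > 0) \<and>
        (\<forall>t \<in> {last_time \<Phi><..T}.
          0 \<le> C N t \<Phi> \<and>
          ((\<lambda>s. P N s \<Phi>) has_real_derivative
            - (1 - gamma_coeff (e N) \<Phi> t) * loss (e N) g\<^sub>0 (C N t \<Phi>) t (P N t) \<Phi>) (at t within {0..T})))"
    if N: "1 \<le> N" and sm: "e N < min (1 / 2) (1 / (3 * B + 1))" for N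
  proof -
    note sc = diameter_scaling[OF N, folded e_def]
    have eN: "0 < e N" "e N < 1 / 2" "e N < 1" using sc sm by auto
    have "e N * (3 * B + 1) < 1" using sm B(1) by (simp add: field_simps)
    then have B3: "B * (3 * e N) < 1" using eN by (simp add: algebra_simps)
    have VM: "0 \<le> V (e N)" "M (e N) \<le> e N powr (- 1 / 2)" using assms(4) eN by (auto simp: cutoffs_def)
    \<comment> \<open>The threshold on \<open>N\<close> involves \<open>B\<close> and the cutoffs
      only, not the tree. This gives one smallness condition for all good trees.\<close>
    have hist: "good_history T (e N) \<Phi> N g\<^sub>0" if \<Phi>: "\<Phi> \<in> good_trees T V M (e N)" for \<Phi>
    proof -
      have reg: "regular T (e N) T \<Phi>"
        using \<Phi> eN assms(1) by unfold_locales (auto simp: good_trees_def regular_trees_def)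
      then interpret regular T "e N" T \<Phi> .
      have "real n \<le> real N" using \<Phi> VM sc(3) by (auto simp: good_trees_def)
      moreover have "0 < survival (e N) g\<^sub>0 (root_pos \<Phi>) t" if t: "0 \<le> t" "t \<le> T" for t
      proof -
        have "1 - survival (e N) g\<^sub>0 (root_pos \<Phi>) t \<le> B * (e N)\<^sup>2 * (V (e N) + 2)"
          using B(2)[rule_format, OF path_axioms _ VM(1) t eN(1,2)] \<Phi> by (auto simp: good_trees_def)
        also have "\<dots> \<le> B * (3 * e N)"
          using mult_left_mono[OF cutoff_bound[OF assms(4) eN(1,3)] B(1)] by (simp add: mult.assoc)
        finally show ?thesis using B3 by simp
      qed
      ultimately show ?thesis using assms(3) sc(2) by unfold_locales auto
    qed
    have "empirical_density T V M (e N) N f\<^sub>0 g\<^sub>0 (P N)"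
      unfolding empirical_density_def
    proof (intro conjI ballI impI)
      fix t assume t: "t \<in> {0..T}"
      show "P N t \<in> borel_measurable (tree_measure T)"
        unfolding P_def by (rule measurable_tree_measure) (rule history_density_measurable[OF f g])
      show "0 \<le> P N t \<Phi>" for \<Phi> unfolding P_def by (rule history_density_nonneg[OF f g])
      show "empirical_law (e N) N f\<^sub>0 g\<^sub>0 t ({True} \<times> A) = (\<integral>\<^sup>+ \<Phi> \<in> A. ennreal (P N t \<Phi>) \<partial>tree_measure T)"
        if A: "A \<in> sets (tree_measure T)" "A \<subseteq> regular_trees T (e N) t" for A
      proof -
        interpret law_setup T "e N" t N f\<^sub>0 g\<^sub>0 A
          using assms(1) f g eN t A by unfold_locales auto
        show ?thesis unfolding P_def by (rule law_eq)
      qed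
    next
      fix \<Phi> t assume \<Phi>: "\<Phi> \<in> good_trees T V M (e N)" and t: "t \<in> {0..<T}"
      interpret good_history T "e N" \<Phi> N f\<^sub>0 g\<^sub>0 by (rule hist[OF \<Phi>])
      show "continuous (at_right t) (\<lambda>s. P N s \<Phi>)" unfolding P_def using t by (intro density_right_continuous) auto
    qed
    moreover have "P N 0 \<Phi> = zeta (e N) N g\<^sub>0 \<Phi> * f\<^sub>0 (fst (fst \<Phi>)) (snd (fst \<Phi>)) * (if n_coll \<Phi> = 0 then 1 else 0) \<and>
        (n_coll \<Phi> \<ge> 1 \<longrightarrow>
          (\<forall>t \<in> {0..<last_time \<Phi>}. P N t \<Phi> = 0) \<and>
          P N (last_time \<Phi>) \<Phi> =
            (1 - gamma_coeff (e N) \<Phi> (last_time \<Phi>)) * gain_coeff (e N) g\<^sub>0 (P N (last_time \<Phi>)) \<Phi>) \<and>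
        (\<forall>t \<in> {last_time \<Phi>..T}. unmet_mass (e N) g\<^sub>0 \<Phi> t > 0) \<and>
        (\<forall>t \<in> {last_time \<Phi><..T}.
          0 \<le> C N t \<Phi> \<and>
          ((\<lambda>s. P N s \<Phi>) has_real_derivative
            - (1 - gamma_coeff (e N) \<Phi> t) * loss (e N) g\<^sub>0 (C N t \<Phi>) t (P N t) \<Phi>) (at t within {0..T}))"
      if \<Phi>: "\<Phi> \<in> good_trees T V M (e N)" for \<Phi>
    proof -
      interpret H: good_history T "e N" \<Phi> N f\<^sub>0 g\<^sub>0 by (rule hist[OF \<Phi>])
      show ?thesis
        unfolding P_def C_def
        using H.density_start H.density_early H.density_gain H.unmet_mass_positive H.tail.tau H.density_derivative H.rates_nonneg(2)[OF g]
        by (intro conjI impI ballI) auto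
    qed
    ultimately show ?thesis by blast
  qed
  have "\<forall>\<^sub>F N in sequentially. 1 \<le> N \<and> e N < min (1 / 2) (1 / (3 * B + 1))"
    using eventually_ge_at_top[of 1] small by eventually_elim simp
  then show ?thesis
    unfolding Let_def e_def[symmetric]
    using limit main by (intro exI[of _ P] exI[of _ C] conjI) (auto elim!: eventually_mono)
qed

end
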